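(* Let $(X,V)$ be a directed projective manifold, and let $Z$ be a closed subscheme of $X$. Let $f\colon(\mathbb{C},T_{\mathbb{C}})\to(X,V)$ be a non-constant holomorphic curve such that $f(\mathbb{C})\not\subset\operatorname{Supp}Z$. Choose a linear system $\mathfrak{S}\subset|L|$ on $X$ such that $\mathfrak{S}$ separates $1$-jets at every point of $X$ and $\mathcal{I}_Z=\mathfrak{s}_{\supset Z}$. Then there exists a constant $c>0$ such that the inequality $$\varepsilon\,\mathcal{N}\Big(\exp\big(2(1-\varepsilon)\lambda_Z\circ f-2\lambda_{Z^{(1)}}\circ f_{[1]}\big)\,f^{*}dd^c\varphi_{\mathfrak S},\,r\Big)\le c\,T_f(r,L)+O(1)$$ holds for any $0<\varepsilon<1$.
   Context: A directed projective manifold $(X,V)$ is a connected complex projective manifold $X$ with a holomorphic subbundle $V\subset T_X$. A holomorphic curve $f\colon(\mathbb{C},T_{\mathbb{C}})\to(X,V)$ is a holomorphic map $f\colon\mathbb{C}\to X$ with $f'(z)\in V_{f(z)}$ for all $z$. $X_1=\mathrm{P}(V)$ is the bundle of lines in $V$, with projection $\pi_1\colon X_1\to X$. The lift $f_{[1]}\colon\mathbb{C}\to X_1$ of a non-constant $f$ is $f_{[1]}(z)=(f(z),[u(z)])$, where near each $z_0$ one writes $f'(z)=(z-z_0)^m u(z)$ with $u(z_0)\ne0$. Jets of subschemes: for a closed subscheme $Z\subset X$ with ideal sheaf $\mathcal{I}_Z$, the closed subscheme $Z^{(1)}\subset X_1=\mathrm{P}(V)$ is defined, over each affine open $U\subset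 X$ with $\mathcal{I}_Z(U)=(\zeta_1,\dots,\zeta_s)$, by the homogeneous ideal $(\zeta_1,\dots,\zeta_s,d\zeta_1,\dots,d\zeta_s)$, where $d\zeta_i$ is restricted to $V$ and viewed as a function linear on the fibres of $V$; these glue. Weil functions: for a closed subscheme $Y$ of a projective manifold $M$, a Weil function $\lambda_Y\colon M\setminus\operatorname{Supp}Y\to\mathbb{R}$ is a continuous function for which there are an affine Zariski open covering $\{U_\epsilon\}$ of $M$ and generators $g_1,\dots,g_{r_\epsilon}$ of $\mathcal{I}_Y(U_\epsilon)$ such that $|\lambda_Y+\log\max_i|g_i||$ is bounded on $U_\epsilon\setminus\operatorname{Supp}Y$ by a continuous function on $U_\epsilon$. It is unique up to a bounded function. In the claim, $\lambda_Z$ and $\lambda_{Z^{(1)}}$ are chosen Weil functions for $Z\subset X$ and $Z^{(1)}\subset X_1$. Linear systems: $L$ is a holomorphic line bundle on $X$; a linear system $\mathfrak{S}\subset|L|$ corresponds to a linear subspace $\mathbb{S}\subset H^0(X,L)$. $\mathfrak{S}$ separates $1$-jets at $x$ if $\mathbb{S}\to L\otimes\mathcal{O}_{X,x}/\mathfrak{m}_{X,x}^2$ is surjective. $\mathfrak{S}_{\supset Z}=\{D\in\mathfrak{S}\mid Z\subset D\}$, and $\mathfrak{s}_{\supset Z}\subset\mathcal{O}_X$ is its base ideal, i.e. the image of the evaluation map of the corresponding space of sections, tensored with $L^{-1}$. With a basis $\varsigma_0,\dots,\varsigma_N$ of $\mathbb{S}$, $\varphi_{\mathfrak S}=\log\sum_i|\varsigma_i|^2$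 (computed in local trivializations of $L$); $dd^c\varphi_{\mathfrak S}$ is a globally defined $(1,1)$-form. Nevanlinna notation: $dd^c=\frac{i}{2\pi}\partial\bar\partial$; $\mathcal{N}(\Phi,r)=\int_0^r\frac{dt}{t}\int_{\{|z|<t\}}\Phi$; $T_f(r,L)=\mathcal{N}(f^*dd^c\varphi,r)$ modulo bounded functions, where $\varphi$ is the local weight of a continuous Hermitian metric $\|\xi\|_h^2=|\xi|^2e^{-\varphi}$ on $L$. $O(1)$ denotes a bounded real-valued function of $r\in\mathbb{R}_{\ge0}$. *)

theory Defs
  imports "HOL-Complex_Analysis.Complex_Analysis" "HOL-Library.Function_Algebras"
begin

section \<open>Complex projective space\<close>

typedef (overloaded) ('n::finite) cproj =
  "{l :: (complex^'n) set. vec.subspace l \<and> vec.dim l = 1}"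
  morphisms line_of Abs_cproj
proof -
  have "vec.dim {axis (undefined::'n) (1::complex)} = 1"
    by (rule vec.dim_eq_card_independent[THEN trans])
       (auto simp: vec.dependent_single axis_eq_0_iff)
  then show ?thesis
    by (intro exI[of _ "vec.span {axis undefined 1}"])
       (simp add: vec.subspace_span vec.dim_span)
qed

text \<open>The point with homogeneous coordinates \<open>a\<close>; meaningful only for \<open>a \<noteq> 0\<close>.\<close>

definition pt :: "complex^'n \<Rightarrow> ('n::finite) cproj" where
  "pt a = Abs_cproj (vec.span {a})"

text \<open>The Euclidean topology is the quotient topology of \<open>\<complex>\<^sup>N\<^sup>+\<^sup>1 - {0}\<close>.\<close>

instantiation cproj :: (finite) topological_space
begin

definition open_cproj :: "'a cproj set \<Rightarrow> bool" where
  "open_cproj W \<longleftrightarrow> open {a. a \<noteq> 0 \<and> pt a \<in> W}"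

instance
proof
  have "{a::complex^'a. a \<noteq> 0 \<and> pt a \<in> UNIV} = - {0}" by auto
  then show "open (UNIV :: 'a cproj set)"
    by (simp add: open_cproj_def open_Compl)
next
  fix S T :: "'a cproj set"
  assume "open S" "open T"
  then have "open ({a. a \<noteq> 0 \<and> pt a \<in> S} \<inter> {a. a \<noteq> 0 \<and> pt a \<in> T})"
    unfolding open_cproj_def by (rule open_Int)
  moreover have "{a. a \<noteq> 0 \<and> pt a \<in> S} \<inter> {a. a \<noteq> 0 \<and> pt a \<in> T}
      = {a. a \<noteq> 0 \<and> pt a \<in> S \<inter> T}" by auto
  ultimately show "open (S \<inter> T)" by (simp add: open_cproj_def)
next
  fix K :: "'a cproj set set"
  assume "\<forall>S\<in>K. open S"
  then have "open (\<Union>S\<in>K. {a. a \<noteq> 0 \<and> pt a \<in> S})"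
    unfolding open_cproj_def by (intro open_UN) auto
  moreover have "(\<Union>S\<in>K. {a. a \<noteq> 0 \<and> pt a \<in> S}) = {a. a \<noteq> 0 \<and> pt a \<in> \<Union>K}" by auto
  ultimately show "open (\<Union>K)" by (simp add: open_cproj_def)
qed

end

section \<open>Holomorphic functions and projective manifolds\<close>

definition complex_differentiable_at :: "(complex^'n \<Rightarrow> complex) \<Rightarrow> complex^('n::finite) \<Rightarrow> bool" where
  "complex_differentiable_at F a \<longleftrightarrow>
     (\<exists>D. (F has_derivative D) (at a) \<and> (\<forall>c v. D (c *s v) = c * D v))"

text \<open>Functions on projective space are differentiated through their
  pull-backs to \<open>\<complex>\<^sup>N\<^sup>+\<^sup>1 - {0}\<close>.\<close>

definition ambient_holomorphic :: "('n::finite) cproj set \<Rightarrow> ('n cproj \<Rightarrow> complex) \<Rightarrow> bool" where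
  "ambient_holomorphic W G \<longleftrightarrow> open W \<and>
     (\<forall>a. a \<noteq> 0 \<and> pt a \<in> W \<longrightarrow> complex_differentiable_at (\<lambda>b. G (pt b)) a)"

definition cone_deriv :: "(('n::finite) cproj \<Rightarrow> complex) \<Rightarrow> complex^'n \<Rightarrow> complex^'n \<Rightarrow> complex" where
  "cone_deriv G a = frechet_derivative (\<lambda>b. G (pt b)) (at a)"

text \<open>A connected closed submanifold of projective space, locally a zero set of
  holomorphic functions with independent differentials.\<close>

definition projective_manifold :: "('n::finite) cproj set \<Rightarrow> bool" where
  "projective_manifold X \<longleftrightarrow> X \<noteq> {} \<and> connected X \<and> closed X \<and>
     (\<forall>a. a \<noteq> 0 \<and> pt a \<in> X \<longrightarrow>
        (\<exists>W k (G :: nat \<Rightarrow> 'n cproj \<Rightarrow> complex). pt a \<in> W \<and>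
           (\<forall>j<k. ambient_holomorphic W (G j)) \<and> open W \<and>
           X \<inter> W = {y\<in>W. \<forall>j<k. G j y = 0} \<and>
           (\<forall>c. (\<forall>v. (\<Sum>j<k. c j * cone_deriv (G j) a v) = 0) \<longrightarrow> (\<forall>j<k. c j = 0))))"

text \<open>Representatives of germs at \<open>x\<close> of the structure sheaf of holomorphic functions
  on \<open>X\<close>; the values of \<open>g\<close> away from \<open>x\<close> are irrelevant.\<close>

definition holo_germ :: "('n::finite) cproj set \<Rightarrow> 'n cproj \<Rightarrow> ('n cproj \<Rightarrow> complex) \<Rightarrow> bool" where
  "holo_germ X x g \<longleftrightarrow>
     (\<exists>W G. x \<in> W \<and> ambient_holomorphic W G \<and> (\<forall>y\<in>W \<inter> X. g y = G y))"

text \<open>The ideal of the analytic local ring at \<open>x\<close> generated by a set of germs.\<close>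

definition germ_ideal ::
  "('n::finite) cproj set \<Rightarrow> 'n cproj \<Rightarrow> ('n cproj \<Rightarrow> complex) set \<Rightarrow> ('n cproj \<Rightarrow> complex) set" where
  "germ_ideal X x E = {g. \<exists>(n::nat) c e. (\<forall>k<n. holo_germ X x (c k) \<and> e k \<in> E) \<and>
     (\<exists>W. open W \<and> x \<in> W \<and> (\<forall>y\<in>W \<inter> X. g y = (\<Sum>k<n. c k y * e k y)))}"

definition max_ideal :: "('n::finite) cproj set \<Rightarrow> 'n cproj \<Rightarrow> ('n cproj \<Rightarrow> complex) set" where
  "max_ideal X x = {g. holo_germ X x g \<and> g x = 0}"

definition max_ideal_sq :: "('n::finite) cproj set \<Rightarrow> 'n cproj \<Rightarrow> ('n cproj \<Rightarrow> complex) set" where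
  "max_ideal_sq X x =
     germ_ideal X x {\<lambda>y. a y * b y | a b. a \<in> max_ideal X x \<and> b \<in> max_ideal X x}"

section \<open>Directed manifolds and holomorphic curves\<close>

text \<open>
  The tangent space of projective space at a line \<open>l\<close> is \<open>Hom(l, \<complex>\<^sup>N\<^sup>+\<^sup>1 / l)\<close>. A subspace
  \<open>Hom(l, W / l)\<close> of it is represented by the linear subspace \<open>W\<close>, which contains \<open>l\<close>.
  A tangent vector at \<open>pt a\<close> is thus given by a vector \<open>v\<close>, determined modulo \<open>a\<close>: the
  image of \<open>v\<close> under the derivative of \<open>pt\<close> at \<open>a\<close>.
\<close>

definition affine_tangent :: "('n::finite) cproj set \<Rightarrow> 'n cproj \<Rightarrow> (complex^'n) set" where
  "affine_tangent X x = {v. \<forall>a W G. a \<in> line_of x \<and> a \<noteq> 0 \<and> x \<in> W \<and>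
     ambient_holomorphic W G \<and> (\<forall>y\<in>W \<inter> X. G y = 0) \<longrightarrow> cone_deriv G a v = 0}"

definition holomorphic_subbundle ::
  "('n::finite) cproj set \<Rightarrow> ('n cproj \<Rightarrow> (complex^'n) set) \<Rightarrow> bool" where
  "holomorphic_subbundle X V \<longleftrightarrow> (\<exists>r::nat. \<forall>x\<in>X.
     line_of x \<subseteq> V x \<and> V x \<subseteq> affine_tangent X x \<and>
     (\<exists>W (E :: nat \<Rightarrow> 'n cproj \<Rightarrow> complex^'n). open W \<and> x \<in> W \<and>
        (\<forall>y\<in>W \<inter> X. (\<forall>k<r. \<forall>j. holo_germ X y (\<lambda>y'. E k y' $ j)) \<and>
           V y = vec.span (line_of y \<union> {E k y | k. k < r}) \<and> vec.dim (V y) = r + 1)))"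

definition vec_holomorphic_on :: "(complex \<Rightarrow> complex^('n::finite)) \<Rightarrow> complex set \<Rightarrow> bool" where
  "vec_holomorphic_on F D \<longleftrightarrow> (\<forall>j. (\<lambda>z. F z $ j) holomorphic_on D)"

definition vec_deriv :: "(complex \<Rightarrow> complex^'n) \<Rightarrow> complex \<Rightarrow> complex^('n::finite)" where
  "vec_deriv F z = (\<chi> j. deriv (\<lambda>w. F w $ j) z)"

definition local_lift ::
  "(complex \<Rightarrow> ('n::finite) cproj) \<Rightarrow> complex set \<Rightarrow> (complex \<Rightarrow> complex^'n) \<Rightarrow> bool" where
  "local_lift f D F \<longleftrightarrow> open D \<and> vec_holomorphic_on F D \<and> (\<forall>z\<in>D. F z \<noteq> 0 \<and> f z = pt (F z))"

definition directed_curve ::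
  "('n::finite) cproj set \<Rightarrow> ('n cproj \<Rightarrow> (complex^'n) set) \<Rightarrow> (complex \<Rightarrow> 'n cproj) \<Rightarrow> bool" where
  "directed_curve X V f \<longleftrightarrow> (\<forall>z. f z \<in> X) \<and>
     (\<forall>z. \<exists>D F. z \<in> D \<and> local_lift f D F) \<and>
     (\<forall>D F. local_lift f D F \<longrightarrow> (\<forall>z\<in>D. vec_deriv F z \<in> V (f z)))"

text \<open>
  The pair consisting of \<open>pt a\<close> and the line spanned by the tangent vector \<open>v\<close>, i.e. the flag
  \<open>\<complex>a \<subseteq> \<complex>a + \<complex>v\<close>, is realised as the point \<open>a \<otimes> (a \<and> v)\<close> (Pluecker embedding
  followed by Segre embedding). This closed embedding of the bundle of lines makes \<open>P(V)\<close> a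
  projective manifold. Meaningful only for linearly independent \<open>a\<close>, \<open>v\<close>.
\<close>

definition flag_pt :: "complex^'n \<Rightarrow> complex^'n \<Rightarrow> ('n \<times> 'n \<times> ('n::finite)) cproj" where
  "flag_pt a v = pt (\<chi> t. case t of (i, j, k) \<Rightarrow> a $ i * (a $ j * v $ k - a $ k * v $ j))"

definition PV ::
  "('n::finite) cproj set \<Rightarrow> ('n cproj \<Rightarrow> (complex^'n) set) \<Rightarrow> ('n \<times> 'n \<times> 'n) cproj set" where
  "PV X V = {flag_pt a v | a v. a \<noteq> 0 \<and> pt a \<in> X \<and> v \<in> V (pt a) \<and> v \<notin> line_of (pt a)}"

text \<open>With \<open>F\<close> a local lift of \<open>f\<close>, the tangent vector \<open>f'(z)\<close> is represented by \<open>F'(z)\<close>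
  modulo \<open>F(z)\<close>; so the condition below says \<open>f'(z) = (z - z0)\<^sup>m u(z)\<close> and \<open>u(z0) \<noteq> 0\<close>.\<close>

definition curve_lift :: "(complex \<Rightarrow> ('n::finite) cproj) \<Rightarrow> complex \<Rightarrow> ('n \<times> 'n \<times> 'n) cproj" where
  "curve_lift f z0 = (THE p. \<exists>D F u (m::nat). z0 \<in> D \<and> local_lift f D F \<and>
     vec_holomorphic_on u D \<and>
     (\<forall>z\<in>D. vec_deriv F z - (z - z0) ^ m *s u z \<in> line_of (f z)) \<and>
     u z0 \<notin> line_of (f z0) \<and> p = flag_pt (F z0) (u z0))"

section \<open>Algebraic structure: regular functions and closed subschemes\<close>

inductive poly_fun :: "(('i \<Rightarrow> complex) \<Rightarrow> complex) \<Rightarrow> bool" where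
  const: "poly_fun (\<lambda>_. c)"
| coord: "poly_fun (\<lambda>y. y i)"
| add: "poly_fun p \<Longrightarrow> poly_fun q \<Longrightarrow> poly_fun (\<lambda>y. p y + q y)"
| mult: "poly_fun p \<Longrightarrow> poly_fun q \<Longrightarrow> poly_fun (\<lambda>y. p y * q y)"

definition hom_poly :: "nat \<Rightarrow> (complex^('n::finite) \<Rightarrow> complex) \<Rightarrow> bool" where
  "hom_poly d p \<longleftrightarrow> (\<exists>q. poly_fun q \<and> p = (\<lambda>a. q (($) a))) \<and> (\<forall>c a. p (c *s a) = c ^ d * p a)"

definition zariski_open :: "('n::finite) cproj set \<Rightarrow> 'n cproj set \<Rightarrow> bool" where
  "zariski_open M U \<longleftrightarrow> (\<exists>P. (\<forall>p\<in>P. \<exists>d. hom_poly d p) \<and>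
     U = {x\<in>M. \<exists>p\<in>P. \<exists>a\<in>line_of x. p a \<noteq> 0})"

text \<open>Regularity of \<open>g\<close> on a Zariski open subset \<open>U\<close> of a projective manifold (with its
  reduced structure); the values of \<open>g\<close> outside \<open>U\<close> are irrelevant.\<close>

definition regular_on :: "('n::finite) cproj set \<Rightarrow> ('n cproj \<Rightarrow> complex) \<Rightarrow> bool" where
  "regular_on U g \<longleftrightarrow> (\<forall>x\<in>U. \<exists>d p q. hom_poly d p \<and> hom_poly d q \<and>
     (\<exists>a\<in>line_of x. q a \<noteq> 0) \<and> (\<forall>y\<in>U. \<forall>b\<in>line_of y. q b \<noteq> 0 \<longrightarrow> g y = p b / q b))"

text \<open>Closed algebraic subsets of affine \<open>m\<close>-space, with points encoded as sequences vanishing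
  from index \<open>m\<close> on.\<close>

definition affine_algebraic :: "nat \<Rightarrow> (nat \<Rightarrow> complex) set \<Rightarrow> bool" where
  "affine_algebraic m Y \<longleftrightarrow> (\<exists>P. (\<forall>p\<in>P. poly_fun p) \<and>
     Y = {y. (\<forall>k\<ge>m. y k = 0) \<and> (\<forall>p\<in>P. p y = 0)})"

definition affine_zariski_open :: "(nat \<Rightarrow> complex) set \<Rightarrow> (nat \<Rightarrow> complex) set \<Rightarrow> bool" where
  "affine_zariski_open Y T \<longleftrightarrow> (\<exists>P. (\<forall>p\<in>P. poly_fun p) \<and> T = {y\<in>Y. \<exists>p\<in>P. p y \<noteq> 0})"

definition affine_regular_on :: "(nat \<Rightarrow> complex) set \<Rightarrow> ((nat \<Rightarrow> complex) \<Rightarrow> complex) \<Rightarrow> bool" where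
  "affine_regular_on T g \<longleftrightarrow> (\<forall>y\<in>T. \<exists>p q. poly_fun p \<and> poly_fun q \<and> q y \<noteq> 0 \<and>
     (\<forall>y'\<in>T. q y' \<noteq> 0 \<longrightarrow> g y' = p y' / q y'))"

text \<open>\<open>U\<close> is isomorphic, as a space with functions, to a closed algebraic subset of affine space.\<close>

definition affine_open :: "('n::finite) cproj set \<Rightarrow> 'n cproj set \<Rightarrow> bool" where
  "affine_open M U \<longleftrightarrow> zariski_open M U \<and>
     (\<exists>m Y h. affine_algebraic m Y \<and> bij_betw h U Y \<and>
        (\<forall>W\<subseteq>U. zariski_open M W \<longleftrightarrow> affine_zariski_open Y (h ` W)) \<and>
        (\<forall>W\<subseteq>U. zariski_open M W \<longrightarrow>
           (\<forall>g. regular_on W (\<lambda>x. g (h x)) \<longleftrightarrow> affine_regular_on (h ` W) g)))"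

text \<open>Ideal sheaves are given by their sections over Zariski open sets. Sections over \<open>U\<close> are
  represented by functions on the whole type, of which only the values on \<open>U\<close> matter.\<close>

type_synonym 'x ideal_sheaf = "'x set \<Rightarrow> ('x \<Rightarrow> complex) set"

definition generates ::
  "('n::finite) cproj set \<Rightarrow> 'n cproj ideal_sheaf \<Rightarrow> ('n cproj \<Rightarrow> complex) list \<Rightarrow> bool" where
  "generates U I gs \<longleftrightarrow> I U = {g. \<exists>c. (\<forall>k<length gs. regular_on U (c k)) \<and>
     (\<forall>x\<in>U. g x = (\<Sum>k<length gs. c k x * (gs ! k) x))}"

text \<open>A closed subscheme of \<open>M\<close>, given by its ideal sheaf: a sheaf of ideals of the sheaf of
  regular functions that is locally generated by finitely many sections (as \<open>M\<close> is Noetherian,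
  this is quasi-coherence).\<close>

definition closed_subscheme :: "('n::finite) cproj set \<Rightarrow> 'n cproj ideal_sheaf \<Rightarrow> bool" where
  "closed_subscheme M I \<longleftrightarrow>
     (\<forall>U. zariski_open M U \<longrightarrow>
        (\<forall>g\<in>I U. regular_on U g) \<and> (\<lambda>_. 0) \<in> I U \<and>
        (\<forall>g\<in>I U. \<forall>h\<in>I U. (\<lambda>x. g x + h x) \<in> I U) \<and>
        (\<forall>g\<in>I U. \<forall>c. regular_on U c \<longrightarrow> (\<lambda>x. c x * g x) \<in> I U) \<and>
        (\<forall>g\<in>I U. \<forall>h. (\<forall>x\<in>U. h x = g x) \<longrightarrow> h \<in> I U) \<and>
        (\<forall>U'. zariski_open M U' \<and> U' \<subseteq> U \<longrightarrow> I U \<subseteq> I U') \<and>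
        (\<forall>g. (\<forall>x\<in>U. \<exists>U'. zariski_open M U' \<and> x \<in> U' \<and> U' \<subseteq> U \<and> g \<in> I U') \<longrightarrow> g \<in> I U)) \<and>
     (\<forall>x\<in>M. \<exists>U gs. zariski_open M U \<and> x \<in> U \<and> set gs \<subseteq> I U \<and>
        (\<forall>U' g. zariski_open M U' \<and> U' \<subseteq> U \<and> g \<in> I U' \<longrightarrow>
           (\<forall>y\<in>U'. \<exists>W c. zariski_open M W \<and> y \<in> W \<and> W \<subseteq> U' \<and>
              (\<forall>k<length gs. regular_on W (c k)) \<and>
              (\<forall>y'\<in>W. g y' = (\<Sum>k<length gs. c k y' * (gs ! k) y')))))"

definition supp :: "('n::finite) cproj set \<Rightarrow> 'n cproj ideal_sheaf \<Rightarrow> 'n cproj set" where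
  "supp M I = {x\<in>M. \<forall>U. zariski_open M U \<and> x \<in> U \<longrightarrow> (\<forall>g\<in>I U. g x = 0)}"

section \<open>Jets of subschemes\<close>

text \<open>\<open>dg(v)\<close> for a function \<open>g\<close> on \<open>X\<close> and the tangent vector of \<open>X\<close> at \<open>pt a\<close> given by \<open>v\<close>,
  computed with a local holomorphic extension of \<open>g\<close>; by definition of \<open>affine_tangent\<close>, the
  result does not depend on the extension.\<close>

definition differential ::
  "('n::finite) cproj set \<Rightarrow> ('n cproj \<Rightarrow> complex) \<Rightarrow> complex^'n \<Rightarrow> complex^'n \<Rightarrow> complex" where
  "differential X g a v = (THE d. \<exists>W G. pt a \<in> W \<and> ambient_holomorphic W G \<and>
     (\<forall>y\<in>W \<inter> X. g y = G y) \<and> d = cone_deriv G a v)"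

text \<open>
  The ideal sheaf on \<open>P(V)\<close> of the jet of the subscheme with ideal sheaf \<open>I\<close>. Over an affine open
  \<open>U\<close> where \<open>I\<close> is generated by \<open>\<zeta>\<^sub>1, \<dots>, \<zeta>\<^sub>s\<close>, the homogeneous ideal
  \<open>(\<zeta>\<^sub>1, \<dots>, \<zeta>\<^sub>s, d\<zeta>\<^sub>1, \<dots>, d\<zeta>\<^sub>s)\<close> gives, on the chart where the fibrewise linear function \<open>dh\<close>
  does not vanish, the ideal generated by the degree zero functions \<open>\<zeta>\<^sub>k\<close> and \<open>d\<zeta>\<^sub>k / dh\<close>.
  For regular functions \<open>h\<close> on affine open sets these charts cover \<open>P(V)\<close>.
\<close>

definition jet_ideal ::
  "('n::finite) cproj set \<Rightarrow> ('n cproj \<Rightarrow> (complex^'n) set) \<Rightarrow> 'n cproj ideal_sheaf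
     \<Rightarrow> ('n \<times> 'n \<times> 'n) cproj ideal_sheaf" where
  "jet_ideal X V I W = {g. regular_on W g \<and>
     (\<forall>p\<in>W. \<exists>U zs h W' b c.
        affine_open X U \<and> generates U I zs \<and> regular_on U h \<and>
        zariski_open (PV X V) W' \<and> p \<in> W' \<and> W' \<subseteq> W \<and>
        (\<forall>k<length zs. regular_on W' (b k) \<and> regular_on W' (c k)) \<and>
        (\<forall>a v. a \<noteq> 0 \<and> pt a \<in> X \<and> v \<in> V (pt a) \<and> v \<notin> line_of (pt a) \<and> flag_pt a v \<in> W' \<longrightarrow>
           pt a \<in> U \<and> differential X h a v \<noteq> 0 \<and>
           g (flag_pt a v) =
             (\<Sum>k<length zs. b k (flag_pt a v) * (zs ! k) (pt a)
                + c k (flag_pt a v) * (differential X (zs ! k) a v / differential X h a v))))}"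

section \<open>Weil functions\<close>

definition weil_function ::
  "('n::finite) cproj set \<Rightarrow> 'n cproj ideal_sheaf \<Rightarrow> ('n cproj \<Rightarrow> real) \<Rightarrow> bool" where
  "weil_function M I lam \<longleftrightarrow> continuous_on (M - supp M I) lam \<and>
     (\<exists>\<U>. \<Union>\<U> = M \<and> (\<forall>U\<in>\<U>. affine_open M U \<and>
        (\<exists>gs B. gs \<noteq> [] \<and> generates U I gs \<and> continuous_on U B \<and>
           (\<forall>x\<in>U - supp M I. \<bar>lam x + ln (Max ((\<lambda>g. cmod (g x)) ` set gs))\<bar> \<le> B x))))"

section \<open>Line bundles, sections and linear systems\<close>

text \<open>A line bundle trivialised over an open cover. A section is given by its local
  expressions, related by \<open>s\<^sub>i = g\<^sub>i\<^sub>j s\<^sub>j\<close> with \<open>g\<^sub>i\<^sub>j\<close> the transition functions.\<close>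

record ('i, 'x) bundle_data =
  triv :: "'i \<Rightarrow> 'x set"
  trans_fun :: "'i \<Rightarrow> 'i \<Rightarrow> 'x \<Rightarrow> complex"

definition line_bundle :: "('n::finite) cproj set \<Rightarrow> ('i, 'n cproj) bundle_data \<Rightarrow> bool" where
  "line_bundle X L \<longleftrightarrow>
     (\<forall>i. openin (top_of_set X) (triv L i)) \<and> (\<Union>i. triv L i) = X \<and>
     (\<forall>i j. \<forall>x\<in>triv L i \<inter> triv L j. holo_germ X x (trans_fun L i j) \<and> trans_fun L i j x \<noteq> 0) \<and>
     (\<forall>i j k. \<forall>x\<in>triv L i \<inter> triv L j \<inter> triv L k.
        trans_fun L i j x * trans_fun L j k x = trans_fun L i k x)"

text \<open>The local expressions are normalised to vanish outside the trivialising sets, so that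
  equality of sections is equality of functions.\<close>

definition sections ::
  "('n::finite) cproj set \<Rightarrow> ('i, 'n cproj) bundle_data \<Rightarrow> ('i \<Rightarrow> 'n cproj \<Rightarrow> complex) set" where
  "sections X L = {s.
     (\<forall>i. \<forall>x\<in>triv L i. holo_germ X x (s i)) \<and>
     (\<forall>i x. x \<notin> triv L i \<longrightarrow> s i x = 0) \<and>
     (\<forall>i j. \<forall>x\<in>triv L i \<inter> triv L j. s i x = trans_fun L i j x * s j x)}"

abbreviation scale_section :: "complex \<Rightarrow> ('i \<Rightarrow> 'x \<Rightarrow> complex) \<Rightarrow> 'i \<Rightarrow> 'x \<Rightarrow> complex" where
  "scale_section c s \<equiv> (\<lambda>i x. c * s i x)"

text \<open>A linear system is represented by the corresponding space of sections.\<close>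

definition linear_system ::
  "('n::finite) cproj set \<Rightarrow> ('i, 'n cproj) bundle_data \<Rightarrow> ('i \<Rightarrow> 'n cproj \<Rightarrow> complex) set \<Rightarrow> bool" where
  "linear_system X L S \<longleftrightarrow> S \<subseteq> sections X L \<and> module.subspace scale_section S"

definition section_basis ::
  "('i \<Rightarrow> 'x \<Rightarrow> complex) set \<Rightarrow> ('i \<Rightarrow> 'x \<Rightarrow> complex) set \<Rightarrow> bool" where
  "section_basis S B \<longleftrightarrow> finite B \<and> \<not> module.dependent scale_section B \<and>
     module.span scale_section B = S"

definition separates_1_jets ::
  "('n::finite) cproj set \<Rightarrow> ('i, 'n cproj) bundle_data \<Rightarrow> ('i \<Rightarrow> 'n cproj \<Rightarrow> complex) set
     \<Rightarrow> 'n cproj \<Rightarrow> bool" where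
  "separates_1_jets X L S x \<longleftrightarrow> (\<forall>i. x \<in> triv L i \<longrightarrow>
     (\<forall>g. holo_germ X x g \<longrightarrow> (\<exists>s\<in>S. (\<lambda>y. s i y - g y) \<in> max_ideal_sq X x)))"

text \<open>The stalk at \<open>x\<close> of the analytic ideal sheaf generated by the algebraic ideal sheaf \<open>I\<close>.\<close>

definition ideal_stalk ::
  "('n::finite) cproj set \<Rightarrow> 'n cproj ideal_sheaf \<Rightarrow> 'n cproj \<Rightarrow> ('n cproj \<Rightarrow> complex) set" where
  "ideal_stalk X I x = germ_ideal X x (\<Union>{I U | U. zariski_open X U \<and> x \<in> U})"

definition subsystem_containing ::
  "('n::finite) cproj set \<Rightarrow> ('i, 'n cproj) bundle_data \<Rightarrow> ('i \<Rightarrow> 'n cproj \<Rightarrow> complex) set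
     \<Rightarrow> 'n cproj ideal_sheaf \<Rightarrow> ('i \<Rightarrow> 'n cproj \<Rightarrow> complex) set" where
  "subsystem_containing X L S I = {s\<in>S. \<forall>i. \<forall>x\<in>triv L i. s i \<in> ideal_stalk X I x}"

definition base_ideal_eq ::
  "('n::finite) cproj set \<Rightarrow> ('i, 'n cproj) bundle_data \<Rightarrow> ('i \<Rightarrow> 'n cproj \<Rightarrow> complex) set
     \<Rightarrow> 'n cproj ideal_sheaf \<Rightarrow> bool" where
  "base_ideal_eq X L S I \<longleftrightarrow>
     (\<forall>i. \<forall>x\<in>triv L i. ideal_stalk X I x = germ_ideal X x ((\<lambda>s. s i) ` S))"

definition weight_of_basis :: "('i \<Rightarrow> 'x \<Rightarrow> complex) set \<Rightarrow> 'i \<Rightarrow> 'x \<Rightarrow> real" where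
  "weight_of_basis B i x = ln (\<Sum>s\<in>B. (cmod (s i x))\<^sup>2)"

section \<open>Nevanlinna theory\<close>

definition part_re :: "(complex \<Rightarrow> real) \<Rightarrow> complex \<Rightarrow> real" where
  "part_re u z = deriv (\<lambda>t. u (z + of_real t)) 0"

definition part_im :: "(complex \<Rightarrow> real) \<Rightarrow> complex \<Rightarrow> real" where
  "part_im u z = deriv (\<lambda>t. u (z + \<i> * of_real t)) 0"

text \<open>The density of \<open>dd\<^sup>c u\<close> with respect to \<open>dx \<and> dy\<close>:
  \<open>dd\<^sup>c u = (i / 2\<pi>) u\<^sub>z\<^sub>z\<^sub>' dz \<and> dz' = (\<Delta>u / 4\<pi>) dx \<and> dy\<close>, where \<open>z'\<close> is the conjugate of \<open>z\<close>.\<close>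

definition ddc :: "(complex \<Rightarrow> real) \<Rightarrow> complex \<Rightarrow> real" where
  "ddc u z = (part_re (part_re u) z + part_im (part_im u) z) / (4 * pi)"

text \<open>The density of \<open>f\<^sup>* dd\<^sup>c \<phi>\<close>, equal to \<open>dd\<^sup>c (\<phi> \<circ> f)\<close> for holomorphic \<open>f\<close>, for local weights
  \<open>\<phi>\<close>. It does not depend on the index, as two weights differ by a pluriharmonic function.\<close>

definition pullback_ddc ::
  "('i, 'x) bundle_data \<Rightarrow> ('i \<Rightarrow> 'x \<Rightarrow> real) \<Rightarrow> (complex \<Rightarrow> 'x) \<Rightarrow> complex \<Rightarrow> real" where
  "pullback_ddc L \<phi> f z = ddc (\<lambda>w. \<phi> (SOME i. f z \<in> triv L i) (f w)) z"

definition nevanlinna_N :: "complex measure \<Rightarrow> real \<Rightarrow> ennreal" where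
  "nevanlinna_N \<mu> r = (\<integral>\<^sup>+t\<in>{0<..r}. emeasure \<mu> (ball 0 t) / ennreal t \<partial>lborel)"

text \<open>The local weights of a continuous Hermitian metric \<open>\<bar>\<xi>\<bar>\<^sup>2 exp (- \<phi>)\<close>.\<close>

definition hermitian_weight ::
  "('i, ('n::finite) cproj) bundle_data \<Rightarrow> ('i \<Rightarrow> 'n cproj \<Rightarrow> real) \<Rightarrow> bool" where
  "hermitian_weight L \<phi> \<longleftrightarrow> (\<forall>i. continuous_on (triv L i) (\<phi> i)) \<and>
     (\<forall>i j. \<forall>x\<in>triv L i \<inter> triv L j. \<phi> i x = \<phi> j x + ln ((cmod (trans_fun L i j x))\<^sup>2))"

primrec C_k :: "nat \<Rightarrow> (complex \<Rightarrow> real) \<Rightarrow> bool" where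
  "C_k 0 u \<longleftrightarrow> continuous_on UNIV u"
| "C_k (Suc k) u \<longleftrightarrow> (\<exists>ux uy. C_k k ux \<and> C_k k uy \<and>
     (\<forall>z. (u has_derivative (\<lambda>h. ux z * Re h + uy z * Im h)) (at z)))"

text \<open>
  As \<open>\<phi>\<close> is merely continuous, \<open>f\<^sup>* dd\<^sup>c \<phi> = dd\<^sup>c (\<phi> \<circ> f)\<close> is a current, here required to be the
  difference of two locally finite measures (for a smooth metric, the positive and negative parts
  of the form). The pairing with test functions defining \<open>dd\<^sup>c\<close> of a continuous function extends
  to twice continuously differentiable test functions with compact support.
\<close>

definition pullback_ddc_current ::
  "('i, ('n::finite) cproj) bundle_data \<Rightarrow> ('i \<Rightarrow> 'n cproj \<Rightarrow> real) \<Rightarrow> (complex \<Rightarrow> 'n cproj)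
     \<Rightarrow> complex measure \<Rightarrow> complex measure \<Rightarrow> bool" where
  "pullback_ddc_current L \<phi> f \<mu> \<nu> \<longleftrightarrow>
     sets \<mu> = sets borel \<and> sets \<nu> = sets borel \<and>
     (\<forall>r. emeasure \<mu> (ball 0 r) < \<infinity> \<and> emeasure \<nu> (ball 0 r) < \<infinity>) \<and>
     (\<forall>i \<eta>. C_k 2 \<eta> \<and> compact (closure {z. \<eta> z \<noteq> 0}) \<and>
        closure {z. \<eta> z \<noteq> 0} \<subseteq> {z. f z \<in> triv L i} \<longrightarrow>
        (\<integral>z. \<eta> z \<partial>\<mu>) - (\<integral>z. \<eta> z \<partial>\<nu>) = (\<integral>z. \<phi> i (f z) * ddc \<eta> z \<partial>lborel))"

text \<open>\<open>T\<close> is a representative of the characteristic function of \<open>f\<close> with respect to \<open>L\<close>, which is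
  defined modulo bounded functions of \<open>r \<ge> 0\<close>.\<close>

definition characteristic_fun ::
  "('i, ('n::finite) cproj) bundle_data \<Rightarrow> (complex \<Rightarrow> 'n cproj) \<Rightarrow> (real \<Rightarrow> real) \<Rightarrow> bool" where
  "characteristic_fun L f T \<longleftrightarrow> (\<exists>\<phi> \<mu> \<nu>. hermitian_weight L \<phi> \<and> pullback_ddc_current L \<phi> f \<mu> \<nu> \<and>
     (\<forall>r\<ge>0. nevanlinna_N \<mu> r < \<infinity> \<and> nevanlinna_N \<nu> r < \<infinity>) \<and>
     bounded ((\<lambda>r. T r - (enn2real (nevanlinna_N \<mu> r) - enn2real (nevanlinna_N \<nu> r))) ` {0..}))"

end

theory Submission
  imports Defs "HOL-Computational_Algebra.Fundamental_Theorem_Algebra"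
begin

text \<open>
  Let \<open>B\<close> and \<open>Z\<close> be bases of the linear system and of its subsystem containing the subscheme, and let
  \<open>\<rho>\<close> be the quotient of the sums of squares of the sections in \<open>Z\<close> and in \<open>B\<close>. Since the subsystem
  generates the ideal sheaf, \<open>exp (2 \<lambda>)\<close> is at most a constant times \<open>1 / \<rho>\<close>, and
  \<open>exp (- 2 \<lambda>\<^sub>1) \<Theta>\<close> is at most a constant times \<open>\<rho> \<Theta> + Q\<close>, where \<open>\<Theta>\<close> is the pulled back form and \<open>Q\<close> is
  the sum of squares of the covariant derivatives of the sections in \<open>Z\<close> along the curve. By
  Cauchy--Schwarz, \<open>\<epsilon>\<^sup>2 \<rho> powr (\<epsilon> - 1) Q\<close> is bounded by \<open>dd\<^sup>c (\<rho> powr \<epsilon>) + \<epsilon> \<rho> powr \<epsilon> \<Theta>\<close> up to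
  factors \<open>\<pi>\<close>. As \<open>\<rho>\<close> is bounded, integrating against a logarithmic cutoff (Jensen's formula) bounds the
  counting function of the left-hand side by a multiple of the characteristic function.
\<close>

section \<open>Hilbert's Nullstellensatz for polynomial functions\<close>

text \<open>Three obstacles shape the development. A Weil function comes with generators over
  arbitrary affine open sets, whereas the hypothesis on the linear system concerns stalks. Passing
  between them means that a section over a principal open subset extends after multiplication by a
  power of the equation; this is what the Nullstellensatz is for. It is needed on P(V) as well: if
  the generators of the jet ideal vanished simultaneously off the preimage of Z, the Weil estimate
  would contain \<open>ln 0\<close>, which is 0 here and carries no information. Secondly, \<rho>
  powr (\<epsilon> - 1) is singular at the zeros of \<rho>. The differential inequality is proved
  for \<rho> + \<kappa> with \<kappa> > 0, where everything is twice differentiable, and \<kappa>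
  tends to 0 by Fatou's lemma. Thirdly, c must not depend on \<epsilon>. Integration bounds
  \<epsilon>^2 times the singular integral by a constant plus \<epsilon> times a multiple of T.
  After division by \<epsilon> the coefficient of T is free of \<epsilon>, and 1/\<epsilon>
  multiplies only a constant; this explains the factor \<epsilon> in the claim.\<close>

lemma poly_fun_prod: "(\<And>i. i \<in> A ==> poly_fun (p i)) ==> poly_fun (\<lambda>y. \<Prod>i\<in>A. p i y)"
  by (induction A rule: infinite_finite_induct) (auto intro: poly_fun.intros)

lemma poly_fun_power: "poly_fun p ==> poly_fun (\<lambda>y. p y ^ n)"
  by (induction n) (auto intro: poly_fun.intros)

lemma poly_fun_minus: "poly_fun p ==> poly_fun q ==> poly_fun (\<lambda>y. p y - q y)"
  using poly_fun.add[OF _ poly_fun.mult[OF poly_fun.const[of "-1"]], of p q] by simp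

interpretation fs: vector_space "\<lambda>(c::complex) (p::'x => complex) x. c * p x"
  by unfold_locales (auto simp: fun_eq_iff algebra_simps)

text \<open>A monomial is a list of variable indices, with repetitions as exponents. There are
  countably many lists, and the proof of the Nullstellensatz rests on this countability of a
  spanning set.\<close>

definition monom_fun :: "nat list => (nat => complex) => complex" where
  "monom_fun l y = prod_list (map y l)"

text \<open>Concatenating lists multiplies monomials; the two nested inductions are bilinear
  extension.\<close>

lemma span_monom_mult:
  assumes "p \<in> fs.span (range monom_fun)" "q \<in> fs.span (range monom_fun)"
  shows "(\<lambda>y. p y * q y) \<in> fs.span (range monom_fun)"
  using assms(1)
proof (induction p rule: fs.span_induct_alt)
  case base
  show ?case using fs.span_zero by (simp add: zero_fun_def)
next
  case (step c x p)
  then obtain l where l: "x = monom_fun l" by auto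
  have "(\<lambda>y. x y * q y) \<in> fs.span (range monom_fun)" using assms(2)
  proof (induction q rule: fs.span_induct_alt)
    case base
    show ?case using fs.span_zero by (simp add: zero_fun_def)
  next
    case (step d z q)
    then obtain l' where l': "z = monom_fun l'" by auto
    have "(\<lambda>y. x y * z y) = monom_fun (l @ l')"
      by (auto simp: l l' monom_fun_def)
    then have "(\<lambda>y. x y * z y) \<in> fs.span (range monom_fun)"
      by (auto intro: fs.span_base)
    from fs.span_add[OF fs.span_scale[OF this, of d] step.IH]
    show ?case by (simp add: plus_fun_def algebra_simps)
  qed
  from fs.span_add[OF fs.span_scale[OF this, of c] step.IH]
  show ?case by (simp add: plus_fun_def algebra_simps)
qed

lemma poly_fun_in_span: "poly_fun p ==> p \<in> fs.span (range monom_fun)"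
proof (induction rule: poly_fun.induct)
  case (const c)
  have "monom_fun [] \<in> fs.span (range monom_fun)" by (auto intro: fs.span_base)
  from fs.span_scale[OF this, of c] show ?case by (simp add: monom_fun_def[of "[]"])
next
  case (coord i)
  have "monom_fun [i] \<in> fs.span (range monom_fun)" by (auto intro: fs.span_base)
  then show ?case by (simp add: monom_fun_def[abs_def])
next
  case (add p q)
  then show ?case using fs.span_add[OF add.IH] by (simp add: plus_fun_def)
next
  case (mult p q)
  then show ?case by (simp add: span_monom_mult)
qed

lemma sum_apply: "(\<Sum>i\<in>A. p i) y = (\<Sum>i\<in>A. p i y :: complex)"
  by (induction A rule: infinite_finite_induct) auto

lemma uncountable_fiber:
  assumes "uncountable S"
  obtains n :: nat where "uncountable {x\<in>S. g x = n}"
proof -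
  have "S = (\<Union>n. {x\<in>S. g x = n})" by auto
  moreover have "countable (\<Union>n. {x\<in>S. g x = n})" if "\<And>n. countable {x\<in>S. g x = n}"
    using that by (intro countable_UN) auto
  ultimately show ?thesis using assms that by metis
qed

text \<open>Each function lies in the span of the first n monomials for some n. Uncountably many of
  them share one n, and n + 1 vectors in a space spanned by n elements are dependent.\<close>

lemma uncountable_family_dependent:
  fixes a :: "complex => (nat => complex) => complex"
  assumes S: "uncountable S" and a: "\<And>l. l \<in> S ==> poly_fun (a l)"
  obtains F \<mu> l0 where "finite F" "F \<subseteq> S" "l0 \<in> F" "\<mu> l0 ~= (0::complex)"
    "\<And>y. (\<Sum>l\<in>F. \<mu> l * a l y) = 0"
proof -
  define e where "e n = monom_fun (from_nat n)" for n
  have re: "range e = range monom_fun"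
    unfolding e_def using image_image[of monom_fun "from_nat :: nat => nat list" UNIV] by simp
  have "\<exists>n. a l \<in> fs.span (e ` {..<n})" if "l \<in> S" for l
  proof -
    have "a l \<in> fs.span (range e)" using poly_fun_in_span[OF a[OF that]] re by simp
    then obtain t r where t: "finite t" "t \<subseteq> range e" "a l = (\<Sum>v\<in>t. (\<lambda>x. r v * v x))"
      unfolding fs.span_explicit by auto
    from finite_subset_image[OF t(1,2)] obtain N where N: "finite N" "t = e ` N" by auto
    then obtain n where "N \<subseteq> {..<n}" using finite_nat_iff_bounded by auto
    then have "t \<subseteq> e ` {..<n}" using N by auto
    then have "a l \<in> fs.span (e ` {..<n})" unfolding t(3)
      by (intro fs.span_sum fs.span_scale fs.span_base) auto
    then show ?thesis by auto
  qed
  then obtain g where g: "\<And>l. l \<in> S ==> a l \<in> fs.span (e ` {..<g l})" by metis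
  obtain n where n: "uncountable {x\<in>S. g x = n}" using uncountable_fiber[OF S] by blast
  then have "infinite {x\<in>S. g x = n}" using countable_finite by blast
  then obtain F where F: "F \<subseteq> {x\<in>S. g x = n}" "card F = Suc n" "finite F"
    by (metis infinite_arbitrarily_large)
  show ?thesis
  \<comment> \<open>Dependence is a property of the image of F, so a coincidence a l = a l' is
    treated separately: there the relation is a l - a l' = 0.\<close>
  proof (cases "inj_on a F")
    case True
    have sub: "a ` F \<subseteq> fs.span (e ` {..<n})" using g F by auto
    have "fs.dependent (a ` F)"
    proof (rule ccontr)
      assume "fs.independent (a ` F)"
      from fs.independent_span_bound[OF _ this sub]
      have "card (a ` F) \<le> card (e ` {..<n})" by simp
      also have "\<dots> \<le> n" using card_image_le[of "{..<n}" e] by simp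
      finally show False using F card_image[OF True] by simp
    qed
    then obtain u where u: "\<exists>v\<in>a ` F. u v ~= 0" "(\<Sum>v\<in>a ` F. (\<lambda>x. u v * v x)) = 0"
      using fs.dependent_finite[of "a ` F"] F by auto
    then obtain l0 where "l0 \<in> F" "u (a l0) ~= 0" by auto
    moreover have "(\<Sum>l\<in>F. u (a l) * a l y) = 0" for y
    proof -
      have "(\<Sum>l\<in>F. u (a l) * a l y) = (\<Sum>v\<in>a ` F. u v * v y)"
        using True by (simp add: sum.reindex)
      also have "\<dots> = (\<Sum>v\<in>a ` F. (\<lambda>x. u v * v x)) y" 
        using sum_apply[of "\<lambda>v x. u v * v x" "a ` F" y] by simp
      finally show ?thesis using u by simp
    qed
    ultimately show ?thesis using that[of F l0 "\<lambda>l. u (a l)"] F by auto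
  next
    case False
    then obtain l l' where ll: "l \<in> F" "l' \<in> F" "l ~= l'" "a l = a l'" by (auto simp: inj_on_def)
    show ?thesis
      by (rule that[of "{l, l'}" l "\<lambda>x. if x = l then 1 else -1"]) (use ll F in auto)
  qed
qed

section \<open>Ideals of polynomial functions in countably many variables\<close>

definition poly_ideal :: "((nat => complex) => complex) set => bool" where
  "poly_ideal A \<longleftrightarrow> A \<subseteq> Collect poly_fun \<and> (\<lambda>_. 0) \<in> A \<and>
     (\<forall>a\<in>A. \<forall>b\<in>A. (\<lambda>y. a y + b y) \<in> A) \<and> (\<forall>a\<in>A. \<forall>p. poly_fun p --> (\<lambda>y. p y * a y) \<in> A)"

lemma poly_ideal_add: "poly_ideal A ==> a \<in> A ==> b \<in> A ==> (\<lambda>y. a y + b y) \<in> A"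
  and poly_ideal_mult: "poly_ideal A ==> a \<in> A ==> poly_fun p ==> (\<lambda>y. p y * a y) \<in> A"
  and poly_ideal_poly: "poly_ideal A ==> a \<in> A ==> poly_fun a"
  and poly_ideal_zero: "poly_ideal A ==> (\<lambda>_. 0) \<in> A"
  by (auto simp: poly_ideal_def)

lemma poly_ideal_mult': "poly_ideal A ==> a \<in> A ==> poly_fun p ==> (\<lambda>y. a y * p y) \<in> A"
  using poly_ideal_mult[of A a p] by (simp add: mult.commute)

lemma poly_ideal_diff: "poly_ideal A ==> a \<in> A ==> b \<in> A ==> (\<lambda>y. a y - b y) \<in> A"
  using poly_ideal_add[of A a "\<lambda>y. -1 * b y"] poly_ideal_mult[OF _ _ poly_fun.const, of A b "-1"]
  by simp

lemma poly_ideal_sum: 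
  "poly_ideal A ==> (\<And>i. i \<in> I ==> a i \<in> A) ==> (\<lambda>y. \<Sum>i\<in>I. a i y) \<in> A"
  by (induction I rule: infinite_finite_induct) (auto intro: poly_ideal_zero poly_ideal_add)

lemma poly_ideal_unit: "poly_ideal A ==> (\<lambda>_. c) \<in> A ==> c ~= 0 ==> poly_fun p ==> p \<in> A"
  using poly_ideal_mult[of A "\<lambda>_. c" "\<lambda>y. p y * inverse c"] poly_fun.mult[OF _ poly_fun.const, of p "inverse c"]
  by (simp add: mult.assoc)

lemma poly_fun_poly: "poly_fun q ==> poly_fun (\<lambda>y. poly p (q y))"
  by (induction p) (auto intro: poly_fun.intros)

text \<open>Zorn's lemma for the ideals above A that contain no power of f. By maximality M + (b)
  contains a power of f as soon as b is not in M, and multiplying two such expressions shows that M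
  is prime.\<close>

lemma maximal_avoiding_ideal:
  assumes A: "poly_ideal A" and f: "poly_fun f" and nf: "\<And>N::nat. (\<lambda>y. f y ^ N) \<notin> A"
  obtains M where "poly_ideal M" "A \<subseteq> M" "\<And>N::nat. (\<lambda>y. f y ^ N) \<notin> M"
    "\<And>b. poly_fun b ==> b \<notin> M ==>
       \<exists>N::nat. \<exists>m\<in>M. \<exists>p. poly_fun p \<and> (\<lambda>y. f y ^ N) = (\<lambda>y. m y + p y * b y)"
    "\<And>a b. poly_fun a ==> poly_fun b ==> (\<lambda>y. a y * b y) \<in> M ==> a \<in> M \<or> b \<in> M"
proof -
  define \<S> where "\<S> = {B. poly_ideal B \<and> A \<subseteq> B \<and> (\<forall>N::nat. (\<lambda>y. f y ^ N) \<notin> B)}"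
  have "\<exists>M\<in>\<S>. \<forall>X\<in>\<S>. M \<subseteq> X --> X = M"
  proof (rule subset_Zorn_nonempty)
    show "\<S> ~= {}" using A nf by (auto simp: \<S>_def)
    fix \<C> assume C: "\<C> ~= {}" "subset.chain \<S> \<C>"
    then have CS: "\<C> \<subseteq> \<S>" and ch: "\<And>x y. x \<in> \<C> ==> y \<in> \<C> ==> x \<subseteq> y \<or> y \<subseteq> x"
      by (auto simp: subset_chain_def)
    have "poly_ideal (\<Union>\<C>)"
      unfolding poly_ideal_def
    proof (intro conjI ballI allI impI)
      show "\<Union>\<C> \<subseteq> Collect poly_fun" using CS by (auto simp: \<S>_def poly_ideal_def)
      show "(\<lambda>_. 0) \<in> \<Union>\<C>" using CS C(1) by (auto simp: \<S>_def poly_ideal_def)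
      show "(\<lambda>y. p y * a y) \<in> \<Union>\<C>" if "a \<in> \<Union>\<C>" "poly_fun p" for a p
        using that CS by (fastforce simp: \<S>_def poly_ideal_def)
      show "(\<lambda>y. a y + b y) \<in> \<Union>\<C>" if ab: "a \<in> \<Union>\<C>" "b \<in> \<Union>\<C>" for a b
      proof -
        obtain x y where xy: "x \<in> \<C>" "a \<in> x" "y \<in> \<C>" "b \<in> y" using ab by blast
        then have "poly_ideal x" "poly_ideal y" using CS by (auto simp: \<S>_def)
        then obtain z where z: "z \<in> \<C>" "a \<in> z" "b \<in> z" "poly_ideal z"
          using ch[OF xy(1,3)] xy by blast
        from UnionI[OF z(1) poly_ideal_add[OF z(4,2,3)]] show ?thesis .
      qed
    qed
    moreover have "A \<subseteq> \<Union>\<C>" using CS C(1) by (auto simp: \<S>_def)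
    moreover have "\<forall>N::nat. (\<lambda>y. f y ^ N) \<notin> \<Union>\<C>" using CS by (auto simp: \<S>_def)
    ultimately show "\<Union>\<C> \<in> \<S>" by (auto simp: \<S>_def)
  qed
  then obtain M where M: "M \<in> \<S>" "\<And>X. X \<in> \<S> ==> M \<subseteq> X ==> X = M" by blast
  have MI: "poly_ideal M" "A \<subseteq> M" "\<And>N::nat. (\<lambda>y. f y ^ N) \<notin> M" using M(1) by (auto simp: \<S>_def)
  have ex: "\<exists>N::nat. \<exists>m\<in>M. \<exists>p. poly_fun p \<and> (\<lambda>y. f y ^ N) = (\<lambda>y. m y + p y * b y)"
    if b: "poly_fun b" "b \<notin> M" for b
  proof (rule ccontr)
    assume no: "\<not> ?thesis"
    define X where "X = {(\<lambda>y. m y + p y * b y) | m p. m \<in> M \<and> poly_fun p}"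
    have XI: "g \<in> X" if "m \<in> M" "poly_fun p" "\<And>y. g y = m y + p y * b y" for g m p
    proof -
      have "g = (\<lambda>y. m y + p y * b y)" using that(3) by (rule ext)
      then show ?thesis using that(1,2) unfolding X_def by blast
    qed
    have "poly_ideal X"
      unfolding poly_ideal_def
    proof (intro conjI ballI allI impI)
      show "X \<subseteq> Collect poly_fun" using MI b by (auto simp: X_def intro!: poly_fun.intros dest: poly_ideal_poly)
      show "(\<lambda>_. 0) \<in> X"
        by (rule XI[OF poly_ideal_zero[OF MI(1)] poly_fun.const[of 0]]) simp
      show "(\<lambda>y. q y * a y) \<in> X" if a: "a \<in> X" and q: "poly_fun q" for a q
      proof -
        obtain m p where "a = (\<lambda>y. m y + p y * b y)" "m \<in> M" "poly_fun p" using a by (auto simp: X_def)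
        then show ?thesis
          by (intro XI[OF poly_ideal_mult[OF MI(1) _ q] poly_fun.mult[OF q]]) (auto simp: algebra_simps)
      qed
      show "(\<lambda>y. a y + a' y) \<in> X" if a: "a \<in> X" and a': "a' \<in> X" for a a'
      proof -
        obtain m p m' p' where "a = (\<lambda>y. m y + p y * b y)" "m \<in> M" "poly_fun p"
          "a' = (\<lambda>y. m' y + p' y * b y)" "m' \<in> M" "poly_fun p'"
          using a a' unfolding X_def by blast
        then show ?thesis
          by (intro XI[OF poly_ideal_add[OF MI(1)] poly_fun.add]) (auto simp: algebra_simps)
      qed
    qed
    moreover have MX: "M \<subseteq> X" unfolding X_def using poly_fun.const[of 0] by force
    moreover have "\<forall>N::nat. (\<lambda>y. f y ^ N) \<notin> X" using no unfolding X_def by blast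
    ultimately have "X \<in> \<S>" using MI by (auto simp: \<S>_def)
    then have "X = M" using M(2) MX by blast
    moreover have "b \<in> X" unfolding X_def
      using poly_ideal_zero[OF MI(1)] poly_fun.const[of 1] by force
    ultimately show False using b by simp
  qed
  have pr: "a \<in> M \<or> b \<in> M" if ab: "poly_fun a" "poly_fun b" "(\<lambda>y. a y * b y) \<in> M" for a b
  proof (rule ccontr)
    assume "\<not> ?thesis"
    then have nab: "a \<notin> M" "b \<notin> M" by auto
    obtain N m p N' m' p' where *: "m \<in> M" "poly_fun p" "(\<lambda>y. f y ^ N) = (\<lambda>y. m y + p y * a y)"
       "m' \<in> M" "poly_fun p'" "(\<lambda>y. f y ^ N') = (\<lambda>y. m' y + p' y * b y)"
      using ex[OF ab(1) nab(1)] ex[OF ab(2) nab(2)] by blast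
    \<comment> \<open>Every term of the product is a multiple of m or m' except the last one, which
      is a multiple of a b.\<close>
    have "(\<lambda>y. f y ^ (N + N')) = (\<lambda>y. (m y * (m' y + p' y * b y) + p y * a y * m' y) + p y * p' y * (a y * b y))"
    proof
      fix y
      show "f y ^ (N + N') = (m y * (m' y + p' y * b y) + p y * a y * m' y) + p y * p' y * (a y * b y)"
        using fun_cong[OF *(3), of y] fun_cong[OF *(6), of y] by (simp add: power_add algebra_simps)
    qed
    also have "\<dots> \<in> M"
      using * ab poly_ideal_poly[OF MI(1)]
      by (intro poly_ideal_add[OF MI(1)] poly_ideal_mult'[OF MI(1) *(1)] poly_ideal_mult[OF MI(1) *(4)]
          poly_ideal_mult[OF MI(1) ab(3)] poly_fun.intros) auto
    finally show False using MI(3) by blast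
  qed
  show ?thesis using that MI ex pr by blast
qed

text \<open>The residue field of the localisation at \<open>f\<close> of a maximal \<open>f\<close>-avoiding ideal has countable
  dimension over \<open>\<complex>\<close>, so it cannot contain a transcendental element \<open>x\<close>: the uncountably many
  inverses of \<open>x - l\<close> would be independent.\<close>

theorem nullstellensatz:
  assumes A: "poly_ideal A" and f: "poly_fun f"
    and van: "\<And>y. (\<forall>a\<in>A. a y = 0) ==> f y = 0"
  shows "\<exists>N::nat. (\<lambda>y. f y ^ N) \<in> A"
proof (rule ccontr)
  assume "\<not> ?thesis"
  then have nf: "\<And>N::nat. (\<lambda>y. f y ^ N) \<notin> A" by blast
  obtain M where M: "poly_ideal M" "A \<subseteq> M" "\<And>N::nat. (\<lambda>y. f y ^ N) \<notin> M"
    and ex: "\<And>b. poly_fun b ==> b \<notin> M ==>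
       \<exists>N::nat. \<exists>m\<in>M. \<exists>p. poly_fun p \<and> (\<lambda>y. f y ^ N) = (\<lambda>y. m y + p y * b y)"
    and pr: "\<And>a b. poly_fun a ==> poly_fun b ==> (\<lambda>y. a y * b y) \<in> M ==> a \<in> M \<or> b \<in> M"
    by (rule maximal_avoiding_ideal[OF A f nf], rule that)
  have fM: "f \<notin> M" using M(3)[of 1] by simp
  have noconst: "(\<lambda>_. c) \<notin> M" if "c ~= 0" for c
    using poly_ideal_unit[OF M(1) _ that f] fM by blast
  have root: "\<exists>l. (\<lambda>y. y i - l) \<in> M" for i
  proof -
    \<comment> \<open>Over the complex numbers a polynomial in the i-th coordinate splits into
      linear factors, so primality of M puts one of these factors into M.\<close>
    have split: "\<exists>l. (\<lambda>y. y i - l) \<in> M" if "p ~= 0" "(\<lambda>y. poly p (y i)) \<in> M" for p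
      using that
    proof (induction "degree p" arbitrary: p)
      case 0
      then obtain c where c: "p = [:c:]" using degree_eq_zeroE by metis
      then show ?case using 0 noconst[of c] by auto
    next
      case (Suc n)
      then have "\<not> constant (poly p)" by (simp add: constant_degree)
      then obtain z where "poly p z = 0" using fundamental_theorem_of_algebra by blast
      then obtain q where q: "p = [:-z, 1:] * q" using poly_eq_0_iff_dvd by blast
      have "q ~= 0" using Suc.prems q by auto
      then have "degree p = Suc (degree q)" using degree_mult_eq[of "[:-z, 1:]" q] by (simp add: q)
      then have dq: "n = degree q" using Suc by simp
      have "(\<lambda>y. poly p (y i)) = (\<lambda>y. (y i - z) * poly q (y i))" unfolding q by (simp add: algebra_simps)
      then have "(\<lambda>y. (y i - z)) \<in> M \<or> (\<lambda>y. poly q (y i)) \<in> M"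
        using Suc.prems by (intro pr) (auto intro: poly_fun_minus poly_fun_poly poly_fun.intros)
      then show ?case using Suc.hyps(1)[OF dq \<open>q ~= 0\<close>] by blast
    qed
    show ?thesis
    proof (rule ccontr)
      assume no: "\<not> ?thesis"
      \<comment> \<open>If no y i - l lies in M, each of them is invertible modulo M up to a power
        of f: below, \<open>p l\<close> plays the role of f^(N l) / (y i - l).\<close>
      have "\<exists>t::nat \<times> _ \<times> _. fst (snd t) \<in> M \<and> poly_fun (snd (snd t)) \<and>
          (\<forall>y. f y ^ fst t = fst (snd t) y + snd (snd t) y * (y i - l))" for l
      proof -
        have "poly_fun (\<lambda>y::nat => complex. y i - l)" by (intro poly_fun_minus poly_fun.intros)
        from ex[OF this] no obtain N m p where "m \<in> M" "poly_fun p"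
          "(\<lambda>y. f y ^ N) = (\<lambda>y. m y + p y * (y i - l))" by blast
        then show ?thesis by (intro exI[of _ "(N, m, p)"]) (auto simp: fun_eq_iff)
      qed
      then obtain t :: "complex => nat \<times> _ \<times> _" where t: "\<And>l. fst (snd (t l)) \<in> M \<and> poly_fun (snd (snd (t l))) \<and>
          (\<forall>y. f y ^ fst (t l) = fst (snd (t l)) y + snd (snd (t l)) y * (y i - l))"
        using choice[of "\<lambda>l t. fst (snd t) \<in> M \<and> poly_fun (snd (snd t)) \<and>
          (\<forall>y. f y ^ fst t = fst (snd t) y + snd (snd t) y * (y i - l))"] by blast
      define N m p where "N l = fst (t l)" and "m l = fst (snd (t l))" and "p l = snd (snd (t l))" for l
      have Nmp: "\<And>l. m l \<in> M" "\<And>l. poly_fun (p l)" "\<And>l y. f y ^ N l = m l y + p l y * (y i - l)"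
        using t by (auto simp: N_def m_def p_def)
      \<comment> \<open>The exponents are natural numbers, so uncountably many l share one exponent
        K.\<close>
      obtain K where K: "uncountable {x\<in>UNIV. N x = K}"
        using uncountable_fiber[OF uncountable_UNIV_complex] by blast
      obtain F \<mu> l0 where F: "finite F" "F \<subseteq> {x\<in>UNIV. N x = K}" "l0 \<in> F" "\<mu> l0 ~= 0"
        "\<And>y. (\<Sum>l\<in>F. \<mu> l * p l y) = 0"
        by (rule uncountable_family_dependent[OF K, of p]) (use Nmp(2) in \<open>blast+\<close>)
      \<comment> \<open>P is the numerator of the sum of \<mu> l / (X - l) over F. It does not
        vanish at l0, where only the summand l = l0 survives.\<close>
      define P where "P = (\<Sum>l\<in>F. smult (\<mu> l) (\<Prod>k\<in>F - {l}. [:-k, 1:]))"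
      have "poly P l0 = (\<Sum>l\<in>F. if l = l0 then \<mu> l0 * (\<Prod>k\<in>F-{l0}. l0 - k) else 0)"
        unfolding P_def poly_sum poly_smult poly_prod
        by (intro sum.cong) (use F in \<open>auto simp: prod_zero_iff\<close>)
      also have "\<dots> = \<mu> l0 * (\<Prod>k\<in>F-{l0}. l0 - k)" using F by simp
      also have "\<dots> ~= 0" using F by (auto simp: prod_zero_iff)
      finally have "P ~= 0" by auto
      \<comment> \<open>Substitute f^K = m l + p l (y i - l) in the l-th summand. The terms with p l
        add up to the full product times the linear relation and vanish; what remains lies in
        M.\<close>
      have "(\<lambda>y. f y ^ K * poly P (y i)) = (\<lambda>y. \<Sum>l\<in>F. (\<mu> l * (\<Prod>k\<in>F - {l}. y i - k)) * m l y)"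
      proof
        fix y
        have "f y ^ K * poly P (y i) = (\<Sum>l\<in>F. \<mu> l * (\<Prod>k\<in>F - {l}. y i - k) * f y ^ K)"
          unfolding P_def poly_sum by (simp add: sum_distrib_left poly_prod mult_ac)
        also have "\<dots> = (\<Sum>l\<in>F. (\<mu> l * (\<Prod>k\<in>F - {l}. y i - k)) * m l y + (\<Prod>k\<in>F. y i - k) * (\<mu> l * p l y))"
        proof (intro sum.cong refl)
          fix l assume l: "l \<in> F"
          have e: "f y ^ K = m l y + p l y * (y i - l)" using Nmp(3)[of y l] l F by auto
          show "\<mu> l * (\<Prod>k\<in>F - {l}. y i - k) * f y ^ K =
            (\<mu> l * (\<Prod>k\<in>F - {l}. y i - k)) * m l y + (\<Prod>k\<in>F. y i - k) * (\<mu> l * p l y)"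
            unfolding e prod.remove[OF F(1) l, of "\<lambda>k. y i - k"] by (simp only: distrib_left mult_ac)
        qed
        also have "\<dots> = (\<Sum>l\<in>F. (\<mu> l * (\<Prod>k\<in>F - {l}. y i - k)) * m l y)"
          using F(5)[of y] by (simp add: sum.distrib flip: sum_distrib_left)
        finally show "f y ^ K * poly P (y i) = \<dots>" .
      qed
      also have "\<dots> \<in> M"
        by (intro poly_ideal_sum[OF M(1)] poly_ideal_mult[OF M(1)] Nmp(1) poly_fun.mult
            poly_fun.const poly_fun_prod poly_fun_minus poly_fun.coord)
      finally have "(\<lambda>y. f y ^ K) \<in> M \<or> (\<lambda>y. poly P (y i)) \<in> M"
        by (intro pr poly_fun_power poly_fun_poly poly_fun.coord f)
      then show False using M(3) split[OF \<open>P ~= 0\<close>] no by blast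
    qed
  qed
  \<comment> \<open>M is now the ideal of a point z: every a differs from its value a z by an
    element of M. Hence M vanishes at z, so f z = 0 by hypothesis, and this puts f itself into
    M.\<close>
  then obtain z where z: "\<And>i. (\<lambda>y. y i - z i) \<in> M" by metis
  have ev: "(\<lambda>y. a y - a z) \<in> M" if "poly_fun a" for a
    using that
  proof (induction rule: poly_fun.induct)
    case (const c)
    then show ?case using poly_ideal_zero[OF M(1)] by simp
  next
    case (coord i)
    then show ?case using z by simp
  next
    case (add p q)
    then show ?case using poly_ideal_add[OF M(1) add.IH] by (simp add: algebra_simps)
  next
    case (mult p q)
    have "(\<lambda>y. q y * (p y - p z) + p z * (q y - q z)) \<in> M"
      by (intro poly_ideal_add[OF M(1)] poly_ideal_mult[OF M(1)] mult poly_fun.const)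
    then show ?case by (simp add: algebra_simps)
  qed
  have "a z = 0" if "a \<in> M" for a
  proof (rule ccontr)
    assume "a z ~= 0"
    moreover have "(\<lambda>y. a y - (a y - a z)) \<in> M"
      by (rule poly_ideal_diff[OF M(1) that ev[OF poly_ideal_poly[OF M(1) that]]])
    ultimately show False using noconst[of "a z"] by simp
  qed
  then have "f z = 0" using van M(2) by blast
  then show False using ev[OF f] fM by simp
qed

section \<open>Points of projective space and regular functions\<close>

lemma line_of_pt: 
  assumes "a ~= 0"
  shows "line_of (pt a) = range (\<lambda>c. c *s a)"
proof -
  have i: "vec.independent {a}" using assms by (simp add: vec.dependent_single)
  have "vec.dim (vec.span {a}) = card {a}"
    by (rule vec.dim_eq_card_independent[OF i, THEN trans[OF vec.dim_span]])
  then have "line_of (pt a) = vec.span {a}"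
    unfolding pt_def by (intro Abs_cproj_inverse) (simp add: vec.subspace_span)
  then show ?thesis by (simp add: vec.span_singleton)
qed

lemma cproj_cases:
  obtains a where "a ~= 0" "x = pt a"
proof -
  have x: "vec.subspace (line_of x)" "vec.dim (line_of x) = 1" using line_of[of x] by auto
  obtain B where B: "B \<subseteq> line_of x" "vec.independent B" "line_of x \<subseteq> vec.span B" "card B = 1"
    using vec.basis_exists[of "line_of x"] x(2) by metis
  then obtain a where a: "B = {a}" by (auto simp: card_1_singleton_iff)
  have "a ~= 0" using B(2) a by (auto simp: vec.dependent_single)
  moreover have "vec.span {a} = line_of x"
    using B a vec.span_minimal[OF B(1) x(1)] by auto
  then have "x = pt a" unfolding pt_def by (simp add: line_of_inverse)
  ultimately show ?thesis using that by blast
qed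

lemma mem_line_self: "a ~= 0 ==> a \<in> line_of (pt a)"
  by (auto simp: line_of_pt intro: range_eqI[of _ _ 1])

lemma pt_scale: "c ~= 0 ==> a ~= 0 ==> pt (c *s a) = pt a"
proof -
  assume "c ~= 0" "a ~= 0"
  have "vec.span {c *s a} = vec.span {a}"
  proof -
    have "(k::complex) *s a = (k / c) *s (c *s a)" for k using \<open>c ~= 0\<close> by (simp add: vector_smult_assoc)
    then have "k *s a \<in> range (\<lambda>k. k *s (c *s a))" for k :: complex by blast
    then show ?thesis by (auto simp: vec.span_singleton vector_smult_assoc)
  qed
  then show ?thesis by (simp add: pt_def)
qed

lemma pt_eqD:
  assumes "a ~= 0" "b ~= 0" "pt a = pt b"
  obtains c where "c ~= 0" "b = c *s a"
proof -
  have "b \<in> line_of (pt a)" using mem_line_self[OF assms(2)] assms(3) by simp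
  then obtain c where "b = c *s a" using line_of_pt[OF assms(1)] by auto
  then show ?thesis using that assms(2) by (cases "c = 0") auto
qed

section \<open>Homogeneous polynomials, Zariski open sets and regular functions\<close>

lemma hom_poly_scale: "hom_poly d p ==> p (c *s a) = c ^ d * p a"
  by (simp add: hom_poly_def)

lemma hom_polyE:
  assumes "hom_poly d p"
  obtains q where "poly_fun q" "\<And>a. p a = q (vec_nth a)"
  using assms unfolding hom_poly_def by metis

lemma hom_polyI:
  assumes "poly_fun q" "\<And>a. p a = q (vec_nth a)" "\<And>c a. p (c *s a) = c ^ d * p a"
  shows "hom_poly d p"
  unfolding hom_poly_def using assms by blast

lemma hom_poly_mult:
  assumes p: "hom_poly d p" and q: "hom_poly e q"
  shows "hom_poly (d + e) (\<lambda>a. p a * q a)"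
proof -
  obtain p' where p': "poly_fun p'" "\<And>a. p a = p' (vec_nth a)" by (rule hom_polyE[OF p], rule that)
  obtain q' where q': "poly_fun q'" "\<And>a. q a = q' (vec_nth a)" by (rule hom_polyE[OF q], rule that)
  show ?thesis
    by (rule hom_polyI[OF poly_fun.mult[OF p'(1) q'(1)]])
      (simp_all add: hom_poly_scale[OF p] hom_poly_scale[OF q] power_add flip: p'(2) q'(2))
qed

lemma hom_poly_add:
  assumes p: "hom_poly d p" and q: "hom_poly d q"
  shows "hom_poly d (\<lambda>a. p a + q a)"
proof -
  obtain p' where p': "poly_fun p'" "\<And>a. p a = p' (vec_nth a)" by (rule hom_polyE[OF p], rule that)
  obtain q' where q': "poly_fun q'" "\<And>a. q a = q' (vec_nth a)" by (rule hom_polyE[OF q], rule that)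
  show ?thesis
    by (rule hom_polyI[OF poly_fun.add[OF p'(1) q'(1)]])
      (simp_all add: hom_poly_scale[OF p] hom_poly_scale[OF q] algebra_simps flip: p'(2) q'(2))
qed

lemma hom_poly_const: "hom_poly 0 (\<lambda>_. c)"
  unfolding hom_poly_def by (auto intro!: exI[of _ "\<lambda>_. c"] poly_fun.const)

lemma hom_poly_line_nz:
  assumes "hom_poly d p" "b ~= 0"
  shows "(\<exists>a\<in>line_of (pt b). p a ~= 0) \<longleftrightarrow> p b ~= 0"
  using assms mem_line_self[OF assms(2)] by (auto simp: line_of_pt hom_poly_scale)

lemma zariski_open_subset: "zariski_open M U ==> U \<subseteq> M"
  by (auto simp: zariski_open_def)

lemma zariski_openE:
  assumes "zariski_open M U" "a ~= 0" "pt a \<in> U"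
  obtains d p where "hom_poly d p" "p a ~= 0" "\<And>b. b ~= 0 ==> pt b \<in> M ==> p b ~= 0 ==> pt b \<in> U"
proof -
  obtain P where P: "\<forall>p\<in>P. \<exists>d. hom_poly d p" "U = {x\<in>M. \<exists>p\<in>P. \<exists>a\<in>line_of x. p a ~= 0}"
    using assms(1) unfolding zariski_open_def by blast
  then obtain p where p: "p \<in> P" "\<exists>b\<in>line_of (pt a). p b ~= 0" using assms(3) by blast
  then obtain d where d: "hom_poly d p" using P by blast
  show ?thesis
  proof (rule that[OF d])
    show "p a ~= 0" using p(2) hom_poly_line_nz[OF d assms(2)] by blast
    show "pt b \<in> U" if "b ~= 0" "pt b \<in> M" "p b ~= 0" for b
      using P(2) p(1) that mem_line_self[of b] by blast
  qed
qed

text \<open>The defining family can be taken to be all homogeneous polynomials whose non-vanishing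
  locus in M is contained in U, so openness only has to be checked around each point.\<close>

lemma zariski_openI:
  assumes "U \<subseteq> M" "\<And>a. a ~= 0 ==> pt a \<in> U ==>
    \<exists>d p. hom_poly d p \<and> p a ~= 0 \<and> (\<forall>b. b ~= 0 --> pt b \<in> M --> p b ~= 0 --> pt b \<in> U)"
  shows "zariski_open M U"
proof -
  define P where "P = {p. (\<exists>d. hom_poly d p) \<and> (\<forall>b. b ~= 0 --> pt b \<in> M --> p b ~= 0 --> pt b \<in> U)}"
  have "U = {x\<in>M. \<exists>p\<in>P. \<exists>a\<in>line_of x. p a ~= 0}"
  proof (intro set_eqI iffI)
    fix x assume "x \<in> U"
    moreover obtain a where a: "a ~= 0" "x = pt a" by (rule cproj_cases)
    ultimately obtain p where "p \<in> P" "p a ~= 0" using assms(2)[of a] by (auto simp: P_def)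
    then show "x \<in> {x\<in>M. \<exists>p\<in>P. \<exists>a\<in>line_of x. p a ~= 0}"
      using assms(1) \<open>x \<in> U\<close> a mem_line_self by blast
  next
    fix x assume x: "x \<in> {x\<in>M. \<exists>p\<in>P. \<exists>a\<in>line_of x. p a ~= 0}"
    obtain b where b: "b ~= 0" "x = pt b" by (rule cproj_cases)
    obtain p where p: "p \<in> P" "\<exists>a\<in>line_of (pt b). p a ~= 0" using x b by blast
    then obtain d where "hom_poly d p" by (auto simp: P_def)
    then have "p b ~= 0" using p hom_poly_line_nz b by blast
    then show "x \<in> U" using p(1) b x by (auto simp: P_def)
  qed
  then show ?thesis unfolding zariski_open_def by (intro exI[of _ P]) (auto simp: P_def)
qed

lemma zariski_open_Int:
  assumes "zariski_open M U" "zariski_open M W"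
  shows "zariski_open M (U \<inter> W)"
proof (rule zariski_openI)
  show "U \<inter> W \<subseteq> M" using zariski_open_subset[OF assms(1)] by blast
  fix a :: "complex^'a" assume a: "a ~= 0" "pt a \<in> U \<inter> W"
  obtain d p where p: "hom_poly d p" "p a ~= 0" "\<And>b. b ~= 0 ==> pt b \<in> M ==> p b ~= 0 ==> pt b \<in> U"
    using zariski_openE[OF assms(1) a(1)] a(2) by blast
  obtain e q where q: "hom_poly e q" "q a ~= 0" "\<And>b. b ~= 0 ==> pt b \<in> M ==> q b ~= 0 ==> pt b \<in> W"
    using zariski_openE[OF assms(2) a(1)] a(2) by blast
  show "\<exists>d p. hom_poly d p \<and> p a ~= 0 \<and> (\<forall>b. b ~= 0 --> pt b \<in> M --> p b ~= 0 --> pt b \<in> U \<inter> W)"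
    by (rule exI[of _ "d + e"], rule exI[of _ "\<lambda>b. p b * q b"]) (use p q in \<open>auto intro: hom_poly_mult\<close>)
qed

lemma regular_onE:
  assumes "regular_on U g" "a ~= 0" "pt a \<in> U"
  obtains d p q where "hom_poly d p" "hom_poly d q" "q a ~= 0"
    "\<And>b. b ~= 0 ==> pt b \<in> U ==> q b ~= 0 ==> g (pt b) = p b / q b"
proof -
  obtain d p q where *: "hom_poly d p" "hom_poly d q" "\<exists>b\<in>line_of (pt a). q b ~= 0"
     "\<forall>y\<in>U. \<forall>b\<in>line_of y. q b ~= 0 --> g y = p b / q b"
    using assms unfolding regular_on_def by blast
  show ?thesis
    by (rule that[OF *(1,2)]) (use * hom_poly_line_nz[OF *(2) assms(2)] mem_line_self in blast)+
qed

text \<open>Numerator and denominator have the same degree, so a quotient checked on one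
  representative is valid on the whole line.\<close>

lemma regular_onI:
  assumes "\<And>a. a ~= 0 ==> pt a \<in> U ==> \<exists>d p q. hom_poly d p \<and> hom_poly d q \<and> q a ~= 0 \<and>
    (\<forall>b. b ~= 0 --> pt b \<in> U --> q b ~= 0 --> g (pt b) = p b / q b)"
  shows "regular_on U g"
  unfolding regular_on_def
proof
  fix x assume x: "x \<in> U"
  obtain a where a: "a ~= 0" "x = pt a" by (rule cproj_cases)
  obtain d p q where *: "hom_poly d p" "hom_poly d q" "q a ~= 0"
    "\<forall>b. b ~= 0 --> pt b \<in> U --> q b ~= 0 --> g (pt b) = p b / q b"
    using assms[of a] a x by blast
  have "g y = p b / q b" if "y \<in> U" "b \<in> line_of y" "q b ~= 0" for y b
  proof -
    obtain b' where b': "b' ~= 0" "y = pt b'" by (rule cproj_cases)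
    then obtain c where c: "b = c *s b'" using \<open>b \<in> line_of y\<close> line_of_pt by auto
    then have "q b = c ^ d * q b'" "p b = c ^ d * p b'" using * by (auto simp: hom_poly_scale)
    then show ?thesis using * b' that by auto
  qed
  then show "\<exists>d p q. hom_poly d p \<and> hom_poly d q \<and> (\<exists>a\<in>line_of x. q a ~= 0) \<and>
      (\<forall>y\<in>U. \<forall>b\<in>line_of y. q b ~= 0 --> g y = p b / q b)"
    using * a mem_line_self[of a] by blast
qed

lemma regular_on_subset: 
  assumes "regular_on U g" "W \<subseteq> U"
  shows "regular_on W g"
proof (rule regular_onI)
  fix a :: "complex^'a" assume a: "a ~= 0" "pt a \<in> W"
  then have "pt a \<in> U" using assms(2) by blast
  from regular_onE[OF assms(1) a(1) this] obtain d p q where 1: "hom_poly d p" "hom_poly d q" "q a ~= 0"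
    "\<And>b. b ~= 0 ==> pt b \<in> U ==> q b ~= 0 ==> g (pt b) = p b / q b" by blast
  show "\<exists>d p q. hom_poly d p \<and> hom_poly d q \<and> q a ~= 0 \<and>
    (\<forall>b. b ~= 0 --> pt b \<in> W --> q b ~= 0 --> g (pt b) = p b / q b)"
    by (rule exI[of _ d], rule exI[of _ p], rule exI[of _ q]) (use 1 assms(2) in auto)
qed

lemma regular_on_cong: "(\<And>x. x \<in> U ==> g x = h x) ==> regular_on U g \<longleftrightarrow> regular_on U h"
  by (simp add: regular_on_def)

lemma regular_on_const: "regular_on U (\<lambda>_. c)"
  by (rule regular_onI, rule exI[of _ 0], rule exI[of _ "\<lambda>_. c"], rule exI[of _ "\<lambda>_. 1"])
    (simp add: hom_poly_const)

lemma regular_on_add: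
  assumes "regular_on U g" "regular_on U h"
  shows "regular_on U (\<lambda>x. g x + h x)"
proof (rule regular_onI)
  fix a :: "complex^'a" assume a: "a ~= 0" "pt a \<in> U"
  obtain d p q where 1: "hom_poly d p" "hom_poly d q" "q a ~= 0"
    "\<And>b. b ~= 0 ==> pt b \<in> U ==> q b ~= 0 ==> g (pt b) = p b / q b"
    using regular_onE[OF assms(1) a] by blast
  obtain d' p' q' where 2: "hom_poly d' p'" "hom_poly d' q'" "q' a ~= 0"
    "\<And>b. b ~= 0 ==> pt b \<in> U ==> q' b ~= 0 ==> h (pt b) = p' b / q' b"
    using regular_onE[OF assms(2) a] by blast
  have "hom_poly (d + d') (\<lambda>b. p b * q' b + q b * p' b)" using 1 2 by (intro hom_poly_add hom_poly_mult)
  moreover have "hom_poly (d + d') (\<lambda>b. q b * q' b)" using 1 2 by (intro hom_poly_mult)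
  moreover have "g (pt b) + h (pt b) = (p b * q' b + q b * p' b) / (q b * q' b)"
    if "b ~= 0" "pt b \<in> U" "q b * q' b ~= 0" for b
    using 1(4)[of b] 2(4)[of b] that by (simp add: field_simps)
  ultimately show "\<exists>d p q. hom_poly d p \<and> hom_poly d q \<and> q a ~= 0 \<and>
    (\<forall>b. b ~= 0 --> pt b \<in> U --> q b ~= 0 --> g (pt b) + h (pt b) = p b / q b)"
    using 1(3) 2(3) by (intro exI[of _ "d + d'"] exI[of _ "\<lambda>b. p b * q' b + q b * p' b"] exI[of _ "\<lambda>b. q b * q' b"]) auto
qed

lemma regular_on_mult:
  assumes "regular_on U g" "regular_on U h"
  shows "regular_on U (\<lambda>x. g x * h x)"
proof (rule regular_onI)
  fix a :: "complex^'a" assume a: "a ~= 0" "pt a \<in> U"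
  obtain d p q where 1: "hom_poly d p" "hom_poly d q" "q a ~= 0"
    "\<And>b. b ~= 0 ==> pt b \<in> U ==> q b ~= 0 ==> g (pt b) = p b / q b"
    using regular_onE[OF assms(1) a] by blast
  obtain d' p' q' where 2: "hom_poly d' p'" "hom_poly d' q'" "q' a ~= 0"
    "\<And>b. b ~= 0 ==> pt b \<in> U ==> q' b ~= 0 ==> h (pt b) = p' b / q' b"
    using regular_onE[OF assms(2) a] by blast
  have "hom_poly (d + d') (\<lambda>b. p b * p' b)" "hom_poly (d + d') (\<lambda>b. q b * q' b)"
    using 1 2 by (auto intro: hom_poly_mult)
  then show "\<exists>d p q. hom_poly d p \<and> hom_poly d q \<and> q a ~= 0 \<and>
    (\<forall>b. b ~= 0 --> pt b \<in> U --> q b ~= 0 --> g (pt b) * h (pt b) = p b / q b)"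
    using 1(3,4) 2(3,4) by (intro exI[of _ "d + d'"] exI[of _ "\<lambda>b. p b * p' b"] exI[of _ "\<lambda>b. q b * q' b"]) auto
qed

lemma regular_on_sum:
  "(\<And>i. i \<in> A ==> regular_on U (g i)) ==> regular_on U (\<lambda>x. \<Sum>i\<in>A. g i x)"
  by (induction A rule: infinite_finite_induct) (auto intro: regular_on_const regular_on_add)

lemma regular_on_power: "regular_on U g ==> regular_on U (\<lambda>x. g x ^ n)"
  by (induction n) (auto intro: regular_on_const regular_on_mult)

lemma regular_on_inverse:
  assumes "regular_on U h" "\<And>x. x \<in> U ==> h x ~= 0"
  shows "regular_on U (\<lambda>x. inverse (h x))"
proof (rule regular_onI)
  fix a :: "complex^'a" assume a: "a ~= 0" "pt a \<in> U"
  obtain d p q where 1: "hom_poly d p" "hom_poly d q" "q a ~= 0"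
    "\<And>b. b ~= 0 ==> pt b \<in> U ==> q b ~= 0 ==> h (pt b) = p b / q b"
    using regular_onE[OF assms(1) a] by blast
  \<comment> \<open>The inverse is written as q^2 / (p q) rather than q / p: the formula for h is
    known only where q does not vanish.\<close>
  have "hom_poly (d + d) (\<lambda>b. q b * q b)" "hom_poly (d + d) (\<lambda>b. p b * q b)"
    using 1 by (auto intro: hom_poly_mult)
  moreover have "p a ~= 0" using 1(3) 1(4)[OF a] assms(2)[OF a(2)] a by auto
  moreover have "inverse (h (pt b)) = (q b * q b) / (p b * q b)"
    if "b ~= 0" "pt b \<in> U" "p b * q b ~= 0" for b
    using 1(4)[of b] that by simp
  ultimately show "\<exists>d p q. hom_poly d p \<and> hom_poly d q \<and> q a ~= 0 \<and>
    (\<forall>b. b ~= 0 --> pt b \<in> U --> q b ~= 0 --> inverse (h (pt b)) = p b / q b)"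
    using 1(3) by (intro exI[of _ "d + d"] exI[of _ "\<lambda>b. q b * q b"] exI[of _ "\<lambda>b. p b * q b"]) auto
qed

lemma regular_on_divide:
  "regular_on U g ==> regular_on U h ==> (\<And>x. x \<in> U ==> h x ~= 0) ==> regular_on U (\<lambda>x. g x / h x)"
  unfolding divide_inverse by (intro regular_on_mult regular_on_inverse)

text \<open>The formula in \<open>regular_on\<close> has to hold on all of U wherever the
  denominator is non-zero. Multiplying numerator and denominator by a polynomial s whose
  non-vanishing locus lies in W makes a formula on W meet this demand.\<close>

lemma regular_on_local:
  assumes "U \<subseteq> M" "\<And>x. x \<in> U ==> \<exists>W. zariski_open M W \<and> x \<in> W \<and> regular_on W g"
  shows "regular_on U g"
proof (rule regular_onI)
  fix a :: "complex^'a" assume a: "a ~= 0" "pt a \<in> U"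
  obtain W where W: "zariski_open M W" "pt a \<in> W" "regular_on W g" using assms(2) a by blast
  obtain d p q where 1: "hom_poly d p" "hom_poly d q" "q a ~= 0"
    "\<And>b. b ~= 0 ==> pt b \<in> W ==> q b ~= 0 ==> g (pt b) = p b / q b"
    using regular_onE[OF W(3) a(1) W(2)] by blast
  obtain e s where 2: "hom_poly e s" "s a ~= 0" "\<And>b. b ~= 0 ==> pt b \<in> M ==> s b ~= 0 ==> pt b \<in> W"
    using zariski_openE[OF W(1) a(1) W(2)] by blast
  have "hom_poly (d + e) (\<lambda>b. p b * s b)" "hom_poly (d + e) (\<lambda>b. q b * s b)"
    using 1 2 by (auto intro: hom_poly_mult)
  moreover have "g (pt b) = (p b * s b) / (q b * s b)"
    if "b ~= 0" "pt b \<in> U" "q b * s b ~= 0" for b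
    using 1(4)[of b] 2(3)[of b] that assms(1) by auto
  ultimately show "\<exists>d p q. hom_poly d p \<and> hom_poly d q \<and> q a ~= 0 \<and>
    (\<forall>b. b ~= 0 --> pt b \<in> U --> q b ~= 0 --> g (pt b) = p b / q b)"
    using 1(3) 2(2) by (intro exI[of _ "d + e"] exI[of _ "\<lambda>b. p b * s b"] exI[of _ "\<lambda>b. q b * s b"]) auto
qed

lemma zariski_open_nonzero:
  assumes "zariski_open M W" "regular_on W g"
  shows "zariski_open M {x\<in>W. g x ~= 0}"
proof (rule zariski_openI)
  show "{x\<in>W. g x ~= 0} \<subseteq> M" using zariski_open_subset[OF assms(1)] by blast
  fix a :: "complex^'a" assume a: "a ~= 0" "pt a \<in> {x\<in>W. g x ~= 0}"
  then have aW: "pt a \<in> W" "g (pt a) ~= 0" by auto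
  obtain d p q where 1: "hom_poly d p" "hom_poly d q" "q a ~= 0"
    "\<And>b. b ~= 0 ==> pt b \<in> W ==> q b ~= 0 ==> g (pt b) = p b / q b"
    using regular_onE[OF assms(2) a(1) aW(1)] by blast
  obtain e s where 2: "hom_poly e s" "s a ~= 0" "\<And>b. b ~= 0 ==> pt b \<in> M ==> s b ~= 0 ==> pt b \<in> W"
    using zariski_openE[OF assms(1) a(1) aW(1)] by blast
  \<comment> \<open>The factors p and q control the value of g, and s confines the locus to W, where
    p / q represents g.\<close>
  have "hom_poly (d + d + e) (\<lambda>b. p b * q b * s b)" using 1 2 by (intro hom_poly_mult)
  moreover have "p a ~= 0" using 1(3) 1(4)[OF a(1) aW(1)] aW by auto
  moreover have "pt b \<in> {x\<in>W. g x ~= 0}" if "b ~= 0" "pt b \<in> M" "p b * q b * s b ~= 0" for b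
    using 1(4)[of b] 2(3)[of b] that by auto
  ultimately show "\<exists>d p. hom_poly d p \<and> p a ~= 0 \<and>
     (\<forall>b. b ~= 0 --> pt b \<in> M --> p b ~= 0 --> pt b \<in> {x\<in>W. g x ~= 0})"
    using 1(3) 2(2) by (intro exI[of _ "d + d + e"] exI[of _ "\<lambda>b. p b * q b * s b"]) auto
qed

section \<open>Generators of an ideal sheaf on an affine open set\<close>

text \<open>Later arguments concern ideals of polynomials in the coordinates h; this lemma removes
  the model Y from them. The last item is the Nullstellensatz on U: an ideal containing all
  polynomials that vanish on U has its zeros in the model.\<close>

lemma affine_open_model:
  assumes "affine_open M U"
  obtains h :: "('n::finite) cproj => nat => complex" where
    "\<And>p. poly_fun p ==> zariski_open M {x\<in>U. p (h x) ~= 0}"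
    "\<And>W p. W \<subseteq> U ==> zariski_open M W ==> poly_fun p ==> regular_on W (\<lambda>x. p (h x))"
    "\<And>W x. W \<subseteq> U ==> zariski_open M W ==> x \<in> W ==>
       \<exists>p. poly_fun p \<and> p (h x) ~= 0 \<and> {x\<in>U. p (h x) ~= 0} \<subseteq> W"
    "\<And>W g x. W \<subseteq> U ==> zariski_open M W ==> regular_on W g ==> x \<in> W ==>
       \<exists>p q. poly_fun p \<and> poly_fun q \<and> q (h x) ~= 0 \<and> (\<forall>v\<in>W. q (h v) ~= 0 --> g v = p (h v) / q (h v))"
    "\<And>A f. poly_ideal A ==> {p. poly_fun p \<and> (\<forall>x\<in>U. p (h x) = 0)} \<subseteq> A ==> poly_fun f ==>
       \<forall>x\<in>U. (\<forall>a\<in>A. a (h x) = 0) --> f (h x) = 0 ==> \<exists>N::nat. (\<lambda>y. f y ^ N) \<in> A"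
proof -
  obtain m Y h where Y: "affine_algebraic m Y" and h: "bij_betw h U Y"
    and zo': "\<forall>W\<subseteq>U. zariski_open M W \<longleftrightarrow> affine_zariski_open Y (h ` W)"
    and rg': "\<forall>W\<subseteq>U. zariski_open M W -->
      (\<forall>g. regular_on W (\<lambda>x. g (h x)) \<longleftrightarrow> affine_regular_on (h ` W) g)"
    using assms unfolding affine_open_def by (elim conjE exE) (rule that)
  note zo = zo'[rule_format] and rg = rg'[rule_format]
  have hU: "h ` U = Y" and inj: "inj_on h U" using h by (auto simp: bij_betw_def)
  obtain P where P: "\<forall>p\<in>P. poly_fun p" "Y = {y. (\<forall>k\<ge>m. y k = 0) \<and> (\<forall>p\<in>P. p y = 0)}"
    using Y unfolding affine_algebraic_def by blast
  show ?thesis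
  proof (rule that[of h])
    fix p :: "(nat => complex) => complex" assume p: "poly_fun p"
    have "h ` {x\<in>U. p (h x) ~= 0} = {y\<in>Y. p y ~= 0}" using hU by auto
    then have "affine_zariski_open Y (h ` {x\<in>U. p (h x) ~= 0})"
      unfolding affine_zariski_open_def using p by (intro exI[of _ "{p}"]) auto
    then show "zariski_open M {x\<in>U. p (h x) ~= 0}" by (subst zo) auto
  next
    fix W and p :: "(nat => complex) => complex" assume W: "W \<subseteq> U" "zariski_open M W" "poly_fun p"
    have "affine_regular_on (h ` W) p" unfolding affine_regular_on_def
    proof
      fix y
      show "\<exists>p' q. poly_fun p' \<and> poly_fun q \<and> q y ~= 0 \<and> (\<forall>y'\<in>h ` W. q y' ~= 0 --> p y' = p' y' / q y')"
        by (rule exI[of _ p], rule exI[of _ "\<lambda>_. 1"]) (use W poly_fun.const in auto)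
    qed
    then show "regular_on W (\<lambda>x. p (h x))" using rg[OF W(1,2)] by simp
  next
    fix W x assume W: "W \<subseteq> U" "zariski_open M W" "x \<in> W"
    then have "affine_zariski_open Y (h ` W)" using zo by simp
    then obtain T where T: "\<forall>p\<in>T. poly_fun p" "h ` W = {y\<in>Y. \<exists>p\<in>T. p y ~= 0}"
      unfolding affine_zariski_open_def by (elim exE conjE) (rule that)
    have "h x \<in> h ` W" using W by blast
    then obtain p where p: "p \<in> T" "p (h x) ~= 0" using T(2) by auto
    have "{x\<in>U. p (h x) ~= 0} \<subseteq> W"
    proof
      fix v assume "v \<in> {x\<in>U. p (h x) ~= 0}"
      then have v: "v \<in> U" "p (h v) ~= 0" by auto
      then have "h v \<in> h ` W" using T(2) p hU by blast
      then show "v \<in> W" using v(1) W(1) inj by (auto dest: inj_onD)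
    qed
    then show "\<exists>p. poly_fun p \<and> p (h x) ~= 0 \<and> {x\<in>U. p (h x) ~= 0} \<subseteq> W" using p T by blast
  next
    fix W g x assume W: "W \<subseteq> U" "zariski_open M W" "regular_on W g" "x \<in> W"
    define g' where "g' y = g (inv_into U h y)" for y
    have g': "g' (h v) = g v" if "v \<in> U" for v using inj that by (simp add: g'_def)
    have "regular_on W (\<lambda>x. g' (h x))" using W regular_on_cong[of W "\<lambda>x. g' (h x)" g] g' by blast
    then have "affine_regular_on (h ` W) g'" using rg[OF W(1,2)] by blast
    from this[unfolded affine_regular_on_def, THEN bspec, OF imageI[OF W(4)]]
    obtain p q where pq: "poly_fun p" "poly_fun q" "q (h x) ~= 0"
      "\<forall>y\<in>h ` W. q y ~= 0 --> g' y = p y / q y" by (elim exE conjE) (rule that)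
    have "\<forall>v\<in>W. q (h v) ~= 0 --> g v = p (h v) / q (h v)"
    proof (intro ballI impI)
      fix v assume v: "v \<in> W" "q (h v) ~= 0"
      then have "g' (h v) = p (h v) / q (h v)" using pq(4) by blast
      then show "g v = p (h v) / q (h v)" using g' v(1) W(1) by auto
    qed
    with pq(1-3) show "\<exists>p q. poly_fun p \<and> poly_fun q \<and> q (h x) ~= 0 \<and> (\<forall>v\<in>W. q (h v) ~= 0 --> g v = p (h v) / q (h v))"
      by blast
  next
    fix A and f :: "(nat => complex) => complex"
    assume A: "poly_ideal A" "{p. poly_fun p \<and> (\<forall>x\<in>U. p (h x) = 0)} \<subseteq> A" "poly_fun f"
      and van: "\<forall>x\<in>U. (\<forall>a\<in>A. a (h x) = 0) --> f (h x) = 0"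
    show "\<exists>N::nat. (\<lambda>y. f y ^ N) \<in> A"
    proof (rule nullstellensatz[OF A(1,3)])
      fix y assume y: "\<forall>a\<in>A. a y = 0"
      \<comment> \<open>Points of the model are sequences vanishing from index m on, so these
        coordinates vanish on U and belong to A. Together with the equations P they force every zero
        of A into Y.\<close>
      have "(\<lambda>y. y k) \<in> A" if "k \<ge> m" for k
        by (intro subsetD[OF A(2)]) (use that P hU poly_fun.coord in auto)
      moreover have "P \<subseteq> A"
      proof
        fix p assume "p \<in> P"
        then have "poly_fun p" "\<forall>x\<in>U. p (h x) = 0" using P hU by auto
        then show "p \<in> A" using A(2) by auto
      qed
      ultimately have "y \<in> Y" using y P(2) by auto
      then obtain x where "x \<in> U" "y = h x" using hU by auto
      then show "f y = 0" using van y by blast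
    qed
  qed
qed

text \<open>The sections \<open>G y k\<close> stand for local generators of an ideal sheaf: a section over a principal
  open subset of an affine set extends after multiplication by a power of the equation.\<close>

lemma extend_local_combination:
  fixes G :: "('n::finite) cproj => nat => 'n cproj => complex" and L :: "'n cproj => nat"
  assumes U: "affine_open M U" and W0: "zariski_open M W0" "W0 \<subseteq> U" "x \<in> W0"
    and N: "\<And>y. y \<in> U ==> zariski_open M (N y)" "\<And>y. y \<in> U ==> y \<in> N y" "\<And>y. y \<in> U ==> N y \<subseteq> U"
    and loc: "\<And>y w. y \<in> U ==> w \<in> N y ==> w \<in> W0 ==>
      \<exists>W c. zariski_open M W \<and> w \<in> W \<and> W \<subseteq> N y \<inter> W0 \<and> (\<forall>k<L y. regular_on W (c k)) \<and>
        (\<forall>v\<in>W. e v = (\<Sum>k<L y. c k v * G y k v))"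
  obtains q g where "regular_on U q" "q x ~= 0" "\<forall>v\<in>W0. g v = q v * e v"
    "\<forall>y'\<in>U. \<exists>y\<in>U. \<exists>W c. zariski_open M W \<and> y' \<in> W \<and> W \<subseteq> N y \<and>
       (\<forall>k<L y. regular_on W (c k)) \<and> (\<forall>v\<in>W. g v = (\<Sum>k<L y. c k v * G y k v))"
proof -
  have UM: "zariski_open M U" using U by (simp add: affine_open_def)
  obtain h :: "'n cproj => nat => complex" where
    hD: "\<And>p. poly_fun p ==> zariski_open M {x\<in>U. p (h x) ~= 0}" and
    hR: "\<And>W p. W \<subseteq> U ==> zariski_open M W ==> poly_fun p ==> regular_on W (\<lambda>x. p (h x))" and
    hE: "\<And>W x. W \<subseteq> U ==> zariski_open M W ==> x \<in> W ==>
       \<exists>p. poly_fun p \<and> p (h x) ~= 0 \<and> {x\<in>U. p (h x) ~= 0} \<subseteq> W" and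
    hF: "\<And>W g x. W \<subseteq> U ==> zariski_open M W ==> regular_on W g ==> x \<in> W ==>
       \<exists>p q. poly_fun p \<and> poly_fun q \<and> q (h x) ~= 0 \<and> (\<forall>v\<in>W. q (h v) ~= 0 --> g v = p (h v) / q (h v))" and
    hN: "\<And>A f. poly_ideal A ==> {p. poly_fun p \<and> (\<forall>x\<in>U. p (h x) = 0)} \<subseteq> A ==> poly_fun f ==>
       \<forall>x\<in>U. (\<forall>a\<in>A. a (h x) = 0) --> f (h x) = 0 ==> \<exists>N::nat. (\<lambda>y. f y ^ N) \<in> A"
    by (rule affine_open_model[OF U], rule that)
  obtain q0 where q0: "poly_fun q0" "q0 (h x) ~= 0" "{x\<in>U. q0 (h x) ~= 0} \<subseteq> W0"
    using hE[OF W0(2,1,3)] by blast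
  have "\<exists>t. \<forall>y\<in>U. poly_fun (t y) \<and> t y (h y) ~= 0 \<and> {x\<in>U. t y (h x) ~= 0} \<subseteq> N y"
    by (rule bchoice) (use hE N in blast)
  then obtain t where t: "\<And>y. y \<in> U ==> poly_fun (t y)" "\<And>y. y \<in> U ==> t y (h y) ~= 0"
    "\<And>y. y \<in> U ==> {x\<in>U. t y (h x) ~= 0} \<subseteq> N y" by blast
  have "\<exists>NP. (\<forall>k. poly_fun (snd NP k)) \<and> (\<forall>v\<in>U. q0 (h v) ~= 0 --> t y (h v) ~= 0 -->
      (q0 (h v) * t y (h v)) ^ (fst NP :: nat) * e v = (\<Sum>k<L y. snd NP k (h v) * G y k v))" if y: "y \<in> U" for y
  proof -
    \<comment> \<open>A is the ideal of denominators: those r for which r e is a polynomial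
      combination of the generators where q0 and t y do not vanish. Once q0 t y is seen to vanish at
      the zeros of A on U, the Nullstellensatz puts a power of it into A.\<close>
    define C where "C r P \<longleftrightarrow> poly_fun r \<and> (\<forall>k. poly_fun (P k)) \<and> (\<forall>v\<in>U. q0 (h v) ~= 0 --> t y (h v) ~= 0 -->
      r (h v) * e v = (\<Sum>k<L y. P k (h v) * G y k v))" for r and P :: "nat => (nat => complex) => complex"
    define A where "A = {r. \<exists>P. C r P}"
    have AI: "r \<in> A" if "C r P" for r P using that by (auto simp: A_def)
    have "poly_ideal A"
      unfolding poly_ideal_def
    proof (intro conjI ballI allI impI)
      show "A \<subseteq> Collect poly_fun" by (auto simp: A_def C_def)
      show "(\<lambda>_. 0) \<in> A" by (rule AI[of _ "\<lambda>_ _. 0"]) (auto simp: C_def poly_fun.const)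
      show "(\<lambda>z. a z + b z) \<in> A" if ab: "a \<in> A" "b \<in> A" for a b
      proof -
        obtain P Q where "C a P" "C b Q" using ab by (auto simp: A_def)
        then show ?thesis
          by (intro AI[of _ "\<lambda>k z. P k z + Q k z"]) (auto simp: C_def algebra_simps sum.distrib intro: poly_fun.add)
      qed
      show "(\<lambda>z. p z * a z) \<in> A" if ap: "a \<in> A" "poly_fun p" for a p
      proof -
        obtain P where "C a P" using ap by (auto simp: A_def)
        then show ?thesis using ap(2)
          by (intro AI[of _ "\<lambda>k z. p z * P k z"]) (auto simp: C_def mult.assoc sum_distrib_left[symmetric] intro: poly_fun.mult)
      qed
    qed
    moreover have "{p. poly_fun p \<and> (\<forall>x\<in>U. p (h x) = 0)} \<subseteq> A"
    proof
      fix p assume p: "p \<in> {p. poly_fun p \<and> (\<forall>x\<in>U. p (h x) = 0)}"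
      show "p \<in> A" by (rule AI[of _ "\<lambda>_ _. 0"]) (use p in \<open>auto simp: C_def poly_fun.const\<close>)
    qed
    moreover have "poly_fun (\<lambda>z. q0 z * t y z)" using q0 t[OF y] by (auto intro: poly_fun.mult)
    moreover have "q0 (h w) * t y (h w) = 0" if w: "w \<in> U" "\<forall>a\<in>A. a (h w) = 0" for w
    proof (rule ccontr)
      assume nz: "q0 (h w) * t y (h w) ~= 0"
      then have "w \<in> W0" "w \<in> N y" using q0(3) t(3)[OF y] w(1) by auto
      then obtain W c where W: "zariski_open M W" "w \<in> W" "W \<subseteq> N y \<inter> W0" "\<forall>k<L y. regular_on W (c k)"
        "\<forall>v\<in>W. e v = (\<Sum>k<L y. c k v * G y k v)" using loc[OF y] by blast
      have WU: "W \<subseteq> U" using W(3) W0(2) by blast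
      have "\<exists>ab. \<forall>k\<in>{..<L y}. poly_fun (fst (ab k)) \<and> poly_fun (snd (ab k)) \<and> snd (ab k) (h w) ~= 0 \<and>
          (\<forall>v\<in>W. snd (ab k) (h v) ~= 0 --> c k v = fst (ab k) (h v) / snd (ab k) (h v))"
      proof (rule bchoice, intro ballI)
        fix k assume "k \<in> {..<L y}"
        then obtain p q where "poly_fun p" "poly_fun q" "q (h w) ~= 0" "\<forall>v\<in>W. q (h v) ~= 0 --> c k v = p (h v) / q (h v)"
          using hF[OF WU W(1) _ W(2), of "c k"] W(4) by blast
        then show "\<exists>ab. poly_fun (fst ab) \<and> poly_fun (snd ab) \<and> snd ab (h w) ~= 0 \<and>
          (\<forall>v\<in>W. snd ab (h v) ~= 0 --> c k v = fst ab (h v) / snd ab (h v))"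
          by (intro exI[of _ "(p, q)"]) auto
      qed
      then obtain ab where ab: "\<forall>k\<in>{..<L y}. poly_fun (fst (ab k)) \<and> poly_fun (snd (ab k)) \<and> snd (ab k) (h w) ~= 0 \<and>
          (\<forall>v\<in>W. snd (ab k) (h v) ~= 0 --> c k v = fst (ab k) (h v) / snd (ab k) (h v))" by blast
      define a b where "a k = (if k < L y then fst (ab k) else (\<lambda>_. 0))" and "b k = (if k < L y then snd (ab k) else (\<lambda>_. 0))" for k
      have a: "\<And>k. poly_fun (a k)" and b: "\<And>k. poly_fun (b k)" and bw: "\<And>k. k < L y ==> b k (h w) ~= 0"
        and cab: "\<And>k v. k < L y ==> v \<in> W ==> b k (h v) ~= 0 ==> c k v = a k (h v) / b k (h v)"
        using ab by (auto simp: a_def b_def poly_fun.const)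
      obtain d where d: "poly_fun d" "d (h w) ~= 0" "{x\<in>U. d (h x) ~= 0} \<subseteq> W" using hE[OF WU W(1,2)] by blast
      \<comment> \<open>A common denominator of the coefficients, times an equation d that confines
        the locus to W.\<close>
      define r where "r z = d z * (\<Prod>k<L y. b k z)" for z
      have r: "poly_fun r" unfolding r_def[abs_def] by (intro poly_fun.mult d poly_fun_prod b)
      \<comment> \<open>One factor r clears the denominators. The other makes both sides vanish
        where r does, so that the identity holds on all of U and not only on W.\<close>
      have "C (\<lambda>z. r z * r z) (\<lambda>k z. r z * d z * (a k z * (\<Prod>j\<in>{..<L y} - {k}. b j z)))"
        unfolding C_def
      proof (intro conjI allI ballI impI)
        show "poly_fun (\<lambda>z. r z * r z)" using r by (intro poly_fun.mult)
        show "poly_fun (\<lambda>z. r z * d z * (a k z * (\<Prod>j\<in>{..<L y} - {k}. b j z)))" for k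
          by (intro poly_fun.mult r d a poly_fun_prod b)
        fix v assume v: "v \<in> U"
        show "r (h v) * r (h v) * e v =
           (\<Sum>k<L y. r (h v) * d (h v) * (a k (h v) * (\<Prod>j\<in>{..<L y} - {k}. b j (h v))) * G y k v)"
        proof (cases "r (h v) = 0")
          case False
          then have bn: "\<And>k. k < L y ==> b k (h v) ~= 0" and dn: "d (h v) ~= 0" by (auto simp: r_def)
          then have vW: "v \<in> W" using d(3) v by blast
          have "r (h v) * r (h v) * e v = (\<Sum>k<L y. r (h v) * r (h v) * (c k v * G y k v))"
            using W(5) vW by (simp add: sum_distrib_left)
          also have "\<dots> = (\<Sum>k<L y. r (h v) * d (h v) * (a k (h v) * (\<Prod>j\<in>{..<L y} - {k}. b j (h v))) * G y k v)"
          proof (intro sum.cong refl)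
            fix k assume k: "k \<in> {..<L y}"
            have "(\<Prod>j<L y. b j (h v)) = b k (h v) * (\<Prod>j\<in>{..<L y} - {k}. b j (h v))"
              by (rule prod.remove) (use k in auto)
            then show "r (h v) * r (h v) * (c k v * G y k v) =
                r (h v) * d (h v) * (a k (h v) * (\<Prod>j\<in>{..<L y} - {k}. b j (h v))) * G y k v"
              using bn[of k] cab[of k v] vW k unfolding r_def by (simp add: field_simps)
          qed
          finally show ?thesis .
        qed simp
      qed
      then have "(\<lambda>z. r z * r z) \<in> A" by (rule AI)
      then have "r (h w) * r (h w) = 0" using w(2) by fastforce
      moreover have "r (h w) ~= 0" using bw d(2) by (auto simp: r_def)
      ultimately show False by simp
    qed
    ultimately obtain n :: nat where "(\<lambda>z. (q0 z * t y z) ^ n) \<in> A" using hN[of A "\<lambda>z. q0 z * t y z"] by blast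
    then obtain P where "C (\<lambda>z. (q0 z * t y z) ^ n) P" by (auto simp: A_def)
    then show ?thesis by (intro exI[of _ "(n, P)"]) (auto simp: C_def)
  qed
  then have "\<exists>NP. \<forall>y\<in>U. (\<forall>k. poly_fun (snd (NP y) k)) \<and> (\<forall>v\<in>U. q0 (h v) ~= 0 --> t y (h v) ~= 0 -->
      (q0 (h v) * t y (h v)) ^ (fst (NP y) :: nat) * e v = (\<Sum>k<L y. snd (NP y) k (h v) * G y k v))"
    by (intro bchoice) blast
  then obtain NP where NP: "\<forall>y\<in>U. (\<forall>k. poly_fun (snd (NP y) k)) \<and> (\<forall>v\<in>U. q0 (h v) ~= 0 --> t y (h v) ~= 0 -->
      (q0 (h v) * t y (h v)) ^ (fst (NP y) :: nat) * e v = (\<Sum>k<L y. snd (NP y) k (h v) * G y k v))" by blast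
  define n P where "n y = fst (NP y)" and "P y = snd (NP y)" for y
  have P: "\<And>y k. y \<in> U ==> poly_fun (P y k)" and
    nP: "\<And>y v. y \<in> U ==> v \<in> U ==> q0 (h v) ~= 0 ==> t y (h v) ~= 0 ==>
      (q0 (h v) * t y (h v)) ^ n y * e v = (\<Sum>k<L y. P y k (h v) * G y k v)"
    using NP by (auto simp: n_def P_def)
  \<comment> \<open>Quasi-compactness of U: no point is a common zero of all t y, so by the
    Nullstellensatz 1 lies in the ideal of functions that vanish at the common zeros of finitely
    many of them.\<close>
  obtain F where F: "finite F" "F \<subseteq> U" "\<And>v. v \<in> U ==> \<exists>y\<in>F. t y (h v) ~= 0"
  proof -
    define C where "C r F \<longleftrightarrow> poly_fun r \<and> finite F \<and> F \<subseteq> U \<and>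
      (\<forall>v\<in>U. (\<forall>y\<in>F. t y (h v) = 0) --> r (h v) = 0)" for r F
    define A where "A = {r. \<exists>F. C r F}"
    have AI: "r \<in> A" if "C r F" for r F using that by (auto simp: A_def)
    have "poly_ideal A"
      unfolding poly_ideal_def
    proof (intro conjI ballI allI impI)
      show "A \<subseteq> Collect poly_fun" by (auto simp: A_def C_def)
      show "(\<lambda>_. 0) \<in> A" by (rule AI[of _ "{}"]) (auto simp: C_def poly_fun.const)
      show "(\<lambda>z. a z + b z) \<in> A" if ab: "a \<in> A" "b \<in> A" for a b
      proof -
        obtain F F' where "C a F" "C b F'" using ab by (auto simp: A_def)
        then show ?thesis by (intro AI[of _ "F \<union> F'"]) (auto simp: C_def intro: poly_fun.add)
      qed
      show "(\<lambda>z. p z * a z) \<in> A" if ap: "a \<in> A" "poly_fun p" for a p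
      proof -
        obtain F where "C a F" using ap by (auto simp: A_def)
        then show ?thesis using ap(2) by (intro AI[of _ F]) (auto simp: C_def intro: poly_fun.mult)
      qed
    qed
    moreover have "{p. poly_fun p \<and> (\<forall>x\<in>U. p (h x) = 0)} \<subseteq> A"
    proof
      fix p assume p: "p \<in> {p. poly_fun p \<and> (\<forall>x\<in>U. p (h x) = 0)}"
      show "p \<in> A" by (rule AI[of _ "{}"]) (use p in \<open>auto simp: C_def\<close>)
    qed
    moreover have "(1::complex) = 0" if w: "w \<in> U" "\<forall>a\<in>A. a (h w) = 0" for w
    proof -
      have "t w \<in> A" by (rule AI[of _ "{w}"]) (use t(1) w(1) in \<open>auto simp: C_def\<close>)
      then show ?thesis using w t(2)[OF w(1)] by blast
    qed
    ultimately obtain m :: nat where "(\<lambda>z. 1 ^ m) \<in> A" using hN[of A "\<lambda>_. 1"] poly_fun.const[of 1] by blast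
    then obtain F where "C (\<lambda>z. 1) F" by (auto simp: A_def)
    then show ?thesis using that[of F] by (auto simp: C_def)
  qed
  \<comment> \<open>K is a common bound for the exponents n y. The exponent Suc K keeps Suc K - n y
    positive, so the coefficients c vanish together with q0, where g is set to 0.\<close>
  define K where "K = (\<Sum>y\<in>F. n y)"
  have nK: "n y \<le> K" if "y \<in> F" for y unfolding K_def using F(1) that by (simp add: member_le_sum)
  define q where "q v = q0 (h v) ^ Suc K" for v
  define g where "g v = (if q0 (h v) = 0 then 0 else q v * e v)" for v
  show ?thesis
  proof (rule that)
    show "regular_on U q" unfolding q_def[abs_def]
      by (intro regular_on_power hR UM q0) simp
    show "q x ~= 0" using q0 by (simp add: q_def)
    show "\<forall>v\<in>W0. g v = q v * e v" by (simp add: g_def q_def)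
  next
    show "\<forall>y'\<in>U. \<exists>y\<in>U. \<exists>W c. zariski_open M W \<and> y' \<in> W \<and> W \<subseteq> N y \<and>
       (\<forall>k<L y. regular_on W (c k)) \<and> (\<forall>v\<in>W. g v = (\<Sum>k<L y. c k v * G y k v))"
    proof
    fix y' assume y': "y' \<in> U"
    then obtain y where y: "y \<in> F" "t y (h y') ~= 0" using F(3) by blast
    then have yU: "y \<in> U" using F by blast
    define W where "W = {v\<in>U. t y (h v) ~= 0}"
    have W: "zariski_open M W" "W \<subseteq> U" unfolding W_def by (auto intro: hD t yU)
    define c where "c k v = q0 (h v) ^ (Suc K - n y) * P y k (h v) / t y (h v) ^ n y" for k v
    have "g v = (\<Sum>k<L y. c k v * G y k v)" if v: "v \<in> W" for v
    proof (cases "q0 (h v) = 0")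
      case True
      then have "c k v = 0" for k using nK[OF y(1)] by (simp add: c_def)
      then show ?thesis using True by (simp add: g_def)
    next
      case False
      have tn: "t y (h v) ~= 0" and vU: "v \<in> U" using v by (auto simp: W_def)
      have "q0 (h v) ^ Suc K = q0 (h v) ^ (Suc K - n y) * q0 (h v) ^ n y"
        using nK[OF y(1)] by (simp flip: power_add)
      then have "g v = q0 (h v) ^ (Suc K - n y) / t y (h v) ^ n y * ((q0 (h v) * t y (h v)) ^ n y * e v)"
        using False tn by (simp add: g_def q_def power_mult_distrib)
      also have "\<dots> = q0 (h v) ^ (Suc K - n y) / t y (h v) ^ n y * (\<Sum>k<L y. P y k (h v) * G y k v)"
        using nP[OF yU vU False tn] by simp
      also have "\<dots> = (\<Sum>k<L y. c k v * G y k v)" by (simp add: c_def sum_distrib_left sum_divide_distrib mult_ac)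
      finally show ?thesis .
    qed
    moreover have "\<forall>k<L y. regular_on W (c k)" unfolding c_def[abs_def]
      by (intro allI impI regular_on_divide regular_on_mult regular_on_power hR W q0 P t yU) (auto simp: W_def)
    moreover have "y' \<in> W" "W \<subseteq> N y" using y y' t(3)[OF yU] by (auto simp: W_def)
    ultimately show "\<exists>y\<in>U. \<exists>W c. zariski_open M W \<and> y' \<in> W \<and> W \<subseteq> N y \<and>
       (\<forall>k<L y. regular_on W (c k)) \<and> (\<forall>v\<in>W. g v = (\<Sum>k<L y. c k v * G y k v))"
      using W yU by blast
    qed
  qed
qed

section \<open>Sections of an ideal sheaf and generators of its stalks\<close>

lemma closed_subscheme_section_regular: "closed_subscheme M I ==> zariski_open M U ==> g \<in> I U ==> regular_on U g"
  and closed_subscheme_zero: "closed_subscheme M I ==> zariski_open M U ==> (\<lambda>_. 0) \<in> I U"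
  and closed_subscheme_add: "closed_subscheme M I ==> zariski_open M U ==> g \<in> I U ==> h \<in> I U ==>
    (\<lambda>x. g x + h x) \<in> I U"
  and closed_subscheme_mult: "closed_subscheme M I ==> zariski_open M U ==> g \<in> I U ==> regular_on U c ==>
    (\<lambda>x. c x * g x) \<in> I U"
  and closed_subscheme_cong: "closed_subscheme M I ==> zariski_open M U ==> g \<in> I U ==>
    (\<And>x. x \<in> U ==> h x = g x) ==> h \<in> I U"
  and closed_subscheme_restrict: "closed_subscheme M I ==> zariski_open M U ==> zariski_open M U' ==> U' \<subseteq> U ==>
    g \<in> I U ==> g \<in> I U'"
  unfolding closed_subscheme_def by (elim conjE, simp)+ blast

lemma closed_subscheme_glue:
  assumes "closed_subscheme M I" "zariski_open M U"
    "\<And>x. x \<in> U ==> \<exists>U'. zariski_open M U' \<and> x \<in> U' \<and> U' \<subseteq> U \<and> g \<in> I U'"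
  shows "g \<in> I U"
  using assms unfolding closed_subscheme_def by (elim conjE) simp

lemma closed_subscheme_local_generators:
  assumes "closed_subscheme M I" "x \<in> M"
  obtains U gs where "zariski_open M U" "x \<in> U" "set gs \<subseteq> I U"
    "\<forall>U' g y. zariski_open M U' --> U' \<subseteq> U --> g \<in> I U' --> y \<in> U' -->
       (\<exists>W c. zariski_open M W \<and> y \<in> W \<and> W \<subseteq> U' \<and> (\<forall>k<length gs. regular_on W (c k)) \<and>
              (\<forall>y'\<in>W. g y' = (\<Sum>k<length gs. c k y' * (gs ! k) y')))"
proof -
  have "\<forall>x\<in>M. \<exists>U gs. zariski_open M U \<and> x \<in> U \<and> set gs \<subseteq> I U \<and>
        (\<forall>U' g. zariski_open M U' \<and> U' \<subseteq> U \<and> g \<in> I U' -->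
           (\<forall>y\<in>U'. \<exists>W c. zariski_open M W \<and> y \<in> W \<and> W \<subseteq> U' \<and>
              (\<forall>k<length gs. regular_on W (c k)) \<and>
              (\<forall>y'\<in>W. g y' = (\<Sum>k<length gs. c k y' * (gs ! k) y'))))"
    using assms(1) unfolding closed_subscheme_def by (elim conjE)
  from bspec[OF this assms(2)] obtain U gs where *: "zariski_open M U" "x \<in> U" "set gs \<subseteq> I U"
    "\<forall>U' g. zariski_open M U' \<and> U' \<subseteq> U \<and> g \<in> I U' -->
           (\<forall>y\<in>U'. \<exists>W c. zariski_open M W \<and> y \<in> W \<and> W \<subseteq> U' \<and>
              (\<forall>k<length gs. regular_on W (c k)) \<and>
              (\<forall>y'\<in>W. g y' = (\<Sum>k<length gs. c k y' * (gs ! k) y')))"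
    by (elim exE conjE) (rule that)
  show ?thesis by (rule that[OF *(1-3)]) (use *(4) in simp)
qed

lemma closed_subscheme_sum:
  assumes "closed_subscheme M I" "zariski_open M U" "\<And>i. i \<in> A ==> g i \<in> I U"
  shows "(\<lambda>x. \<Sum>i\<in>A. g i x) \<in> I U"
  using assms(3)
proof (induction A rule: infinite_finite_induct)
  case (insert a A)
  then show ?case using closed_subscheme_add[OF assms(1,2), of "g a" "\<lambda>x. \<Sum>i\<in>A. g i x"] by simp
qed (auto intro: closed_subscheme_zero[OF assms(1,2)])

lemma generates_mem:
  assumes "generates U I zs" "k < length zs"
  shows "zs ! k \<in> I U"
proof -
  have "(zs ! k) x = (\<Sum>j<length zs. (if j = k then 1 else 0) * (zs ! j) x)" for x
  proof -
    have "(\<Sum>j<length zs. (if j = k then 1 else 0) * (zs ! j) x) = (\<Sum>j<length zs. if j = k then (zs ! k) x else 0)"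
      by (intro sum.cong) auto
    then show ?thesis using assms(2) by simp
  qed
  moreover have "regular_on U (\<lambda>_. if j = k then 1 else 0)" for j by (rule regular_on_const)
  ultimately show ?thesis using assms(1) unfolding generates_def
    by (auto intro!: exI[of _ "\<lambda>j _. if j = k then 1 else 0"])
qed

text \<open>After multiplication by a function q with q x \<noteq> 0 a section near x extends to U,
  where it is a combination of zs by hypothesis; dividing by q gives the local expression. In this
  way generators over an affine set generate all stalks.\<close>

lemma generates_stalk:
  assumes I: "closed_subscheme M I" and U: "affine_open M U" and gen: "generates U I zs"
    and x: "x \<in> U" "x \<in> U'" and U': "zariski_open M U'" and e: "e \<in> I U'"
  obtains W c where "zariski_open M W" "x \<in> W" "W \<subseteq> U \<inter> U'" "\<forall>k<length zs. regular_on W (c k)"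
    "\<forall>v\<in>W. e v = (\<Sum>k<length zs. c k v * (zs ! k) v)"
proof -
  have UM: "zariski_open M U" using U by (simp add: affine_open_def)
  define W0 where "W0 = U \<inter> U'"
  have W0: "zariski_open M W0" "W0 \<subseteq> U" "x \<in> W0"
    using zariski_open_Int[OF UM U'] x by (auto simp: W0_def)
  define good where "good y ng \<longleftrightarrow> zariski_open M (fst ng) \<and> y \<in> fst ng \<and> set (snd ng) \<subseteq> I (fst ng) \<and>
    (\<forall>U' g y. zariski_open M U' --> U' \<subseteq> fst ng --> g \<in> I U' --> y \<in> U' -->
       (\<exists>W c. zariski_open M W \<and> y \<in> W \<and> W \<subseteq> U' \<and> (\<forall>k<length (snd ng). regular_on W (c k)) \<and>
              (\<forall>y'\<in>W. g y' = (\<Sum>k<length (snd ng). c k y' * (snd ng ! k) y'))))" for y ng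
  have "\<exists>ng. good y ng" if "y \<in> U" for y
  proof -
    have "y \<in> M" using that zariski_open_subset[OF UM] by blast
    then obtain V gs where
      "zariski_open M V" "y \<in> V" "set gs \<subseteq> I V"
    "\<forall>U' g y. zariski_open M U' --> U' \<subseteq> V --> g \<in> I U' --> y \<in> U' -->
       (\<exists>W c. zariski_open M W \<and> y \<in> W \<and> W \<subseteq> U' \<and> (\<forall>k<length gs. regular_on W (c k)) \<and>
              (\<forall>y'\<in>W. g y' = (\<Sum>k<length gs. c k y' * (gs ! k) y')))"
      by (rule closed_subscheme_local_generators[OF I, of y], intro that)
    then show ?thesis unfolding good_def by (intro exI[of _ "(V, gs)"]) simp
  qed
  then obtain ng where ng: "\<And>y. y \<in> U ==> good y (ng y)" using bchoice[of U good] by blast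
  define N where "N y = fst (ng y) \<inter> U" for y
  define gs where "gs y = snd (ng y)" for y
  have N: "zariski_open M (N y)" "y \<in> N y" "N y \<subseteq> U" if "y \<in> U" for y
    using ng[OF that] zariski_open_Int[OF _ UM] that by (auto simp: good_def N_def)
  have loc: "\<exists>W c. zariski_open M W \<and> w \<in> W \<and> W \<subseteq> N y \<inter> W0 \<and> (\<forall>k<length (gs y). regular_on W (c k)) \<and>
        (\<forall>v\<in>W. e v = (\<Sum>k<length (gs y). c k v * (gs y ! k) v))"
    if y: "y \<in> U" "w \<in> N y" "w \<in> W0" for y w
  proof -
    have z: "zariski_open M (N y \<inter> W0)" using zariski_open_Int[OF N(1)[OF y(1)] W0(1)] .
    moreover have "e \<in> I (N y \<inter> W0)"
      by (rule closed_subscheme_restrict[OF I U' z _ e]) (auto simp: W0_def)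
    moreover have "N y \<inter> W0 \<subseteq> fst (ng y)" by (auto simp: N_def)
    ultimately show ?thesis using ng[OF y(1)] y(2,3) unfolding good_def gs_def by blast
  qed
  obtain q g where q: "regular_on U q" "q x ~= 0" "\<forall>v\<in>W0. g v = q v * e v"
    and g: "\<forall>y'\<in>U. \<exists>y\<in>U. \<exists>W c. zariski_open M W \<and> y' \<in> W \<and> W \<subseteq> N y \<and>
       (\<forall>k<length (gs y). regular_on W (c k)) \<and> (\<forall>v\<in>W. g v = (\<Sum>k<length (gs y). c k v * (gs y ! k) v))"
    apply (rule extend_local_combination[where N=N and e=e and L="\<lambda>y. length (gs y)"
        and G="\<lambda>y k. gs y ! k", OF U W0])
    apply (erule N(1)) apply (erule N(2)) apply (erule N(3)) apply (erule (2) loc) apply (rule that) apply assumption+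
    done
  have "g \<in> I U"
  proof (rule closed_subscheme_glue[OF I UM])
    fix y' assume "y' \<in> U"
    from bspec[OF g this] obtain y W c where y: "y \<in> U" and W: "zariski_open M W" "y' \<in> W" "W \<subseteq> N y"
       and c: "\<forall>k<length (gs y). regular_on W (c k)" and gv: "\<forall>v\<in>W. g v = (\<Sum>k<length (gs y). c k v * (gs y ! k) v)"
      by blast
    have "(\<lambda>v. \<Sum>k<length (gs y). c k v * (gs y ! k) v) \<in> I W"
    proof (rule closed_subscheme_sum[OF I W(1)])
      fix k assume k: "k \<in> {..<length (gs y)}"
      have "gs y ! k \<in> I (fst (ng y))" using ng[OF y] k by (auto simp: good_def gs_def)
      then have "gs y ! k \<in> I W"
        using ng[OF y] W by (intro closed_subscheme_restrict[OF I _ W(1)]) (auto simp: good_def N_def)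
      then show "(\<lambda>v. c k v * (gs y ! k) v) \<in> I W"
        using c k by (intro closed_subscheme_mult[OF I W(1)]) auto
    qed
    then have "g \<in> I W" by (rule closed_subscheme_cong[OF I W(1)]) (use gv in auto)
    then show "\<exists>U'. zariski_open M U' \<and> y' \<in> U' \<and> U' \<subseteq> U \<and> g \<in> I U'"
      using W N(3)[OF y] by blast
  qed
  then have "\<exists>c. (\<forall>k<length zs. regular_on U (c k)) \<and>
     (\<forall>v\<in>U. g v = (\<Sum>k<length zs. c k v * (zs ! k) v))"
    using gen unfolding generates_def by simp
  then obtain c where c': "\<forall>k<length zs. regular_on U (c k)"
    "\<forall>v\<in>U. g v = (\<Sum>k<length zs. c k v * (zs ! k) v)" by (elim exE conjE) (rule that)
  note c = c'[rule_format]
  define W where "W = {v\<in>W0. q v ~= 0}"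
  have qW0: "regular_on W0 q" using regular_on_subset[OF q(1) W0(2)] .
  have WW: "W \<subseteq> W0" "W \<subseteq> U" using W0 by (auto simp: W_def)
  show ?thesis
  proof (rule that[of W "\<lambda>k v. c k v / q v"])
    show "zariski_open M W" unfolding W_def by (rule zariski_open_nonzero[OF W0(1) qW0])
    show "x \<in> W" "W \<subseteq> U \<inter> U'" using q(2) W0 by (auto simp: W_def W0_def)
    show "\<forall>k<length zs. regular_on W (\<lambda>v. c k v / q v)"
    proof (intro allI impI)
      fix k assume "k < length zs"
      from regular_on_subset[OF c(1)[OF this] WW(2)] show "regular_on W (\<lambda>v. c k v / q v)"
        by (rule regular_on_divide[OF _ regular_on_subset[OF qW0 WW(1)]]) (simp add: W_def)
    qed
    show "\<forall>v\<in>W. e v = (\<Sum>k<length zs. c k v / q v * (zs ! k) v)"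
    proof
      fix v assume "v \<in> W"
      then have "q v ~= 0" "v \<in> W0" "v \<in> U" using WW by (auto simp: W_def)
      then have "e v = (\<Sum>k<length zs. c k v * (zs ! k) v) / q v"
        using q(3) c(2)[of v] by (simp add: field_simps)
      then show "e v = (\<Sum>k<length zs. c k v / q v * (zs ! k) v)" by (simp add: sum_divide_distrib)
    qed
  qed
qed

section \<open>The projectivised bundle as a space of flags\<close>

definition flag_tensor :: "complex^'n => complex^'n => complex^('n \<times> 'n \<times> ('n::finite))" where
  "flag_tensor a v = (\<chi> t. case t of (i, j, k) => a $ i * (a $ j * v $ k - a $ k * v $ j))"

lemma flag_pt_eq: "flag_pt a v = pt (flag_tensor a v)"
  by (simp add: flag_pt_def flag_tensor_def)

lemma flag_tensor_nth [simp]: "flag_tensor a v $ (i, j, k) = a $ i * (a $ j * v $ k - a $ k * v $ j)"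
  by (simp add: flag_tensor_def)

lemma independent_minor:
  fixes a v :: "complex^('n::finite)"
  assumes "a ~= 0" "v \<notin> line_of (pt a)"
  obtains j k where "a $ j * v $ k - a $ k * v $ j ~= 0"
proof -
  obtain j where j: "a $ j ~= 0" using assms(1) by (auto simp: vec_eq_iff)
  have "\<exists>k. a $ j * v $ k - a $ k * v $ j ~= 0"
  proof (rule ccontr)
    assume "\<not> ?thesis"
    then have "v $ k = (v $ j / a $ j) * a $ k" for k using j by (simp add: field_simps)
    then have "v = (v $ j / a $ j) *s a" unfolding vec_eq_iff vector_smult_component by blast
    then show False using assms line_of_pt[OF assms(1)] by blast
  qed
  then show ?thesis using that by blast
qed

lemma flag_tensor_nonzero: 
  fixes a v :: "complex^('n::finite)"
  shows "a ~= 0 ==> v \<notin> line_of (pt a) ==> flag_tensor a v ~= 0"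
proof
  assume a: "a ~= 0" "v \<notin> line_of (pt a)" and z: "flag_tensor a v = 0"
  obtain j k where jk: "a $ j * v $ k - a $ k * v $ j ~= 0" by (rule independent_minor[OF a])
  obtain i where "a $ i ~= 0" using a(1) by (auto simp: vec_eq_iff)
  then have "flag_tensor a v $ (i, j, k) ~= 0" using jk by simp
  then show False using z by simp
qed

text \<open>Contracting a \<otimes> (a \<and> v) at fixed indices j, k leaves a multiplied by a 2 x
  2 minor of (a, v). This is a linear formula for the projection of P(V) to X, valid where that
  minor is non-zero.\<close>

definition slice :: "'n => 'n => complex^('n \<times> 'n \<times> 'n) => complex^('n::finite)" where
  "slice j k t = (\<chi> i. t $ (i, j, k))"

lemma slice_flag_tensor: "slice j k (c *s flag_tensor a v) = (c * (a $ j * v $ k - a $ k * v $ j)) *s a"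
  by (simp add: slice_def vec_eq_iff algebra_simps)

lemma slice_scale: "slice j k (c *s t) = c *s slice j k t"
  by (simp add: slice_def vec_eq_iff)

lemma poly_fun_reindex: "poly_fun p ==> poly_fun (\<lambda>y. p (\<lambda>i. y (\<sigma> i)))"
  by (induction rule: poly_fun.induct) (auto intro: poly_fun.intros)

lemma hom_poly_slice:
  assumes p: "hom_poly d p"
  shows "hom_poly d (\<lambda>t. p (slice j k t))"
proof -
  obtain q where q: "poly_fun q" "\<And>a. p a = q (vec_nth a)" by (rule hom_polyE[OF p], rule that)
  show ?thesis
  proof (rule hom_polyI)
    show "poly_fun (\<lambda>y. q (\<lambda>i. y (i, j, k)))" using poly_fun_reindex[OF q(1)] .
    show "p (slice j k t) = q (\<lambda>i. t $ (i, j, k))" for t by (simp add: q(2) slice_def vec_lambda_inverse)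
    show "p (slice j k (c *s t)) = c ^ d * p (slice j k t)" for c t
      by (simp add: slice_scale hom_poly_scale[OF p])
  qed
qed

text \<open>The projection of the bundle of lines to X; only its values at flags are
  meaningful.\<close>

definition flag_base :: "('n \<times> 'n \<times> ('n::finite)) cproj => 'n cproj" where
  "flag_base p = (SOME x. \<exists>a v. a ~= 0 \<and> v \<notin> line_of (pt a) \<and> x = pt a \<and> p = flag_pt a v)"

text \<open>Slicing two proportional tensors at a non-vanishing minor shows that their first vectors
  are proportional.\<close>

lemma flag_base_flag_pt:
  assumes a: "a ~= 0" "v \<notin> line_of (pt a)"
  shows "flag_base (flag_pt a v) = pt a"
proof -
  have "x = pt a" if x: "x = pt b" "b ~= 0" "w \<notin> line_of (pt b)" "flag_pt a v = flag_pt b w" for x b w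
  proof -
    obtain c where c: "c ~= 0" "flag_tensor b w = c *s flag_tensor a v"
      using pt_eqD[OF flag_tensor_nonzero[OF a] flag_tensor_nonzero[OF x(2,3)]] x(4) by (metis flag_pt_eq)
    obtain j k where jk: "b $ j * w $ k - b $ k * w $ j ~= 0" by (rule independent_minor[OF x(2,3)])
    have "slice j k (1 *s flag_tensor b w) = slice j k (c *s flag_tensor a v)" using c by simp
    then have e: "(b $ j * w $ k - b $ k * w $ j) *s b = (c * (a $ j * v $ k - a $ k * v $ j)) *s a"
      unfolding slice_flag_tensor by simp
    then have "c * (a $ j * v $ k - a $ k * v $ j) ~= 0" using jk x(2) by (metis vector_mul_eq_0)
    then show ?thesis using pt_scale[OF jk x(2)] pt_scale[of _ a] a(1) e x(1) by metis
  qed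
  moreover have "\<exists>b w. b ~= 0 \<and> w \<notin> line_of (pt b) \<and> flag_base (flag_pt a v) = pt b \<and> flag_pt a v = flag_pt b w"
    unfolding flag_base_def by (rule someI_ex) (use a in blast)
  ultimately show ?thesis by blast
qed

lemma PV_flag:
  assumes "p \<in> PV X V"
  obtains a v where "a ~= 0" "pt a \<in> X" "v \<in> V (pt a)" "v \<notin> line_of (pt a)" "p = flag_pt a v" "flag_base p = pt a"
  using assms flag_base_flag_pt unfolding PV_def by blast

lemma PV_coords:
  assumes "t ~= 0" "pt t \<in> PV X V"
  obtains a v c where "a ~= 0" "pt a \<in> X" "v \<notin> line_of (pt a)" "flag_base (pt t) = pt a" "c ~= 0"
    "t = c *s flag_tensor a v"
proof -
  obtain a v where a: "a ~= 0" "pt a \<in> X" "v \<notin> line_of (pt a)" "pt t = flag_pt a v" "flag_base (pt t) = pt a"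
    using PV_flag[OF assms(2)] by metis
  then obtain c where "c ~= 0" "t = c *s flag_tensor a v"
    using pt_eqD[OF flag_tensor_nonzero[OF a(1,3)] assms(1)] by (metis flag_pt_eq)
  then show ?thesis using that a by blast
qed

text \<open>Polynomials on X are pulled back by \<open>slice\<close> at a minor that does not vanish
  at the given flag. Homogeneity turns non-vanishing of the pull-back into non-vanishing at the base
  point.\<close>

lemma zariski_open_flag_base:
  assumes W: "zariski_open X W"
  shows "zariski_open (PV X V) {p\<in>PV X V. flag_base p \<in> W}"
proof (rule zariski_openI)
  fix t :: "complex^('a \<times> 'a \<times> 'a)" assume t: "t ~= 0" "pt t \<in> {p\<in>PV X V. flag_base p \<in> W}"
  then obtain a v c where a: "a ~= 0" "pt a \<in> X" "v \<notin> line_of (pt a)" "flag_base (pt t) = pt a" "c ~= 0"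
    "t = c *s flag_tensor a v" using PV_coords[of t X V] by blast
  then have "pt a \<in> W" using t by simp
  obtain d p where p: "hom_poly d p" "p a ~= 0" "\<And>b. b ~= 0 ==> pt b \<in> X ==> p b ~= 0 ==> pt b \<in> W"
    using zariski_openE[OF W a(1) \<open>pt a \<in> W\<close>] by blast
  obtain j k where jk: "a $ j * v $ k - a $ k * v $ j ~= 0" by (rule independent_minor[OF a(1,3)])
  have "p (slice j k t) ~= 0"
    unfolding a(6) slice_flag_tensor hom_poly_scale[OF p(1)] using p(2) a(5) jk by simp
  moreover have "pt b \<in> {p\<in>PV X V. flag_base p \<in> W}"
    if b: "b ~= 0" "pt b \<in> PV X V" "p (slice j k b) ~= 0" for b
  proof -
    obtain a' v' c' where a': "a' ~= 0" "pt a' \<in> X" "v' \<notin> line_of (pt a')" "flag_base (pt b) = pt a'" "c' ~= 0"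
      "b = c' *s flag_tensor a' v'" using PV_coords[OF b(1,2)] by blast
    have "p a' ~= 0" using b(3) unfolding a'(6) slice_flag_tensor hom_poly_scale[OF p(1)] by auto
    then show ?thesis using p(3) a' b by auto
  qed
  ultimately show "\<exists>d p. hom_poly d p \<and> p t ~= 0 \<and>
      (\<forall>b. b ~= 0 --> pt b \<in> PV X V --> p b ~= 0 --> pt b \<in> {p \<in> PV X V. flag_base p \<in> W})"
    using hom_poly_slice[OF p(1), of j k] by (intro exI[of _ d] exI[of _ "\<lambda>t. p (slice j k t)"]) auto
qed blast

lemma regular_on_flag_base:
  assumes g: "regular_on U g"
  shows "regular_on {p\<in>PV X V. flag_base p \<in> U} (\<lambda>p. g (flag_base p))"
proof (rule regular_onI)
  fix t :: "complex^('a \<times> 'a \<times> 'a)" assume t: "t ~= 0" "pt t \<in> {p\<in>PV X V. flag_base p \<in> U}"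
  then obtain a v c where a: "a ~= 0" "pt a \<in> X" "v \<notin> line_of (pt a)" "flag_base (pt t) = pt a" "c ~= 0"
    "t = c *s flag_tensor a v" using PV_coords[of t X V] by blast
  then have "pt a \<in> U" using t by simp
  obtain d p q where pq: "hom_poly d p" "hom_poly d q" "q a ~= 0"
    "\<And>b. b ~= 0 ==> pt b \<in> U ==> q b ~= 0 ==> g (pt b) = p b / q b"
    using regular_onE[OF g a(1) \<open>pt a \<in> U\<close>] by blast
  obtain j k where jk: "a $ j * v $ k - a $ k * v $ j ~= 0" by (rule independent_minor[OF a(1,3)])
  have "q (slice j k t) ~= 0"
    unfolding a(6) slice_flag_tensor hom_poly_scale[OF pq(2)] using pq(3) a(5) jk by simp
  moreover have "g (flag_base (pt b)) = p (slice j k b) / q (slice j k b)"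
    if b: "b ~= 0" "pt b \<in> {p\<in>PV X V. flag_base p \<in> U}" "q (slice j k b) ~= 0" for b
  proof -
    obtain a' v' c' where a': "a' ~= 0" "pt a' \<in> X" "v' \<notin> line_of (pt a')" "flag_base (pt b) = pt a'" "c' ~= 0"
      "b = c' *s flag_tensor a' v'" using PV_coords[of b X V] b by blast
    define m where "m = c' * (a' $ j * v' $ k - a' $ k * v' $ j)"
    have "p (slice j k b) = m ^ d * p a'" "q (slice j k b) = m ^ d * q a'"
      unfolding a'(6) slice_flag_tensor hom_poly_scale[OF pq(1)] hom_poly_scale[OF pq(2)] m_def by auto
    then show ?thesis using pq(4)[of a'] a' b by auto
  qed
  ultimately show "\<exists>d p q. hom_poly d p \<and> hom_poly d q \<and> q t ~= 0 \<and>
      (\<forall>b. b ~= 0 --> pt b \<in> {p \<in> PV X V. flag_base p \<in> U} --> q b ~= 0 --> g (flag_base (pt b)) = p b / q b)"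
    using hom_poly_slice[OF pq(1), of j k] hom_poly_slice[OF pq(2), of j k]
    by (intro exI[of _ d] exI[of _ "\<lambda>t. p (slice j k t)"] exI[of _ "\<lambda>t. q (slice j k t)"]) auto
qed

text \<open>The part of \<open>jet_ideal\<close> that does not mention a section. It is isolated so
  that charts obtained from one section can be used for another.\<close>

definition jet_chart where
  "jet_chart X V I U zs h W \<longleftrightarrow> affine_open X U \<and> generates U I zs \<and> regular_on U h \<and>
     zariski_open (PV X V) W \<and>
     (\<forall>a v. a ~= 0 \<and> pt a \<in> X \<and> v \<in> V (pt a) \<and> v \<notin> line_of (pt a) \<and> flag_pt a v \<in> W -->
           pt a \<in> U \<and> differential X h a v ~= 0)"

lemma jet_ideal_chart:
  assumes "g \<in> jet_ideal X V I W" "p \<in> W"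
  obtains U zs h W' b c where "jet_chart X V I U zs h W'" "p \<in> W'" "W' \<subseteq> W"
    "\<And>k. k < length zs ==> regular_on W' (b k) \<and> regular_on W' (c k)"
    "\<And>a v. a ~= 0 ==> pt a \<in> X ==> v \<in> V (pt a) ==> v \<notin> line_of (pt a) ==> flag_pt a v \<in> W' ==>
       g (flag_pt a v) = (\<Sum>k<length zs. b k (flag_pt a v) * (zs ! k) (pt a)
                + c k (flag_pt a v) * (differential X (zs ! k) a v / differential X h a v))"
proof -
  have "\<forall>p\<in>W. \<exists>U zs h W' b c.
        affine_open X U \<and> generates U I zs \<and> regular_on U h \<and>
        zariski_open (PV X V) W' \<and> p \<in> W' \<and> W' \<subseteq> W \<and>
        (\<forall>k<length zs. regular_on W' (b k) \<and> regular_on W' (c k)) \<and>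
        (\<forall>a v. a ~= 0 \<and> pt a \<in> X \<and> v \<in> V (pt a) \<and> v \<notin> line_of (pt a) \<and> flag_pt a v \<in> W' -->
           pt a \<in> U \<and> differential X h a v ~= 0 \<and>
           g (flag_pt a v) =
             (\<Sum>k<length zs. b k (flag_pt a v) * (zs ! k) (pt a)
                + c k (flag_pt a v) * (differential X (zs ! k) a v / differential X h a v)))"
    using assms(1) unfolding jet_ideal_def by simp
  from bspec[OF this assms(2)] show ?thesis
    apply (elim exE conjE)
    subgoal for U zs h W' b c
      by (rule that[of U zs h W' b c]) (auto simp: jet_chart_def)
    done
qed

text \<open>The case of coefficients c = 0, where no differential occurs; it covers combinations of
  pull-backs of sections of I.\<close>

lemma jet_idealI:
  assumes "regular_on W g"
    "\<And>p. p \<in> W ==> \<exists>U zs h W' b. jet_chart X V I U zs h W' \<and> p \<in> W' \<and> W' \<subseteq> W \<and>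
       (\<forall>k<length zs. regular_on W' (b k)) \<and>
       (\<forall>q\<in>W'. g q = (\<Sum>k<length zs. b k q * (zs ! k) (flag_base q)))"
  shows "g \<in> jet_ideal X V I W"
  unfolding jet_ideal_def mem_Collect_eq
proof (intro conjI ballI)
  fix p assume "p \<in> W"
  from assms(2)[OF this] obtain U zs h W' b where *: "jet_chart X V I U zs h W'" "p \<in> W'" "W' \<subseteq> W"
       "\<forall>k<length zs. regular_on W' (b k)"
       "\<forall>q\<in>W'. g q = (\<Sum>k<length zs. b k q * (zs ! k) (flag_base q))"
    by (elim exE conjE) (rule that)
  show "\<exists>U zs h W' b c.
        affine_open X U \<and> generates U I zs \<and> regular_on U h \<and>
        zariski_open (PV X V) W' \<and> p \<in> W' \<and> W' \<subseteq> W \<and>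
        (\<forall>k<length zs. regular_on W' (b k) \<and> regular_on W' (c k)) \<and>
        (\<forall>a v. a ~= 0 \<and> pt a \<in> X \<and> v \<in> V (pt a) \<and> v \<notin> line_of (pt a) \<and> flag_pt a v \<in> W' -->
           pt a \<in> U \<and> differential X h a v ~= 0 \<and>
           g (flag_pt a v) =
             (\<Sum>k<length zs. b k (flag_pt a v) * (zs ! k) (pt a)
                + c k (flag_pt a v) * (differential X (zs ! k) a v / differential X h a v)))"
    by (rule exI[of _ U], rule exI[of _ zs], rule exI[of _ h], rule exI[of _ W'], rule exI[of _ b],
        rule exI[of _ "\<lambda>_ _. 0"]) (use * in \<open>auto simp: jet_chart_def regular_on_const flag_base_flag_pt\<close>)
qed (rule assms(1))

text \<open>The pull-back of the ideal sheaf of \<open>Z\<close> is contained in that of its jet.\<close>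

lemma jet_generators_nonvanishing:
  assumes I: "closed_subscheme X I" and U1: "affine_open (PV X V) U1"
    and gen: "generates U1 (jet_ideal X V I) gs" and p: "p \<in> U1" and ns: "flag_base p \<notin> supp X I"
  shows "\<exists>g\<in>set gs. g p ~= 0"
proof -
  have U1P: "zariski_open (PV X V) U1" using U1 by (simp add: affine_open_def)
  \<comment> \<open>Membership of the zero section serves to obtain a jet chart around every point
    of U1.\<close>
  have z: "(\<lambda>_. 0) \<in> jet_ideal X V I U1"
  proof -
    have "\<forall>k<length gs. regular_on U1 (\<lambda>_. 0)" using regular_on_const by blast
    then show ?thesis using gen unfolding generates_def by (auto intro!: exI[of _ "\<lambda>_ _. 0"])
  qed
  define good where "good y t \<longleftrightarrow> (case t of (U, zs, h, W) => jet_chart X V I U zs h W \<and> y \<in> W \<and> W \<subseteq> U1)" for y t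
  have "\<exists>t. good y t" if y: "y \<in> U1" for y
  proof -
    obtain U zs h W' where "jet_chart X V I U zs h W'" "y \<in> W'" "W' \<subseteq> U1"
      by (rule jet_ideal_chart[OF z y], rule that)
    then show ?thesis unfolding good_def by (intro exI[of _ "(U, zs, h, W')"]) simp
  qed
  then obtain t where t: "\<And>y. y \<in> U1 ==> good y (t y)" using bchoice[of U1 good] by blast
  define CU Cz Ch N where "CU y = fst (t y)" and "Cz y = fst (snd (t y))" and "Ch y = fst (snd (snd (t y)))"
    and "N y = snd (snd (snd (t y)))" for y
  have ch: "jet_chart X V I (CU y) (Cz y) (Ch y) (N y)" "y \<in> N y" "N y \<subseteq> U1" if "y \<in> U1" for y
    using t[OF that] by (auto simp: good_def CU_def Cz_def Ch_def N_def split: prod.splits)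
  have CU: "affine_open X (CU y)" "generates (CU y) I (Cz y)" "zariski_open (PV X V) (N y)"
    "zariski_open X (CU y)" if "y \<in> U1" for y
    using ch[OF that] by (auto simp: jet_chart_def affine_open_def)
  have base: "flag_base w \<in> CU y" "flag_base w \<in> X" "w \<in> PV X V" if "y \<in> U1" "w \<in> N y" for y w
  proof -
    show w: "w \<in> PV X V" using zariski_open_subset[OF CU(3)[OF that(1)]] that by blast
    obtain a v where a: "a ~= 0" "pt a \<in> X" "v \<in> V (pt a)" "v \<notin> line_of (pt a)" "w = flag_pt a v" "flag_base w = pt a"
      by (rule PV_flag[OF w], rule that)
    then show "flag_base w \<in> CU y" "flag_base w \<in> X" using ch(1)[OF that(1)] that by (auto simp: jet_chart_def)
  qed
  have "flag_base p \<in> X" using base(2)[OF p ch(2)[OF p]] .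
  then obtain U' e0 where U': "zariski_open X U'" "flag_base p \<in> U'" "e0 \<in> I U'" "e0 (flag_base p) ~= 0"
    using ns unfolding supp_def by blast
  obtain W c where W: "zariski_open X W" "flag_base p \<in> W" "W \<subseteq> CU p \<inter> U'"
      "\<forall>k<length (Cz p). regular_on W (c k)"
      "\<forall>v\<in>W. e0 v = (\<Sum>k<length (Cz p). c k v * (Cz p ! k) v)"
    by (rule generates_stalk[OF I CU(1,2)[OF p] base(1)[OF p ch(2)[OF p]] U'(2,1,3)], rule that)
  then have "(\<Sum>k<length (Cz p). c k (flag_base p) * (Cz p ! k) (flag_base p)) ~= 0" using U'(4) by metis
  then obtain l where l: "l < length (Cz p)" "(Cz p ! l) (flag_base p) ~= 0"
    by (metis (no_types, lifting) lessThan_iff mult_zero_right sum.neutral)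
  \<comment> \<open>A generator of I over the chart at p that does not vanish at the base point,
    pulled back to P(V). It is controlled over N p only and has to be extended to U1.\<close>
  define e where "e q = (Cz p ! l) (flag_base q)" for q
  have lI: "Cz p ! l \<in> I (CU p)" by (rule generates_mem[OF CU(2)[OF p] l(1)])
  have loc: "\<exists>W c. zariski_open (PV X V) W \<and> w \<in> W \<and> W \<subseteq> N y \<inter> N p \<and> (\<forall>k<length (Cz y). regular_on W (c k)) \<and>
        (\<forall>v\<in>W. e v = (\<Sum>k<length (Cz y). c k v * (Cz y ! k) (flag_base v)))"
    if y: "y \<in> U1" "w \<in> N y" "w \<in> N p" for y w
  proof -
    obtain W c where W: "zariski_open X W" "flag_base w \<in> W" "W \<subseteq> CU y \<inter> CU p"
      "\<forall>k<length (Cz y). regular_on W (c k)"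
      "\<forall>v\<in>W. (Cz p ! l) v = (\<Sum>k<length (Cz y). c k v * (Cz y ! k) v)"
      by (rule generates_stalk[OF I CU(1,2)[OF y(1)] base(1)[OF y(1,2)] base(1)[OF p y(3)] CU(4)[OF p] lI], rule that)
    define W' where "W' = {q\<in>PV X V. flag_base q \<in> W}"
    define W'' where "W'' = W' \<inter> (N y \<inter> N p)"
    have "zariski_open (PV X V) W''" unfolding W''_def W'_def
      by (intro zariski_open_Int zariski_open_flag_base W CU y p)
    moreover have "regular_on W'' (\<lambda>v. c k (flag_base v))" if "k < length (Cz y)" for k
      by (rule regular_on_subset[OF regular_on_flag_base[OF W(4)[rule_format, OF that], of X V]]) (auto simp: W''_def W'_def)
    moreover have "e v = (\<Sum>k<length (Cz y). c k (flag_base v) * (Cz y ! k) (flag_base v))" if "v \<in> W''" for v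
      using that W(5) by (auto simp: W''_def W'_def e_def)
    moreover have "w \<in> W''" using W(2) base(3)[OF y(1,2)] y by (auto simp: W''_def W'_def)
    ultimately show ?thesis
      by (intro exI[of _ W''] exI[of _ "\<lambda>k v. c k (flag_base v)"]) (auto simp: W''_def)
  qed
  have lC: "regular_on (N y) (\<lambda>v. (Cz y ! k) (flag_base v))" if "y \<in> U1" "k < length (Cz y)" for y k
  proof -
    have "Cz y ! k \<in> I (CU y)" by (rule generates_mem[OF CU(2)[OF that(1)] that(2)])
    then have "regular_on (CU y) (Cz y ! k)" by (rule closed_subscheme_section_regular[OF I CU(4)[OF that(1)]])
    from regular_on_flag_base[OF this, of X V] show ?thesis
      by (rule regular_on_subset) (use base[OF that(1)] in auto)
  qed
  obtain q g where "regular_on U1 q" and q: "q p ~= 0" "\<forall>v\<in>N p. g v = q v * e v"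
    and g: "\<forall>y'\<in>U1. \<exists>y\<in>U1. \<exists>W c. zariski_open (PV X V) W \<and> y' \<in> W \<and> W \<subseteq> N y \<and>
       (\<forall>k<length (Cz y). regular_on W (c k)) \<and> (\<forall>v\<in>W. g v = (\<Sum>k<length (Cz y). c k v * (Cz y ! k) (flag_base v)))"
    apply (rule extend_local_combination[where N=N and e=e and L="\<lambda>y. length (Cz y)"
        and G="\<lambda>y k v. (Cz y ! k) (flag_base v)", OF U1 CU(3)[OF p] ch(3)[OF p] ch(2)[OF p]])
    apply (erule CU(3)) apply (erule ch(2)) apply (erule ch(3)) apply (erule (2) loc) apply (rule that) apply assumption+
    done
  have "g \<in> jet_ideal X V I U1"
  proof (rule jet_idealI)
    show "regular_on U1 g"
    proof (rule regular_on_local[OF zariski_open_subset[OF U1P]])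
      fix y' assume "y' \<in> U1"
      from bspec[OF g this] obtain y W c where y: "y \<in> U1" and W: "zariski_open (PV X V) W" "y' \<in> W" "W \<subseteq> N y"
         and c: "\<forall>k<length (Cz y). regular_on W (c k)"
         and gv: "\<forall>v\<in>W. g v = (\<Sum>k<length (Cz y). c k v * (Cz y ! k) (flag_base v))" by blast
      have "regular_on W (\<lambda>v. \<Sum>k<length (Cz y). c k v * (Cz y ! k) (flag_base v))"
        by (rule regular_on_sum, rule regular_on_mult, use c in simp, rule regular_on_subset[OF lC[OF y] W(3)]) simp
      then have "regular_on W g"
        using regular_on_cong[of W g "\<lambda>v. \<Sum>k<length (Cz y). c k v * (Cz y ! k) (flag_base v)"] gv by simp
      then show "\<exists>W. zariski_open (PV X V) W \<and> y' \<in> W \<and> regular_on W g" using W by blast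
    qed
    fix y' assume "y' \<in> U1"
    from bspec[OF g this] obtain y W c where y: "y \<in> U1" and W: "zariski_open (PV X V) W" "y' \<in> W" "W \<subseteq> N y"
       and c: "\<forall>k<length (Cz y). regular_on W (c k)"
       and gv: "\<forall>v\<in>W. g v = (\<Sum>k<length (Cz y). c k v * (Cz y ! k) (flag_base v))" by blast
    have "jet_chart X V I (CU y) (Cz y) (Ch y) W" using ch(1)[OF y] W unfolding jet_chart_def by blast
    then show "\<exists>U zs h W' b. jet_chart X V I U zs h W' \<and> y' \<in> W' \<and> W' \<subseteq> U1 \<and>
       (\<forall>k<length zs. regular_on W' (b k)) \<and>
       (\<forall>q\<in>W'. g q = (\<Sum>k<length zs. b k q * (zs ! k) (flag_base q)))"
      using W ch(3)[OF y] c gv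
      by (intro exI[of _ "CU y"] exI[of _ "Cz y"] exI[of _ "Ch y"] exI[of _ W] exI[of _ c]) blast
  qed
  then obtain c where "\<forall>x\<in>U1. g x = (\<Sum>k<length gs. c k x * (gs ! k) x)"
    using gen unfolding generates_def by blast
  moreover have "g p ~= 0" using q ch(2)[OF p] l(2) by (simp add: e_def)
  ultimately have "(\<Sum>k<length gs. c k p * (gs ! k) p) ~= 0" using p by metis
  then obtain k where "k < length gs" "(gs ! k) p ~= 0"
    by (metis (no_types, lifting) lessThan_iff mult_zero_right sum.neutral)
  then show ?thesis using nth_mem by blast
qed

section \<open>Twice continuously differentiable functions on the plane\<close>

text \<open>Stated with \<open>part_re\<close> and \<open>part_im\<close> because \<open>ddc\<close>
  iterates exactly these.\<close>

definition C1_on :: "complex set => (complex => real) => bool" where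
  "C1_on D u \<longleftrightarrow> (\<forall>z\<in>D. (u has_derivative (\<lambda>h. part_re u z * Re h + part_im u z * Im h)) (at z)) \<and>
     continuous_on D (part_re u) \<and> continuous_on D (part_im u)"

definition C2_on :: "complex set => (complex => real) => bool" where
  "C2_on D u \<longleftrightarrow> C1_on D u \<and> C1_on D (part_re u) \<and> C1_on D (part_im u)"

lemma has_derivative_parts:
  assumes "(u has_derivative (\<lambda>h. p * Re h + q * Im h)) (at z)"
  shows "part_re u z = p" "part_im u z = q"
proof -
  have 1: "((\<lambda>t. u (z + of_real t)) has_derivative (\<lambda>t. p * Re (of_real t) + q * Im (of_real t))) (at 0)"
    by (rule has_derivative_compose[of "\<lambda>t. z + of_real t" of_real 0 UNIV u, simplified])
      (auto intro!: derivative_eq_intros assms)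
  have 2: "((\<lambda>t. u (z + \<i> * of_real t)) has_derivative (\<lambda>t. p * Re (\<i> * of_real t) + q * Im (\<i> * of_real t))) (at 0)"
    by (rule has_derivative_compose[of "\<lambda>t. z + \<i> * of_real t" "\<lambda>t. \<i> * of_real t" 0 UNIV u, simplified])
      (auto intro!: derivative_eq_intros assms)
  show "part_re u z = p" unfolding part_re_def
    by (rule DERIV_imp_deriv) (use 1 in \<open>simp add: has_field_derivative_def mult_commute_abs mult.commute\<close>)
  show "part_im u z = q" unfolding part_im_def
    by (rule DERIV_imp_deriv) (use 2 in \<open>simp add: has_field_derivative_def mult_commute_abs mult.commute\<close>)
qed

lemma C1_on_has_derivative:
  "C1_on D u ==> z \<in> D ==> (u has_derivative (\<lambda>h. part_re u z * Re h + part_im u z * Im h)) (at z)"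
  by (simp add: C1_on_def)

lemma C1_on_continuous: "C1_on D u ==> continuous_on D u"
  by (meson C1_on_has_derivative has_derivative_continuous continuous_at_imp_continuous_on)

lemma C1_onI:
  assumes "\<And>z. z \<in> D ==> (u has_derivative (\<lambda>h. p z * Re h + q z * Im h)) (at z)"
    "continuous_on D p" "continuous_on D q"
  shows "C1_on D u"
proof -
  have e: "part_re u z = p z" "part_im u z = q z" if "z \<in> D" for z
    using has_derivative_parts[OF assms(1)[OF that]] by auto
  have "continuous_on D (part_re u) \<longleftrightarrow> continuous_on D p" "continuous_on D (part_im u) \<longleftrightarrow> continuous_on D q"
    by (auto intro!: continuous_on_cong simp: e)
  then show ?thesis using assms unfolding C1_on_def by (auto simp: e)
qed

lemma C1_on_subset: "C1_on D u ==> E \<subseteq> D ==> C1_on E u"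
  unfolding C1_on_def by (blast intro: continuous_on_subset)

lemma C2_on_subset: "C2_on D u ==> E \<subseteq> D ==> C2_on E u"
  unfolding C2_on_def by (blast intro: C1_on_subset)

lemma C1_on_cong:
  assumes "open D" "C1_on D u" "\<And>z. z \<in> D ==> v z = u z"
  shows "C1_on D v"
proof (rule C1_onI[of D v "part_re u" "part_im u"])
  fix z assume "z \<in> D"
  then show "(v has_derivative (\<lambda>h. part_re u z * Re h + part_im u z * Im h)) (at z)"
    by (intro has_derivative_transform_within_open[OF C1_on_has_derivative[OF assms(2)] assms(1)])
      (simp_all add: assms(3))
qed (use assms(2) in \<open>auto simp: C1_on_def\<close>)

lemma part_cong:
  assumes "open D" "z \<in> D" "\<And>w. w \<in> D ==> v w = u w" "C1_on D u"
  shows "part_re v z = part_re u z" "part_im v z = part_im u z"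
proof -
  have "(v has_derivative (\<lambda>h. part_re u z * Re h + part_im u z * Im h)) (at z)"
    by (rule has_derivative_transform_within_open[OF C1_on_has_derivative[OF assms(4,2)] assms(1,2)])
      (simp add: assms(3))
  then show "part_re v z = part_re u z" "part_im v z = part_im u z" by (auto dest: has_derivative_parts)
qed

text \<open>Openness of D allows \<open>part_re u\<close> and \<open>part_im u\<close>, known to be
  p and q on D only, to be replaced by them under a further derivative.\<close>

lemma C2_onI:
  assumes D: "open D" and d': "\<forall>z\<in>D. (u has_derivative (\<lambda>h. p z * Re h + q z * Im h)) (at z)"
    and p: "C1_on D p" and q: "C1_on D q"
  shows "C2_on D u" "\<And>z. z \<in> D ==> part_re u z = p z" "\<And>z. z \<in> D ==> part_im u z = q z"
    "\<And>z. z \<in> D ==> ddc u z = (part_re p z + part_im q z) / (4 * pi)"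
proof -
  note d = d'[rule_format]
  show e: "part_re u z = p z" "part_im u z = q z" if "z \<in> D" for z
    using has_derivative_parts[OF d[OF that]] by auto
  have "C1_on D u" by (rule C1_onI[OF d]) (use C1_on_continuous[OF p] C1_on_continuous[OF q] in auto)
  moreover have "C1_on D (part_re u)" "C1_on D (part_im u)" by (rule C1_on_cong[OF D]; use p q e in auto)+
  ultimately show "C2_on D u" by (simp add: C2_on_def)
  show "ddc u z = (part_re p z + part_im q z) / (4 * pi)" if "z \<in> D" for z
    unfolding ddc_def using part_cong[OF D that e(1) p] part_cong[OF D that e(2) q] by simp
qed

lemma C2_on_cong:
  assumes "open D" "C2_on D u" "\<And>z. z \<in> D ==> v z = u z"
  shows "C2_on D v" "\<And>z. z \<in> D ==> ddc v z = ddc u z"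
proof -
  have u: "C1_on D u" "C1_on D (part_re u)" "C1_on D (part_im u)" using assms(2) by (auto simp: C2_on_def)
  have d: "(v has_derivative (\<lambda>h. part_re u z * Re h + part_im u z * Im h)) (at z)" if "z \<in> D" for z
    by (rule has_derivative_transform_within_open[OF C1_on_has_derivative[OF u(1) that] assms(1) that])
      (simp add: assms(3))
  show "C2_on D v" by (rule C2_onI(1)[OF assms(1) _ u(2,3)]) (use d in blast)
  show "ddc v z = ddc u z" if "z \<in> D" for z
    using C2_onI(4)[OF assms(1) _ u(2,3) that] d by (simp add: ddc_def)
qed

lemma C1_on_Un:
  assumes "open D" "open E" "C1_on D u" "C1_on E u"
  shows "C1_on (D \<union> E) u"
  using assms unfolding C1_on_def by (auto intro: continuous_on_open_Un)

lemma C2_on_Union: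
  assumes "\<And>D. D \<in> \<D> ==> open D" "\<And>D. D \<in> \<D> ==> C2_on D u"
  shows "C2_on (\<Union>\<D>) u"
  using assms unfolding C2_on_def C1_on_def by (auto intro!: continuous_on_open_Union)

lemma C2_on_local:
  assumes "\<And>z. z \<in> D ==> \<exists>E. open E \<and> z \<in> E \<and> C2_on E u"
  shows "C2_on D u"
proof -
  have "C2_on (\<Union>{E. open E \<and> C2_on E u}) u" by (rule C2_on_Union) auto
  then show ?thesis by (rule C2_on_subset) (use assms in blast)
qed

lemma C2_on_ddc_continuous: "C2_on D u ==> continuous_on D (ddc u)"
  unfolding ddc_def[abs_def] C2_on_def C1_on_def by (auto intro!: continuous_intros)

lemma C2_on_C_k: "C2_on UNIV u ==> C_k 2 u"
proof -
  assume u: "C2_on UNIV u"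
  have C1: "C_k (Suc 0) v" if "C1_on UNIV v" for v
    unfolding C_k.simps(2)
    by (rule exI[of _ "part_re v"], rule exI[of _ "part_im v"]) (use that in \<open>simp add: C1_on_def\<close>)
  have "C_k (Suc (Suc 0)) u"
    unfolding C_k.simps(2)[of "Suc 0"]
    by (rule exI[of _ "part_re u"], rule exI[of _ "part_im u"])
      (use u C1[of "part_re u"] C1[of "part_im u"] in \<open>simp add: C2_on_def C1_on_def\<close>)
  then show ?thesis by (simp add: numeral_2_eq_2)
qed

lemma C1_on_const: "C1_on D (\<lambda>_. c)"
  by (rule C1_onI[of _ _ "\<lambda>_. 0" "\<lambda>_. 0"]) auto

lemma C1_on_add:
  assumes "C1_on D u" "C1_on D v"
  shows "C1_on D (\<lambda>z. u z + v z)"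
  by (rule C1_onI[of _ _ "\<lambda>z. part_re u z + part_re v z" "\<lambda>z. part_im u z + part_im v z"])
    (use assms in \<open>auto intro!: derivative_eq_intros continuous_intros C1_on_has_derivative simp: C1_on_def algebra_simps\<close>)

lemma C1_on_mult:
  assumes "C1_on D u" "C1_on D v"
  shows "C1_on D (\<lambda>z. u z * v z)"
    "\<And>z. z \<in> D ==> part_re (\<lambda>z. u z * v z) z = part_re u z * v z + u z * part_re v z"
    "\<And>z. z \<in> D ==> part_im (\<lambda>z. u z * v z) z = part_im u z * v z + u z * part_im v z"
proof -
  have d: "((\<lambda>z. u z * v z) has_derivative (\<lambda>h. (part_re u z * v z + u z * part_re v z) * Re h +
    (part_im u z * v z + u z * part_im v z) * Im h)) (at z)" if "z \<in> D" for z
    using assms[THEN C1_on_has_derivative, OF that] by (auto intro!: derivative_eq_intros simp: algebra_simps)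
  show "C1_on D (\<lambda>z. u z * v z)"
    by (rule C1_onI[OF d]) (use assms assms[THEN C1_on_continuous] in \<open>auto intro!: continuous_intros simp: C1_on_def\<close>)
  show "\<And>z. z \<in> D ==> part_re (\<lambda>z. u z * v z) z = part_re u z * v z + u z * part_re v z"
    "\<And>z. z \<in> D ==> part_im (\<lambda>z. u z * v z) z = part_im u z * v z + u z * part_im v z"
    using has_derivative_parts[OF d] by auto
qed

lemma C1_on_compose:
  assumes u: "C1_on D u" and F: "\<forall>t\<in>S. (F has_real_derivative F' t) (at t)"
    and S: "u ` D \<subseteq> S" "continuous_on S F'"
  shows "C1_on D (\<lambda>z. F (u z))"
    "\<And>z. z \<in> D ==> part_re (\<lambda>z. F (u z)) z = F' (u z) * part_re u z"
    "\<And>z. z \<in> D ==> part_im (\<lambda>z. F (u z)) z = F' (u z) * part_im u z"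
proof -
  have d: "((\<lambda>z. F (u z)) has_derivative (\<lambda>h. (F' (u z) * part_re u z) * Re h + (F' (u z) * part_im u z) * Im h)) (at z)"
    if "z \<in> D" for z
  proof -
    have "(F has_derivative (*) (F' (u z))) (at (u z))"
      using F S(1) that by (auto simp: has_field_derivative_def)
    from has_derivative_compose[OF C1_on_has_derivative[OF u that] this]
    show ?thesis by (simp add: algebra_simps)
  qed
  have "continuous_on D (\<lambda>z. F' (u z))"
    using continuous_on_compose2[OF S(2) C1_on_continuous[OF u]] S(1) by auto
  then show "C1_on D (\<lambda>z. F (u z))"
    by - (rule C1_onI[OF d], use u in \<open>auto intro!: continuous_intros simp: C1_on_def\<close>)
  show "\<And>z. z \<in> D ==> part_re (\<lambda>z. F (u z)) z = F' (u z) * part_re u z"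
    "\<And>z. z \<in> D ==> part_im (\<lambda>z. F (u z)) z = F' (u z) * part_im u z"
    using has_derivative_parts[OF d] by auto
qed

lemma C2_on_mult:
  assumes D: "open D" and u: "C2_on D u" and v: "C2_on D v"
  shows "C2_on D (\<lambda>z. u z * v z)"
proof -
  have c: "C1_on D u" "C1_on D v" "C1_on D (part_re u)" "C1_on D (part_im u)" "C1_on D (part_re v)" "C1_on D (part_im v)"
    using u v by (auto simp: C2_on_def)
  show ?thesis
    by (rule C2_onI(1)[OF D, of _ "\<lambda>z. part_re u z * v z + u z * part_re v z" "\<lambda>z. part_im u z * v z + u z * part_im v z"])
     (use c C1_on_has_derivative[OF C1_on_mult(1)[OF c(1,2)]] C1_on_mult(2,3)[OF c(1,2)] in
      \<open>auto intro!: C1_on_add C1_on_mult(1)\<close>)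
qed

lemma C2_on_const: "C2_on D (\<lambda>_. c)"
proof -
  have "part_re (\<lambda>_. c) = (\<lambda>_. 0)" "part_im (\<lambda>_. c) = (\<lambda>_. 0)"
    by (auto simp: part_re_def part_im_def fun_eq_iff)
  then show ?thesis by (simp add: C2_on_def C1_on_const)
qed

lemma C2_on_add:
  assumes D: "open D" and u: "C2_on D u" and v: "C2_on D v"
  shows "C2_on D (\<lambda>z. u z + v z)"
proof -
  have c: "C1_on D u" "C1_on D v" "C1_on D (part_re u)" "C1_on D (part_im u)" "C1_on D (part_re v)" "C1_on D (part_im v)"
    using u v by (auto simp: C2_on_def)
  show ?thesis
    by (rule C2_onI(1)[OF D, of _ "\<lambda>z. part_re u z + part_re v z" "\<lambda>z. part_im u z + part_im v z"])
     (use c C1_on_has_derivative[OF c(1)] C1_on_has_derivative[OF c(2)] in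
      \<open>auto intro!: C1_on_add derivative_eq_intros simp: algebra_simps\<close>)
qed

lemma C2_on_compose:
  assumes D: "open D" and u: "C2_on D u" and F: "\<forall>t\<in>S. (F has_real_derivative F' t) (at t)"
    and F': "\<forall>t\<in>S. (F' has_real_derivative F'' t) (at t)"
    and S: "u ` D \<subseteq> S" "continuous_on S F''"
  shows "C2_on D (\<lambda>z. F (u z))"
    "\<And>z. z \<in> D ==> ddc (\<lambda>z. F (u z)) z =
      F'' (u z) * ((part_re u z)\<^sup>2 + (part_im u z)\<^sup>2) / (4 * pi) + F' (u z) * ddc u z"
proof -
  have c: "C1_on D u" "C1_on D (part_re u)" "C1_on D (part_im u)" using u by (auto simp: C2_on_def)
  have cF': "continuous_on S F'" using F' by (meson DERIV_isCont continuous_at_imp_continuous_on)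
  note C = C1_on_compose[OF c(1) F S(1) cF'] and C' = C1_on_compose[OF c(1) F' S]
  have d: "((\<lambda>z. F (u z)) has_derivative (\<lambda>h. (F' (u z) * part_re u z) * Re h + (F' (u z) * part_im u z) * Im h)) (at z)"
    if "z \<in> D" for z
    using C1_on_has_derivative[OF C(1) that] C(2,3)[OF that] by simp
  have dB: "\<forall>z\<in>D. ((\<lambda>z. F (u z)) has_derivative
      (\<lambda>h. (F' (u z) * part_re u z) * Re h + (F' (u z) * part_im u z) * Im h)) (at z)" using d by blast
  note E = C2_onI[OF D dB C1_on_mult(1)[OF C'(1) c(2)] C1_on_mult(1)[OF C'(1) c(3)]]
  show "C2_on D (\<lambda>z. F (u z))" by (rule E(1))
  fix z assume z: "z \<in> D"
  show "ddc (\<lambda>z. F (u z)) z = F'' (u z) * ((part_re u z)\<^sup>2 + (part_im u z)\<^sup>2) / (4 * pi) + F' (u z) * ddc u z"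
    unfolding E(4)[OF z] C1_on_mult(2)[OF C'(1) c(2) z] C1_on_mult(3)[OF C'(1) c(3) z] C'(2)[OF z] C'(3)[OF z]
    by (simp add: ddc_def field_simps power2_eq_square)
qed

section \<open>Integration by parts\<close>

lemma integrable_continuous_compact:
  fixes g :: "complex => real"
  assumes "continuous_on K g" "compact K" "\<And>z. z \<notin> K ==> g z = 0"
  shows "integrable lborel g"
proof -
  have "g = (\<lambda>z. indicator K z *\<^sub>R g z)" using assms(3) by (auto simp: fun_eq_iff indicator_def)
  then show ?thesis using borel_integrable_compact[OF assms(2,1)] by simp
qed

text \<open>Lebesgue measure is translation invariant, so every difference quotient of P has
  integral zero; dominated convergence passes to the derivative.\<close>

lemma integral_directional_derivative:
  fixes P P' :: "complex => real"
  assumes d: "\<And>z. ((\<lambda>t. P (z + of_real t * w)) has_real_derivative P' z) (at 0)"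
    and c: "continuous_on UNIV P" "continuous_on UNIV P'" and K: "\<And>z. norm z > R ==> P z = 0"
    and w: "norm w = 1"
  shows "(\<integral>z. P' z \<partial>lborel) = 0"
proof -
  have ds: "((\<lambda>t. P (z + of_real t * w)) has_real_derivative P' (z + of_real s * w)) (at s)" for z s
  proof -
    have "((\<lambda>t. P (z + of_real s * w + of_real t * w)) has_real_derivative P' (z + of_real s * w)) (at (s - s))"
      using d[of "z + of_real s * w"] by simp
    from DERIV_shift[THEN iffD1, OF this[unfolded diff_conv_add_uminus]]
    show ?thesis by (simp add: algebra_simps)
  qed
  have P'0: "P' z = 0" if "norm z > R" for z
  proof -
    have "((\<lambda>t. P (z + of_real t * w)) has_real_derivative 0) (at 0)"
    proof (rule has_field_derivative_transform_within_open[of "\<lambda>_. 0" 0 0 "{t. norm (z + of_real t * w) > R}"])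
      show "open {t. R < cmod (z + complex_of_real t * w)}"
        by (intro open_Collect_less continuous_intros)
    qed (use that K in auto)
    then show ?thesis using d[of z] DERIV_unique by blast
  qed
  have "bounded (P' ` cball 0 (\<bar>R\<bar> + 2))"
    by (intro compact_imp_bounded compact_continuous_image continuous_on_subset[OF c(2)]) auto
  then obtain M0 where M0: "\<forall>z\<in>cball 0 (\<bar>R\<bar> + 2). \<bar>P' z\<bar> \<le> M0"
    unfolding bounded_iff by auto
  define M where "M = max 0 M0"
  have M: "\<bar>P' z\<bar> \<le> M" for z
    using P'0[of z]
    by (cases "norm z > R") (auto simp: M_def intro!: max.coboundedI2 M0[rule_format])
  define g where "g n z = real (Suc n) * (P (of_real (1 / real (Suc n)) * w + z) - P z)" for n z
  have Pint: "integrable lborel P"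
    by (rule integrable_continuous_compact[of "cball 0 R"]) (use K in \<open>auto intro: continuous_on_subset[OF c(1)]\<close>)
  have tr: "(\<integral>z. P (a + z) \<partial>lborel) = (\<integral>z. P z \<partial>lborel)" "integrable lborel (\<lambda>z. P (a + z))" for a
  proof -
    have m: "P \<in> borel_measurable borel" using c(1) by (rule borel_measurable_continuous_onI)
    have "(\<integral>z. P z \<partial>distr lborel borel ((+) a)) = (\<integral>z. P (a + z) \<partial>lborel)"
      by (rule integral_distr) (use m in auto)
    then show "(\<integral>z. P (a + z) \<partial>lborel) = (\<integral>z. P z \<partial>lborel)" by (simp add: lborel_distr_plus)
    have "integrable (distr lborel borel ((+) a)) P \<longleftrightarrow> integrable lborel (\<lambda>z. P (a + z))"
      by (rule integrable_distr_eq) (use m in auto)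
    then show "integrable lborel (\<lambda>z. P (a + z))" using Pint by (simp add: lborel_distr_plus)
  qed
  have g0: "(\<integral>z. g n z \<partial>lborel) = 0" for n
    unfolding g_def using Pint tr by simp
  have "(\<lambda>n. \<integral>z. g n z \<partial>lborel) \<longlonglongrightarrow> (\<integral>z. P' z \<partial>lborel)"
  proof (rule integral_dominated_convergence[where w = "\<lambda>z. M * indicator (cball 0 (\<bar>R\<bar> + 1)) z"])
    show "P' \<in> borel_measurable lborel" using borel_measurable_continuous_onI[OF c(2)] by simp
    show "g n \<in> borel_measurable lborel" for n
      unfolding g_def[abs_def] using Pint tr(2) by (intro borel_measurable_times borel_measurable_diff) auto
    have "integrable lborel (indicator (cball (0::complex) (\<bar>R\<bar> + 1)) :: complex => real)"
      using emeasure_bounded_finite[of "cball (0::complex) (\<bar>R\<bar> + 1)"] by (intro integrable_real_indicator) auto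
    then show "integrable lborel (\<lambda>z. M * indicator (cball (0::complex) (\<bar>R\<bar> + 1)) z)" by simp
    show "AE z in lborel. (\<lambda>n. g n z) \<longlonglongrightarrow> P' z"
    proof (rule AE_I2)
      fix z
      have "((\<lambda>h. (P (z + of_real (0 + h) * w) - P (z + of_real 0 * w)) / h) \<longlongrightarrow> P' z) (at 0)"
        using d[of z] unfolding DERIV_def .
      moreover have "filterlim (\<lambda>n. 1 / real (Suc n)) (at 0) sequentially"
        using LIMSEQ_inverse_real_of_nat by (intro filterlim_atI) (auto simp: inverse_eq_divide)
      ultimately have "(\<lambda>n. (P (z + of_real (0 + 1 / real (Suc n)) * w) - P (z + of_real 0 * w)) / (1 / real (Suc n))) \<longlonglongrightarrow> P' z"
        by (rule filterlim_compose)
      then show "(\<lambda>n. g n z) \<longlonglongrightarrow> P' z" unfolding g_def by (simp add: algebra_simps)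
    qed
    \<comment> \<open>The mean value theorem bounds the quotient by M. Since the step is at most 1,
      the quotient vanishes outside the ball of radius |R| + 1.\<close>
    show "AE z in lborel. norm (g n z) \<le> M * indicator (cball 0 (\<bar>R\<bar> + 1)) z" for n
    proof (rule AE_I2)
      fix z
      define h where "h = 1 / real (Suc n)"
      have h: "0 < h" "h \<le> 1" by (auto simp: h_def)
      show "norm (g n z) \<le> M * indicator (cball 0 (\<bar>R\<bar> + 1)) z"
      proof (cases "z \<in> cball 0 (\<bar>R\<bar> + 1)")
        case True
        obtain s where "P (z + of_real h * w) - P (z + of_real 0 * w) = (h - 0) * P' (z + of_real s * w)"
          using MVT2[OF h(1), of "\<lambda>t. P (z + of_real t * w)" "\<lambda>s. P' (z + of_real s * w)"] ds by blast
        then have "g n z = P' (z + of_real s * w)"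
          using h unfolding g_def h_def[symmetric] by (simp add: h_def field_simps)
        then show ?thesis using True M by simp
      next
        case False
        then have z: "norm z > R + 1" "norm z > R" by auto
        have "norm z \<le> norm (of_real h * w + z) + norm (of_real h * w)"
          using norm_triangle_ineq4[of "of_real h * w + z" "of_real h * w"] by simp
        moreover have "norm (of_real h * w) \<le> 1" using h w by (simp add: norm_mult)
        ultimately have "norm (of_real h * w + z) > R" using z by linarith
        then show ?thesis using K z False unfolding g_def h_def[symmetric] by simp
      qed
    qed
  qed
  then have "(\<lambda>n. 0) \<longlonglongrightarrow> (\<integral>z. P' z \<partial>lborel)" by (simp add: g0)
  then show ?thesis using LIMSEQ_const_iff by metis
qed

lemma integral_part_zero:
  assumes P: "C1_on UNIV P" and K: "\<And>z. norm z > R ==> P z = 0"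
  shows "(\<integral>z. part_re P z \<partial>lborel) = 0" "(\<integral>z. part_im P z \<partial>lborel) = 0"
    "integrable lborel (part_re P)" "integrable lborel (part_im P)"
proof -
  have c: "continuous_on UNIV P" "continuous_on UNIV (part_re P)" "continuous_on UNIV (part_im P)"
    using P C1_on_continuous[OF P] by (auto simp: C1_on_def)
  have "((\<lambda>t. P (z + of_real t * w)) has_real_derivative (part_re P z * Re w + part_im P z * Im w)) (at 0)" for z w
  proof -
    have "((\<lambda>t. P (z + of_real t * w)) has_derivative
        (\<lambda>t. part_re P z * Re (of_real t * w) + part_im P z * Im (of_real t * w))) (at 0)"
      by (rule has_derivative_compose[of "\<lambda>t. z + of_real t * w" "\<lambda>t. of_real t * w" 0 UNIV P, simplified])
        (use C1_on_has_derivative[OF P] in \<open>auto intro!: derivative_eq_intros\<close>)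
    moreover have "(\<lambda>t. part_re P z * Re (of_real t * w) + part_im P z * Im (of_real t * w)) =
        (*) (part_re P z * Re w + part_im P z * Im w)" by (auto simp: fun_eq_iff algebra_simps)
    ultimately show ?thesis by (simp add: has_field_derivative_def)
  qed
  from this[of _ 1] this[of _ \<i>]
  have d: "\<And>z. ((\<lambda>t. P (z + of_real t * 1)) has_real_derivative part_re P z) (at 0)"
     "\<And>z. ((\<lambda>t. P (z + of_real t * \<i>)) has_real_derivative part_im P z) (at 0)" by simp_all
  show "(\<integral>z. part_re P z \<partial>lborel) = 0"
    by (rule integral_directional_derivative[OF d(1) c(1,2) K]) auto
  show "(\<integral>z. part_im P z \<partial>lborel) = 0"
    by (rule integral_directional_derivative[OF d(2) c(1,3) K]) auto
  have "part_re P z = 0" "part_im P z = 0" if "z \<notin> cball 0 R" for z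
    using part_cong[of "- cball 0 R" z P "\<lambda>_. 0"] that K C1_on_const
      by (auto simp: part_re_def part_im_def)
  then show "integrable lborel (part_re P)" "integrable lborel (part_im P)"
    by (auto intro!: integrable_continuous_compact[of "cball 0 R"] continuous_on_subset[OF c(2)] continuous_on_subset[OF c(3)])
qed

text \<open>Green's identity: \<eta> \<Delta>u - u \<Delta>\<eta> is the divergence of \<eta> grad u
  - u grad \<eta>, a field supported in K. As u is differentiable on D only, the field is extended
  by 0.\<close>

lemma integral_ddc_by_parts:
  assumes D: "open D" and u: "C2_on D u" and \<eta>: "C2_on UNIV \<eta>" and K: "compact K" "K \<subseteq> D"
    and supp: "\<And>z. z \<notin> K ==> \<eta> z = 0"
  shows "(\<integral>z. \<eta> z * ddc u z \<partial>lborel) = (\<integral>z. u z * ddc \<eta> z \<partial>lborel)"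
    "integrable lborel (\<lambda>z. \<eta> z * ddc u z)" "integrable lborel (\<lambda>z. u z * ddc \<eta> z)"
proof -
  have cu: "C1_on D u" "C1_on D (part_re u)" "C1_on D (part_im u)" using u by (auto simp: C2_on_def)
  have ce: "C1_on UNIV \<eta>" "C1_on UNIV (part_re \<eta>)" "C1_on UNIV (part_im \<eta>)" using \<eta> by (auto simp: C2_on_def)
  note ceD = ce[THEN C1_on_subset[OF _ subset_UNIV[of D]]]
  have oK: "open (- K)" using K(1) by (simp add: compact_imp_closed open_Compl)
  have z1: "part_re \<eta> z = 0" "part_im \<eta> z = 0" if "z \<notin> K" for z
    using part_cong[OF oK, of z \<eta> "\<lambda>_. 0"] supp C1_on_const that by (auto simp: part_re_def part_im_def)
  have z2: "ddc \<eta> z = 0" if "z \<notin> K" for z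
    using C2_on_cong(2)[OF oK C2_on_const, of \<eta> 0 z] supp that by (simp add: ddc_def part_re_def part_im_def)
  obtain R where "\<forall>z\<in>K. norm z \<le> R" using compact_imp_bounded[OF K(1)] unfolding bounded_iff by blast
  then have R: "K \<subseteq> cball 0 R" by auto
  \<comment> \<open>D and the complement of K are open and cover the plane, so the extension by 0 is
    continuously differentiable everywhere.\<close>
  have main: "C1_on UNIV (\<lambda>z. if z \<in> D then P z else 0)"
     if P: "C1_on D P" and P0: "\<And>z. z \<in> D - K ==> P z = 0" for P
  proof -
    have "C1_on (D \<union> - K) (\<lambda>z. if z \<in> D then P z else 0)"
    proof (rule C1_on_Un[OF D oK])
      show "C1_on D (\<lambda>z. if z \<in> D then P z else 0)" by (rule C1_on_cong[OF D P]) simp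
      show "C1_on (- K) (\<lambda>z. if z \<in> D then P z else 0)" by (rule C1_on_cong[OF oK C1_on_const[of _ 0]]) (use P0 in auto)
    qed
    moreover have "D \<union> - K = UNIV" using K(2) by auto
    ultimately show ?thesis by simp
  qed
  define P0 where "P0 z = \<eta> z * part_re u z + (- u z) * part_re \<eta> z" for z
  define R0 where "R0 z = \<eta> z * part_im u z + (- u z) * part_im \<eta> z" for z
  have nu: "C1_on D (\<lambda>z. - u z)" "\<And>z. z \<in> D ==> part_re (\<lambda>z. - u z) z = - part_re u z"
     "\<And>z. z \<in> D ==> part_im (\<lambda>z. - u z) z = - part_im u z"
    using C1_on_mult[OF C1_on_const[of D "-1"] cu(1)] by (simp_all add: part_re_def[of "\<lambda>_. -1"] part_im_def[of "\<lambda>_. -1"])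
  have C0: "C1_on D P0" "C1_on D R0"
    unfolding P0_def[abs_def] R0_def[abs_def] by (intro C1_on_add C1_on_mult(1) cu ceD nu(1))+
  have add_parts: "part_re (\<lambda>z. a z + b z) z = part_re a z + part_re b z"
      "part_im (\<lambda>z. a z + b z) z = part_im a z + part_im b z"
    if "C1_on D a" "C1_on D b" "z \<in> D" for a b z
  proof -
    have "((\<lambda>z. a z + b z) has_derivative (\<lambda>h. (part_re a z + part_re b z) * Re h + (part_im a z + part_im b z) * Im h)) (at z)"
      using C1_on_has_derivative[OF that(1,3)] C1_on_has_derivative[OF that(2,3)]
      by (auto intro!: derivative_eq_intros simp: algebra_simps)
    then show "part_re (\<lambda>z. a z + b z) z = part_re a z + part_re b z"
      "part_im (\<lambda>z. a z + b z) z = part_im a z + part_im b z" by (auto dest: has_derivative_parts)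
  qed
  have pP: "part_re P0 z = \<eta> z * part_re (part_re u) z - u z * part_re (part_re \<eta>) z" if z: "z \<in> D" for z
    unfolding P0_def[abs_def]
    by (subst add_parts(1)[OF C1_on_mult(1)[OF ceD(1) cu(2)] C1_on_mult(1)[OF nu(1) ceD(2)] z])
      (unfold C1_on_mult(2)[OF ceD(1) cu(2) z] C1_on_mult(2)[OF nu(1) ceD(2) z] nu(2)[OF z], simp)
  have pR: "part_im R0 z = \<eta> z * part_im (part_im u) z - u z * part_im (part_im \<eta>) z" if z: "z \<in> D" for z
    unfolding R0_def[abs_def]
    by (subst add_parts(2)[OF C1_on_mult(1)[OF ceD(1) cu(3)] C1_on_mult(1)[OF nu(1) ceD(3)] z])
      (unfold C1_on_mult(3)[OF ceD(1) cu(3) z] C1_on_mult(3)[OF nu(1) ceD(3) z] nu(3)[OF z], simp)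
  define P where "P z = (if z \<in> D then P0 z else 0)" for z
  define Q where "Q z = (if z \<in> D then R0 z else 0)" for z
  have CP: "C1_on UNIV P" "C1_on UNIV Q" unfolding P_def[abs_def] Q_def[abs_def]
    by (intro main C0; use supp z1 in \<open>auto simp: P0_def R0_def\<close>)+
  have PR: "P z = 0" "Q z = 0" if "norm z > R" for z
  proof -
    have "z \<notin> K" using R that by auto
    then show "P z = 0" "Q z = 0" using supp[of z] z1[of z] by (auto simp: P_def Q_def P0_def R0_def)
  qed
  note IP = integral_part_zero[OF CP(1) PR(1)] and IQ = integral_part_zero[OF CP(2) PR(2)]
  have I: "integrable lborel (\<lambda>z. \<eta> z * ddc u z)"
  proof (rule integrable_continuous_compact[OF _ K(1)])
    show "continuous_on K (\<lambda>z. \<eta> z * ddc u z)"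
      by (intro continuous_intros continuous_on_subset[OF C1_on_continuous[OF ce(1)]]
          continuous_on_subset[OF C2_on_ddc_continuous[OF u]] K) auto
  qed (simp add: supp)
  have J: "integrable lborel (\<lambda>z. u z * ddc \<eta> z)"
  proof (rule integrable_continuous_compact[OF _ K(1)])
    show "continuous_on K (\<lambda>z. u z * ddc \<eta> z)"
      by (intro continuous_intros continuous_on_subset[OF C1_on_continuous[OF cu(1)]]
          continuous_on_subset[OF C2_on_ddc_continuous[OF \<eta>]] K) auto
  qed (simp add: z2)
  show "integrable lborel (\<lambda>z. \<eta> z * ddc u z)" "integrable lborel (\<lambda>z. u z * ddc \<eta> z)" by fact+
  have e: "\<eta> z * ddc u z - u z * ddc \<eta> z = (part_re P z + part_im Q z) / (4 * pi)" for z
  proof (cases "z \<in> D")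
    case True
    have "part_re P z = part_re P0 z" "part_im Q z = part_im R0 z"
      using part_cong(1)[OF D True _ C0(1), of P] part_cong(2)[OF D True _ C0(2), of Q] by (auto simp: P_def Q_def)
    then show ?thesis unfolding ddc_def times_divide_eq_right pP[OF True] pR[OF True] diff_divide_distrib[symmetric]
        by (simp add: pP[OF True] pR[OF True] algebra_simps)
  next
    case False
    then have zK: "z \<in> - K" using K by auto
    have "part_re P z = 0" "part_im Q z = 0"
      using part_cong[OF oK zK _ C1_on_const[of _ 0], of P] part_cong[OF oK zK _ C1_on_const[of _ 0], of Q] supp z1
      by (auto simp: P_def Q_def P0_def R0_def part_re_def[of "\<lambda>_. 0"] part_im_def[of "\<lambda>_. 0"])
    then show ?thesis using supp[of z] z2[of z] zK by simp
  qed
  have "(\<integral>z. \<eta> z * ddc u z \<partial>lborel) - (\<integral>z. u z * ddc \<eta> z \<partial>lborel) = (\<integral>z. (part_re P z + part_im Q z) / (4 * pi) \<partial>lborel)"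
    by (subst Bochner_Integration.integral_diff[OF I J, symmetric]) (simp add: e)
  also have "\<dots> = 0" using IP IQ by simp
  finally show "(\<integral>z. \<eta> z * ddc u z \<partial>lborel) = (\<integral>z. u z * ddc \<eta> z \<partial>lborel)" by simp
qed

section \<open>Cut-off functions\<close>

text \<open>A twice differentiable convex substitute for the positive part of t: it vanishes for t
  \<le> 0 and its slope increases to 1 at infinity. Being rational for t > 0, it has the explicit
  derivatives \<open>cutoff1\<close> and \<open>cutoff2\<close>.\<close>

definition cutoff :: "real => real" where "cutoff t = (if t \<le> 0 then 0 else t ^ 3 / (1 + t)\<^sup>2)"
definition cutoff1 :: "real => real" where "cutoff1 t = (if t \<le> 0 then 0 else t\<^sup>2 * (3 + t) / (1 + t) ^ 3)"
definition cutoff2 :: "real => real" where "cutoff2 t = (if t \<le> 0 then 0 else 6 * t / (1 + t) ^ 4)"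

text \<open>At t = 0 the quadratic bound makes the difference quotients tend to 0.\<close>

lemma DERIV_extend_zero:
  fixes h h' :: "real => real"
  assumes h: "\<And>t. t > 0 ==> (h has_real_derivative h' t) (at t)"
    and b: "\<And>t. 0 < t ==> \<bar>h t\<bar> \<le> C * t\<^sup>2"
  shows "((\<lambda>t. if t \<le> 0 then 0 else h t) has_real_derivative (if t \<le> 0 then 0 else h' t)) (at t)"
proof -
  consider "t < 0" | "t = 0" | "t > 0" by linarith
  then show ?thesis
  proof cases
    case 1
    have "((\<lambda>t. if t \<le> 0 then 0 else h t) has_real_derivative 0) (at t)"
      by (rule has_field_derivative_transform_within_open[of "\<lambda>_. 0" 0 t "{..<0}"]) (use 1 in auto)
    then show ?thesis using 1 by simp
  next
    case 3
    have "((\<lambda>t. if t \<le> 0 then 0 else h t) has_real_derivative h' t) (at t)"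
      by (rule has_field_derivative_transform_within_open[of h "h' t" t "{0<..}"]) (use 3 h in auto)
    then show ?thesis using 3 by simp
  next
    case 2
    have C: "C \<ge> 0" using b[of 1] by (simp add: abs_le_iff)
    have lim: "((\<lambda>x. (if x \<le> 0 then 0 else h x) / x) \<longlongrightarrow> 0) (at (0::real))"
    proof (rule Lim_null_comparison[of _ "\<lambda>x. C * \<bar>x\<bar>"])
      have "norm ((if x \<le> 0 then 0 else h x) / x) \<le> C * \<bar>x\<bar>" for x :: real
      proof (cases "x \<le> 0")
        case False
        then show ?thesis using b[of x] by (simp add: field_simps power2_eq_square)
      qed (use C in \<open>auto simp: mult_nonneg_nonpos\<close>)
      then show "\<forall>\<^sub>F x in at 0. norm ((if x \<le> 0 then 0 else h x) / x) \<le> C * \<bar>x\<bar>" by auto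
      show "((\<lambda>x. C * \<bar>x\<bar>) \<longlongrightarrow> 0) (at (0::real))" by (auto intro!: tendsto_eq_intros)
    qed
    show ?thesis unfolding 2 has_field_derivative_iff using lim by simp
  qed
qed

lemma DERIV_cutoff: "(cutoff has_real_derivative cutoff1 t) (at t)"
proof -
  have e: "cutoff = (\<lambda>t. if t \<le> 0 then 0 else t ^ 3 / (1 + t)\<^sup>2)" by (auto simp: cutoff_def)
  show ?thesis unfolding e cutoff1_def
  proof (rule DERIV_extend_zero[where C = 1])
    show "((\<lambda>t. t ^ 3 / (1 + t)\<^sup>2) has_real_derivative t\<^sup>2 * (3 + t) / (1 + t) ^ 3) (at t)" if "t > 0" for t :: real
    proof -
      have n: "1 + t ~= 0" using that by simp
      have "((\<lambda>t. t ^ 3 / (1 + t)\<^sup>2) has_real_derivative (3 * t\<^sup>2 * (1 + t)\<^sup>2 - t ^ 3 * (2 * (1 + t))) / ((1 + t)\<^sup>2 * (1 + t)\<^sup>2)) (at t)"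
        using n by (auto intro!: derivative_eq_intros)
      moreover have "(3 * t\<^sup>2 * (1 + t)\<^sup>2 - t ^ 3 * (2 * (1 + t))) / ((1 + t)\<^sup>2 * (1 + t)\<^sup>2) = t\<^sup>2 * (3 + t) / (1 + t) ^ 3"
      proof -
        have "3 * t\<^sup>2 * (1 + t)\<^sup>2 - t ^ 3 * (2 * (1 + t)) = (1 + t) * (t\<^sup>2 * (3 + t))" by algebra
        moreover have "(1 + t)\<^sup>2 * (1 + t)\<^sup>2 = (1 + t) * (1 + t) ^ 3" by algebra
        ultimately show ?thesis using n by simp
      qed
      ultimately show ?thesis by simp
    qed
    show "\<bar>t ^ 3 / (1 + t)\<^sup>2\<bar> \<le> 1 * t\<^sup>2" if "0 < t" for t :: real
    proof -
      have "t * t\<^sup>2 \<le> (1 + t)\<^sup>2 * t\<^sup>2" using that by (intro mult_right_mono) (auto simp: power2_eq_square algebra_simps)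
      then have "t ^ 3 \<le> (1 + t)\<^sup>2 * t\<^sup>2" by (simp add: power3_eq_cube power2_eq_square)
      then show ?thesis using that by (simp add: pos_divide_le_eq mult.commute)
    qed
  qed
qed

lemma DERIV_cutoff1: "(cutoff1 has_real_derivative cutoff2 t) (at t)"
proof -
  have e: "cutoff1 = (\<lambda>t. if t \<le> 0 then 0 else t\<^sup>2 * (3 + t) / (1 + t) ^ 3)" by (auto simp: cutoff1_def)
  show ?thesis unfolding e cutoff2_def
  proof (rule DERIV_extend_zero[where C = 3])
    show "((\<lambda>t. t\<^sup>2 * (3 + t) / (1 + t) ^ 3) has_real_derivative 6 * t / (1 + t) ^ 4) (at t)" if "t > 0" for t :: real
    proof -
      have n: "1 + t ~= 0" using that by simp
      have "((\<lambda>t. t\<^sup>2 * (3 + t) / (1 + t) ^ 3) has_real_derivative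
          ((2 * t * (3 + t) + t\<^sup>2) * (1 + t) ^ 3 - t\<^sup>2 * (3 + t) * (3 * (1 + t)\<^sup>2)) / ((1 + t) ^ 3 * (1 + t) ^ 3)) (at t)"
        using n by (auto intro!: derivative_eq_intros simp: algebra_simps)
      moreover have "((2 * t * (3 + t) + t\<^sup>2) * (1 + t) ^ 3 - t\<^sup>2 * (3 + t) * (3 * (1 + t)\<^sup>2)) / ((1 + t) ^ 3 * (1 + t) ^ 3) = 6 * t / (1 + t) ^ 4"
      proof -
        have "(2 * t * (3 + t) + t\<^sup>2) * (1 + t) ^ 3 - t\<^sup>2 * (3 + t) * (3 * (1 + t)\<^sup>2) = (1 + t)\<^sup>2 * (6 * t)" by algebra
        moreover have "(1 + t) ^ 3 * (1 + t) ^ 3 = (1 + t)\<^sup>2 * (1 + t) ^ 4" by algebra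
        moreover have "(1 + t)\<^sup>2 * (6 * t) / ((1 + t)\<^sup>2 * (1 + t) ^ 4) = 6 * t / (1 + t) ^ 4"
          using n by (intro mult_divide_mult_cancel_left) simp
        ultimately show ?thesis by (simp only:)
      qed
      ultimately show ?thesis by simp
    qed
    show "\<bar>t\<^sup>2 * (3 + t) / (1 + t) ^ 3\<bar> \<le> 3 * t\<^sup>2" if "0 < t" for t :: real
    proof -
      have "3 + t \<le> 3 * (1 + t) ^ 3" using that by (simp add: power3_eq_cube algebra_simps)
      then have "t\<^sup>2 * (3 + t) \<le> t\<^sup>2 * (3 * (1 + t) ^ 3)" by (intro mult_left_mono) auto
      then show ?thesis using that by (simp add: pos_divide_le_eq mult_ac)
    qed
  qed
qed

lemma DERIV_cutoff_compose:
  assumes "(f has_real_derivative f') (at x)" "D = cutoff1 (f x) * f'"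
  shows "((\<lambda>x. cutoff (f x)) has_real_derivative D) (at x)"
  using DERIV_chain2[OF DERIV_cutoff assms(1)] assms(2) by simp

lemma DERIV_cutoff1_compose:
  assumes "(f has_real_derivative f') (at x)" "D = cutoff2 (f x) * f'"
  shows "((\<lambda>x. cutoff1 (f x)) has_real_derivative D) (at x)"
  using DERIV_chain2[OF DERIV_cutoff1 assms(1)] assms(2) by simp

lemma continuous_cutoff2: "continuous_on UNIV cutoff2"
proof -
  have e: "cutoff2 = (\<lambda>t. 6 * max 0 t / (1 + max 0 t) ^ 4)" by (auto simp: cutoff2_def fun_eq_iff)
  show ?thesis unfolding e by (intro continuous_intros ballI) (simp add: max_def)
qed

lemma cutoff_bounds: "0 \<le> cutoff t" "0 \<le> cutoff1 t" "cutoff1 t \<le> 1" "0 \<le> cutoff2 t" "t > 0 ==> 0 < cutoff t" "t \<le> 0 ==> cutoff t = 0"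
  "t \<le> 0 ==> cutoff1 t = 0"
proof -
  show "0 \<le> cutoff t" "0 \<le> cutoff1 t" "0 \<le> cutoff2 t" "t > 0 ==> 0 < cutoff t" "t \<le> 0 ==> cutoff t = 0"  "t \<le> 0 ==> cutoff1 t = 0"
    by (auto simp: cutoff_def cutoff1_def cutoff2_def)
  show "cutoff1 t \<le> 1"
  proof (cases "t \<le> 0")
    case False
    then have "t\<^sup>2 * (3 + t) \<le> (1 + t) ^ 3" by (simp add: power2_eq_square power3_eq_cube algebra_simps)
    then show ?thesis using False by (simp add: cutoff1_def)
  qed (simp add: cutoff1_def)
qed

section \<open>Bump functions and the decomposition of test functions\<close>

lemma C2_on_dist_sq:
  "C2_on UNIV (\<lambda>z. (cmod (z - c))\<^sup>2)" "part_re (\<lambda>z. (cmod (z - c))\<^sup>2) z = 2 * Re (z - c)"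
  "part_im (\<lambda>z. (cmod (z - c))\<^sup>2) z = 2 * Im (z - c)" "ddc (\<lambda>z. (cmod (z - c))\<^sup>2) z = 1 / pi"
proof -
  have 1: "C1_on UNIV (\<lambda>z. 2 * Re (z - c))" "part_re (\<lambda>z. 2 * Re (z - c)) z = 2" for z
  proof -
    have d: "((\<lambda>z. 2 * Re (z - c)) has_derivative (\<lambda>h. 2 * Re h + 0 * Im h)) (at z)" for z
      by (auto intro!: derivative_eq_intros)
    then show "C1_on UNIV (\<lambda>z. 2 * Re (z - c))" by (intro C1_onI[of _ _ "\<lambda>_. 2" "\<lambda>_. 0"]) auto
    show "part_re (\<lambda>z. 2 * Re (z - c)) z = 2" using has_derivative_parts(1)[OF d] .
  qed
  have 2: "C1_on UNIV (\<lambda>z. 2 * Im (z - c))" "part_im (\<lambda>z. 2 * Im (z - c)) z = 2" for z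
  proof -
    have d: "((\<lambda>z. 2 * Im (z - c)) has_derivative (\<lambda>h. 0 * Re h + 2 * Im h)) (at z)" for z
      by (auto intro!: derivative_eq_intros)
    then show "C1_on UNIV (\<lambda>z. 2 * Im (z - c))" by (intro C1_onI[of _ _ "\<lambda>_. 0" "\<lambda>_. 2"]) auto
    show "part_im (\<lambda>z. 2 * Im (z - c)) z = 2" using has_derivative_parts(2)[OF d] .
  qed
  have d: "\<forall>z\<in>UNIV. ((\<lambda>z. (cmod (z - c))\<^sup>2) has_derivative (\<lambda>h. 2 * Re (z - c) * Re h + 2 * Im (z - c) * Im h)) (at z)"
    unfolding cmod_power2 by (auto intro!: derivative_eq_intros simp: fun_eq_iff algebra_simps)
  note E = C2_onI[OF open_UNIV d 1(1) 2(1)]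
  show "C2_on UNIV (\<lambda>z. (cmod (z - c))\<^sup>2)" "part_re (\<lambda>z. (cmod (z - c))\<^sup>2) z = 2 * Re (z - c)"
    "part_im (\<lambda>z. (cmod (z - c))\<^sup>2) z = 2 * Im (z - c)" "ddc (\<lambda>z. (cmod (z - c))\<^sup>2) z = 1 / pi"
    using E 1(2) 2(2) by auto
qed

text \<open>With s = |z - c|^2 / \<rho>^2 the two cut-offs are positive for s < 2 and for s > 1
  respectively, so the denominator is never 0. The quotient is 1 for s \<le> 1 and 0 for s \<ge>
  2.\<close>

definition bump :: "complex => real => complex => real" where
  "bump c \<rho> z = cutoff (2 - (cmod (z - c))\<^sup>2 / \<rho>\<^sup>2) *
     inverse (cutoff (2 - (cmod (z - c))\<^sup>2 / \<rho>\<^sup>2) + cutoff ((cmod (z - c))\<^sup>2 / \<rho>\<^sup>2 - 1))"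

lemma C2_on_bump: "C2_on UNIV (bump c \<rho>)"
proof -
  note S = C2_on_dist_sq(1)[of c]
  have cc: "continuous_on UNIV (\<lambda>t. cutoff2 (f t) * d)" if "continuous_on UNIV f" for f :: "real => real" and d
    using that by (intro continuous_intros continuous_on_compose2[OF continuous_cutoff2]) auto
  have a: "C2_on UNIV (\<lambda>z. cutoff (2 - (cmod (z - c))\<^sup>2 / \<rho>\<^sup>2))"
    by (rule C2_on_compose(1)[OF open_UNIV S, of UNIV "\<lambda>t. cutoff (2 - t / \<rho>\<^sup>2)" "\<lambda>t. cutoff1 (2 - t / \<rho>\<^sup>2) * (- 1 / \<rho>\<^sup>2)"
        "\<lambda>t. cutoff2 (2 - t / \<rho>\<^sup>2) * (1 / \<rho>\<^sup>2)\<^sup>2"])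
      (auto intro!: DERIV_cutoff_compose DERIV_cutoff1_compose derivative_eq_intros cc continuous_intros
        simp: power2_eq_square divide_inverse)
  have b: "C2_on UNIV (\<lambda>z. cutoff ((cmod (z - c))\<^sup>2 / \<rho>\<^sup>2 - 1))"
    by (rule C2_on_compose(1)[OF open_UNIV S, of UNIV "\<lambda>t. cutoff (t / \<rho>\<^sup>2 - 1)" "\<lambda>t. cutoff1 (t / \<rho>\<^sup>2 - 1) * (1 / \<rho>\<^sup>2)"
        "\<lambda>t. cutoff2 (t / \<rho>\<^sup>2 - 1) * (1 / \<rho>\<^sup>2)\<^sup>2"])
      (auto intro!: DERIV_cutoff_compose DERIV_cutoff1_compose derivative_eq_intros cc continuous_intros
        simp: power2_eq_square divide_inverse)
  have "C2_on UNIV (\<lambda>z. inverse (cutoff (2 - (cmod (z - c))\<^sup>2 / \<rho>\<^sup>2) + cutoff ((cmod (z - c))\<^sup>2 / \<rho>\<^sup>2 - 1)))"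
  proof (rule C2_on_compose(1)[OF open_UNIV C2_on_add[OF open_UNIV a b], of "{0<..}" inverse "\<lambda>t. - (inverse t)\<^sup>2" "\<lambda>t. 2 * (inverse t) ^ 3"])
    have "0 < cutoff (2 - t) + cutoff (t - 1)" for t
      using cutoff_bounds(1)[of "2 - t"] cutoff_bounds(1)[of "t - 1"] cutoff_bounds(5)[of "2 - t"] cutoff_bounds(5)[of "t - 1"]
      by (cases "t < 2") (auto intro: add_pos_nonneg add_nonneg_pos)
    then show "range (\<lambda>z. cutoff (2 - (cmod (z - c))\<^sup>2 / \<rho>\<^sup>2) + cutoff ((cmod (z - c))\<^sup>2 / \<rho>\<^sup>2 - 1)) \<subseteq> {0<..}" by auto
    show "\<forall>t\<in>{0<..}. (inverse has_real_derivative (- (inverse t)\<^sup>2)) (at t)"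
      by (auto intro!: derivative_eq_intros simp: power2_eq_square)
    show "\<forall>t\<in>{0<..}. ((\<lambda>t. - (inverse t)\<^sup>2) has_real_derivative (2 * (inverse t) ^ 3)) (at t)"
      by (auto intro!: derivative_eq_intros simp: power2_eq_square power3_eq_cube)
    show "continuous_on {0<..} (\<lambda>t. 2 * (inverse t) ^ 3 :: real)" by (auto intro!: continuous_intros)
  qed
  from C2_on_mult[OF open_UNIV a this] show ?thesis by (simp add: bump_def[abs_def])
qed

lemma bump_inside: "\<rho> > 0 ==> z \<in> ball c \<rho> ==> bump c \<rho> z = 1"
proof -
  assume "\<rho> > 0" "z \<in> ball c \<rho>"
  then have "(cmod (z - c))\<^sup>2 / \<rho>\<^sup>2 < 1" by (simp add: dist_norm norm_minus_commute power_strict_mono)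
  then show ?thesis using cutoff_bounds(5)[of "2 - (cmod (z - c))\<^sup>2 / \<rho>\<^sup>2"] by (simp add: bump_def cutoff_bounds(6))
qed

lemma bump_outside: "\<rho> > 0 ==> z \<notin> cball c (2 * \<rho>) ==> bump c \<rho> z = 0"
proof -
  assume \<rho>: "\<rho> > 0" "z \<notin> cball c (2 * \<rho>)"
  then have "(2 * \<rho>)\<^sup>2 \<le> (cmod (z - c))\<^sup>2" by (intro power_mono) (auto simp: dist_norm norm_minus_commute)
  then have "4 * \<rho>\<^sup>2 \<le> (cmod (z - c))\<^sup>2" by (simp add: power_mult_distrib)
  then have "2 * \<rho>\<^sup>2 \<le> (cmod (z - c))\<^sup>2" using zero_le_power2[of \<rho>] by linarith
  then have "2 \<le> (cmod (z - c))\<^sup>2 / \<rho>\<^sup>2" using \<rho> by (simp add: pos_le_divide_eq)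
  then show ?thesis by (simp add: bump_def cutoff_bounds(6))
qed

text \<open>This replaces a partition of unity. Cover K by finitely many balls and peel them off one
  at a time, splitting a test function \<theta> into \<theta> b and \<theta> (1 - b) with a bump b
  that is 1 on the ball. The first summand lives in one member of the cover, and the second vanishes
  outside the remaining balls.\<close>

lemma partition_of_unity_induct:
  assumes cover: "\<And>z. \<exists>D\<in>\<D>. open D \<and> z \<in> D" and K: "compact K"
    and \<eta>: "C2_on UNIV \<eta>" "\<And>z. z \<notin> K ==> \<eta> z = 0"
    and local: "\<And>\<eta> D K'. C2_on UNIV \<eta> ==> D \<in> \<D> ==> compact K' ==> K' \<subseteq> D ==> (\<And>z. z \<notin> K' ==> \<eta> z = 0) ==> Q \<eta>"
    and zero: "Q (\<lambda>_. 0)"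
    and add: "\<And>a b. C2_on UNIV a ==> C2_on UNIV b ==> (\<And>z. z \<notin> K ==> a z = 0) ==> (\<And>z. z \<notin> K ==> b z = 0) ==>
      Q a ==> Q b ==> Q (\<lambda>z. a z + b z)"
  shows "Q \<eta>"
proof -
  have "\<exists>\<rho> D. \<rho> > 0 \<and> D \<in> \<D> \<and> cball z (2 * \<rho>) \<subseteq> D" for z
  proof -
    obtain D e where "D \<in> \<D>" "e > 0" "cball z e \<subseteq> D" using cover[of z] open_contains_cball by metis
    then show ?thesis by (intro exI[of _ "e / 2"] exI[of _ D]) auto
  qed
  then obtain \<rho> D where \<rho>: "\<And>z. \<rho> z > 0" "\<And>z. D z \<in> \<D>" "\<And>z. cball z (2 * \<rho> z) \<subseteq> D z" by metis
  obtain F where F: "finite F" "F \<subseteq> K" "K \<subseteq> (\<Union>z\<in>F. ball z (\<rho> z))"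
    by (rule compactE_image[OF K, of K "\<lambda>z. ball z (\<rho> z)"]) (use \<rho>(1) in auto)
  have "Q \<theta>" if "C2_on UNIV \<theta>" "\<And>z. z \<notin> K ==> \<theta> z = 0" "\<And>z. z \<notin> (\<Union>z\<in>F. ball z (\<rho> z)) ==> \<theta> z = 0" for \<theta>
    using F(1) that
  proof (induction F arbitrary: \<theta> rule: finite_induct)
    case empty
    then have "\<theta> = (\<lambda>_. 0)" by auto
    then show ?case using zero by simp
  next
    case (insert c F)
    define a where "a z = \<theta> z * bump c (\<rho> c) z" for z
    define b where "b z = \<theta> z * (1 + (-1) * bump c (\<rho> c) z)" for z
    have a: "C2_on UNIV a" unfolding a_def[abs_def] by (intro C2_on_mult insert.prems C2_on_bump) auto
    have b: "C2_on UNIV b" unfolding b_def[abs_def]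
      by (intro C2_on_mult C2_on_add C2_on_const insert.prems C2_on_bump) auto
    have z: "a z = 0" "b z = 0" if "z \<notin> K" for z using insert.prems(2)[OF that] by (auto simp: a_def b_def)
    have "Q a"
    proof (rule local[OF a \<rho>(2)[of c] _ \<rho>(3)[of c]])
      show "a z = 0" if "z \<notin> cball c (2 * \<rho> c)" for z using bump_outside[OF \<rho>(1) that] by (simp add: a_def)
    qed simp
    moreover have "Q b"
    proof (rule insert.IH[OF b z(2)])
      fix z assume "z \<notin> (\<Union>z\<in>F. ball z (\<rho> z))"
      then show "b z = 0" using bump_inside[OF \<rho>(1), of z c] insert.prems(3)[of z]
        by (cases "z \<in> ball c (\<rho> c)") (auto simp: b_def)
    qed
    ultimately have "Q (\<lambda>z. a z + b z)" by (intro add a b z)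
    moreover have "(\<lambda>z. a z + b z) = \<theta>" by (auto simp: a_def b_def fun_eq_iff algebra_simps)
    ultimately show ?case by simp
  qed
  then show ?thesis using \<eta> F(3) by blast
qed

section \<open>Radial integrals and approximation of the logarithmic kernel\<close>

text \<open>The disc of radius sqrt a has area pi a, so the image of Lebesgue measure under |z|^2 is
  pi times Lebesgue measure on the half-line.\<close>

lemma nn_integral_radial:
  fixes \<phi> :: "real => ennreal"
  assumes [measurable]: "\<phi> \<in> borel_measurable borel"
  shows "(\<integral>\<^sup>+z. \<phi> ((cmod z)\<^sup>2) \<partial>lborel) = ennreal pi * (\<integral>\<^sup>+x. \<phi> x * indicator {0..} x \<partial>lborel)"
proof -
  have eq: "distr lborel borel (\<lambda>z::complex. (cmod z)\<^sup>2) = density lborel (\<lambda>x. ennreal pi * indicator {0..} x)"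
  proof (rule measure_eqI_generator_eq[where E = "range (\<lambda>a. {..a})" and \<Omega> = UNIV and A = "\<lambda>n. {..real n}"])
    fix X :: "real set" assume "X \<in> range (\<lambda>a. {..a})"
    then obtain a where X: "X = {..a}" by auto
    have l: "emeasure (distr lborel borel (\<lambda>z::complex. (cmod z)\<^sup>2)) X = emeasure lborel {z::complex. (cmod z)\<^sup>2 \<le> a}"
      unfolding X by (subst emeasure_distr) (auto simp: vimage_def)
    have r: "emeasure (density lborel (\<lambda>x. ennreal pi * indicator {0..} x)) X = ennreal pi * emeasure lborel ({0..} \<inter> {..a})"
      unfolding X by (subst emeasure_density) (auto simp: mult.assoc nn_integral_cmult simp flip: indicator_inter_arith)
    show "emeasure (distr lborel borel (\<lambda>z::complex. (cmod z)\<^sup>2)) X = emeasure (density lborel (\<lambda>x. ennreal pi * indicator {0..} x)) X"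
    proof (cases "a \<ge> 0")
      case True
      have sq: "(cmod z)\<^sup>2 \<le> a \<longleftrightarrow> cmod z \<le> sqrt a" for z
        by (simp only: real_sqrt_le_iff[of "(cmod z)\<^sup>2" a, symmetric] real_sqrt_abs abs_norm_cancel)
      have "{z. (cmod z)\<^sup>2 \<le> a} = cball 0 (sqrt a)"
        by (rule set_eqI) (simp only: mem_Collect_eq mem_cball_0 sq)
      moreover have "emeasure lborel (cball (0::complex) (sqrt a)) = ennreal (pi * a)"
        using emeasure_cball[of "sqrt a" "0::complex"] True by (simp add: unit_ball_vol_2)
      moreover have "{0..} \<inter> {..a} = {0..a}" by auto
      ultimately show ?thesis unfolding l r using True by (simp add: ennreal_mult')
    next
      case False
      then have "{z. (cmod z)\<^sup>2 \<le> a} = {}" "{0..} \<inter> {..a} = {}"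
        by (auto simp: not_le intro: less_le_trans[OF _ zero_le_power2])
      then show ?thesis unfolding l r by simp
    qed
  next
    show "Int_stable (range (\<lambda>a::real. {..a}))" by (auto simp: Int_stable_def)
    have "sets (borel :: real measure) = sigma_sets UNIV (range (\<lambda>a. {..a}))" by (simp add: borel_eq_atMost)
    then show "sets (distr lborel borel (\<lambda>z::complex. (cmod z)\<^sup>2)) = sigma_sets UNIV (range (\<lambda>a. {..a}))"
      "sets (density lborel (\<lambda>x::real. ennreal pi * indicator {0..} x)) = sigma_sets UNIV (range (\<lambda>a. {..a}))" by auto
    show "(\<Union>i. {..real i}) = UNIV" using real_arch_simple by auto
    fix i
    have "emeasure (distr lborel borel (\<lambda>z::complex. (cmod z)\<^sup>2)) {..real i} = emeasure lborel {z::complex. (cmod z)\<^sup>2 \<le> real i}"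
      by (subst emeasure_distr) (auto simp: vimage_def)
    also have "\<dots> \<le> emeasure lborel (cball (0::complex) (sqrt (real i)))"
      by (intro emeasure_mono) (auto simp: real_le_rsqrt)
    also have "\<dots> < \<infinity>" by (rule emeasure_bounded_finite) simp
    finally show "emeasure (distr lborel borel (\<lambda>z::complex. (cmod z)\<^sup>2)) {..real i} ~= \<infinity>" by simp
  qed auto
  have "(\<integral>\<^sup>+z. \<phi> ((cmod z)\<^sup>2) \<partial>lborel) = (\<integral>\<^sup>+x. \<phi> x \<partial>distr lborel borel (\<lambda>z::complex. (cmod z)\<^sup>2))"
    by (subst nn_integral_distr) auto
  also have "\<dots> = (\<integral>\<^sup>+x. ennreal pi * (\<phi> x * indicator {0..} x) \<partial>lborel)"
    unfolding eq by (subst nn_integral_density) (auto simp: mult_ac)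
  finally show ?thesis by (simp add: nn_integral_cmult)
qed

text \<open>A twice differentiable approximation from below of the kernel max 0 (ln (r / |z|)),
  increasing in m. The term 1 / m removes the pole at 0, the cut-off smooths the corner at |z| = r,
  and the 2 in the denominator accounts for the squares under the logarithms.\<close>

definition log_cutoff :: "real => real => complex => real" where
  "log_cutoff r m z = cutoff (m * (ln (r\<^sup>2) - ln ((cmod z)\<^sup>2 + 1 / m))) / (2 * m)"

text \<open>For a function F of x = |z|^2 the density \<open>ddc\<close> is (x F'' + F') / pi. Its
  two parts come from the corner near |z| = r and from the smoothed pole at 0; they have opposite
  signs and are bounded separately.\<close>

lemma C2_on_log_cutoff:
  assumes m: "m > 0"
  shows "C2_on UNIV (log_cutoff r m)"
    "\<bar>ddc (log_cutoff r m) z\<bar> \<le> (m * cutoff2 (m * (ln (r\<^sup>2) - ln ((cmod z)\<^sup>2 + 1 / m))) / ((cmod z)\<^sup>2 + 1 / m)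
        + (1 / m) / ((cmod z)\<^sup>2 + 1 / m)\<^sup>2) / (2 * pi)"
proof -
  note S = C2_on_dist_sq[of 0, simplified]
  define \<tau> where "\<tau> x = m * (ln (r\<^sup>2) - ln (x + 1 / m))" for x
  define \<delta> where "\<delta> = 1 / m"
  have \<delta>: "\<delta> > 0" using m by (simp add: \<delta>_def)
  define F where "F x = cutoff (\<tau> x) / (2 * m)" for x
  define F' where "F' x = - cutoff1 (\<tau> x) / (2 * (x + \<delta>))" for x
  define F'' where "F'' x = m * cutoff2 (\<tau> x) / (2 * (x + \<delta>)\<^sup>2) + cutoff1 (\<tau> x) / (2 * (x + \<delta>)\<^sup>2)" for x
  have d\<tau>: "(\<tau> has_real_derivative - m / (x + \<delta>)) (at x)" if "x > - \<delta>" for x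
    unfolding \<tau>_def[abs_def] \<delta>_def[symmetric] using that by (auto intro!: derivative_eq_intros simp: field_simps)
  have 1: "\<forall>x\<in>{-\<delta><..}. (F has_real_derivative F' x) (at x)"
  proof
    fix x assume x: "x \<in> {-\<delta><..}"
    have n: "x + \<delta> ~= 0" using x by auto
    have "(F has_real_derivative cutoff1 (\<tau> x) * (- m / (x + \<delta>)) / (2 * m)) (at x)"
      unfolding F_def[abs_def] by (rule DERIV_cdivide[OF DERIV_cutoff_compose[OF d\<tau> refl]]) (use x in auto)
    moreover have "cutoff1 (\<tau> x) * (- m / (x + \<delta>)) / (2 * m) = F' x"
    proof -
      have "a * (- m / s) / (2 * m) = - a / (2 * s)" if "s ~= 0" for a s using m that by (simp add: divide_simps)
      from this[OF n] show ?thesis by (simp only: F'_def)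
    qed
    ultimately show "(F has_real_derivative F' x) (at x)" by simp
  qed
  have 2: "\<forall>x\<in>{-\<delta><..}. (F' has_real_derivative F'' x) (at x)"
  proof
    fix x assume x: "x \<in> {-\<delta><..}"
    have n: "x + \<delta> ~= 0" using x by auto
    have "(F' has_real_derivative (- (cutoff2 (\<tau> x) * (- m / (x + \<delta>))) * (2 * (x + \<delta>)) - - cutoff1 (\<tau> x) * 2) / ((2 * (x + \<delta>)) * (2 * (x + \<delta>)))) (at x)"
      unfolding F'_def[abs_def]
    proof (rule DERIV_divide[OF DERIV_minus[OF DERIV_cutoff1_compose[OF d\<tau> refl]]])
      show "((\<lambda>x. 2 * (x + \<delta>)) has_real_derivative 2) (at x)" by (auto intro!: derivative_eq_intros)
    qed (use x n in auto)
    moreover have "(- (cutoff2 (\<tau> x) * (- m / (x + \<delta>))) * (2 * (x + \<delta>)) - - cutoff1 (\<tau> x) * 2) / ((2 * (x + \<delta>)) * (2 * (x + \<delta>))) = F'' x"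
      unfolding F''_def using n by (simp add: divide_simps power2_eq_square) (simp add: algebra_simps)
    ultimately show "(F' has_real_derivative F'' x) (at x)" by simp
  qed
  have 3: "range (\<lambda>z. (cmod z)\<^sup>2) \<subseteq> {-\<delta><..}" using \<delta> by (auto intro: less_le_trans[OF _ zero_le_power2])
  have c\<tau>: "continuous_on {-\<delta><..} \<tau>" using d\<tau> by (meson DERIV_isCont continuous_at_imp_continuous_on greaterThan_iff)
  have c1: "continuous_on UNIV cutoff1" using DERIV_cutoff1 by (meson DERIV_isCont continuous_at_imp_continuous_on)
  have 4: "continuous_on {-\<delta><..} F''"
    unfolding F''_def[abs_def]
    by (intro continuous_intros continuous_on_compose2[OF continuous_cutoff2 c\<tau>] continuous_on_compose2[OF c1 c\<tau>]) auto
  have e: "log_cutoff r m = (\<lambda>z. F ((cmod z)\<^sup>2))" by (auto simp: log_cutoff_def F_def \<tau>_def fun_eq_iff)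
  note C = C2_on_compose[OF open_UNIV S(1) 1 2 3 4]
  show "C2_on UNIV (log_cutoff r m)" unfolding e by (rule C(1))
  define x where "x = (cmod z)\<^sup>2"
  have x: "x \<ge> 0" "x + \<delta> > 0" using \<delta> by (auto simp: x_def add_nonneg_pos)
  have "(2 * Re z)\<^sup>2 + (2 * Im z)\<^sup>2 = 4 * x" by (simp add: x_def cmod_power2 algebra_simps)
  then have d: "ddc (log_cutoff r m) z = (F'' x * x + F' x) / pi"
    unfolding e using C(2)[of z] S(2,3,4)[of z] by (simp add: x_def add_divide_distrib)
  have e2: "F'' x * x + F' x = (m * cutoff2 (\<tau> x) * (x / (x + \<delta>)) / (x + \<delta>) - cutoff1 (\<tau> x) * (\<delta> / (x + \<delta>)\<^sup>2)) / 2"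
    unfolding F''_def F'_def using x(2)
    by (simp add: divide_simps power2_eq_square) (simp add: algebra_simps)
  have ab: "\<bar>(a - b) / 2\<bar> \<le> (a' + b') / 2" if "0 \<le> a" "a \<le> a'" "0 \<le> b" "b \<le> b'" for a b a' b' :: real
  proof -
    have "\<bar>a - b\<bar> \<le> a' + b'" using that by linarith
    then show ?thesis by simp
  qed
  have 1: "m * cutoff2 (\<tau> x) * (x / (x + \<delta>)) / (x + \<delta>) \<le> m * cutoff2 (\<tau> x) / (x + \<delta>)"
    using x \<delta> m cutoff_bounds(4)[of "\<tau> x"] by (intro divide_right_mono mult_left_le) auto
  have 2: "0 \<le> m * cutoff2 (\<tau> x) * (x / (x + \<delta>)) / (x + \<delta>)" using x \<delta> m cutoff_bounds(4)[of "\<tau> x"] by simp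
  have 3: "cutoff1 (\<tau> x) * (\<delta> / (x + \<delta>)\<^sup>2) \<le> \<delta> / (x + \<delta>)\<^sup>2"
    by (rule mult_left_le_one_le) (use \<delta> cutoff_bounds in auto)
  have 4: "0 \<le> cutoff1 (\<tau> x) * (\<delta> / (x + \<delta>)\<^sup>2)" using \<delta> cutoff_bounds(2)[of "\<tau> x"] by simp
  have "\<bar>F'' x * x + F' x\<bar> \<le> (m * cutoff2 (\<tau> x) / (x + \<delta>) + \<delta> / (x + \<delta>)\<^sup>2) / 2"
    unfolding e2 by (rule ab[OF 2 1 4 3])
  then have "\<bar>F'' x * x + F' x\<bar> / pi \<le> (m * cutoff2 (\<tau> x) / (x + \<delta>) + \<delta> / (x + \<delta>)\<^sup>2) / 2 / pi"
    by (intro divide_right_mono) auto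
  then show "\<bar>ddc (log_cutoff r m) z\<bar> \<le> (m * cutoff2 (m * (ln (r\<^sup>2) - ln ((cmod z)\<^sup>2 + 1 / m))) / ((cmod z)\<^sup>2 + 1 / m)
        + (1 / m) / ((cmod z)\<^sup>2 + 1 / m)\<^sup>2) / (2 * pi)"
    unfolding d by (simp add: x_def \<delta>_def \<tau>_def abs_divide)
qed

text \<open>In the limit \<open>ddc\<close> of the kernel has mass 1/2 on the circle and -1/2 at the
  origin, hence total variation 1; for finite m the computation gives at most (cutoff1 (\<tau> 0) +
  1) / 2. A bound independent of r and m is what keeps the error terms bounded.\<close>

lemma nn_integral_ddc_log_cutoff:
  assumes m: "m > 0" and r: "r > 0"
  shows "(\<integral>\<^sup>+z. ennreal \<bar>ddc (log_cutoff r m) z\<bar> \<partial>lborel) \<le> 1"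
proof -
  define \<delta> where "\<delta> = 1 / m"
  have \<delta>: "\<delta> > 0" using m by (simp add: \<delta>_def)
  define \<tau> where "\<tau> x = m * (ln (r\<^sup>2) - ln (x + \<delta>))" for x
  define w where "w x = (m * cutoff2 (\<tau> x) / (x + \<delta>) + \<delta> / (x + \<delta>)\<^sup>2) / (2 * pi)" for x
  \<comment> \<open>An antiderivative of w on the half-line. It tends to 0 at infinity, since
    \<open>cutoff1\<close> contributes nothing once x \<ge> r^2.\<close>
  define A where "A x = (- cutoff1 (\<tau> x) - \<delta> / (x + \<delta>)) / (2 * pi)" for x
  have [measurable]: "cutoff2 \<in> borel_measurable borel" by (rule borel_measurable_continuous_onI[OF continuous_cutoff2])
  have w[measurable]: "w \<in> borel_measurable borel" unfolding w_def[abs_def] \<tau>_def[abs_def] by measurable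
  have "(\<integral>\<^sup>+z. ennreal \<bar>ddc (log_cutoff r m) z\<bar> \<partial>lborel) \<le> (\<integral>\<^sup>+z. ennreal (w ((cmod z)\<^sup>2)) \<partial>lborel)"
    using C2_on_log_cutoff(2)[OF m, of r] by (intro nn_integral_mono ennreal_leI) (simp add: w_def \<tau>_def \<delta>_def)
  also have "\<dots> = ennreal pi * (\<integral>\<^sup>+x. ennreal (w x) * indicator {0..} x \<partial>lborel)"
    by (rule nn_integral_radial) measurable
  also have "(\<integral>\<^sup>+x. ennreal (w x) * indicator {0..} x \<partial>lborel) = 0 - A 0"
  proof (rule nn_integral_FTC_atLeast[OF w])
    fix x :: real assume x: "0 \<le> x"
    have n: "x + \<delta> > 0" using x \<delta> by simp
    have d\<tau>: "(\<tau> has_real_derivative - m / (x + \<delta>)) (at x)"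
      unfolding \<tau>_def[abs_def] using n by (auto intro!: derivative_eq_intros simp: field_simps)
    have "((\<lambda>x. - cutoff1 (\<tau> x) - \<delta> / (x + \<delta>)) has_real_derivative
        (- (cutoff2 (\<tau> x) * (- m / (x + \<delta>))) - (- \<delta> / (x + \<delta>)\<^sup>2))) (at x)"
      using n
      by (auto intro!: DERIV_cutoff1_compose derivative_eq_intros d\<tau> simp: power2_eq_square)
    from DERIV_cdivide[OF this, of "2 * pi"] show "(A has_real_derivative w x) (at x)"
      by (simp add: w_def A_def[abs_def] mult.commute)
    show "0 \<le> w x" using n m \<delta> cutoff_bounds(4) by (simp add: w_def)
  next
    have "\<forall>\<^sub>F x in at_top. A x = - (\<delta> / (x + \<delta>)) / (2 * pi)"
      using eventually_ge_at_top[of "r\<^sup>2"]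
    proof eventually_elim
      case (elim x)
      have "x \<ge> 0" using elim zero_le_power2[of r] by linarith
      then have "ln (r\<^sup>2) \<le> ln (x + \<delta>)" using r \<delta> elim by (subst ln_le_cancel_iff) auto
      then have "\<tau> x \<le> 0" using m by (simp add: \<tau>_def mult_nonneg_nonpos)
      then show ?case by (simp add: A_def cutoff_bounds(7))
    qed
    moreover have "((\<lambda>x. - (\<delta> / (x + \<delta>)) / (2 * pi)) \<longlongrightarrow> 0) at_top"
    proof -
      have "filterlim (\<lambda>x. x + \<delta>) at_top at_top"
        using filterlim_tendsto_add_at_top[OF tendsto_const filterlim_ident, of \<delta>] by (simp add: add.commute)
      then have "((\<lambda>x. \<delta> / (x + \<delta>)) \<longlongrightarrow> 0) at_top"
        by (intro tendsto_divide_0[OF tendsto_const] filterlim_at_top_imp_at_infinity)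
      from tendsto_divide[OF tendsto_minus[OF this] tendsto_const, of "2 * pi"] show ?thesis by simp
    qed
    ultimately show "(A \<longlongrightarrow> 0) at_top" by (simp add: tendsto_cong)
  qed
  also have "ennreal pi * ennreal (0 - A 0) = ennreal (pi * (0 - A 0))"
    by (subst ennreal_mult') (auto)
  also have "pi * (0 - A 0) = (cutoff1 (\<tau> 0) + 1) / 2" using \<delta> by (simp add: A_def field_simps)
  also have "ennreal \<dots> \<le> 1" using cutoff_bounds(3)[of "\<tau> 0"] by simp
  finally show ?thesis .
qed

declare of_nat_Suc [simp del]

text \<open>This form displays the approximation as t / 2 times a factor that increases to 1 with m;
  monotonicity and the limit are read off from it.\<close>

lemma cutoff_scaled: "t > 0 ==> m > 0 ==> cutoff (m * t) / (2 * m) = t / 2 * (m * t / (1 + m * t))\<^sup>2"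
proof -
  assume "t > 0" "m > 0"
  have "cutoff s = s * (s / (1 + s))\<^sup>2" if "s > 0" for s
    using that by (simp add: cutoff_def power_divide power2_eq_square power3_eq_cube)
  from this[of "m * t"] \<open>t > 0\<close> \<open>m > 0\<close> show ?thesis by simp
qed

lemma log_cutoff_nonneg: "m > 0 ==> 0 \<le> log_cutoff r m z"
  by (simp add: log_cutoff_def cutoff_bounds)

lemma log_cutoff_mono:
  assumes m: "0 < m" "m \<le> m'"
  shows "log_cutoff r m z \<le> log_cutoff r m' z"
proof -
  define t where "t = ln (r\<^sup>2) - ln ((cmod z)\<^sup>2 + 1 / m)"
  define t' where "t' = ln (r\<^sup>2) - ln ((cmod z)\<^sup>2 + 1 / m')"
  have "1 / m' \<le> 1 / m" using m by (simp add: frac_le)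
  moreover have "0 < (cmod z)\<^sup>2 + 1 / m'" using m by (simp add: add_nonneg_pos)
  ultimately have tt: "t \<le> t'" by (simp add: t_def t'_def)
  show ?thesis
  proof (cases "t \<le> 0")
    case True
    then have "m * t \<le> 0" using m by (simp add: mult_nonneg_nonpos)
    then have "log_cutoff r m z = 0" unfolding log_cutoff_def t_def[symmetric] by (simp add: cutoff_bounds)
    then show ?thesis using log_cutoff_nonneg[of m'] m by simp
  next
    case False
    then have t: "t > 0" "t' > 0" using tt by auto
    have "m * t \<le> m' * t'" using m tt t by (intro mult_mono) auto
    moreover have "0 < m * t" "0 < m' * t'" using m t by auto
    ultimately have "m * t / (1 + m * t) \<le> m' * t' / (1 + m' * t')"
      by (simp add: divide_simps) (simp add: algebra_simps)
    then have "(m * t / (1 + m * t))\<^sup>2 \<le> (m' * t' / (1 + m' * t'))\<^sup>2"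
      using m t by (intro power_mono) auto
    then have "t / 2 * (m * t / (1 + m * t))\<^sup>2 \<le> t' / 2 * (m' * t' / (1 + m' * t'))\<^sup>2"
      using tt t by (intro mult_mono) auto
    then show ?thesis unfolding log_cutoff_def t_def[symmetric] t'_def[symmetric]
      using cutoff_scaled[OF t(1) m(1)] cutoff_scaled[OF t(2), of m'] m by simp
  qed
qed

lemma log_cutoff_outside:
  assumes "m > 0" "r > 0" "z \<notin> cball 0 r"
  shows "log_cutoff r m z = 0"
proof -
  have "r\<^sup>2 \<le> (cmod z)\<^sup>2" using assms by (intro power_mono) auto
  moreover have "0 < 1 / m" "0 < r\<^sup>2" using assms by auto
  ultimately have "ln (r\<^sup>2) \<le> ln ((cmod z)\<^sup>2 + 1 / m)"
    by (subst ln_le_cancel_iff) linarith+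
  then have "m * (ln (r\<^sup>2) - ln ((cmod z)\<^sup>2 + 1 / m)) \<le> 0" using assms by (intro mult_nonneg_nonpos) auto
  then show ?thesis by (simp add: log_cutoff_def cutoff_bounds)
qed

text \<open>The weight with which a point z enters \<open>nevanlinna_N\<close> once the two
  integrations are exchanged.\<close>

definition log_kernel :: "real => complex => ennreal" where
  "log_kernel r z = (\<integral>\<^sup>+t\<in>{0<..r}. indicator (ball 0 t) z / ennreal t \<partial>lborel)"

lemma log_kernel_eq:
  assumes r: "r > 0" and z: "z ~= 0"
  shows "log_kernel r z = ennreal (max 0 (ln (r / cmod z)))"
proof (cases "cmod z < r")
  case False
  have z0: "indicator (ball 0 t) z / ennreal t * indicator {0<..r} t = (0::ennreal)" for t
    using False by (auto simp: indicator_def)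
  have "log_kernel r z = nn_integral lborel (\<lambda>t::real. 0)" unfolding log_kernel_def by (intro nn_integral_cong z0)
  then have "log_kernel r z = 0" by simp
  moreover have "ln (r / cmod z) \<le> 0" using False r z by (subst ln_le_zero_iff) auto
  ultimately show ?thesis by (simp add: max_def)
next
  case True
  define a where "a = cmod z"
  have a: "a > 0" "a < r" using z True by (auto simp: a_def)
  \<comment> \<open>The open ball excludes t = |z|, a single point, so almost everywhere the closed
    interval may be used instead.\<close>
  have "AE t in lborel. indicator (ball 0 t) z / ennreal t * indicator {0<..r} t = ennreal (1 / t) * indicator {a..r} t"
    using AE_lborel_singleton[of a]
  proof eventually_elim
    case (elim t)
    show ?case
    proof (cases "a < t \<and> t \<le> r")
      case True
      then have "1 / ennreal t = ennreal (1 / t)" using a divide_ennreal[of 1 t] by simp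
      then show ?thesis using True a by (simp add: a_def[symmetric])
    next
      case False
      then show ?thesis using elim a by (auto simp: a_def[symmetric] indicator_def)
    qed
  qed
  then have "log_kernel r z = (\<integral>\<^sup>+t. ennreal (1 / t) * indicator {a..r} t \<partial>lborel)"
    unfolding log_kernel_def by (rule nn_integral_cong_AE)
  also have "\<dots> = ln r - ln a"
    by (rule nn_integral_FTC_Icc) (use a in \<open>auto intro!: derivative_eq_intros simp: divide_inverse\<close>)
  finally show ?thesis using a r by (simp add: a_def[symmetric] ln_div max_def)
qed

text \<open>The value at 0 dominates all other values, and at distance r exp (- n) from 0 the kernel
  equals n.\<close>

lemma log_kernel_zero:
  assumes r: "r > 0"
  shows "log_kernel r 0 = \<infinity>"
proof (rule ccontr)
  assume "log_kernel r 0 ~= \<infinity>"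
  then have "log_kernel r 0 < top" by (simp add: top.not_eq_extremum)
  then obtain n :: nat where n: "log_kernel r 0 < of_nat n" using ennreal_Ex_less_of_nat by blast
  define z where "z = complex_of_real (r * exp (- real n))"
  have cz: "cmod z = r * exp (- real n)" using r by (simp add: z_def norm_mult)
  then have z: "z ~= 0" using r by auto
  have "log_kernel r z \<le> log_kernel r 0"
    unfolding log_kernel_def
    by (intro nn_integral_mono mult_right_mono divide_right_mono_ennreal)
      (auto simp: indicator_def intro: le_less_trans[OF norm_ge_zero])
  moreover have "log_kernel r z = ennreal (real n)"
    using r by (simp add: log_kernel_eq[OF r z] cz exp_minus field_simps)
  ultimately show False using n by (simp add: ennreal_of_nat_eq_real_of_nat)
qed

text \<open>The approximations increase with m, so it suffices to compute their limit: infinite at z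
  = 0, and half the positive part of ln (r^2) - ln (|z|^2) elsewhere.\<close>

lemma log_kernel_SUP:
  assumes r: "r > 0"
  shows "log_kernel r z = (SUP m. ennreal (log_cutoff r (real (Suc m)) z))"
proof -
  define L where "L m = log_cutoff r (real (Suc m)) z" for m
  define t where "t m = ln (r\<^sup>2) - ln ((cmod z)\<^sup>2 + 1 / real (Suc m))" for m
  have inc: "incseq (\<lambda>m. ennreal (L m))"
    by (intro incseq_SucI ennreal_leI) (auto simp: L_def intro: log_cutoff_mono)
  have L: "L m = t m / 2 * (real (Suc m) * t m / (1 + real (Suc m) * t m))\<^sup>2" if "t m > 0" for m
    using cutoff_scaled[OF that, of "real (Suc m)"] by (simp add: L_def log_cutoff_def t_def)
  have inv: "(\<lambda>m. 1 / real (Suc m)) \<longlonglongrightarrow> 0" using LIMSEQ_inverse_real_of_nat by (simp add: inverse_eq_divide)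
  have "(\<lambda>m. ennreal (L m)) \<longlonglongrightarrow> log_kernel r z"
  proof (cases "z = 0")
    case True
    have tm: "t m = ln (r\<^sup>2) + ln (real (Suc m))" for m unfolding t_def True by (simp add: ln_div)
    have top: "filterlim t at_top sequentially" unfolding tm[abs_def]
      by (intro filterlim_tendsto_add_at_top[OF tendsto_const] filterlim_compose[OF ln_at_top]
          filterlim_compose[OF filterlim_real_sequentially filterlim_Suc])
    have "filterlim L at_top sequentially"
    proof (rule filterlim_at_top_mono)
      \<comment> \<open>1/8 is 1/2 times (1/2)^2: for t m \<ge> 1 the fraction in
        \<open>cutoff_scaled\<close> is at least 1/2.\<close>
      show "filterlim (\<lambda>m. (1 / 8) * t m) at_top sequentially"
        by (rule filterlim_tendsto_pos_mult_at_top[OF tendsto_const _ top]) simp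
      have "\<forall>\<^sub>F m in sequentially. 1 \<le> t m" using top by (simp add: filterlim_at_top)
      then show "\<forall>\<^sub>F m in sequentially. (1 / 8) * t m \<le> L m"
      proof eventually_elim
        case (elim m)
        define s where "s = real (Suc m) * t m"
        have "1 * 1 \<le> s" unfolding s_def using elim by (intro mult_mono) auto
        then have "1 / 2 \<le> s / (1 + s)" by (simp add: field_simps)
        then have "(1 / 2)\<^sup>2 \<le> (s / (1 + s))\<^sup>2" by (intro power_mono) auto
        then have "t m / 2 * (1 / 2)\<^sup>2 \<le> t m / 2 * (s / (1 + s))\<^sup>2" using elim by (intro mult_left_mono) auto
        then show ?case using L[of m] elim by (simp add: s_def power2_eq_square)
      qed
    qed
    then show ?thesis by (simp add: True log_kernel_zero[OF r] ennreal_tendsto_top_eq_at_top)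
  next
    case False
    define T where "T = ln (r\<^sup>2) - ln ((cmod z)\<^sup>2)"
    have T2: "ln (r / cmod z) = T / 2" using r False by (simp add: T_def ln_div ln_realpow)
    have tT: "t \<longlonglongrightarrow> T" unfolding t_def[abs_def] T_def
        using tendsto_diff[OF tendsto_const tendsto_ln[OF tendsto_add[OF tendsto_const inv]], of "(cmod z)\<^sup>2" "ln (r\<^sup>2)"]
        False by simp
    have "L \<longlonglongrightarrow> max 0 (T / 2)"
    proof (cases "T \<le> 0")
      case True
      have "L m = 0" for m
      proof -
        have "ln ((cmod z)\<^sup>2) \<le> ln ((cmod z)\<^sup>2 + 1 / real (Suc m))" using False
          by (subst ln_le_cancel_iff) (auto intro: add_pos_nonneg)
        then have "t m \<le> 0" using True by (simp add: t_def T_def)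
        then show ?thesis by (simp add: L_def log_cutoff_def t_def cutoff_bounds mult_nonneg_nonpos)
      qed
      then have "L = (\<lambda>_. 0)" by auto
      then show ?thesis using True by (simp add: max_def)
    next
      case F: False
      then have ev: "\<forall>\<^sub>F m in sequentially. t m > 0" using order_tendstoD(1)[OF tT, of 0] by simp
      have rs: "filterlim (\<lambda>m. real (Suc m)) at_top sequentially"
        by (rule filterlim_compose[OF filterlim_real_sequentially filterlim_Suc])
      have "filterlim (\<lambda>m. t m * real (Suc m)) at_top sequentially"
        by (rule filterlim_tendsto_pos_mult_at_top[OF tT _ rs]) (use F in simp)
      then have "(\<lambda>m. 1 / (t m * real (Suc m))) \<longlonglongrightarrow> 0"
        by (intro tendsto_divide_0[OF tendsto_const] filterlim_at_top_imp_at_infinity)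
      then have "(\<lambda>m. t m / 2 * (1 / (1 / (t m * real (Suc m)) + 1))\<^sup>2) \<longlonglongrightarrow> T / 2 * (1 / (0 + 1))\<^sup>2"
        by (intro tendsto_intros tT) auto
      moreover have "\<forall>\<^sub>F m in sequentially. t m / 2 * (1 / (1 / (t m * real (Suc m)) + 1))\<^sup>2 = L m"
        using ev
      proof eventually_elim
        case (elim m)
        define s where "s = t m * real (Suc m)"
        have "s > 0" using elim by (simp add: s_def)
        then have "1 / (1 / s + 1) = s / (1 + s)" by (simp add: field_simps)
        then show ?case using L[OF elim] by (simp add: s_def mult.commute)
      qed
      ultimately have "L \<longlonglongrightarrow> T / 2 * (1 / (0 + 1))\<^sup>2" by (rule Lim_transform_eventually)
      then show ?thesis using F by (simp add: max_def)
    qed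
    then show ?thesis unfolding log_kernel_eq[OF r False] T2 by (rule tendsto_ennrealI)
  qed
  then show ?thesis using LIMSEQ_unique LIMSEQ_SUP[OF inc] unfolding L_def by blast
qed

section \<open>Counting functions as integrals against the logarithmic kernel\<close>

lemma tonelli_log_kernel:
  fixes g :: "complex => ennreal"
  assumes M: "sets M = sets borel" "sigma_finite_measure M" and g[measurable]: "g \<in> borel_measurable borel"
  shows "(\<integral>\<^sup>+t\<in>{0<..r}. (\<integral>\<^sup>+z. g z * indicator (ball 0 t) z \<partial>M) / ennreal t \<partial>lborel) = (\<integral>\<^sup>+z. g z * log_kernel r z \<partial>M)"
proof -
  note [measurable_cong] = M(1)
  interpret sigma_finite_measure M by fact
  interpret P: pair_sigma_finite M lborel by standard
  \<comment> \<open>Describing the balls of all radii by one set of pairs makes the joint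
    measurability evident.\<close>
  define k where "k z t = g z * (indicator {p. cmod (fst p) < snd p} (z, t) / ennreal t * indicator {0<..r} t)" for z t
  have k[measurable]: "case_prod k \<in> borel_measurable (M \<Otimes>\<^sub>M lborel)"
    unfolding k_def[abs_def] by measurable
  have ind: "indicator {p. cmod (fst p) < snd p} (z, t) = (indicator (ball 0 t) z :: ennreal)" for z :: complex and t
    by (auto simp: indicator_def)
  have "(\<integral>\<^sup>+t\<in>{0<..r}. (\<integral>\<^sup>+z. g z * indicator (ball 0 t) z \<partial>M) / ennreal t \<partial>lborel) = (\<integral>\<^sup>+t. (\<integral>\<^sup>+z. k z t \<partial>M) \<partial>lborel)"
  proof (intro nn_integral_cong)
    fix t
    have [measurable]: "ball (0::complex) t \<in> sets borel" by simp
    have "(\<integral>\<^sup>+z. k z t \<partial>M) = (\<integral>\<^sup>+z. g z * indicator (ball 0 t) z * (indicator {0<..r} t / ennreal t) \<partial>M)"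
      by (intro nn_integral_cong) (simp add: k_def ind ennreal_times_divide mult_ac divide_ennreal_def)
    also have "\<dots> = (\<integral>\<^sup>+z. g z * indicator (ball 0 t) z \<partial>M) * (indicator {0<..r} t / ennreal t)"
      by (rule nn_integral_multc) measurable
    finally show "(\<integral>\<^sup>+z. g z * indicator (ball 0 t) z \<partial>M) / ennreal t * indicator {0<..r} t = (\<integral>\<^sup>+z. k z t \<partial>M)"
      by (simp add: divide_ennreal_def mult_ac)
  qed
  also have "\<dots> = (\<integral>\<^sup>+z. (\<integral>\<^sup>+t. k z t \<partial>lborel) \<partial>M)" by (rule P.Fubini'[OF k])
  also have "\<dots> = (\<integral>\<^sup>+z. g z * log_kernel r z \<partial>M)"
  proof (intro nn_integral_cong)
    fix z
    have "(\<integral>\<^sup>+t. k z t \<partial>lborel) = g z * (\<integral>\<^sup>+t. indicator {p. cmod (fst p) < snd p} (z, t) / ennreal t * indicator {0<..r} t \<partial>lborel)"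
      unfolding k_def by (rule nn_integral_cmult) measurable
    then show "(\<integral>\<^sup>+t. k z t \<partial>lborel) = g z * log_kernel r z" by (simp add: ind log_kernel_def)
  qed
  finally show ?thesis .
qed

lemma nevanlinna_N_eq:
  assumes M: "sets M = sets borel" and fin: "\<And>r. emeasure M (ball 0 r) < \<infinity>"
  shows "nevanlinna_N M r = (\<integral>\<^sup>+z. log_kernel r z \<partial>M)"
proof -
  have "sigma_finite_measure M"
  proof
    have "(\<Union>n::nat. ball (0::complex) (real n)) = UNIV" using reals_Archimedean2 by auto
    moreover have "space M = UNIV" using sets_eq_imp_space_eq[OF M] by simp
    ultimately show "\<exists>A. countable A \<and> A \<subseteq> sets M \<and> \<Union>A = space M \<and> (\<forall>a\<in>A. emeasure M a ~= \<infinity>)"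
      using fin M by (intro exI[of _ "range (\<lambda>n::nat. ball 0 (real n))"]) (auto simp: less_top[symmetric])
  qed
  from tonelli_log_kernel[OF M this, of "\<lambda>_. 1" r] show ?thesis
    unfolding nevanlinna_N_def using M by simp
qed

text \<open>\<open>E\<close> is not assumed measurable. Then \<open>density\<close> evaluates either
  to the integral over the set or to 0, so an upper bound by a measurable majorant survives.\<close>

lemma nevanlinna_N_density_le:
  assumes g[measurable]: "g \<in> borel_measurable borel" and le: "AE z in lborel. E z \<le> g z"
  shows "nevanlinna_N (density lborel E) r \<le> (\<integral>\<^sup>+z. g z * log_kernel r z \<partial>lborel)"
proof -
  have "emeasure (density lborel E) A \<le> (\<integral>\<^sup>+z. g z * indicator A z \<partial>lborel)" for A
  proof -
    have "emeasure (density lborel E) A \<le> (\<integral>\<^sup>+z. E z * indicator A z \<partial>lborel)"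
      unfolding density_def by (subst emeasure_measure_of_conv) auto
    also have "\<dots> \<le> (\<integral>\<^sup>+z. g z * indicator A z \<partial>lborel)"
    proof (rule nn_integral_mono_AE)
      show "AE z in lborel. E z * indicator A z \<le> g z * indicator A z"
        using le by eventually_elim (auto intro: mult_right_mono)
    qed
    finally show ?thesis .
  qed
  then have "nevanlinna_N (density lborel E) r \<le> (\<integral>\<^sup>+t\<in>{0<..r}. (\<integral>\<^sup>+z. g z * indicator (ball 0 t) z \<partial>lborel) / ennreal t \<partial>lborel)"
    unfolding nevanlinna_N_def by (intro nn_integral_mono mult_right_mono divide_right_mono_ennreal) auto
  also have "\<dots> = (\<integral>\<^sup>+z. g z * log_kernel r z \<partial>lborel)"
    by (rule tonelli_log_kernel) (auto intro: lborel.sigma_finite_measure_axioms)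
  finally show ?thesis .
qed

lemma log_cutoff_measurable [measurable]: "log_cutoff r (real (Suc m)) \<in> borel_measurable borel"
  using C2_on_log_cutoff(1)[of "real (Suc m)" r]
  by (intro borel_measurable_continuous_onI) (auto simp: C2_on_def intro: C1_on_continuous)

lemma nn_integral_log_kernel_SUP:
  assumes r: "r > 0" and [measurable]: "g \<in> borel_measurable borel" and M: "sets M = sets borel"
  shows "(\<integral>\<^sup>+z. g z * log_kernel r z \<partial>M) = (SUP m. \<integral>\<^sup>+z. g z * ennreal (log_cutoff r (real (Suc m)) z) \<partial>M)"
proof -
  note [measurable_cong] = M
  have "(\<integral>\<^sup>+z. g z * log_kernel r z \<partial>M) = (\<integral>\<^sup>+z. (SUP m. g z * ennreal (log_cutoff r (real (Suc m)) z)) \<partial>M)"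
    by (simp add: log_kernel_SUP[OF r] SUP_mult_left_ennreal)
  also have "\<dots> = (SUP m. \<integral>\<^sup>+z. g z * ennreal (log_cutoff r (real (Suc m)) z) \<partial>M)"
    by (rule nn_integral_monotone_convergence_SUP)
      (auto intro!: incseq_SucI le_funI mult_left_mono ennreal_leI log_cutoff_mono)
  finally show ?thesis .
qed

text \<open>By the mass bound, a bounded function pairs with \<open>ddc (log_cutoff r m)\<close> to
  a quantity bounded uniformly in r and m. This is Jensen's formula with its boundary terms
  estimated.\<close>

lemma integral_ddc_log_cutoff_bound:
  assumes w: "continuous_on UNIV w" "\<And>z. \<bar>w z\<bar> \<le> C" and r: "r > 0" and m: "m > 0"
  shows "\<bar>\<integral>z. w z * ddc (log_cutoff r m) z \<partial>lborel\<bar> \<le> C"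
    "integrable lborel (\<lambda>z. w z * ddc (log_cutoff r m) z)"
proof -
  have C: "C \<ge> 0" using w(2)[of 0] by simp
  have c: "continuous_on UNIV (ddc (log_cutoff r m))" by (intro C2_on_ddc_continuous C2_on_log_cutoff m)
  have z: "ddc (log_cutoff r m) z = 0" if "z \<notin> cball 0 r" for z
    using C2_on_cong(2)[of "- cball 0 r" "\<lambda>_. 0" "log_cutoff r m" z] log_cutoff_outside[OF m r] that
    by (auto simp: C2_on_const ddc_def part_re_def part_im_def)
  have i: "integrable lborel (ddc (log_cutoff r m))"
    by (rule integrable_continuous_compact[of "cball 0 r", OF continuous_on_subset[OF c]]) (auto intro: z)
  show j: "integrable lborel (\<lambda>z. w z * ddc (log_cutoff r m) z)"
    by (rule integrable_continuous_compact[of "cball 0 r"])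
      (auto intro!: continuous_intros continuous_on_subset[OF c] continuous_on_subset[OF w(1)] simp: z)
  have "\<bar>\<integral>z. w z * ddc (log_cutoff r m) z \<partial>lborel\<bar> \<le> (\<integral>z. \<bar>w z * ddc (log_cutoff r m) z\<bar> \<partial>lborel)"
    using integral_norm_bound[of lborel "\<lambda>z. w z * ddc (log_cutoff r m) z"] by simp
  also have "\<dots> \<le> (\<integral>z. C * \<bar>ddc (log_cutoff r m) z\<bar> \<partial>lborel)"
    using i integrable_abs[OF j] w(2) by (intro integral_mono) (auto simp: abs_mult intro: mult_right_mono)
  also have "\<dots> = C * (\<integral>z. \<bar>ddc (log_cutoff r m) z\<bar> \<partial>lborel)" by simp
  also have "(\<integral>z. \<bar>ddc (log_cutoff r m) z\<bar> \<partial>lborel) \<le> 1"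
    using i nn_integral_ddc_log_cutoff[OF m r]
    by (subst integral_eq_nn_integral) (auto simp: enn2real_leI)
  then have "C * (\<integral>z. \<bar>ddc (log_cutoff r m) z\<bar> \<partial>lborel) \<le> C * 1" using C by (rule mult_left_mono)
  finally show "\<bar>\<integral>z. w z * ddc (log_cutoff r m) z \<partial>lborel\<bar> \<le> C" by simp
qed

lemma integral_log_cutoff:
  assumes M: "sets M = sets borel" and fin: "\<And>r. emeasure M (ball 0 r) < \<infinity>" and r: "r > 0"
    and N: "nevanlinna_N M r < \<infinity>"
  shows "(\<integral>z. log_cutoff r (real (Suc m)) z \<partial>M) \<le> enn2real (nevanlinna_N M r)"
    "(\<lambda>m. \<integral>z. log_cutoff r (real (Suc m)) z \<partial>M) \<longlonglongrightarrow> enn2real (nevanlinna_N M r)"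
proof -
  note [measurable_cong] = M
  have e: "nevanlinna_N M r = (SUP m. \<integral>\<^sup>+z. ennreal (log_cutoff r (real (Suc m)) z) \<partial>M)"
    using nevanlinna_N_eq[OF M fin, of r] nn_integral_log_kernel_SUP[OF r _ M, of "\<lambda>_. 1"] by simp
  have i: "(\<integral>z. log_cutoff r (real (Suc m)) z \<partial>M) = enn2real (\<integral>\<^sup>+z. ennreal (log_cutoff r (real (Suc m)) z) \<partial>M)" for m
    by (rule integral_eq_nn_integral) (auto simp: log_cutoff_nonneg)
  have "(\<integral>\<^sup>+z. ennreal (log_cutoff r (real (Suc m)) z) \<partial>M) \<le> nevanlinna_N M r" for m
    unfolding e by (rule SUP_upper) simp
  then show "(\<integral>z. log_cutoff r (real (Suc m)) z \<partial>M) \<le> enn2real (nevanlinna_N M r)"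
    unfolding i using N by (intro enn2real_mono) auto
  have "incseq (\<lambda>m. \<integral>\<^sup>+z. ennreal (log_cutoff r (real (Suc m)) z) \<partial>M)"
    by (intro incseq_SucI nn_integral_mono ennreal_leI log_cutoff_mono) auto
  from LIMSEQ_SUP[OF this] have "(\<lambda>m. \<integral>\<^sup>+z. ennreal (log_cutoff r (real (Suc m)) z) \<partial>M) \<longlonglongrightarrow> nevanlinna_N M r"
    unfolding e .
  then show "(\<lambda>m. \<integral>z. log_cutoff r (real (Suc m)) z \<partial>M) \<longlonglongrightarrow> enn2real (nevanlinna_N M r)"
    unfolding i using N by (intro tendsto_enn2real) auto
qed

text \<open>By hypothesis \<mu> - \<nu> and \<Theta> differ by the current dd^c w, where w will be
  the difference of two weights; pairing it with the logarithmic cut-off costs at most C.\<close>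

lemma current_characteristic_bound:
  assumes \<mu>: "sets \<mu> = sets borel" "\<And>r. emeasure \<mu> (ball 0 r) < \<infinity>" "nevanlinna_N \<mu> r < \<infinity>"
    and \<nu>: "sets \<nu> = sets borel" "\<And>r. emeasure \<nu> (ball 0 r) < \<infinity>" "nevanlinna_N \<nu> r < \<infinity>"
    and w: "continuous_on UNIV w" "\<And>z. \<bar>w z\<bar> \<le> C"
    and \<Theta>: "continuous_on UNIV \<Theta>" "\<And>z. 0 \<le> \<Theta> z"
    and cur: "\<And>\<eta> K. C2_on UNIV \<eta> ==> compact K ==> (\<And>z. z \<notin> K ==> \<eta> z = 0) ==>
      (\<integral>z. \<eta> z \<partial>\<mu>) - (\<integral>z. \<eta> z \<partial>\<nu>) - (\<integral>z. \<eta> z * \<Theta> z \<partial>lborel) = (\<integral>z. w z * ddc \<eta> z \<partial>lborel)"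
    and r: "r > 0"
  shows "(\<integral>z. log_cutoff r (real (Suc m)) z * \<Theta> z \<partial>lborel) \<le> enn2real (nevanlinna_N \<mu> r) - enn2real (nevanlinna_N \<nu> r) + C"
proof -
  define I where "I m = (\<integral>z. log_cutoff r (real (Suc m)) z * \<Theta> z \<partial>lborel)" for m
  have int: "integrable lborel (\<lambda>z. log_cutoff r (real (Suc m)) z * \<Theta> z)" for m
  proof (rule integrable_continuous_compact[of "cball 0 r"])
    have "continuous_on UNIV (log_cutoff r (real (Suc m)))"
      using C2_on_log_cutoff(1)[of "real (Suc m)" r] by (auto simp: C2_on_def intro: C1_on_continuous)
    then show "continuous_on (cball 0 r) (\<lambda>z. log_cutoff r (real (Suc m)) z * \<Theta> z)"
      using \<Theta>(1) by (intro continuous_intros) (auto intro: continuous_on_subset)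
  qed (use log_cutoff_outside[of "real (Suc m)" r] r in auto)
  have "I m \<le> I m'" if "m \<le> m'" for m m'
    unfolding I_def by (intro integral_mono int mult_right_mono log_cutoff_mono \<Theta>) (use that in auto)
  moreover have "I m' \<le> enn2real (nevanlinna_N \<mu> r) - (\<integral>z. log_cutoff r (real (Suc m')) z \<partial>\<nu>) + C" for m'
  proof -
    have "(\<integral>z. log_cutoff r (real (Suc m')) z \<partial>\<mu>) - (\<integral>z. log_cutoff r (real (Suc m')) z \<partial>\<nu>) - I m' =
      (\<integral>z. w z * ddc (log_cutoff r (real (Suc m'))) z \<partial>lborel)"
      unfolding I_def by (rule cur[OF C2_on_log_cutoff(1), of _ "cball 0 r"]) (use log_cutoff_outside[of "real (Suc m')" r] r in auto)
    moreover have "\<bar>\<integral>z. w z * ddc (log_cutoff r (real (Suc m'))) z \<partial>lborel\<bar> \<le> C"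
      by (rule integral_ddc_log_cutoff_bound[OF w r]) simp
    ultimately show ?thesis using integral_log_cutoff(1)[OF \<mu>(1,2) r \<mu>(3), of m'] by linarith
  qed
  \<comment> \<open>\<nu> enters with a minus sign, so its truncated integrals cannot be bounded
    termwise. The left side increases with m; hence m is kept fixed there while m' tends to infinity
    on the right.\<close>
  ultimately have ev: "\<forall>\<^sub>F m' in sequentially. I m \<le> enn2real (nevanlinna_N \<mu> r) - (\<integral>z. log_cutoff r (real (Suc m')) z \<partial>\<nu>) + C"
    by (intro eventually_sequentiallyI[of m]) (meson order_trans)
  have "(\<lambda>m'. enn2real (nevanlinna_N \<mu> r) - (\<integral>z. log_cutoff r (real (Suc m')) z \<partial>\<nu>) + C) \<longlonglongrightarrow>
    enn2real (nevanlinna_N \<mu> r) - enn2real (nevanlinna_N \<nu> r) + C"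
    by (intro tendsto_intros integral_log_cutoff(2)[OF \<nu>(1,2) r \<nu>(3)])
  from tendsto_lowerbound[OF this ev] show ?thesis unfolding I_def by simp
qed

lemma nn_integral_cutoff_le:
  assumes h: "continuous_on UNIV h" "\<And>z. 0 \<le> h z" and r: "r > 0"
    and b: "(\<integral>z. log_cutoff r (real (Suc m)) z * h z \<partial>lborel) \<le> b"
  shows "(\<integral>\<^sup>+z. ennreal (h z) * ennreal (log_cutoff r (real (Suc m)) z) \<partial>lborel) \<le> ennreal b"
    "integrable lborel (\<lambda>z. log_cutoff r (real (Suc m)) z * h z)"
proof -
  show int: "integrable lborel (\<lambda>z. log_cutoff r (real (Suc m)) z * h z)"
  proof (rule integrable_continuous_compact[of "cball 0 r"])
    have "continuous_on UNIV (log_cutoff r (real (Suc m)))"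
      using C2_on_log_cutoff(1)[of "real (Suc m)" r] by (auto simp: C2_on_def intro: C1_on_continuous)
    then show "continuous_on (cball 0 r) (\<lambda>z. log_cutoff r (real (Suc m)) z * h z)"
      using h(1) by (intro continuous_intros) (auto intro: continuous_on_subset)
  qed (use log_cutoff_outside[of "real (Suc m)" r] r in auto)
  have "(\<integral>\<^sup>+z. ennreal (h z) * ennreal (log_cutoff r (real (Suc m)) z) \<partial>lborel) =
     (\<integral>\<^sup>+z. ennreal (log_cutoff r (real (Suc m)) z * h z) \<partial>lborel)"
    by (simp add: ennreal_mult[symmetric] h(2) log_cutoff_nonneg mult.commute)
  also have "\<dots> = ennreal (\<integral>z. log_cutoff r (real (Suc m)) z * h z \<partial>lborel)"
    using int h(2) by (intro nn_integral_eq_integral) (auto simp: log_cutoff_nonneg)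
  also have "\<dots> \<le> ennreal b" using b by (rule ennreal_leI)
  finally show "(\<integral>\<^sup>+z. ennreal (h z) * ennreal (log_cutoff r (real (Suc m)) z) \<partial>lborel) \<le> ennreal b" .
qed

text \<open>\<open>(\<rho> + \<kappa>) powr \<epsilon>\<close> is a smooth bounded function whose \<open>dd\<^sup>c\<close> controls
  the singular density \<open>\<rho> powr (\<epsilon> - 1) * Q\<close> as \<open>\<kappa>\<close> tends to \<open>0\<close>.\<close>

lemma nevanlinna_N_singular_density:
  assumes e: "0 < \<epsilon>" "\<epsilon> < 1"
    and c: "continuous_on UNIV \<rho>" "continuous_on UNIV Q" "continuous_on UNIV \<Theta>"
    and nn: "\<And>z. 0 \<le> \<rho> z" "\<And>z. 0 \<le> Q z" "\<And>z. 0 \<le> \<Theta> z" and \<rho>: "\<And>z. \<rho> z \<le> C0" "AE z in lborel. 0 < \<rho> z"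
    and sm: "\<And>\<kappa>. 0 < \<kappa> ==> C2_on UNIV (\<lambda>z. (\<rho> z + \<kappa>) powr \<epsilon>)"
    and key: "\<And>\<kappa> z. 0 < \<kappa> ==> \<epsilon>\<^sup>2 * ((\<rho> z + \<kappa>) powr (\<epsilon> - 1) * Q z) \<le>
      pi * ddc (\<lambda>z. (\<rho> z + \<kappa>) powr \<epsilon>) z + \<epsilon> * pi * ((\<rho> z + \<kappa>) powr \<epsilon> * \<Theta> z)"
    and A: "\<And>m. (\<integral>z. log_cutoff r (real (Suc m)) z * \<Theta> z \<partial>lborel) \<le> A" and r: "r > 0"
    and E: "AE z in lborel. E z \<le> ennreal (C * (\<rho> z powr (\<epsilon> - 1) * Q z + \<rho> z powr \<epsilon> * \<Theta> z))" and C: "C \<ge> 0"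
  shows "nevanlinna_N (density lborel E) r < \<infinity>"
    "\<epsilon> * enn2real (nevanlinna_N (density lborel E) r) \<le> C * (C0 + 1) * (1 + pi) * A + C * (C0 + 1) * pi / \<epsilon>"
proof -
  define c1 where "c1 = C0 + 1"
  have C0: "C0 \<ge> 0" using nn(1)[of 0] \<rho>(1)[of 0] by simp
  have c1: "c1 \<ge> 1" using C0 by (simp add: c1_def)
  have A0: "A \<ge> 0"
  proof -
    have "0 \<le> (\<integral>z. log_cutoff r (real (Suc 0)) z * \<Theta> z \<partial>lborel)"
      by (intro Bochner_Integration.integral_nonneg mult_nonneg_nonneg log_cutoff_nonneg nn) simp
    then show ?thesis using A[of 0] by linarith
  qed
  have [measurable]: "\<rho> \<in> borel_measurable borel" "Q \<in> borel_measurable borel" "\<Theta> \<in> borel_measurable borel"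
    by (auto intro: borel_measurable_continuous_onI c)
  \<comment> \<open>Since c1 \<ge> 1, raising to the power \<epsilon> < 1 stays below c1, which
    keeps the bound independent of \<epsilon>.\<close>
  have pw: "(\<rho> z + \<kappa>) powr \<epsilon> \<le> c1" if "0 \<le> \<kappa>" "\<kappa> \<le> 1" for z \<kappa>
  proof -
    have "(\<rho> z + \<kappa>) powr \<epsilon> \<le> c1 powr \<epsilon>"
      using nn(1)[of z] \<rho>(1)[of z] that e by (intro powr_mono2) (auto simp: c1_def)
    also have "\<dots> \<le> c1 powr 1" using c1 e by (intro powr_mono) auto
    finally show ?thesis using c1 by simp
  qed
  \<comment> \<open>The outcome of integrating \<open>key\<close> against the cut-off: the
    \<open>ddc\<close> term contributes at most pi c1 and the \<Theta> term at most \<epsilon> pi c1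
    A; both are divided by the \<epsilon>^2 of the left side.\<close>
  define b where "b = (pi * c1 + \<epsilon> * pi * c1 * A) / \<epsilon>\<^sup>2"
  have b0: "b \<ge> 0" using c1 A0 e by (simp add: b_def)
  define \<kappa> where "\<kappa> k = 1 / real (Suc k)" for k
  have \<kappa>: "0 < \<kappa> k" "\<kappa> k \<le> 1" for k by (auto simp: \<kappa>_def)
  have Qb: "(\<integral>\<^sup>+z. ennreal ((\<rho> z + \<kappa> k) powr (\<epsilon> - 1) * Q z) * ennreal (log_cutoff r (real (Suc m)) z) \<partial>lborel) \<le> ennreal b" for k m
  proof -
    define u where "u z = (\<rho> z + \<kappa> k) powr \<epsilon>" for z
    define L where "L = log_cutoff r (real (Suc m))"
    have pos: "\<rho> z + \<kappa> k > 0" for z using nn(1)[of z] \<kappa>(1)[of k] by linarith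
    have cu: "continuous_on UNIV u" unfolding u_def[abs_def] using pos
      by (intro continuous_intros c) (metis less_irrefl)+
    have cq: "continuous_on UNIV (\<lambda>z. (\<rho> z + \<kappa> k) powr (\<epsilon> - 1) * Q z)"
      using pos by (intro continuous_intros c) (metis less_irrefl)+
    have cut: "continuous_on UNIV (\<lambda>z. u z * \<Theta> z)" by (intro continuous_intros cu c)
    have un: "0 \<le> u z" "u z \<le> c1" for z using pw[of "\<kappa> k" z] \<kappa>[of k] by (auto simp: u_def)
    have C2u: "C2_on UNIV u" unfolding u_def[abs_def] by (rule sm[OF \<kappa>(1)])
    have L2: "C2_on UNIV L" unfolding L_def by (rule C2_on_log_cutoff(1)) simp
    have L0: "L z \<ge> 0" for z unfolding L_def by (rule log_cutoff_nonneg) simp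
    have Lz: "L z = 0" if "z \<notin> cball 0 r" for z unfolding L_def by (rule log_cutoff_outside[OF _ r that]) simp
    note bp = integral_ddc_by_parts[OF open_UNIV C2u L2 compact_cball[of 0 r] subset_UNIV Lz]
    have i1: "integrable lborel (\<lambda>z. L z * ((\<rho> z + \<kappa> k) powr (\<epsilon> - 1) * Q z))" unfolding L_def
      by (rule nn_integral_cutoff_le(2)[OF cq _ r order_refl]) (simp add: nn)
    have i2: "integrable lborel (\<lambda>z. L z * (u z * \<Theta> z))" unfolding L_def
      by (rule nn_integral_cutoff_le(2)[OF cut _ r order_refl]) (simp add: nn un)
    have i3: "integrable lborel (\<lambda>z. L z * \<Theta> z)" unfolding L_def
      by (rule nn_integral_cutoff_le(2)[OF c(3) _ r order_refl]) (simp add: nn)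
    have "\<epsilon>\<^sup>2 * (\<integral>z. L z * ((\<rho> z + \<kappa> k) powr (\<epsilon> - 1) * Q z) \<partial>lborel) =
        (\<integral>z. \<epsilon>\<^sup>2 * (L z * ((\<rho> z + \<kappa> k) powr (\<epsilon> - 1) * Q z)) \<partial>lborel)" by simp
    also have "\<dots> \<le> (\<integral>z. pi * (L z * ddc u z) + \<epsilon> * pi * (L z * (u z * \<Theta> z)) \<partial>lborel)"
    proof (rule integral_mono)
      show "integrable lborel (\<lambda>z. \<epsilon>\<^sup>2 * (L z * ((\<rho> z + \<kappa> k) powr (\<epsilon> - 1) * Q z)))" using i1 by simp
      show "integrable lborel (\<lambda>z. pi * (L z * ddc u z) + \<epsilon> * pi * (L z * (u z * \<Theta> z)))" using i2 bp(2) by simp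
      fix z
      have "L z * (\<epsilon>\<^sup>2 * ((\<rho> z + \<kappa> k) powr (\<epsilon> - 1) * Q z)) \<le> L z * (pi * ddc u z + \<epsilon> * pi * (u z * \<Theta> z))"
        unfolding u_def[abs_def] by (rule mult_left_mono[OF key[OF \<kappa>(1)] L0])
      then show "\<epsilon>\<^sup>2 * (L z * ((\<rho> z + \<kappa> k) powr (\<epsilon> - 1) * Q z)) \<le> pi * (L z * ddc u z) + \<epsilon> * pi * (L z * (u z * \<Theta> z))"
        by (simp add: algebra_simps)
    qed
    also have "\<dots> = pi * (\<integral>z. u z * ddc L z \<partial>lborel) + \<epsilon> * pi * (\<integral>z. L z * (u z * \<Theta> z) \<partial>lborel)"
      using i2 bp by simp
    also have "\<dots> \<le> pi * c1 + \<epsilon> * pi * (c1 * A)"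
    proof (intro add_mono mult_left_mono)
      have "\<bar>\<integral>z. u z * ddc L z \<partial>lborel\<bar> \<le> c1" unfolding L_def
        by (rule integral_ddc_log_cutoff_bound[OF cu _ r]) (use un in auto)
      then show "(\<integral>z. u z * ddc L z \<partial>lborel) \<le> c1" by linarith
      have "(\<integral>z. L z * (u z * \<Theta> z) \<partial>lborel) \<le> (\<integral>z. c1 * (L z * \<Theta> z) \<partial>lborel)"
      proof (intro integral_mono i2)
        show "integrable lborel (\<lambda>z. c1 * (L z * \<Theta> z))" using i3 by simp
        show "L z * (u z * \<Theta> z) \<le> c1 * (L z * \<Theta> z)" for z
          using mult_right_mono[OF un(2)[of z], of "L z * \<Theta> z"] L0[of z] nn(3)[of z] by (simp add: mult_ac)
      qed
      also have "\<dots> \<le> c1 * A" using A[of m] c1 by (simp add: L_def)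
      finally show "(\<integral>z. L z * (u z * \<Theta> z) \<partial>lborel) \<le> c1 * A" .
    qed (use e in auto)
    finally have "(\<integral>z. L z * ((\<rho> z + \<kappa> k) powr (\<epsilon> - 1) * Q z) \<partial>lborel) \<le> b"
      using e by (simp add: b_def pos_le_divide_eq mult_ac)
    then show ?thesis unfolding L_def by (intro nn_integral_cutoff_le(1)[OF cq _ r]) (simp add: nn)
  qed
  define \<rho>' where "\<rho>' z = \<rho> z powr (\<epsilon> - 1) * Q z" for z
  have "(\<integral>\<^sup>+z. ennreal (\<rho>' z) * log_kernel r z \<partial>lborel) \<le> ennreal b"
  proof -
    have "(\<integral>\<^sup>+z. ennreal (\<rho>' z) * ennreal (log_cutoff r (real (Suc m)) z) \<partial>lborel) \<le> ennreal b" for m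
    proof -
      \<comment> \<open>Fatou's lemma for \<kappa> k tending to 0. Almost everywhere \<rho> > 0, and
        there the regularised density converges to the singular one.\<close>
      define v where "v k z = ennreal ((\<rho> z + \<kappa> k) powr (\<epsilon> - 1) * Q z) * ennreal (log_cutoff r (real (Suc m)) z)" for k z
      have "AE z in lborel. ennreal (\<rho>' z) * ennreal (log_cutoff r (real (Suc m)) z) = liminf (\<lambda>k. v k z)"
        using \<rho>(2)
      proof eventually_elim
        case (elim z)
        have "\<kappa> \<longlonglongrightarrow> 0" unfolding \<kappa>_def[abs_def] using LIMSEQ_inverse_real_of_nat by (simp add: inverse_eq_divide)
        then have "(\<lambda>k. (\<rho> z + \<kappa> k) powr (\<epsilon> - 1) * Q z * log_cutoff r (real (Suc m)) z) \<longlonglongrightarrow>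
            (\<rho> z + 0) powr (\<epsilon> - 1) * Q z * log_cutoff r (real (Suc m)) z"
          using elim by (intro tendsto_intros) auto
        then have "(\<lambda>k. v k z) \<longlonglongrightarrow> ennreal ((\<rho> z + 0) powr (\<epsilon> - 1) * Q z * log_cutoff r (real (Suc m)) z)"
          unfolding v_def by (subst ennreal_mult[symmetric]) (auto simp: nn log_cutoff_nonneg intro!: tendsto_ennrealI)
        then have "liminf (\<lambda>k. v k z) = ennreal ((\<rho> z + 0) powr (\<epsilon> - 1) * Q z * log_cutoff r (real (Suc m)) z)"
          by (intro lim_imp_Liminf) auto
        then show ?case by (simp add: \<rho>'_def ennreal_mult nn log_cutoff_nonneg)
      qed
      then have "(\<integral>\<^sup>+z. ennreal (\<rho>' z) * ennreal (log_cutoff r (real (Suc m)) z) \<partial>lborel) = (\<integral>\<^sup>+z. liminf (\<lambda>k. v k z) \<partial>lborel)"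
        by (rule nn_integral_cong_AE)
      also have "\<dots> \<le> liminf (\<lambda>k. \<integral>\<^sup>+z. v k z \<partial>lborel)"
        by (rule nn_integral_liminf) (simp add: v_def)
      also have "\<dots> \<le> ennreal b"
        by (rule Liminf_le) (auto simp: v_def intro!: always_eventually Qb)
      finally show ?thesis .
    qed
    then show ?thesis
      by (subst nn_integral_log_kernel_SUP[OF r]) (auto simp: \<rho>'_def intro!: SUP_least)
  qed
  moreover have "(\<integral>\<^sup>+z. ennreal (\<rho> z powr \<epsilon> * \<Theta> z) * log_kernel r z \<partial>lborel) \<le> ennreal (c1 * A)"
  proof -
    have "(\<integral>\<^sup>+z. ennreal (\<rho> z powr \<epsilon> * \<Theta> z) * log_kernel r z \<partial>lborel) \<le> (\<integral>\<^sup>+z. ennreal (c1 * \<Theta> z) * log_kernel r z \<partial>lborel)"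
      by (intro nn_integral_mono mult_right_mono ennreal_leI) (use pw[of 0] nn(3) in \<open>auto intro: mult_right_mono\<close>)
    also have "\<dots> \<le> ennreal (c1 * A)"
    proof (subst nn_integral_log_kernel_SUP[OF r])
      show "(SUP m. \<integral>\<^sup>+z. ennreal (c1 * \<Theta> z) * ennreal (log_cutoff r (real (Suc m)) z) \<partial>lborel) \<le> ennreal (c1 * A)"
      proof (rule SUP_least)
        fix m
        have "(\<integral>z. log_cutoff r (real (Suc m)) z * (c1 * \<Theta> z) \<partial>lborel) \<le> c1 * A"
          using A[of m] c1 by (simp add: mult.left_commute)
        then show "(\<integral>\<^sup>+z. ennreal (c1 * \<Theta> z) * ennreal (log_cutoff r (real (Suc m)) z) \<partial>lborel) \<le> ennreal (c1 * A)"
          by (intro nn_integral_cutoff_le(1) r continuous_intros c) (use c1 nn(3) in auto)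
      qed
    qed auto
    finally show ?thesis .
  qed
  ultimately have S: "(\<integral>\<^sup>+z. ennreal (\<rho>' z) * log_kernel r z \<partial>lborel) + (\<integral>\<^sup>+z. ennreal (\<rho> z powr \<epsilon> * \<Theta> z) * log_kernel r z \<partial>lborel)
     \<le> ennreal b + ennreal (c1 * A)" by (rule add_mono)
  have lm[measurable]: "log_kernel r \<in> borel_measurable borel"
  proof -
    have "log_kernel r = (\<lambda>z. SUP m. ennreal (log_cutoff r (real (Suc m)) z))" using log_kernel_SUP[OF r] by auto
    then show ?thesis by simp
  qed
  have "nevanlinna_N (density lborel E) r \<le> (\<integral>\<^sup>+z. ennreal (C * (\<rho>' z + \<rho> z powr \<epsilon> * \<Theta> z)) * log_kernel r z \<partial>lborel)"
    by (rule nevanlinna_N_density_le) (use E in \<open>auto simp: \<rho>'_def\<close>)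
  also have "\<dots> = (\<integral>\<^sup>+z. ennreal C * (ennreal (\<rho>' z) * log_kernel r z + ennreal (\<rho> z powr \<epsilon> * \<Theta> z) * log_kernel r z) \<partial>lborel)"
  proof (intro nn_integral_cong)
    fix z
    have "ennreal (C * (a + b)) * k = ennreal C * (ennreal a * k + ennreal b * k)" if "0 \<le> a" "0 \<le> b" for a b k
      using C that by (simp add: ennreal_mult distrib_right mult.assoc)
    then show "ennreal (C * (\<rho>' z + \<rho> z powr \<epsilon> * \<Theta> z)) * log_kernel r z =
        ennreal C * (ennreal (\<rho>' z) * log_kernel r z + ennreal (\<rho> z powr \<epsilon> * \<Theta> z) * log_kernel r z)"
      by (simp add: \<rho>'_def nn)
  qed
  also have "\<dots> = ennreal C * ((\<integral>\<^sup>+z. ennreal (\<rho>' z) * log_kernel r z \<partial>lborel) + (\<integral>\<^sup>+z. ennreal (\<rho> z powr \<epsilon> * \<Theta> z) * log_kernel r z \<partial>lborel))"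
    by (simp add: nn_integral_cmult nn_integral_add \<rho>'_def)
  also have "\<dots> \<le> ennreal C * (ennreal b + ennreal (c1 * A))" by (rule mult_left_mono[OF S]) simp
  also have "ennreal b + ennreal (c1 * A) = ennreal (b + c1 * A)"
    by (rule ennreal_plus[symmetric]) (use b0 c1 A0 in auto)
  also have "ennreal C * ennreal (b + c1 * A) = ennreal (C * (b + c1 * A))"
    by (rule ennreal_mult[symmetric]) (use C b0 c1 A0 in auto)
  finally have N: "nevanlinna_N (density lborel E) r \<le> ennreal (C * (b + c1 * A))" .
  then show "nevanlinna_N (density lborel E) r < \<infinity>" by (simp add: le_less_trans)
  have "enn2real (nevanlinna_N (density lborel E) r) \<le> C * (b + c1 * A)"
    using N by (rule enn2real_leI[rotated]) (use C b0 c1 A0 in simp)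
  then have "\<epsilon> * enn2real (nevanlinna_N (density lborel E) r) \<le> \<epsilon> * (C * (b + c1 * A))"
    using e by (intro mult_left_mono) auto
  \<comment> \<open>The factor \<epsilon> cancels one power of \<epsilon> in the denominator of b.
    Only the constant term keeps 1 / \<epsilon>; the coefficient of A stays bounded for \<epsilon> <
    1.\<close>
  also have "\<dots> = C * (c1 * pi / \<epsilon> + pi * c1 * A + \<epsilon> * (c1 * A))"
    using e by (simp add: b_def field_simps power2_eq_square)
  also have "\<dots> \<le> C * (c1 * pi / \<epsilon> + pi * c1 * A + 1 * (c1 * A))"
    using e C c1 A0 by (intro mult_left_mono add_left_mono mult_right_mono) auto
  also have "\<dots> = C * (C0 + 1) * (1 + pi) * A + C * (C0 + 1) * pi / \<epsilon>" by (simp add: c1_def algebra_simps)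
  finally show "\<epsilon> * enn2real (nevanlinna_N (density lborel E) r) \<le> C * (C0 + 1) * (1 + pi) * A + C * (C0 + 1) * pi / \<epsilon>" .
qed

declare of_nat_Suc [simp]

section \<open>Holomorphic functions and differentials on projective space\<close>

lemma norm_smult: "norm (c *s (v::complex^('n::finite))) = cmod c * norm v"
  unfolding norm_vec_def by (simp add: norm_mult L2_set_right_distrib)

lemma bounded_bilinear_smult: "bounded_bilinear (\<lambda>c (v::complex^('n::finite)). c *s v)"
proof
  show "\<exists>K. \<forall>a b. norm (a *s (b::complex^'n)) \<le> norm a * norm b * K"
    by (rule exI[of _ 1]) (simp add: norm_smult)
qed (auto simp: vec_eq_iff algebra_simps)

lemmas tendsto_smult = bounded_bilinear.tendsto[OF bounded_bilinear_smult]

lemma pt_continuous: "continuous_on (- {0}) (pt :: complex^('n::finite) => 'n cproj)"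
proof -
  have "pt -` B \<inter> - {0} = {a. a ~= 0 \<and> pt a \<in> B}" for B :: "'n cproj set" by auto
  then show ?thesis
    by (subst continuous_on_open_vimage) (auto simp: open_cproj_def open_Compl)
qed

lemma open_pt_vimage: "open W ==> open {a. a ~= 0 \<and> pt a \<in> W}"
  by (simp add: open_cproj_def)

lemma hom_poly_tendsto:
  assumes p: "hom_poly d p" and h: "(h \<longlongrightarrow> a) F"
  shows "((\<lambda>x. p (h x)) \<longlongrightarrow> p a) F"
proof -
  obtain q where q: "poly_fun q" "\<And>a. p a = q (vec_nth a)" by (rule hom_polyE[OF p], rule that)
  have "((\<lambda>x. q (vec_nth (h x))) \<longlongrightarrow> q (vec_nth a)) F"
    using q(1) by (induction rule: poly_fun.induct) (auto intro!: tendsto_intros h)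
  then show ?thesis by (simp add: q(2))
qed

lemma zariski_open_eventually:
  assumes U: "zariski_open M U" and a: "a ~= 0" "pt a \<in> U" and h: "(h \<longlongrightarrow> a) F"
    and M: "eventually (\<lambda>x. h x ~= 0 \<and> pt (h x) \<in> M) F"
  shows "eventually (\<lambda>x. pt (h x) \<in> U) F"
proof -
  obtain d p where p: "hom_poly d p" "p a ~= 0" "\<And>b. b ~= 0 ==> pt b \<in> M ==> p b ~= 0 ==> pt b \<in> U"
    using zariski_openE[OF U a] by blast
  have "eventually (\<lambda>x. p (h x) ~= 0) F"
    using tendsto_imp_eventually_ne[OF hom_poly_tendsto[OF p(1) h] p(2)] .
  then show ?thesis using M by eventually_elim (use p(3) in blast)
qed

lemma regular_on_tendsto:
  assumes g: "regular_on U g" and a: "a ~= 0" "pt a \<in> U" and h: "(h \<longlongrightarrow> a) F"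
    and U: "eventually (\<lambda>x. h x ~= 0 \<and> pt (h x) \<in> U) F"
  shows "((\<lambda>x. g (pt (h x))) \<longlongrightarrow> g (pt a)) F"
proof -
  obtain d p q where pq: "hom_poly d p" "hom_poly d q" "q a ~= 0"
    "\<And>b. b ~= 0 ==> pt b \<in> U ==> q b ~= 0 ==> g (pt b) = p b / q b"
    using regular_onE[OF g a] by blast
  have q: "((\<lambda>x. q (h x)) \<longlongrightarrow> q a) F" by (rule hom_poly_tendsto[OF pq(2) h])
  have "((\<lambda>x. p (h x) / q (h x)) \<longlongrightarrow> p a / q a) F"
    by (intro tendsto_divide hom_poly_tendsto[OF pq(1) h] q pq(3))
  moreover have "eventually (\<lambda>x. p (h x) / q (h x) = g (pt (h x))) F"
    using U tendsto_imp_eventually_ne[OF q pq(3)] by eventually_elim (use pq(4) in simp)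
  ultimately have "((\<lambda>x. g (pt (h x))) \<longlongrightarrow> p a / q a) F" by (rule Lim_transform_eventually)
  then show ?thesis using pq(4)[OF a pq(3)] by simp
qed

section \<open>Complex differentiability and differentials on the cone\<close>

lemma complex_differentiable_atI:
  "(F has_derivative D) (at a) ==> (\<And>c v. D (c *s v) = c * D v) ==> complex_differentiable_at F a"
  unfolding complex_differentiable_at_def by blast

lemma complex_differentiable_atE:
  assumes "complex_differentiable_at F a"
  obtains D where "(F has_derivative D) (at a)" "\<And>c v. D (c *s v) = c * D v"
  using assms unfolding complex_differentiable_at_def by blast

lemma complex_differentiable_const: "complex_differentiable_at (\<lambda>_. c) a"
  by (rule complex_differentiable_atI[of _ "\<lambda>_. 0"]) auto

lemma complex_differentiable_add:
  assumes "complex_differentiable_at F a" "complex_differentiable_at G a"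
  shows "complex_differentiable_at (\<lambda>b. F b + G b) a"
proof -
  obtain D where D: "(F has_derivative D) (at a)" "\<And>c v. D (c *s v) = c * D v"
    by (rule complex_differentiable_atE[OF assms(1)], rule that)
  obtain E where E: "(G has_derivative E) (at a)" "\<And>c v. E (c *s v) = c * E v"
    by (rule complex_differentiable_atE[OF assms(2)], rule that)
  show ?thesis
    by (rule complex_differentiable_atI[OF has_derivative_add[OF D(1) E(1)]]) (simp add: D E algebra_simps)
qed

lemma complex_differentiable_mult:
  assumes "complex_differentiable_at F a" "complex_differentiable_at G a"
  shows "complex_differentiable_at (\<lambda>b. F b * G b) a"
proof -
  obtain D where D: "(F has_derivative D) (at a)" "\<And>c v. D (c *s v) = c * D v"
    by (rule complex_differentiable_atE[OF assms(1)], rule that)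
  obtain E where E: "(G has_derivative E) (at a)" "\<And>c v. E (c *s v) = c * E v"
    by (rule complex_differentiable_atE[OF assms(2)], rule that)
  show ?thesis
    by (rule complex_differentiable_atI[OF has_derivative_mult[OF D(1) E(1)]]) (simp add: D E algebra_simps)
qed

lemma complex_differentiable_inverse:
  assumes "complex_differentiable_at F a" "F a ~= 0"
  shows "complex_differentiable_at (\<lambda>b. inverse (F b)) a"
proof -
  obtain D where D: "(F has_derivative D) (at a)" "\<And>c v. D (c *s v) = c * D v"
    by (rule complex_differentiable_atE[OF assms(1)], rule that)
  show ?thesis
    by (rule complex_differentiable_atI[OF Deriv.has_derivative_inverse[OF assms(2) D(1)]]) (simp add: D algebra_simps)
qed

lemma complex_differentiable_hom_poly:
  assumes p: "hom_poly d p"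
  shows "complex_differentiable_at p a"
proof -
  obtain q where q: "poly_fun q" "\<And>a. p a = q (vec_nth a)" by (rule hom_polyE[OF p], rule that)
  have "complex_differentiable_at (\<lambda>b. q (vec_nth b)) a" using q(1)
  proof (induction rule: poly_fun.induct)
    case (coord i)
    show ?case
      by (rule complex_differentiable_atI[of _ "\<lambda>v. v $ i"])
        (auto intro!: bounded_linear_imp_has_derivative bounded_linear_vec_nth)
  qed (auto intro: complex_differentiable_const complex_differentiable_add complex_differentiable_mult)
  moreover have "p = (\<lambda>b. q (vec_nth b))" using q(2) by (rule ext)
  ultimately show ?thesis by simp
qed

lemma complex_differentiable_cong:
  assumes "complex_differentiable_at F a" "open S" "a \<in> S" "\<And>b. b \<in> S ==> F b = G b"
  shows "complex_differentiable_at G a"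
proof -
  obtain D where D: "(F has_derivative D) (at a)" "\<And>c v. D (c *s v) = c * D v"
    by (rule complex_differentiable_atE[OF assms(1)], rule that)
  show ?thesis
    by (rule complex_differentiable_atI[OF has_derivative_transform_within_open[OF D(1) assms(2,3)]])
      (use assms(4) D(2) in auto)
qed

lemma ambient_holomorphic_open: "ambient_holomorphic W G ==> open W"
  by (simp add: ambient_holomorphic_def)

lemma ambient_holomorphic_subset: "ambient_holomorphic W G ==> open W' ==> W' \<subseteq> W ==> ambient_holomorphic W' G"
  by (auto simp: ambient_holomorphic_def)

lemma ambient_holomorphic_const: "open W ==> ambient_holomorphic W (\<lambda>_. c)"
  by (simp add: ambient_holomorphic_def complex_differentiable_const)

lemma ambient_holomorphic_add: "ambient_holomorphic W G ==> ambient_holomorphic W H ==> ambient_holomorphic W (\<lambda>y. G y + H y)"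
  by (simp add: ambient_holomorphic_def complex_differentiable_add)

lemma ambient_holomorphic_mult: "ambient_holomorphic W G ==> ambient_holomorphic W H ==> ambient_holomorphic W (\<lambda>y. G y * H y)"
  by (simp add: ambient_holomorphic_def complex_differentiable_mult)

lemma ambient_holomorphic_sum:
  "open W ==> (\<And>i. i \<in> A ==> ambient_holomorphic W (G i)) ==> ambient_holomorphic W (\<lambda>y. \<Sum>i\<in>A. G i y)"
  by (induction A rule: infinite_finite_induct) (auto intro: ambient_holomorphic_const ambient_holomorphic_add)

lemma cone_deriv:
  assumes "ambient_holomorphic W G" "a ~= 0" "pt a \<in> W"
  shows "((\<lambda>b. G (pt b)) has_derivative cone_deriv G a) (at a)" "cone_deriv G a (c *s v) = c * cone_deriv G a v"
proof -
  obtain D where D: "((\<lambda>b. G (pt b)) has_derivative D) (at a)" "\<And>c v. D (c *s v) = c * D v"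
    by (rule complex_differentiable_atE[of "\<lambda>b. G (pt b)" a], use assms in \<open>simp add: ambient_holomorphic_def\<close>, rule that)
  have "D = cone_deriv G a" unfolding cone_deriv_def by (rule frechet_derivative_at[OF D(1)])
  then show "((\<lambda>b. G (pt b)) has_derivative cone_deriv G a) (at a)" "cone_deriv G a (c *s v) = c * cone_deriv G a v"
    using D by auto
qed

lemma cone_deriv_unique:
  assumes "((\<lambda>b. G (pt b)) has_derivative D) (at a)"
  shows "cone_deriv G a = D"
  unfolding cone_deriv_def by (rule frechet_derivative_at[OF assms, symmetric])

lemma cone_deriv_linear:
  assumes "ambient_holomorphic W G" "a ~= 0" "pt a \<in> W"
  shows "cone_deriv G a (v + w) = cone_deriv G a v + cone_deriv G a w"
  using linear_add[OF has_derivative_linear[OF cone_deriv(1)[OF assms]]] .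

text \<open>Pull-backs by \<open>pt\<close> are constant along the line through a. Consequently
  differentials depend on v only modulo a, as tangent vectors of projective space require.\<close>

lemma cone_deriv_radial:
  assumes "ambient_holomorphic W G" "a ~= 0" "pt a \<in> W"
  shows "cone_deriv G a a = 0"
proof -
  have "((\<lambda>t::real. G (pt (of_real (1 + t) *s a))) has_derivative (\<lambda>t. cone_deriv G a (of_real t *s a))) (at 0)"
  proof -
    have bl: "bounded_linear (\<lambda>t::real. of_real t *s a)"
      by (rule bounded_linear_compose[OF bounded_bilinear.bounded_linear_left[OF bounded_bilinear_smult] bounded_linear_of_real])
    have "((\<lambda>t::real. a + of_real t *s a) has_derivative (\<lambda>t. 0 + of_real t *s a)) (at 0)"
      by (intro has_derivative_add has_derivative_const bounded_linear_imp_has_derivative bl)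
    then have "((\<lambda>t::real. of_real (1 + t) *s a) has_derivative (\<lambda>t. of_real t *s a)) (at 0)"
      by (simp add: vector_sadd_rdistrib)
    then show ?thesis
      by (rule has_derivative_compose) (use cone_deriv(1)[OF assms] in simp)
  qed
  moreover have "((\<lambda>t::real. G (pt (of_real (1 + t) *s a))) has_derivative (\<lambda>t. 0)) (at 0)"
  proof (rule has_derivative_transform_within_open[of "\<lambda>_. G (pt a)" _ 0 UNIV "{-1<..}"])
    show "G (pt a) = G (pt (of_real (1 + t) *s a))" if "t \<in> {-1<..}" for t :: real
      using that pt_scale[of "of_real (1 + t)" a] assms(2) by (simp add: of_real_eq_0_iff[symmetric] del: of_real_add)
  qed auto
  ultimately have "(\<lambda>t::real. cone_deriv G a (of_real t *s a)) = (\<lambda>t. 0)" by (rule has_derivative_unique)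
  from fun_cong[OF this, of 1] show ?thesis by simp
qed

text \<open>Differentiate pt (k b) = pt b with respect to b.\<close>

lemma cone_deriv_scale:
  assumes "ambient_holomorphic W G" "a ~= 0" "pt a \<in> W" "k ~= 0"
  shows "cone_deriv G (k *s a) (k *s v) = cone_deriv G a v"
proof -
  have ka: "k *s a ~= 0" "pt (k *s a) \<in> W" using assms pt_scale[of k a] by (auto simp: vector_mul_eq_0)
  have "((\<lambda>b. k *s b) has_derivative (\<lambda>v. k *s v)) (at a)"
    by (rule bounded_linear_imp_has_derivative[OF bounded_bilinear.bounded_linear_right[OF bounded_bilinear_smult]])
  from has_derivative_compose[OF this cone_deriv(1)[OF assms(1) ka]]
  have "((\<lambda>b. G (pt (k *s b))) has_derivative (\<lambda>v. cone_deriv G (k *s a) (k *s v))) (at a)" .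
  then have "((\<lambda>b. G (pt b)) has_derivative (\<lambda>v. cone_deriv G (k *s a) (k *s v))) (at a)"
    by (rule has_derivative_transform_within_open[of _ _ _ _ "- {0}"]) (use assms(2) in \<open>auto simp: pt_scale assms(4)\<close>)
  then show ?thesis using cone_deriv_unique by metis
qed

lemma line_through:
  assumes "ambient_holomorphic W G" "a + \<zeta> *s v ~= 0" "pt (a + \<zeta> *s v) \<in> W"
  shows "((\<lambda>\<zeta>. G (pt (a + \<zeta> *s v))) has_field_derivative cone_deriv G (a + \<zeta> *s v) v) (at \<zeta>)"
proof -
  have "((\<lambda>\<zeta>. a + \<zeta> *s v) has_derivative (\<lambda>h. 0 + h *s v)) (at \<zeta>)"
    by (intro has_derivative_add has_derivative_const bounded_linear_imp_has_derivative
        bounded_bilinear.bounded_linear_left[OF bounded_bilinear_smult])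
  from has_derivative_compose[OF this cone_deriv(1)[OF assms]]
  have "((\<lambda>\<zeta>. G (pt (a + \<zeta> *s v))) has_derivative (\<lambda>h. cone_deriv G (a + \<zeta> *s v) (h *s v))) (at \<zeta>)" by simp
  then show ?thesis
    unfolding has_field_derivative_def cone_deriv(2)[OF assms] by (simp add: mult_commute_abs)
qed

text \<open>Joint continuity of the differential in base point and tangent vector: apply Cauchy's estimate to
  the difference of the restrictions of the function to two nearby complex lines.\<close>

lemma cone_deriv_tendsto:
  assumes G: "ambient_holomorphic W G" and a: "a0 ~= 0" "pt a0 \<in> W"
    and h: "(h \<longlongrightarrow> a0) F" and k: "(k \<longlongrightarrow> v0) F"
  shows "((\<lambda>x. cone_deriv G (h x) (k x)) \<longlongrightarrow> cone_deriv G a0 v0) F"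
proof -
  define \<Omega> where "\<Omega> = {a. a ~= 0 \<and> pt a \<in> W}"
  have "open \<Omega>" unfolding \<Omega>_def by (rule open_pt_vimage[OF ambient_holomorphic_open[OF G]])
  moreover have "a0 \<in> \<Omega>" using a by (simp add: \<Omega>_def)
  ultimately obtain R where R: "R > 0" "cball a0 R \<subseteq> \<Omega>" using open_contains_cball by blast
  define \<Gamma> where "\<Gamma> b = G (pt b)" for b
  have "continuous_on (cball a0 R) \<Gamma>"
    using R(2) cone_deriv(1)[OF G] unfolding \<Gamma>_def \<Omega>_def
    by (intro continuous_at_imp_continuous_on ballI has_derivative_continuous) blast
  then have uc: "uniformly_continuous_on (cball a0 R) \<Gamma>" by (rule compact_uniformly_continuous) simp
  \<comment> \<open>The radius is chosen so that b + \<zeta> v stays in the ball of radius R around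
    a0 whenever |b - a0| \<le> R / 2, |v| \<le> |v0| + 1 and |\<zeta>| \<le> r.\<close>
  define r where "r = R / (2 * (norm v0 + 1))"
  have r: "r > 0" using R(1) by (simp add: r_def add_nonneg_pos)
  have rv: "r * (norm v0 + 1) = R / 2" 
  proof -
    have n: "R / (2 * n) * n = R / 2" if "n > 0" for n using that by simp
    show ?thesis unfolding r_def by (rule n) (rule add_nonneg_pos[OF norm_ge_zero zero_less_one])
  qed
  have in_ball: "b + \<zeta> *s v \<in> cball a0 R" if "norm (b - a0) \<le> R / 2" "norm v \<le> norm v0 + 1" "cmod \<zeta> \<le> r" for b v \<zeta>
  proof -
    have "norm (\<zeta> *s v) \<le> r * (norm v0 + 1)" unfolding norm_smult using that r by (intro mult_mono) auto
    then have "norm ((b - a0) + \<zeta> *s v) \<le> R" using that(1) rv norm_triangle_ineq[of "b - a0" "\<zeta> *s v"] by linarith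
    then show ?thesis by (simp add: dist_norm norm_minus_commute algebra_simps)
  qed
  show ?thesis
  proof (rule tendstoI)
    fix e :: real assume e: "e > 0"
    then have "e * r / 2 > 0" using r by simp
    then obtain d where d: "d > 0" "\<And>x x'. x \<in> cball a0 R ==> x' \<in> cball a0 R ==> dist x' x < d ==> dist (\<Gamma> x') (\<Gamma> x) < e * r / 2"
      using uc unfolding uniformly_continuous_on_def by metis
    have "\<forall>\<^sub>F x in F. dist (h x) a0 < min (R / 2) (d / 2)" using h R d by (intro tendstoD) auto
    moreover have "\<forall>\<^sub>F x in F. dist (k x) v0 < min 1 (d / (2 * r))" using k r d by (intro tendstoD) auto
    ultimately show "\<forall>\<^sub>F x in F. dist (cone_deriv G (h x) (k x)) (cone_deriv G a0 v0) < e"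
    proof eventually_elim
      case (elim x)
      have hx: "norm (h x - a0) \<le> R / 2" "norm (h x - a0) < d / 2" using elim(1) by (auto simp: dist_norm)
      have kx: "norm (k x - v0) < 1" "norm (k x - v0) < d / (2 * r)" using elim(2) by (auto simp: dist_norm)
      have nk: "norm (k x) \<le> norm v0 + 1" using norm_triangle_sub[of "k x" v0] kx(1) by linarith
      \<comment> \<open>The derivative of f at 0 is the difference to be estimated. Uniform
        continuity makes |f| at most e r / 2 on the circle of radius r, and Cauchy's inequality then
        gives e / 2.\<close>
      define f where "f \<zeta> = \<Gamma> (h x + \<zeta> *s k x) - \<Gamma> (a0 + \<zeta> *s v0)" for \<zeta>
      have fd: "(f has_field_derivative (cone_deriv G (h x + \<zeta> *s k x) (k x) - cone_deriv G (a0 + \<zeta> *s v0) v0)) (at \<zeta>)"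
        if "cmod \<zeta> \<le> r" for \<zeta>
      proof -
        have "h x + \<zeta> *s k x \<in> \<Omega>" "a0 + \<zeta> *s v0 \<in> \<Omega>"
          using in_ball[OF hx(1) nk that] in_ball[of a0 v0 \<zeta>] R that by auto
        then show ?thesis unfolding f_def \<Gamma>_def \<Omega>_def by (auto intro!: DERIV_diff line_through[OF G])
      qed
      have "norm ((deriv ^^ 1) f 0) \<le> fact 1 * (e * r / 2) / r ^ 1"
      proof (rule Cauchy_inequality)
        show "f holomorphic_on ball 0 r"
          unfolding holomorphic_on_def
        proof
          fix \<zeta> :: complex assume "\<zeta> \<in> ball 0 r"
          then have "cmod \<zeta> \<le> r" by simp
          from has_field_derivative_at_within[OF fd[OF this]] show "f field_differentiable at \<zeta> within ball 0 r"
            unfolding field_differentiable_def by blast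
        qed
        show "continuous_on (cball 0 r) f"
          using fd by (intro continuous_at_imp_continuous_on ballI) (auto intro: DERIV_isCont)
        show "0 < r" by fact
        fix \<zeta> :: complex assume "norm (0 - \<zeta>) = r"
        then have z: "cmod \<zeta> = r" by simp
        have "dist (h x + \<zeta> *s k x) (a0 + \<zeta> *s v0) = norm ((h x - a0) + \<zeta> *s (k x - v0))"
          by (simp add: dist_norm vector_ssub_ldistrib algebra_simps)
        also have "\<dots> \<le> norm (h x - a0) + r * norm (k x - v0)"
          using norm_triangle_ineq[of "h x - a0" "\<zeta> *s (k x - v0)"] unfolding norm_smult z .
        also have "\<dots> < d / 2 + r * (d / (2 * r))" using hx kx r by (intro add_strict_mono mult_strict_left_mono)
        also have "\<dots> = d" using r by simp
        finally have "dist (\<Gamma> (h x + \<zeta> *s k x)) (\<Gamma> (a0 + \<zeta> *s v0)) < e * r / 2"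
          using in_ball[OF hx(1) nk, of \<zeta>] in_ball[of a0 v0 \<zeta>] R z by (intro d(2)) auto
        then show "norm (f \<zeta>) \<le> e * r / 2" by (simp add: f_def dist_norm)
      qed
      moreover have "deriv f 0 = cone_deriv G (h x) (k x) - cone_deriv G a0 v0"
        using DERIV_imp_deriv[OF fd[of 0]] r by simp
      ultimately have "norm (cone_deriv G (h x) (k x) - cone_deriv G a0 v0) \<le> e / 2" using r by simp
      then show ?case using e by (simp add: dist_norm)
    qed
  qed
qed

lemma ambient_holomorphic_tendsto:
  assumes G: "ambient_holomorphic W G" and a: "a ~= 0" "pt a \<in> W" and h: "(h \<longlongrightarrow> a) F"
  shows "((\<lambda>x. G (pt (h x))) \<longlongrightarrow> G (pt a)) F"
proof -
  have "isCont (\<lambda>b. G (pt b)) a" using has_derivative_continuous[OF cone_deriv(1)[OF G a]] .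
  then show ?thesis using isCont_tendsto_compose[OF _ h] by blast
qed

text \<open>Two local extensions differ by a function vanishing on X, and vectors in
  \<open>affine_tangent\<close> annihilate its differential. This justifies the definite
  description.\<close>

lemma differential_eq:
  assumes G: "ambient_holomorphic W G" and a: "a ~= 0" "pt a \<in> W" and e: "\<And>y. y \<in> W \<inter> X ==> g y = G y"
    and v: "v \<in> affine_tangent X (pt a)"
  shows "differential X g a v = cone_deriv G a v"
  unfolding differential_def
proof (rule the_equality)
  show "\<exists>W G'. pt a \<in> W \<and> ambient_holomorphic W G' \<and> (\<forall>y\<in>W \<inter> X. g y = G' y) \<and> cone_deriv G a v = cone_deriv G' a v"
    using G a e by blast
  fix d assume "\<exists>W G. pt a \<in> W \<and> ambient_holomorphic W G \<and> (\<forall>y\<in>W \<inter> X. g y = G y) \<and> d = cone_deriv G a v"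
  then obtain W' G' where G': "pt a \<in> W'" "ambient_holomorphic W' G'" "\<forall>y\<in>W' \<inter> X. g y = G' y" "d = cone_deriv G' a v"
    by (elim exE conjE) (rule that)
  define H where "H y = G y + (-1) * G' y" for y
  have o: "open (W \<inter> W')" using ambient_holomorphic_open[OF G] ambient_holomorphic_open[OF G'(2)] by blast
  have H: "ambient_holomorphic (W \<inter> W') H" unfolding H_def[abs_def]
    by (intro ambient_holomorphic_add ambient_holomorphic_mult ambient_holomorphic_const o
        ambient_holomorphic_subset[OF G] ambient_holomorphic_subset[OF G'(2)]) auto
  have H0: "\<forall>y\<in>(W \<inter> W') \<inter> X. H y = 0"
  proof
    fix y assume "y \<in> (W \<inter> W') \<inter> X"
    then have "G y = g y" "G' y = g y" using e[of y, symmetric] G'(3) by auto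
    then show "H y = 0" by (simp add: H_def)
  qed
  have aL: "a \<in> line_of (pt a)" by (rule mem_line_self[OF a(1)])
  have "cone_deriv H a v = 0"
    using v aL a G'(1) H H0 unfolding affine_tangent_def by blast
  moreover have "cone_deriv H a = (\<lambda>v. cone_deriv G a v + (-1) * cone_deriv G' a v)"
    unfolding H_def[abs_def]
    by (intro cone_deriv_unique has_derivative_add has_derivative_mult_right cone_deriv(1)[OF G a]
        cone_deriv(1)[OF G'(2) a(1) G'(1)])
  ultimately show "d = cone_deriv G a v" using G'(4) by simp
qed

text \<open>A quotient of homogeneous polynomials of equal degree makes sense on an open subset of
  the ambient projective space, not only on X.\<close>

lemma regular_on_holo_germ:
  assumes U: "zariski_open X U" and g: "regular_on U g" and x: "x \<in> U"
  shows "holo_germ X x g"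
proof -
  obtain a where a: "a ~= 0" "x = pt a" by (rule cproj_cases)
  have aU: "pt a \<in> U" using a x by simp
  obtain d p q where pq: "hom_poly d p" "hom_poly d q" "q a ~= 0"
    "\<And>b. b ~= 0 ==> pt b \<in> U ==> q b ~= 0 ==> g (pt b) = p b / q b"
    using regular_onE[OF g a(1) aU] by blast
  obtain e s where s: "hom_poly e s" "s a ~= 0" "\<And>b. b ~= 0 ==> pt b \<in> X ==> s b ~= 0 ==> pt b \<in> U"
    using zariski_openE[OF U a(1) aU] by blast
  \<comment> \<open>An arbitrary representative; by homogeneity G does not depend on it. The
    condition on s in W ensures that points of X in W lie in U, where the formula for g is
    valid.\<close>
  define rep where "rep y = (SOME b. b ~= 0 \<and> y = pt b)" for y :: "'a cproj"
  have rep: "rep y ~= 0 \<and> y = pt (rep y)" for y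
    unfolding rep_def by (rule someI_ex) (use cproj_cases[of y] in blast)
  define G where "G y = p (rep y) / q (rep y)" for y
  define W where "W = pt ` {b. b ~= 0 \<and> q b ~= 0 \<and> s b ~= 0}"
  have ptW: "pt b \<in> W \<longleftrightarrow> q b ~= 0 \<and> s b ~= 0" if b: "b ~= 0" for b
  proof
    assume "pt b \<in> W"
    then obtain b' where b': "b' ~= 0" "q b' ~= 0" "s b' ~= 0" "pt b' = pt b" unfolding W_def by force
    then obtain c where "c ~= 0" "b = c *s b'" using pt_eqD[OF b'(1) b b'(4)] by blast
    then show "q b ~= 0 \<and> s b ~= 0" using b' hom_poly_scale[OF pq(2)] hom_poly_scale[OF s(1)] by simp
  qed (use b in \<open>auto simp: W_def\<close>)
  have Gb: "G (pt b) = p b / q b" if b: "b ~= 0" for b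
  proof -
    obtain c where "c ~= 0" "rep (pt b) = c *s b" using pt_eqD[OF b, of "rep (pt b)"] rep[of "pt b"] by metis
    then show ?thesis by (simp add: G_def hom_poly_scale[OF pq(1)] hom_poly_scale[OF pq(2)])
  qed
  have contp: "continuous_on UNIV p" if "hom_poly d p" for d and p :: "complex^'a => complex"
    unfolding continuous_on_def using hom_poly_tendsto[OF that tendsto_ident_at] by blast
  have "{b. b ~= 0 \<and> pt b \<in> W} = {b. b ~= 0} \<inter> ({b. q b ~= 0} \<inter> {b. s b ~= 0})" using ptW by auto
  moreover have "open \<dots>"
    by (intro open_Int open_Collect_neq continuous_on_const continuous_on_id contp[OF pq(2)] contp[OF s(1)])
  ultimately have W: "open W" by (simp add: open_cproj_def)
  have "ambient_holomorphic W G"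
    unfolding ambient_holomorphic_def
  proof (intro conjI allI impI W)
    fix b assume b: "b ~= 0 \<and> pt b \<in> W"
    have "complex_differentiable_at (\<lambda>b. p b * inverse (q b)) b"
      using b ptW by (intro complex_differentiable_mult complex_differentiable_inverse
          complex_differentiable_hom_poly[OF pq(1)] complex_differentiable_hom_poly[OF pq(2)]) auto
    then show "complex_differentiable_at (\<lambda>b. G (pt b)) b"
      by (rule complex_differentiable_cong[of _ _ "- {0}"]) (use b Gb in \<open>auto simp: divide_inverse\<close>)
  qed
  moreover have "x \<in> W" using ptW[OF a(1)] a pq s by simp
  moreover have "g y = G y" if "y \<in> W \<inter> X" for y
  proof -
    obtain b where b: "b ~= 0" "y = pt b" by (rule cproj_cases)
    then show ?thesis using that ptW[of b] s(3)[of b] pq(4)[of b] Gb[of b] by auto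
  qed
  ultimately show ?thesis unfolding holo_germ_def by blast
qed

lemma holo_germ_finite:
  assumes "finite A" "\<And>s. s \<in> A ==> holo_germ X x (g s)"
  obtains W G where "open W" "x \<in> W" "\<And>s. s \<in> A ==> ambient_holomorphic W (G s)"
    "\<And>s y. s \<in> A ==> y \<in> W \<inter> X ==> g s y = G s y"
proof -
  have "\<exists>t. x \<in> fst t \<and> ambient_holomorphic (fst t) (snd t) \<and> (\<forall>y\<in>fst t \<inter> X. g s y = snd t y)" if s: "s \<in> A" for s
  proof -
    obtain W G where "x \<in> W \<and> ambient_holomorphic W G \<and> (\<forall>y\<in>W \<inter> X. g s y = G y)"
      using assms(2)[OF s] unfolding holo_germ_def by blast
    then show ?thesis by (intro exI[of _ "(W, G)"]) simp
  qed
  then obtain t where t: "\<And>s. s \<in> A ==> x \<in> fst (t s) \<and> ambient_holomorphic (fst (t s)) (snd (t s)) \<and>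
      (\<forall>y\<in>fst (t s) \<inter> X. g s y = snd (t s) y)" by metis
  define W where "W = (\<Inter>s\<in>A. fst (t s))"
  have o: "open W" unfolding W_def using t assms(1) by (intro open_INT) (auto intro: ambient_holomorphic_open)
  show ?thesis
  proof (rule that[OF o])
    show "x \<in> W" using t by (auto simp: W_def)
    show "ambient_holomorphic W (snd (t s))" if "s \<in> A" for s
      using t[OF that] o that by (auto simp: W_def intro!: ambient_holomorphic_subset[of "fst (t s)"])
    show "g s y = snd (t s) y" if "s \<in> A" "y \<in> W \<inter> X" for s y using t that by (auto simp: W_def)
  qed
qed

section \<open>Holomorphic curves\<close>

lemma vec_holomorphic_has_derivative:
  assumes F: "vec_holomorphic_on F D" and D: "open D" "z \<in> D"
  shows "(F has_derivative (\<lambda>h. h *s vec_deriv F z)) (at z)"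
proof -
  have fd: "(\<lambda>z. F z $ j) field_differentiable at z" for j
    using F D unfolding vec_holomorphic_on_def holomorphic_on_def
    by (metis at_within_open)
  have d: "((\<lambda>z. F z $ j) has_derivative (\<lambda>h. h * vec_deriv F z $ j)) (at z)" for j
    using field_differentiable_derivI[OF fd, of j] by (simp add: vec_deriv_def has_field_derivative_def mult_commute_abs)
  have "((\<lambda>z. \<Sum>j\<in>UNIV. (F z $ j) *s axis j 1) has_derivative (\<lambda>h. \<Sum>j\<in>UNIV. (h * vec_deriv F z $ j) *s axis j 1)) (at z)"
    by (intro has_derivative_sum bounded_linear.has_derivative[OF bounded_bilinear.bounded_linear_left[OF bounded_bilinear_smult]] d)
  moreover have "(\<lambda>z. \<Sum>j\<in>UNIV. (F z $ j) *s axis j 1) = F" by (simp add: basis_expansion)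
  moreover have "(\<lambda>h. \<Sum>j\<in>UNIV. (h * vec_deriv F z $ j) *s axis j 1) = (\<lambda>h. h *s vec_deriv F z)"
  proof
    show "(\<Sum>j\<in>UNIV. (h * vec_deriv F z $ j) *s axis j 1) = h *s vec_deriv F z" for h
      using basis_expansion[of "h *s vec_deriv F z"] by simp
  qed
  ultimately show ?thesis by simp
qed

lemma local_lift_continuous:
  assumes "local_lift f D F" "z \<in> D"
  shows "isCont F z" "isCont f z"
proof -
  have D: "open D" "vec_holomorphic_on F D" "\<And>z. z \<in> D ==> F z ~= 0 \<and> f z = pt (F z)" using assms by (auto simp: local_lift_def)
  show F: "isCont F z" using has_derivative_continuous[OF vec_holomorphic_has_derivative[OF D(2,1) assms(2)]] .
  have "isCont pt (F z)"
    by (rule continuous_on_eq_continuous_at[THEN iffD1, OF _ pt_continuous, rule_format])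
      (use D(3)[OF assms(2)] in \<open>auto simp: open_Compl\<close>)
  then have "isCont (\<lambda>z. pt (F z)) z" using isCont_o2[OF F] by blast
  moreover have "\<forall>\<^sub>F w in nhds z. f w = pt (F w)"
    using D(3) eventually_nhds_in_open[OF D(1) assms(2)] by (auto elim: eventually_mono)
  ultimately show "isCont f z" using isCont_cong by fastforce
qed

lemma curve_chain_rule:
  assumes F: "local_lift f D F" "z \<in> D" and G: "ambient_holomorphic W G" "f z \<in> W"
  shows "((\<lambda>z. G (f z)) has_field_derivative cone_deriv G (F z) (vec_deriv F z)) (at z)"
proof -
  have D: "open D" "vec_holomorphic_on F D" "\<And>z. z \<in> D ==> F z ~= 0 \<and> f z = pt (F z)" using F by (auto simp: local_lift_def)
  have nz: "F z ~= 0" "pt (F z) \<in> W" using D(3)[OF F(2)] G(2) by auto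
  from has_derivative_compose[OF vec_holomorphic_has_derivative[OF D(2,1) F(2)] cone_deriv(1)[OF G(1) nz]]
  have "((\<lambda>z. G (pt (F z))) has_derivative (\<lambda>h. cone_deriv G (F z) (h *s vec_deriv F z))) (at z)" .
  then have "((\<lambda>z. G (f z)) has_derivative (\<lambda>h. cone_deriv G (F z) (h *s vec_deriv F z))) (at z)"
    by (rule has_derivative_transform_within_open[OF _ D(1) F(2)]) (use D(3) in auto)
  then show ?thesis unfolding has_field_derivative_def cone_deriv(2)[OF G(1) nz] by (simp add: mult_commute_abs)
qed

text \<open>The tensor is quadratic in a, linear in v, and blind to multiples of a in v.\<close>

lemma flag_tensor_change:
  "flag_tensor (k *s a) (l *s v + m *s a) = (k * k * l) *s flag_tensor a v"
  by (simp add: vec_eq_iff flag_tensor_def algebra_simps split: prod.split)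

lemma flag_pt_change:
  assumes "a ~= 0" "v \<notin> line_of (pt a)" "k ~= 0" "l ~= 0"
  shows "flag_pt (k *s a) (l *s v + m *s a) = flag_pt a v"
  unfolding flag_pt_eq flag_tensor_change using assms by (intro pt_scale flag_tensor_nonzero) auto

text \<open>Where f' \<noteq> 0 the exponent in the definition of the lift must be 0, and two
  choices of local lift and u differ by scalings and a multiple of F z, which \<open>flag_pt\<close>
  does not see. Critical points of f need no such formula because the pulled back form vanishes
  there.\<close>

lemma curve_lift_regular_point:
  assumes F: "local_lift f D F" "z \<in> D" and v: "vec_deriv F z \<notin> line_of (f z)"
  shows "curve_lift f z = flag_pt (F z) (vec_deriv F z)"
  unfolding curve_lift_def
proof (rule the_equality)
  have D: "open D" "vec_holomorphic_on F D" "\<And>z. z \<in> D ==> F z ~= 0 \<and> f z = pt (F z)" using F by (auto simp: local_lift_def)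
  have "vec_holomorphic_on (vec_deriv F) D"
    using D(1,2) unfolding vec_holomorphic_on_def vec_deriv_def by (auto intro: holomorphic_deriv)
  moreover have "\<forall>w\<in>D. vec_deriv F w - (w - z) ^ 0 *s vec_deriv F w \<in> line_of (f w)"
    using D(3) by (auto simp: line_of_pt intro!: range_eqI[of _ _ 0])
  ultimately show "\<exists>D' F' u (m::nat). z \<in> D' \<and> local_lift f D' F' \<and> vec_holomorphic_on u D' \<and>
     (\<forall>w\<in>D'. vec_deriv F' w - (w - z) ^ m *s u w \<in> line_of (f w)) \<and>
     u z \<notin> line_of (f z) \<and> flag_pt (F z) (vec_deriv F z) = flag_pt (F' z) (u z)"
    using F v by (intro exI[of _ D] exI[of _ F] exI[of _ "vec_deriv F"] exI[of _ "0::nat"]) simp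
  fix p assume "\<exists>D' F' u (m::nat). z \<in> D' \<and> local_lift f D' F' \<and> vec_holomorphic_on u D' \<and>
     (\<forall>w\<in>D'. vec_deriv F' w - (w - z) ^ m *s u w \<in> line_of (f w)) \<and> u z \<notin> line_of (f z) \<and> p = flag_pt (F' z) (u z)"
  then obtain D' F' u and m :: nat where 1: "z \<in> D'" "local_lift f D' F'" "vec_holomorphic_on u D'"
     "\<forall>w\<in>D'. vec_deriv F' w - (w - z) ^ m *s u w \<in> line_of (f w)" "u z \<notin> line_of (f z)" "p = flag_pt (F' z) (u z)"
    by (elim exE conjE) (rule that)
  have D': "open D'" "vec_holomorphic_on F' D'" "\<And>z. z \<in> D' ==> F' z ~= 0 \<and> f z = pt (F' z)" using 1(2) by (auto simp: local_lift_def)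
  have Fz: "F z ~= 0" "f z = pt (F z)" using D(3)[OF F(2)] by auto
  text \<open>Two lifts differ by a holomorphic factor, a quotient of coordinates.\<close>
  obtain j where j: "F z $ j ~= 0" using Fz(1) by (auto simp: vec_eq_iff)
  have cross: "F' w $ i * F w $ j = F' w $ j * F w $ i" if w: "w \<in> D \<inter> D'" for w i
  proof -
    have "F w ~= 0" "F' w ~= 0" "pt (F w) = pt (F' w)" using D(3)[of w] D'(3)[of w] w by auto
    then obtain c where "c ~= 0" "F' w = c *s F w" by (rule pt_eqD)
    then show ?thesis by simp
  qed
  have "F' z ~= 0" "pt (F z) = pt (F' z)" using Fz D'(3)[OF 1(1)] by auto
  then obtain k where k: "k ~= 0" "F' z = k *s F z" by (rule pt_eqD[OF Fz(1)])
  have dd: "((\<lambda>w. F w $ i) has_field_derivative vec_deriv F z $ i) (at z)"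
     "((\<lambda>w. F' w $ i) has_field_derivative vec_deriv F' z $ i) (at z)" for i
    using D(1,2) D'(1,2) F(2) 1(1) unfolding vec_holomorphic_on_def vec_deriv_def
    by (auto intro!: holomorphic_derivI)
  \<comment> \<open>The derivative of the relation \<open>cross\<close> at z expresses
    \<open>vec_deriv F' z\<close> through \<open>vec_deriv F z\<close> and F z.\<close>
  have "vec_deriv F' z $ i * F z $ j + vec_deriv F z $ j * F' z $ i = vec_deriv F' z $ j * F z $ i + vec_deriv F z $ i * F' z $ j" for i
  proof -
    have "((\<lambda>w. F' w $ i * F w $ j) has_field_derivative (vec_deriv F' z $ i * F z $ j + vec_deriv F z $ j * F' z $ i)) (at z)"
      by (rule DERIV_mult[OF dd(2) dd(1)])
    moreover have "((\<lambda>w. F' w $ i * F w $ j) has_field_derivative (vec_deriv F' z $ j * F z $ i + vec_deriv F z $ i * F' z $ j)) (at z)"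
      by (rule has_field_derivative_transform_within_open[OF DERIV_mult[OF dd(2) dd(1)], of "D \<inter> D'"])
        (use D D' F 1 cross in auto)
    ultimately show ?thesis by (rule DERIV_unique)
  qed
  then have comp: "vec_deriv F' z $ i = k * vec_deriv F z $ i + (vec_deriv F' z $ j - k * vec_deriv F z $ j) / F z $ j * F z $ i" for i
    using j unfolding k(2) by (simp add: field_simps)
  define l where "l = (vec_deriv F' z $ j - k * vec_deriv F z $ j) / F z $ j"
  have l: "vec_deriv F' z = k *s vec_deriv F z + l *s F z"
    by (rule vec_eq_iff[THEN iffD2]) (simp only: vector_add_component vector_smult_component l_def comp[symmetric], simp)
  have sub: "x - y \<in> line_of (f z)" "x + y \<in> line_of (f z)" if "x \<in> line_of (f z)" "y \<in> line_of (f z)" for x y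
    using that vec.subspace_diff vec.subspace_add line_of[of "f z"] by auto
  have lF: "c *s F z \<in> line_of (f z)" for c using Fz by (auto simp: line_of_pt)
  \<comment> \<open>For m > 0 the factor (z - z)^m is 0, and the derivative would lie in the line,
    against v.\<close>
  have m0: "m = 0"
  proof (rule ccontr)
    assume "m ~= 0"
    then have "vec_deriv F' z \<in> line_of (f z)" using bspec[OF 1(4,1)] by (simp add: zero_power)
    from sub(1)[OF this lF[of l]] have "k *s vec_deriv F z \<in> line_of (f z)" using l by simp
    then have "(1 / k) *s (k *s vec_deriv F z) \<in> line_of (f z)" using vec.subspace_scale line_of[of "f z"] by blast
    then show False using v k(1) by (simp add: vector_smult_assoc)
  qed
  have "vec_deriv F' z - u z \<in> line_of (f z)" using bspec[OF 1(4,1)] m0 by simp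
  then obtain n where n: "vec_deriv F' z - u z = n *s F z" using Fz line_of_pt[OF Fz(1)] by auto
  have "u z = vec_deriv F' z - n *s F z" unfolding n[symmetric] by simp
  then have uz: "u z = k *s vec_deriv F z + (l - n) *s F z" unfolding l by (simp add: vec_eq_iff algebra_simps)
  show "p = flag_pt (F z) (vec_deriv F z)"
    unfolding 1(6) k(2) uz by (rule flag_pt_change[OF Fz(1) _ k(1) k(1)]) (use v Fz(2) in simp)
qed

section \<open>Compactness of the projectivised bundle\<close>

text \<open>The span of the first m vectors is closed and does not contain the next one, which
  therefore has a positive distance d from it. This bounds the last coefficient, and induction
  bounds the others.\<close>

lemma independent_lower_bound:
  fixes e :: "nat => complex^('n::finite)"
  assumes "\<And>c k. (\<Sum>k<m. c k *s e k) = 0 ==> k < m ==> c k = 0"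
  shows "\<exists>\<delta>>0. \<forall>c. \<delta> * (\<Sum>k<m. cmod (c k)) \<le> norm (\<Sum>k<m. c k *s e k)"
  using assms
proof (induction m)
  case 0
  then show ?case by (intro exI[of _ 1]) simp
next
  case (Suc m)
  have "\<exists>\<delta>>0. \<forall>c. \<delta> * (\<Sum>k<m. cmod (c k)) \<le> norm (\<Sum>k<m. c k *s e k)"
  proof (rule Suc.IH)
    fix c k assume c: "(\<Sum>k<m. c k *s e k) = 0" "k < m"
    have "(\<Sum>k<Suc m. (if k < m then c k else 0) *s e k) = (\<Sum>k<m. c k *s e k)" by simp
    then show "c k = 0" using Suc.prems[of "\<lambda>k. if k < m then c k else 0" k] c by simp
  qed
  then obtain \<delta> where \<delta>: "\<delta> > 0" "\<And>c. \<delta> * (\<Sum>k<m. cmod (c k)) \<le> norm (\<Sum>k<m. c k *s e k)" by blast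
  define S where "S = range (\<lambda>c. \<Sum>k<m. c k *s e k)"
  have SI: "(\<Sum>k<m. c k *s e k) \<in> S" for c by (auto simp: S_def)
  have "subspace S"
  proof (rule subspaceI)
    show "0 \<in> S" using SI[of "\<lambda>_. 0"] by simp
    fix x y assume "x \<in> S" "y \<in> S"
    then obtain c c' where "x = (\<Sum>k<m. c k *s e k)" "y = (\<Sum>k<m. c' k *s e k)" by (auto simp: S_def)
    then show "x + y \<in> S" using SI[of "\<lambda>k. c k + c' k"] by (simp add: vector_sadd_rdistrib sum.distrib)
  next
    fix r and x assume "x \<in> S"
    then obtain c where x: "x = (\<Sum>k<m. c k *s e k)" by (auto simp: S_def)
    have "r *\<^sub>R x = (\<Sum>k<m. (of_real r * c k) *s e k)"
      unfolding x by (simp add: vec_eq_iff scaleR_conv_of_real[where 'a = complex] sum_distrib_left mult.assoc)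
    then show "r *\<^sub>R x \<in> S" using SI[of "\<lambda>k. of_real r * c k"] by simp
  qed
  then have cl: "closed S" by (rule closed_subspace)
  have "e m \<notin> S"
  proof
    assume "e m \<in> S"
    then obtain c where c: "e m = (\<Sum>k<m. c k *s e k)" by (auto simp: S_def)
    have "(\<Sum>k<Suc m. (if k < m then c k else -1) *s e k) = (\<Sum>k<m. c k *s e k) - e m" by (simp add: vec_eq_iff)
    then have "(-1::complex) = 0" using Suc.prems[of "\<lambda>k. if k < m then c k else -1" m] c by simp
    then show False by simp
  qed
  then have d: "infdist (e m) S > 0" using infdist_pos_not_in_closed[OF cl] SI by blast
  define d where "d = infdist (e m) S"
  have d0: "d > 0" using d by (simp add: d_def)
  have low: "cmod c * d \<le> norm (x + c *s e m)" if x: "x \<in> S" for x c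
  proof (cases "c = 0")
    case False
    obtain b where b: "x = (\<Sum>k<m. b k *s e k)" using x by (auto simp: S_def)
    have "(\<Sum>k<m. (- b k / c) *s e k) = - (1 / c) *s x" using False
      by (simp add: b vec_eq_iff sum_distrib_left sum_negf sum_divide_distrib)
    then have "- (1 / c) *s x \<in> S" using SI[of "\<lambda>k. - b k / c"] by simp
    then have "d \<le> dist (e m) (- (1 / c) *s x)" unfolding d_def by (rule infdist_le)
    then have "cmod c * d \<le> cmod c * norm (e m - - (1 / c) *s x)" by (intro mult_left_mono) (auto simp: dist_norm)
    also have "\<dots> = norm (c *s (e m - - (1 / c) *s x))" by (rule norm_smult[symmetric])
    also have "c *s (e m - - (1 / c) *s x) = x + c *s e m" using False by (simp add: vec_eq_iff field_simps)
    finally show ?thesis .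
  qed simp
  \<comment> \<open>With Z the norm of the combination and N the sum of the other coefficients'
    moduli, |c m| \<le> Z / d and \<delta> N \<le> Z + Z |e m| / d; the two bounds add up to M
    Z.\<close>
  define M where "M = (1 + norm (e m) / d) / \<delta> + 1 / d"
  have M: "M > 0" unfolding M_def using d0 \<delta>(1) by (intro add_nonneg_pos) auto
  show ?case
  proof (intro exI[of _ "1 / M"] conjI allI)
    show "1 / M > 0" using M by simp
    fix c
    define X where "X = (\<Sum>k<m. c k *s e k)"
    define Z where "Z = norm (X + c m *s e m)"
    define N where "N = (\<Sum>k<m. cmod (c k))"
    have "cmod (c m) * d \<le> Z" using low[OF SI] by (simp add: Z_def X_def)
    then have c1: "cmod (c m) \<le> Z / d" using d0 by (simp add: pos_le_divide_eq)
    have "\<delta> * N \<le> norm X" using \<delta>(2) by (simp add: X_def N_def)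
    also have "norm X \<le> Z + norm (c m *s e m)" unfolding Z_def using norm_triangle_ineq4[of "X + c m *s e m" "c m *s e m"] by simp
    also have "\<dots> \<le> Z + Z / d * norm (e m)" unfolding norm_smult using c1 by (intro add_left_mono mult_right_mono) auto
    finally have "N \<le> (Z + Z / d * norm (e m)) / \<delta>" using \<delta>(1) by (simp add: pos_le_divide_eq mult.commute)
    then have "N + cmod (c m) \<le> (Z + Z / d * norm (e m)) / \<delta> + Z / d" using c1 by linarith
    also have "\<dots> = M * Z" unfolding M_def by (simp add: distrib_right distrib_left add_divide_distrib mult.commute)
    finally have "(N + cmod (c m)) / M \<le> Z" using M by (simp add: pos_divide_le_eq mult.commute)
    then show "1 / M * (\<Sum>k<Suc m. cmod (c k)) \<le> norm (\<Sum>k<Suc m. c k *s e k)"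
      by (simp add: N_def Z_def X_def)
  qed
qed

text \<open>Moving each vector by less than \<delta> / 2 cannot destroy a lower bound with constant
  \<delta>.\<close>

lemma independent_eventually:
  fixes e :: "'x => nat => complex^('n::finite)"
  assumes i: "\<And>c k. (\<Sum>k<m. c k *s e0 k) = 0 ==> k < m ==> c k = 0"
    and t: "\<And>k. k < m ==> ((\<lambda>x. e x k) \<longlongrightarrow> e0 k) F"
  shows "eventually (\<lambda>x. \<forall>c. (\<Sum>k<m. c k *s e x k) = 0 --> (\<forall>k<m. c k = 0)) F"
proof -
  have "\<exists>\<delta>>0. \<forall>c. \<delta> * (\<Sum>k<m. cmod (c k)) \<le> norm (\<Sum>k<m. c k *s e0 k)"
    by (rule independent_lower_bound) (rule i)
  then obtain \<delta> where \<delta>: "\<delta> > 0" "\<And>c. \<delta> * (\<Sum>k<m. cmod (c k)) \<le> norm (\<Sum>k<m. c k *s e0 k)" by blast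
  have "eventually (\<lambda>x. \<forall>k\<in>{..<m}. dist (e x k) (e0 k) < \<delta> / 2) F"
    by (rule eventually_ball_finite) (use tendstoD[OF t, of _ "\<delta> / 2"] \<delta>(1) in auto)
  then show ?thesis
  proof eventually_elim
    case (elim x)
    show ?case
    proof (intro allI impI)
      fix c k assume c: "(\<Sum>k<m. c k *s e x k) = 0" and k: "k < m"
      have "(\<Sum>k<m. c k *s e0 k) = (\<Sum>k<m. c k *s (e0 k - e x k))"
        using c by (simp add: vector_ssub_ldistrib sum_subtractf)
      moreover have "norm (\<Sum>k<m. c k *s (e0 k - e x k)) \<le> (\<Sum>k<m. cmod (c k) * (\<delta> / 2))"
      proof (rule sum_norm_le)
        fix k assume "k \<in> {..<m}"
        then have "dist (e x k) (e0 k) < \<delta> / 2" using elim by blast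
        then have "norm (e0 k - e x k) \<le> \<delta> / 2" by (simp add: dist_norm norm_minus_commute)
        then show "norm (c k *s (e0 k - e x k)) \<le> cmod (c k) * (\<delta> / 2)"
          unfolding norm_smult by (rule mult_left_mono) simp
      qed
      ultimately have "norm (\<Sum>k<m. c k *s e0 k) \<le> (\<Sum>k<m. cmod (c k) * (\<delta> / 2))" by simp
      then have "norm (\<Sum>k<m. c k *s e0 k) \<le> (\<Sum>k<m. cmod (c k)) * (\<delta> / 2)" by (simp only: sum_distrib_right)
      then have "\<delta> * (\<Sum>k<m. cmod (c k)) \<le> \<delta> * (\<Sum>k<m. cmod (c k)) / 2"
        using \<delta>(2)[of c] by (simp add: mult.commute)
      then have "\<delta> * (\<Sum>k<m. cmod (c k)) \<le> 0" by linarith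
      then have "(\<Sum>k<m. cmod (c k)) \<le> 0" using \<delta>(1) by (simp add: mult_le_0_iff)
      then have "(\<Sum>k<m. cmod (c k)) = 0" by (simp add: sum_nonneg antisym)
      then show "c k = 0" using k by (simp add: sum_nonneg_eq_0_iff)
    qed
  qed
qed

lemma span_family:
  fixes e :: "nat => complex^('n::finite)"
  assumes "v \<in> vec.span (e ` {..<m})"
  shows "\<exists>c. v = (\<Sum>k<m. c k *s e k)"
  using assms
proof (induction rule: vec.span_induct_alt)
  case base
  show ?case by (rule exI[of _ "\<lambda>_. 0"]) simp
next
  case (step b x y)
  then obtain j c where j: "j < m" "x = e j" and c: "y = (\<Sum>k<m. c k *s e k)" by auto
  have "b *s x + y = (\<Sum>k<m. (if k = j then b else 0) *s e k) + (\<Sum>k<m. c k *s e k)"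
  proof -
    have "(\<Sum>k<m. (if k = j then b else 0) *s e k) = (\<Sum>k<m. if k = j then b *s e j else 0)" by (intro sum.cong) auto
    then show ?thesis using j c by simp
  qed
  also have "\<dots> = (\<Sum>k<m. ((if k = j then b else 0) + c k) *s e k)" by (simp add: vector_sadd_rdistrib sum.distrib)
  finally show ?case by (intro exI[of _ "\<lambda>k. (if k = j then b else 0) + c k"])
qed

lemma spanning_family_independent:
  fixes e :: "nat => complex^('n::finite)"
  assumes d: "vec.dim (vec.span (e ` {..<m})) = m" and c: "(\<Sum>k<m. c k *s e k) = 0" and j: "j < m"
  shows "c j = 0"
proof (rule ccontr)
  assume cj: "c j ~= 0"
  define T where "T = e ` ({..<m} - {j})"
  have "(\<Sum>k<m. c k *s e k) = c j *s e j + (\<Sum>k\<in>{..<m}-{j}. c k *s e k)" by (rule sum.remove) (use j in auto)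
  then have "c j *s e j = - (\<Sum>k\<in>{..<m}-{j}. c k *s e k)" using c by (simp add: eq_neg_iff_add_eq_0)
  then have "(1 / c j) *s (c j *s e j) = (1 / c j) *s (- (\<Sum>k\<in>{..<m}-{j}. c k *s e k))" by simp
  then have "e j = (1 / c j) *s (- (\<Sum>k\<in>{..<m}-{j}. c k *s e k))" using cj by (simp add: vector_smult_assoc)
  also have "\<dots> \<in> vec.span T"
    unfolding T_def by (intro vec.span_scale vec.span_neg vec.span_sum vec.span_base) auto
  finally have ej: "e j \<in> vec.span T" .
  have "e ` {..<m} \<subseteq> vec.span T"
  proof
    fix x assume "x \<in> e ` {..<m}"
    then obtain k where "k < m" "x = e k" by auto
    then show "x \<in> vec.span T" using ej by (cases "k = j") (auto simp: T_def intro: vec.span_base)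
  qed
  then have "vec.span (e ` {..<m}) \<subseteq> vec.span T" by (rule vec.span_minimal) (rule vec.subspace_span)
  then have "m \<le> card T" using vec.dim_le_card[of "vec.span (e ` {..<m})" T] d by (simp add: T_def)
  also have "card T \<le> card ({..<m} - {j})" unfolding T_def by (rule card_image_le) simp
  also have "\<dots> < m" using j by simp
  finally show False by simp
qed

text \<open>If v0 were outside the fibre, then a0, the local frame and v0 would be r + 2 independent
  vectors. Independence persists nearby, but there v x lies in a fibre of dimension r + 1.\<close>

lemma subbundle_limit:
  assumes V: "holomorphic_subbundle X V" and F: "F ~= bot"
    and a: "(a \<longlongrightarrow> a0) F" "a0 ~= 0" "pt a0 \<in> X" and v: "(v \<longlongrightarrow> v0) F"
    and ev: "eventually (\<lambda>x. a x ~= 0 \<and> pt (a x) \<in> X \<and> v x \<in> V (pt (a x))) F"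
  shows "v0 \<in> V (pt a0)"
proof (rule ccontr)
  assume nv: "v0 \<notin> V (pt a0)"
  obtain r :: nat and W E where W: "open W" "pt a0 \<in> W"
    and E: "\<forall>y\<in>W \<inter> X. (\<forall>k<r. \<forall>j. holo_germ X y (\<lambda>y'. E k y' $ j)) \<and>
           V y = vec.span (line_of y \<union> {E k y | k. k < r}) \<and> vec.dim (V y) = r + 1"
    using V a(3) unfolding holomorphic_subbundle_def by blast
  \<comment> \<open>Index 0 is the point itself, the indices 1 to r are the frame, and index r + 1
    is the additional vector.\<close>
  define e where "e b w k = (if k = 0 then b else if k \<le> r then E (k - 1) (pt b) else w)" for b w and k :: nat
  have sp: "V (pt b) = vec.span (e b w ` {..<r + 1})" if b: "b ~= 0" "pt b \<in> W \<inter> X" for b w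
  proof -
    have V: "V (pt b) = vec.span (line_of (pt b) \<union> {E k (pt b) | k. k < r})" using E b by blast
    have im: "e b w ` {..<r + 1} = insert b {E k (pt b) | k. k < r}"
    proof (intro set_eqI iffI)
      fix x assume "x \<in> e b w ` {..<r + 1}"
      then obtain k where "k < r + 1" "x = e b w k" by auto
      then show "x \<in> insert b {E k (pt b) | k. k < r}" by (cases k) (auto simp: e_def)
    next
      fix x assume "x \<in> insert b {E k (pt b) | k. k < r}"
      then consider "x = e b w 0" | k where "k < r" "x = e b w (Suc k)" by (auto simp: e_def)
      then show "x \<in> e b w ` {..<r + 1}"
      proof cases
        case 2
        then show ?thesis by (intro image_eqI[of _ _ "Suc k"]) auto
      qed (intro image_eqI[of _ _ 0], auto)
    qed
    have "line_of (pt b) = vec.span {b}" unfolding vec.span_singleton by (rule line_of_pt[OF b(1)])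
    moreover have "vec.span {b} \<subseteq> vec.span (insert b {E k (pt b) | k. k < r})" by (rule vec.span_mono) simp
    ultimately have "line_of (pt b) \<subseteq> vec.span (insert b {E k (pt b) | k. k < r})" by (simp only:)
    moreover have "{E k (pt b) | k. k < r} \<subseteq> vec.span (insert b {E k (pt b) | k. k < r})"
      by (rule order_trans[OF subset_insertI vec.span_superset])
    ultimately have "V (pt b) \<subseteq> vec.span (insert b {E k (pt b) | k. k < r})"
      unfolding V by (intro vec.span_minimal vec.subspace_span Un_least)
    moreover have "vec.span (insert b {E k (pt b) | k. k < r}) \<subseteq> V (pt b)"
      unfolding V using mem_line_self[OF b(1)] by (intro vec.span_mono) blast
    ultimately show ?thesis unfolding im by blast
  qed
  have x0: "pt a0 \<in> W \<inter> X" using W a by blast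
  have dim: "vec.dim (vec.span (e a0 v0 ` {..<r + 1})) = r + 1" using sp[OF a(2) x0] E x0 by metis
  have ind0: "c k = 0" if c: "(\<Sum>k<r + 2. c k *s e a0 v0 k) = 0" and k: "k < r + 2" for c k
  proof -
    have s: "(\<Sum>k<r + 2. c k *s e a0 v0 k) = (\<Sum>k<r + 1. c k *s e a0 v0 k) + c (r + 1) *s v0"
      by (simp add: e_def)
    have cr: "c (r + 1) = 0"
    proof (rule ccontr)
      assume cn: "c (r + 1) ~= 0"
      have "c (r + 1) *s v0 = - (\<Sum>k<r + 1. c k *s e a0 v0 k)" 
        using trans[OF s[symmetric] c] by (simp only: eq_neg_iff_add_eq_0 add.commute)
      then have "(1 / c (r + 1)) *s (c (r + 1) *s v0) = (1 / c (r + 1)) *s (- (\<Sum>k<r + 1. c k *s e a0 v0 k))" by simp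
      then have "v0 = (1 / c (r + 1)) *s (- (\<Sum>k<r + 1. c k *s e a0 v0 k))" using cn by (simp add: vector_smult_assoc)
      also have "\<dots> \<in> vec.span (e a0 v0 ` {..<r + 1})"
        by (intro vec.span_scale vec.span_neg vec.span_sum vec.span_base) auto
      finally show False using nv sp[OF a(2) x0] by simp
    qed
    then have "(\<Sum>k<r + 1. c k *s e a0 v0 k) = 0" using c s by simp
    from spanning_family_independent[OF dim this, of k] cr k show ?thesis by (cases "k = r + 1") auto
  qed
  have evW: "eventually (\<lambda>x. a x ~= 0 \<and> pt (a x) \<in> W') F" if "open W'" "pt a0 \<in> W'" for W'
    using topological_tendstoD[OF a(1) open_pt_vimage[OF that(1)]] a(2) that(2) by simp
  have t: "((\<lambda>x. e (a x) (v x) k) \<longlongrightarrow> e a0 v0 k) F" if "k < r + 2" for k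
  proof -
    consider "k = 0" | "k ~= 0" "k \<le> r" | "k > r" by linarith
    then show ?thesis
    proof cases
      case 2
      have "((\<lambda>x. E (k - 1) (pt (a x))) \<longlongrightarrow> E (k - 1) (pt a0)) F"
      proof (rule vec_tendstoI)
        fix j
        have "holo_germ X (pt a0) (\<lambda>y'. E (k - 1) y' $ j)" using E x0 2 by auto
        then obtain W' G where G: "pt a0 \<in> W'" "ambient_holomorphic W' G" "\<forall>y\<in>W' \<inter> X. E (k - 1) y $ j = G y"
          unfolding holo_germ_def by blast
        have "((\<lambda>x. G (pt (a x))) \<longlongrightarrow> G (pt a0)) F" by (rule ambient_holomorphic_tendsto[OF G(2) a(2) G(1) a(1)])
        moreover have "eventually (\<lambda>x. G (pt (a x)) = E (k - 1) (pt (a x)) $ j) F"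
          using ev evW[OF ambient_holomorphic_open[OF G(2)] G(1)] by eventually_elim (use G(3) in auto)
        ultimately have "((\<lambda>x. E (k - 1) (pt (a x)) $ j) \<longlongrightarrow> G (pt a0)) F" by (rule Lim_transform_eventually)
        then show "((\<lambda>x. E (k - 1) (pt (a x)) $ j) \<longlongrightarrow> E (k - 1) (pt a0) $ j) F" using G a(3) by auto
      qed
      then show ?thesis using 2 by (simp add: e_def)
    qed (use a v in \<open>auto simp: e_def\<close>)
  qed
  have indev: "eventually (\<lambda>x. \<forall>c. (\<Sum>k<r + 2. c k *s e (a x) (v x) k) = 0 --> (\<forall>k<r + 2. c k = 0)) F"
  proof (rule independent_eventually)
    show "c k = 0" if "(\<Sum>k<r + 2. c k *s e a0 v0 k) = 0" "k < r + 2" for c k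
      by (rule ind0[OF that])
    show "((\<lambda>x. e (a x) (v x) k) \<longlongrightarrow> e a0 v0 k) F" if "k < r + 2" for k by (rule t[OF that])
  qed
  have "eventually (\<lambda>x. False) F"
    using indev ev evW[OF W]
  proof eventually_elim
    case (elim x)
    have "v x \<in> vec.span (e (a x) (v x) ` {..<r + 1})" using sp[of "a x" "v x"] elim by auto
    from span_family[OF this] obtain c where c: "v x = (\<Sum>k<r + 1. c k *s e (a x) (v x) k)" by blast
    have "(\<Sum>k<r + 2. (if k < r + 1 then c k else -1) *s e (a x) (v x) k) =
        (\<Sum>k<r + 1. c k *s e (a x) (v x) k) + (-1) *s v x"
      by (simp add: e_def)
    also have "\<dots> = 0" unfolding c[symmetric] by (simp add: vec_eq_iff)
    finally have "\<forall>k<r + 2. (if k < r + 1 then c k else -1) = 0"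
      by (rule mp[OF spec[OF elim(1)]])
    then have "(if r + 1 < r + 1 then c (r + 1) else -1) = 0" by (elim allE[of _ "r + 1"]) simp
    then show ?case by simp
  qed
  then show False using F by simp
qed

section \<open>Orthonormal frames and uniform constants\<close>

definition hinner :: "complex^'n => complex^('n::finite) => complex" where
  "hinner a v = (\<Sum>i\<in>UNIV. cnj (a $ i) * v $ i)"

text \<open>Orthonormal pairs represent all points of P(V). Estimates are proved on this compact set
  of vectors instead of on P(V).\<close>

definition unit_frames where
  "unit_frames X V = {(a, v). norm a = 1 \<and> norm v = 1 \<and> hinner a v = 0 \<and> pt a \<in> X \<and> v \<in> V (pt a)}"

lemma hinner_self: "hinner a a = of_real ((norm a)\<^sup>2)"
proof -
  have "(norm a)\<^sup>2 = (\<Sum>i\<in>UNIV. (cmod (a $ i))\<^sup>2)" unfolding norm_vec_def L2_set_def by (simp add: sum_nonneg)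
  then show ?thesis by (simp add: hinner_def complex_norm_square mult.commute flip: of_real_power)
qed

lemma unit_frames_not_line:
  assumes "(a, v) \<in> unit_frames X V"
  shows "a ~= 0" "v \<notin> line_of (pt a)"
proof -
  have a: "norm a = 1" "norm v = 1" "hinner a v = 0" using assms by (auto simp: unit_frames_def)
  then show a0: "a ~= 0" by auto
  show "v \<notin> line_of (pt a)"
  proof
    assume "v \<in> line_of (pt a)"
    then obtain c where c: "v = c *s a" using line_of_pt[OF a0] by auto
    have "hinner a v = c * hinner a a" by (simp add: c hinner_def sum_distrib_left mult_ac)
    then have "c = 0" using a by (simp add: hinner_self)
    then show False using c a by simp
  qed
qed

lemma closed_cone: "closed X ==> (a \<longlongrightarrow> a0) F ==> F ~= bot ==> a0 ~= 0 ==> eventually (\<lambda>x. a x ~= 0 \<and> pt (a x) \<in> X) F ==> pt a0 \<in> X"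
proof (rule ccontr)
  assume h: "closed X" "(a \<longlongrightarrow> a0) F" "F ~= bot" "a0 ~= 0" "eventually (\<lambda>x. a x ~= 0 \<and> pt (a x) \<in> X) F" "pt a0 \<notin> X"
  have "eventually (\<lambda>x. a x \<in> {b. b ~= 0 \<and> pt b \<in> - X}) F"
    by (rule topological_tendstoD[OF h(2) open_pt_vimage]) (use h in auto)
  then have "eventually (\<lambda>x. False) F" using h(5) by eventually_elim auto
  then show False using h(3) by simp
qed

lemma compact_unit_cone:
  assumes "closed X"
  shows "compact {a. norm a = 1 \<and> pt a \<in> X}"
proof -
  have "closed {a. norm a = 1 \<and> pt a \<in> X}"
    unfolding closed_sequential_limits
  proof (intro allI impI)
    fix s l assume s: "(\<forall>n. s n \<in> {a. norm a = 1 \<and> pt a \<in> X}) \<and> s \<longlonglongrightarrow> l"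
    then have "(\<lambda>n. norm (s n)) \<longlonglongrightarrow> norm l" by (intro tendsto_norm) simp
    then have n: "norm l = 1" using s LIMSEQ_unique[of "\<lambda>n. norm (s n)"] by simp
    then have "l ~= 0" by auto
    moreover have "s n ~= 0 \<and> pt (s n) \<in> X" for n
    proof -
      have "norm (s n) = 1 \<and> pt (s n) \<in> X" using s by blast
      then show ?thesis by auto
    qed
    then have "\<forall>\<^sub>F n in sequentially. s n ~= 0 \<and> pt (s n) \<in> X" by (intro always_eventually) simp
    ultimately have "pt l \<in> X" using s by (intro closed_cone[OF assms, of s l sequentially]) auto
    then show "l \<in> {a. norm a = 1 \<and> pt a \<in> X}" using n by simp
  qed
  moreover have "bounded {a. norm a = 1 \<and> pt a \<in> X}" by (rule boundedI[of _ 1]) simp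
  ultimately show ?thesis by (simp add: compact_eq_bounded_closed)
qed

lemma compact_unit_frames:
  assumes X: "closed X" and V: "holomorphic_subbundle X V"
  shows "compact (unit_frames X V)"
proof -
  have "closed (unit_frames X V)"
    unfolding closed_sequential_limits
  proof (intro allI impI)
    fix s l assume s: "(\<forall>n. s n \<in> unit_frames X V) \<and> s \<longlonglongrightarrow> l"
    obtain a v where l: "l = (a, v)" by (cases l)
    have t: "(\<lambda>n. fst (s n)) \<longlonglongrightarrow> a" "(\<lambda>n. snd (s n)) \<longlonglongrightarrow> v"
      using tendsto_fst[of s l sequentially] tendsto_snd[of s l sequentially] s by (auto simp: l)
    have sn: "norm (fst (s n)) = 1" "norm (snd (s n)) = 1" "hinner (fst (s n)) (snd (s n)) = 0"
      "pt (fst (s n)) \<in> X" "snd (s n) \<in> V (pt (fst (s n)))" for n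
      using s by (auto simp: unit_frames_def split: prod.splits) (metis prod.collapse)+
    have "norm a = 1" "norm v = 1"
      using tendsto_norm[OF t(1)] tendsto_norm[OF t(2)] sn LIMSEQ_unique[OF _ tendsto_const] by simp_all
    moreover have "hinner a v = 0"
    proof -
      have "(\<lambda>n. hinner (fst (s n)) (snd (s n))) \<longlonglongrightarrow> hinner a v"
        unfolding hinner_def by (intro tendsto_intros t)
      then show ?thesis using sn LIMSEQ_unique[OF _ tendsto_const] by simp
    qed
    moreover have a0: "a ~= 0" using \<open>norm a = 1\<close> by auto
    moreover have nz: "fst (s n) ~= 0" for n using sn(1)[of n] by auto
    moreover have pX: "pt a \<in> X"
      by (rule closed_cone[OF X t(1) _ a0]) (use sn nz in \<open>auto intro!: always_eventually\<close>)
    moreover have "v \<in> V (pt a)"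
      by (rule subbundle_limit[OF V _ t(1) a0 pX t(2)]) (use sn nz in \<open>auto intro!: always_eventually\<close>)
    ultimately show "l \<in> unit_frames X V" by (simp add: l unit_frames_def)
  qed
  moreover have "bounded (unit_frames X V)"
  proof (rule bounded_subset)
    show "bounded (sphere (0::complex^'a) 1 \<times> sphere (0::complex^'a) 1)" by (intro bounded_Times bounded_sphere)
  qed (auto simp: unit_frames_def)
  ultimately show ?thesis by (simp add: compact_eq_bounded_closed)
qed

text \<open>Gram--Schmidt. The coefficients are recorded because the quantities compared later scale
  with them.\<close>

lemma unit_frame_normalisation:
  assumes V: "holomorphic_subbundle X V" and a: "a ~= 0" "pt a \<in> X" and v: "v \<in> V (pt a)" "v \<notin> line_of (pt a)"
  obtains a' v' k l m where "(a', v') \<in> unit_frames X V" "k ~= 0" "l ~= 0" "a = k *s a'" "v = l *s v' + m *s a'"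
proof -
  define k where "k = complex_of_real (norm a)"
  define a' where "a' = (1 / k) *s a"
  have k: "k ~= 0" using a by (simp add: k_def)
  have a': "a = k *s a'" using k by (simp add: a'_def vector_smult_assoc)
  have na': "norm a' = 1" using a unfolding a'_def norm_smult k_def by (simp add: norm_divide)
  define m where "m = hinner a' v"
  define w where "w = v - m *s a'"
  have "w ~= 0"
  proof
    assume "w = 0"
    then have "v = (m / k) *s a" by (simp add: w_def a'_def vector_smult_assoc)
    then show False using v(2) line_of_pt[OF a(1)] by blast
  qed
  define l where "l = complex_of_real (norm w)"
  have l: "l ~= 0" using \<open>w ~= 0\<close> by (simp add: l_def)
  define v' where "v' = (1 / l) *s w"
  have v': "norm v' = 1" using \<open>w ~= 0\<close> unfolding v'_def norm_smult l_def by (simp add: norm_divide)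
  have wl: "w = l *s v'" using l by (simp add: v'_def vector_smult_assoc)
  have pa: "pt a' = pt a" unfolding a'_def by (rule pt_scale) (use k a in auto)
  obtain r :: nat and W E where W: "pt a \<in> W" and E: "\<forall>y\<in>W \<inter> X. (\<forall>k<r. \<forall>j. holo_germ X y (\<lambda>y'. E k y' $ j)) \<and>
           V y = vec.span (line_of y \<union> {E k y | k. k < r}) \<and> vec.dim (V y) = r + 1"
    using V a(2) unfolding holomorphic_subbundle_def by blast
  have "V (pt a) = vec.span (line_of (pt a) \<union> {E k (pt a) | k. k < r})" using bspec[OF E, of "pt a"] W a(2) by blast
  then have "vec.subspace (V (pt a))" by (simp add: vec.subspace_span)
  moreover have "a' \<in> V (pt a)"
  proof -
    have "line_of (pt a) \<subseteq> V (pt a)" using V a(2) unfolding holomorphic_subbundle_def by blast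
    moreover have "a' \<in> line_of (pt a)" using line_of_pt[OF a(1)] by (auto simp: a'_def)
    ultimately show ?thesis by blast
  qed
  ultimately have "v' \<in> V (pt a)" unfolding v'_def w_def using v(1)
    by (intro vec.subspace_scale vec.subspace_diff) auto
  moreover have "hinner a' v' = 0"
  proof -
    have "hinner a' v' = (1 / l) * (hinner a' v - m * hinner a' a')"
      by (simp add: hinner_def v'_def w_def sum_distrib_left sum_subtractf sum_divide_distrib algebra_simps diff_divide_distrib)
    then show ?thesis using na' by (simp add: hinner_self m_def)
  qed
  ultimately have "(a', v') \<in> unit_frames X V" using na' v' pa a(2) by (simp add: unit_frames_def)
  moreover have "v = l *s v' + m *s a'" unfolding wl[symmetric] by (simp add: w_def)
  ultimately show ?thesis using that[OF _ k l a'] by blast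
qed

text \<open>Turns estimates near each point into one constant, the maximum over a finite subcover; 1
  is inserted to make it positive.\<close>

lemma compact_uniform_constant:
  fixes P :: "real => 'x::topological_space => bool"
  assumes K: "compact K" and loc: "\<And>x. x \<in> K ==> \<exists>C. eventually (\<lambda>y. y \<in> K --> P C y) (nhds x)"
    and mono: "\<And>C C' y. P C y ==> C \<le> C' ==> P C' y"
  shows "\<exists>C>0. \<forall>y\<in>K. P C y"
proof -
  have "\<exists>CU. open (snd CU) \<and> x \<in> snd CU \<and> (\<forall>y\<in>snd CU. y \<in> K --> P (fst CU) y)" if x: "x \<in> K" for x
  proof -
    obtain C U where "open U" "x \<in> U" "\<forall>y\<in>U. y \<in> K --> P C y"
      using loc[OF x] unfolding eventually_nhds by blast
    then show ?thesis by (intro exI[of _ "(C, U)"]) simp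
  qed
  then obtain CU where CU: "\<And>x. x \<in> K ==> open (snd (CU x)) \<and> x \<in> snd (CU x) \<and> (\<forall>y\<in>snd (CU x). y \<in> K --> P (fst (CU x)) y)"
    by metis
  obtain T where T: "T \<subseteq> K" "finite T" "K \<subseteq> (\<Union>x\<in>T. snd (CU x))"
    by (rule compactE_image[OF K, of K "\<lambda>x. snd (CU x)"]) (use CU in auto)
  define M where "M = Max (insert 1 ((\<lambda>x. fst (CU x)) ` T))"
  have "P M y" if y: "y \<in> K" for y
  proof -
    obtain x where x: "x \<in> T" "y \<in> snd (CU x)" using T y by blast
    then have "P (fst (CU x)) y" using CU T y by blast
    moreover have "fst (CU x) \<le> M" unfolding M_def using x T by (intro Max_ge) auto
    ultimately show ?thesis by (rule mono)
  qed
  moreover have "M > 0" unfolding M_def using T by (intro less_le_trans[OF zero_less_one Max_ge]) auto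
  ultimately show ?thesis by blast
qed

section \<open>Logarithms of sums of squares of holomorphic functions\<close>

definition hsum :: "'j set => ('j => complex) => real" where
  "hsum J A = (\<Sum>j\<in>J. (cmod (A j))\<^sup>2)"

text \<open>If A' is the derivative of a holomorphic A, this is the z-derivative of log |A|^2, that
  is, the connection coefficient of the metric defined by A.\<close>

definition hratio :: "'j set => ('j => complex) => ('j => complex) => complex" where
  "hratio J A A' = (\<Sum>j\<in>J. A' j * cnj (A j)) / of_real (hsum J A)"

lemma hsum_nonneg: "0 \<le> hsum J A"
  by (simp add: hsum_def sum_nonneg)

lemma hsum_of_real: "complex_of_real (hsum J A) = (\<Sum>j\<in>J. A j * cnj (A j))"
  unfolding hsum_def of_real_sum complex_norm_square ..

lemma hratio_mult: "hsum J A ~= 0 ==> (\<Sum>j\<in>J. A' j * cnj (A j)) = hratio J A A' * of_real (hsum J A)"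
  by (simp add: hratio_def)

text \<open>Pythagoras: A' - b A is the sum of the component of A' orthogonal to A and of
  (\<open>hratio J A A'\<close> - b) A.\<close>

lemma hsum_shift:
  assumes "hsum J A ~= 0"
  shows "hsum J (\<lambda>j. A' j - b * A j) / hsum J A =
    hsum J A' / hsum J A - (cmod (hratio J A A'))\<^sup>2 + (cmod (hratio J A A' - b))\<^sup>2"
proof -
  define N where "N = complex_of_real (hsum J A)"
  define \<alpha> where "\<alpha> = hratio J A A'"
  have c: "(\<Sum>j\<in>J. A' j * cnj (A j)) = \<alpha> * N" using hratio_mult[OF assms] by (simp add: \<alpha>_def N_def)
  have c': "(\<Sum>j\<in>J. A j * cnj (A' j)) = cnj \<alpha> * N"
    using arg_cong[OF c, of cnj] by (simp add: cnj_sum N_def mult.commute)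
  have "complex_of_real (hsum J (\<lambda>j. A' j - b * A j)) =
      (\<Sum>j\<in>J. A' j * cnj (A' j) - cnj b * (A' j * cnj (A j)) - b * (A j * cnj (A' j)) + b * cnj b * (A j * cnj (A j)))"
    unfolding hsum_of_real by (intro sum.cong refl) (simp add: algebra_simps)
  also have "\<dots> = of_real (hsum J A') - cnj b * (\<alpha> * N) - b * (cnj \<alpha> * N) + b * cnj b * N"
    unfolding sum.distrib sum_subtractf sum_distrib_left[symmetric] c c' N_def hsum_of_real ..
  also have "\<dots> = of_real (hsum J A') - N * (\<alpha> * cnj \<alpha>) + N * ((\<alpha> - b) * cnj (\<alpha> - b))"
    by (simp add: algebra_simps)
  also have "\<dots> = of_real (hsum J A' - hsum J A * (cmod \<alpha>)\<^sup>2 + hsum J A * (cmod (\<alpha> - b))\<^sup>2)"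
    unfolding complex_norm_square[symmetric] N_def by simp
  finally have "hsum J (\<lambda>j. A' j - b * A j) = hsum J A' - hsum J A * (cmod \<alpha>)\<^sup>2 + hsum J A * (cmod (\<alpha> - b))\<^sup>2"
    unfolding of_real_eq_iff .
  then show ?thesis using assms by (simp add: \<alpha>_def field_simps)
qed

lemma hratio_bound:
  assumes "hsum J A ~= 0"
  shows "(cmod (hratio J A A'))\<^sup>2 \<le> hsum J A' / hsum J A"
proof -
  have "0 \<le> hsum J (\<lambda>j. A' j - hratio J A A' * A j) / hsum J A" by (intro divide_nonneg_nonneg hsum_nonneg)
  then show ?thesis unfolding hsum_shift[OF assms] by simp
qed

text \<open>Cauchy--Schwarz for the covariant derivative \<open>A' - b A\<close>.\<close>

lemma covariant_estimate:
  assumes N: "hsum J A ~= 0" and e: "\<epsilon> \<le> 1"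
  shows "\<epsilon> * (hsum J (\<lambda>j. A' j - b * A j) / hsum J A) \<le>
    hsum J A' / hsum J A - (cmod (hratio J A A'))\<^sup>2 + \<epsilon> * (cmod (hratio J A A' - b))\<^sup>2"
proof -
  have "0 \<le> (1 - \<epsilon>) * (hsum J A' / hsum J A - (cmod (hratio J A A'))\<^sup>2)"
    using hratio_bound[OF N] e by (intro mult_nonneg_nonneg) auto
  moreover have "\<epsilon> * (x - h + g) \<le> x - h + \<epsilon> * g" if "0 \<le> (1 - \<epsilon>) * (x - h)" for x h g :: real
    using that by (simp add: algebra_simps)
  ultimately show ?thesis unfolding hsum_shift[OF N] by blast
qed

lemma norm_sq_C2:
  assumes D: "open D" and \<Phi>: "\<Phi> holomorphic_on D"
  shows "C2_on D (\<lambda>z. (cmod (\<Phi> z))\<^sup>2)"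
    "\<And>z. z \<in> D ==> part_re (\<lambda>z. (cmod (\<Phi> z))\<^sup>2) z = 2 * Re (deriv \<Phi> z * cnj (\<Phi> z))"
    "\<And>z. z \<in> D ==> part_im (\<lambda>z. (cmod (\<Phi> z))\<^sup>2) z = - 2 * Im (deriv \<Phi> z * cnj (\<Phi> z))"
    "\<And>z. z \<in> D ==> ddc (\<lambda>z. (cmod (\<Phi> z))\<^sup>2) z = (cmod (deriv \<Phi> z))\<^sup>2 / pi"
proof -
  have d1: "(\<Phi> has_derivative (\<lambda>h. deriv \<Phi> z * h)) (at z)" if "z \<in> D" for z
    using holomorphic_derivI[OF \<Phi> D that] by (simp add: has_field_derivative_def)
  have d2: "(deriv \<Phi> has_derivative (\<lambda>h. deriv (deriv \<Phi>) z * h)) (at z)" if "z \<in> D" for z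
    using holomorphic_derivI[OF holomorphic_deriv[OF \<Phi> D] D that] by (simp add: has_field_derivative_def)
  have c: "continuous_on D \<Phi>" "continuous_on D (deriv \<Phi>)" "continuous_on D (deriv (deriv \<Phi>))"
    using \<Phi> D holomorphic_deriv by (auto intro!: holomorphic_on_imp_continuous_on holomorphic_deriv)
  \<comment> \<open>w carries both first derivatives, which are 2 Re w and - 2 Im w. Its holomorphic
    and antiholomorphic derivatives are p and q below.\<close>
  define w where "w z = deriv \<Phi> z * cnj (\<Phi> z)" for z
  have dw: "(w has_derivative (\<lambda>h. deriv (deriv \<Phi>) z * h * cnj (\<Phi> z) + deriv \<Phi> z * cnj (deriv \<Phi> z * h))) (at z)"
    if "z \<in> D" for z
    unfolding w_def[abs_def]
    using has_derivative_mult[OF d2[OF that] bounded_linear.has_derivative[OF bounded_linear_cnj d1[OF that]]]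
    by (simp add: add.commute)
  define p where "p z = deriv (deriv \<Phi>) z * cnj (\<Phi> z)" for z
  define q where "q z = (cmod (deriv \<Phi> z))\<^sup>2" for z
  have qq: "deriv \<Phi> z * cnj (deriv \<Phi> z * h) = of_real (q z) * cnj h" for z h
    by (simp add: q_def complex_norm_square mult.assoc flip: of_real_power)
  have dw': "(w has_derivative (\<lambda>h. p z * h + of_real (q z) * cnj h)) (at z)" if "z \<in> D" for z
    using dw[OF that] unfolding qq by (simp add: p_def mult_ac)
  have 1: "C1_on D (\<lambda>z. 2 * Re (w z))" "\<And>z. z \<in> D ==> part_re (\<lambda>z. 2 * Re (w z)) z = 2 * (Re (p z) + q z)"
  proof -
    have d: "((\<lambda>z. 2 * Re (w z)) has_derivative (\<lambda>h. 2 * (Re (p z) + q z) * Re h + (- 2 * Im (p z)) * Im h)) (at z)"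
      if "z \<in> D" for z
      using has_derivative_mult_right[OF bounded_linear.has_derivative[OF bounded_linear_Re dw'[OF that]], of 2]
      by (simp add: algebra_simps)
    show "C1_on D (\<lambda>z. 2 * Re (w z))"
      by (rule C1_onI[OF d]) (auto simp: p_def q_def intro!: continuous_intros c)
    show "\<And>z. z \<in> D ==> part_re (\<lambda>z. 2 * Re (w z)) z = 2 * (Re (p z) + q z)"
      using has_derivative_parts(1)[OF d] by simp
  qed
  have 2: "C1_on D (\<lambda>z. - 2 * Im (w z))" "\<And>z. z \<in> D ==> part_im (\<lambda>z. - 2 * Im (w z)) z = 2 * (q z - Re (p z))"
  proof -
    have d: "((\<lambda>z. - 2 * Im (w z)) has_derivative (\<lambda>h. (- 2 * Im (p z)) * Re h + 2 * (q z - Re (p z)) * Im h)) (at z)"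
      if "z \<in> D" for z
      using has_derivative_mult_right[OF bounded_linear.has_derivative[OF bounded_linear_Im dw'[OF that]], of "-2"]
      by (simp add: algebra_simps)
    show "C1_on D (\<lambda>z. - 2 * Im (w z))"
      by (rule C1_onI[OF d]) (auto simp: p_def q_def intro!: continuous_intros c)
    show "\<And>z. z \<in> D ==> part_im (\<lambda>z. - 2 * Im (w z)) z = 2 * (q z - Re (p z))"
      using has_derivative_parts(2)[OF d] by simp
  qed
  have d: "\<forall>z\<in>D. ((\<lambda>z. (cmod (\<Phi> z))\<^sup>2) has_derivative (\<lambda>h. 2 * Re (w z) * Re h + - 2 * Im (w z) * Im h)) (at z)"
  proof
    fix z assume z: "z \<in> D"
    have "((\<lambda>z. Re (\<Phi> z * cnj (\<Phi> z))) has_derivative (\<lambda>h. Re (\<Phi> z * cnj (deriv \<Phi> z * h) + deriv \<Phi> z * h * cnj (\<Phi> z)))) (at z)"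
      by (intro bounded_linear.has_derivative[OF bounded_linear_Re] has_derivative_mult
          bounded_linear.has_derivative[OF bounded_linear_cnj] d1 z)
    moreover have "(\<lambda>z. Re (\<Phi> z * cnj (\<Phi> z))) = (\<lambda>z. (cmod (\<Phi> z))\<^sup>2)"
      unfolding cmod_power2 by (simp add: fun_eq_iff power2_eq_square)
    moreover have "(\<lambda>h. Re (\<Phi> z * cnj (deriv \<Phi> z * h) + deriv \<Phi> z * h * cnj (\<Phi> z))) = (\<lambda>h. 2 * Re (w z) * Re h + - 2 * Im (w z) * Im h)"
      by (simp add: fun_eq_iff w_def algebra_simps)
    ultimately show "((\<lambda>z. (cmod (\<Phi> z))\<^sup>2) has_derivative (\<lambda>h. 2 * Re (w z) * Re h + - 2 * Im (w z) * Im h)) (at z)" by simp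
  qed
  note E = C2_onI[OF D d 1(1) 2(1)]
  show "C2_on D (\<lambda>z. (cmod (\<Phi> z))\<^sup>2)" by (rule E(1))
  show "\<And>z. z \<in> D ==> part_re (\<lambda>z. (cmod (\<Phi> z))\<^sup>2) z = 2 * Re (deriv \<Phi> z * cnj (\<Phi> z))"
    "\<And>z. z \<in> D ==> part_im (\<lambda>z. (cmod (\<Phi> z))\<^sup>2) z = - 2 * Im (deriv \<Phi> z * cnj (\<Phi> z))"
    using E(2,3) by (auto simp: w_def)
  show "\<And>z. z \<in> D ==> ddc (\<lambda>z. (cmod (\<Phi> z))\<^sup>2) z = (cmod (deriv \<Phi> z))\<^sup>2 / pi"
    using E(4) 1(2) 2(2) by (simp add: q_def)
qed

lemma parts_add:
  assumes D: "open D" and u: "C2_on D u" and v: "C2_on D v" and z: "z \<in> D"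
  shows "part_re (\<lambda>z. u z + v z) z = part_re u z + part_re v z"
    "part_im (\<lambda>z. u z + v z) z = part_im u z + part_im v z" "ddc (\<lambda>z. u z + v z) z = ddc u z + ddc v z"
proof -
  have a: "part_re (\<lambda>z. u z + v z) z = part_re u z + part_re v z"
    "part_im (\<lambda>z. u z + v z) z = part_im u z + part_im v z"
    if "C1_on D u" "C1_on D v" "z \<in> D" for u v z
  proof -
    have "((\<lambda>z. u z + v z) has_derivative (\<lambda>h. (part_re u z + part_re v z) * Re h + (part_im u z + part_im v z) * Im h)) (at z)"
      using has_derivative_add[OF C1_on_has_derivative[OF that(1,3)] C1_on_has_derivative[OF that(2,3)]]
      by (simp add: algebra_simps)
    then show "part_re (\<lambda>z. u z + v z) z = part_re u z + part_re v z"
      "part_im (\<lambda>z. u z + v z) z = part_im u z + part_im v z" by (auto dest: has_derivative_parts)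
  qed
  have c: "C1_on D u" "C1_on D v" "C1_on D (part_re u)" "C1_on D (part_im u)" "C1_on D (part_re v)" "C1_on D (part_im v)"
    using u v by (auto simp: C2_on_def)
  show "part_re (\<lambda>z. u z + v z) z = part_re u z + part_re v z"
    "part_im (\<lambda>z. u z + v z) z = part_im u z + part_im v z" using a[OF c(1,2) z] by auto
  have "part_re (part_re (\<lambda>z. u z + v z)) z = part_re (\<lambda>z. part_re u z + part_re v z) z"
    by (rule part_cong(1)[OF D z _ C1_on_add[OF c(3,5)]]) (rule a(1)[OF c(1,2)])
  moreover have "part_im (part_im (\<lambda>z. u z + v z)) z = part_im (\<lambda>z. part_im u z + part_im v z) z"
    by (rule part_cong(2)[OF D z _ C1_on_add[OF c(4,6)]]) (rule a(2)[OF c(1,2)])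
  ultimately show "ddc (\<lambda>z. u z + v z) z = ddc u z + ddc v z"
    using a(1)[OF c(3,5) z] a(2)[OF c(4,6) z] by (simp add: ddc_def add_divide_distrib)
qed

lemma parts_const_zero: "part_re (\<lambda>_. c) z = 0" "part_im (\<lambda>_. c) z = 0" "ddc (\<lambda>_. c) z = 0"
proof -
  have p: "part_re (\<lambda>_. c) = (\<lambda>_. 0)" "part_im (\<lambda>_. c) = (\<lambda>_. 0)" for c
    by (auto simp: part_re_def part_im_def fun_eq_iff)
  then show "part_re (\<lambda>_. c) z = 0" "part_im (\<lambda>_. c) z = 0" "ddc (\<lambda>_. c) z = 0" by (simp_all add: ddc_def)
qed

lemma parts_scale:
  assumes D: "open D" and u: "C2_on D u" and z: "z \<in> D"
  shows "part_re (\<lambda>z. c * u z) z = c * part_re u z" "part_im (\<lambda>z. c * u z) z = c * part_im u z"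
    "ddc (\<lambda>z. c * u z) z = c * ddc u z" "C2_on D (\<lambda>z. c * u z)"
proof -
  have u1: "C1_on D u" using u by (simp add: C2_on_def)
  show "part_re (\<lambda>z. c * u z) z = c * part_re u z" "part_im (\<lambda>z. c * u z) z = c * part_im u z"
    using C1_on_mult(2,3)[OF C1_on_const u1 z, of c] by (simp_all add: parts_const_zero)
  note C = C2_on_compose[OF D u, of UNIV "\<lambda>t. c * t" "\<lambda>_. c" "\<lambda>_. 0"]
  show "ddc (\<lambda>z. c * u z) z = c * ddc u z" by (subst C(2)) (auto intro!: derivative_eq_intros simp: z)
  show "C2_on D (\<lambda>z. c * u z)" by (rule C2_on_mult[OF D C2_on_const u])
qed

lemma hsum_C2:
  assumes D: "open D" and J: "finite J" and \<Phi>: "\<And>j. j \<in> J ==> \<Phi> j holomorphic_on D"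
  shows "C2_on D (\<lambda>z. hsum J (\<lambda>j. \<Phi> j z)) \<and>
    (\<forall>z\<in>D. part_re (\<lambda>z. hsum J (\<lambda>j. \<Phi> j z)) z = 2 * Re (\<Sum>j\<in>J. deriv (\<Phi> j) z * cnj (\<Phi> j z)) \<and>
      part_im (\<lambda>z. hsum J (\<lambda>j. \<Phi> j z)) z = - 2 * Im (\<Sum>j\<in>J. deriv (\<Phi> j) z * cnj (\<Phi> j z)) \<and>
      ddc (\<lambda>z. hsum J (\<lambda>j. \<Phi> j z)) z = hsum J (\<lambda>j. deriv (\<Phi> j) z) / pi)"
  using J \<Phi>
proof (induction J rule: finite_induct)
  case empty
  then show ?case by (simp add: hsum_def C2_on_const parts_const_zero)
next
  case (insert j J)
  have IH: "C2_on D (\<lambda>z. hsum J (\<lambda>j. \<Phi> j z))"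
    "\<forall>z\<in>D. part_re (\<lambda>z. hsum J (\<lambda>j. \<Phi> j z)) z = 2 * Re (\<Sum>j\<in>J. deriv (\<Phi> j) z * cnj (\<Phi> j z)) \<and>
      part_im (\<lambda>z. hsum J (\<lambda>j. \<Phi> j z)) z = - 2 * Im (\<Sum>j\<in>J. deriv (\<Phi> j) z * cnj (\<Phi> j z)) \<and>
      ddc (\<lambda>z. hsum J (\<lambda>j. \<Phi> j z)) z = hsum J (\<lambda>j. deriv (\<Phi> j) z) / pi"
    using insert.IH insert.prems by auto
  note n = norm_sq_C2[OF D insert.prems[OF insertI1]]
  have h: "hsum (insert j J) A = (cmod (A j))\<^sup>2 + hsum J A" for A using insert.hyps by (simp add: hsum_def)
  show ?case unfolding h using insert.hyps IH(2) n(2,3,4) parts_add[OF D n(1) IH(1)] C2_on_add[OF D n(1) IH(1)]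
    by (auto simp: add_divide_distrib algebra_simps)
qed

text \<open>This is the pull-back of the Fubini--Study form by the map with homogeneous coordinates
  \<Phi>, together with the connection form in its first derivatives.\<close>

lemma ln_hsum_C2:
  assumes D: "open D" and J: "finite J" and \<Phi>: "\<forall>j\<in>J. \<Phi> j holomorphic_on D"
    and pos: "\<forall>z\<in>D. hsum J (\<lambda>j. \<Phi> j z) > 0"
  shows "C2_on D (\<lambda>z. ln (hsum J (\<lambda>j. \<Phi> j z)))"
    "\<And>z. z \<in> D ==> part_re (\<lambda>z. ln (hsum J (\<lambda>j. \<Phi> j z))) z = 2 * Re (hratio J (\<lambda>j. \<Phi> j z) (\<lambda>j. deriv (\<Phi> j) z))"
    "\<And>z. z \<in> D ==> part_im (\<lambda>z. ln (hsum J (\<lambda>j. \<Phi> j z))) z = - 2 * Im (hratio J (\<lambda>j. \<Phi> j z) (\<lambda>j. deriv (\<Phi> j) z))"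
    "\<And>z. z \<in> D ==> ddc (\<lambda>z. ln (hsum J (\<lambda>j. \<Phi> j z))) z =
      (hsum J (\<lambda>j. deriv (\<Phi> j) z) / hsum J (\<lambda>j. \<Phi> j z) - (cmod (hratio J (\<lambda>j. \<Phi> j z) (\<lambda>j. deriv (\<Phi> j) z)))\<^sup>2) / pi"
proof -
  have H: "C2_on D (\<lambda>z. hsum J (\<lambda>j. \<Phi> j z))"
    "\<And>z. z \<in> D ==> part_re (\<lambda>z. hsum J (\<lambda>j. \<Phi> j z)) z = 2 * Re (\<Sum>j\<in>J. deriv (\<Phi> j) z * cnj (\<Phi> j z))"
    "\<And>z. z \<in> D ==> part_im (\<lambda>z. hsum J (\<lambda>j. \<Phi> j z)) z = - 2 * Im (\<Sum>j\<in>J. deriv (\<Phi> j) z * cnj (\<Phi> j z))"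
    "\<And>z. z \<in> D ==> ddc (\<lambda>z. hsum J (\<lambda>j. \<Phi> j z)) z = hsum J (\<lambda>j. deriv (\<Phi> j) z) / pi"
    using hsum_C2[OF D J bspec[OF \<Phi>]] by auto
  have 1: "\<forall>t\<in>{0<..}. (ln has_real_derivative inverse t) (at t)" by (auto intro: DERIV_ln)
  have 2: "\<forall>t\<in>{0<..}. (inverse has_real_derivative - (inverse t)\<^sup>2) (at t)"
    by (auto intro!: derivative_eq_intros simp: power2_eq_square)
  have 3: "(\<lambda>z. hsum J (\<lambda>j. \<Phi> j z)) ` D \<subseteq> {0<..}" using pos by auto
  have 4: "continuous_on {0<..} (\<lambda>t::real. - (inverse t)\<^sup>2)" by (auto intro!: continuous_intros)
  have 5: "continuous_on {0<..} (inverse :: real => real)" by (auto intro!: continuous_intros)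
  have C1: "C1_on D (\<lambda>z. hsum J (\<lambda>j. \<Phi> j z))" using H(1) by (simp add: C2_on_def)
  note L = C2_on_compose[OF D H(1) 1 2 3 4] and L1 = C1_on_compose[OF C1 1 3 5]
  show "C2_on D (\<lambda>z. ln (hsum J (\<lambda>j. \<Phi> j z)))" by (rule L(1))
  fix z assume z: "z \<in> D"
  define N where "N = hsum J (\<lambda>j. \<Phi> j z)"
  define w where "w = (\<Sum>j\<in>J. deriv (\<Phi> j) z * cnj (\<Phi> j z))"
  have N: "N > 0" using bspec[OF pos z] by (simp add: N_def)
  have r: "hratio J (\<lambda>j. \<Phi> j z) (\<lambda>j. deriv (\<Phi> j) z) = w / of_real N" by (simp add: hratio_def w_def N_def)
  show "part_re (\<lambda>z. ln (hsum J (\<lambda>j. \<Phi> j z))) z = 2 * Re (hratio J (\<lambda>j. \<Phi> j z) (\<lambda>j. deriv (\<Phi> j) z))"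
    unfolding L1(2)[OF z] H(2)[OF z] r N_def[symmetric] w_def[symmetric] by (simp add: field_simps)
  show "part_im (\<lambda>z. ln (hsum J (\<lambda>j. \<Phi> j z))) z = - 2 * Im (hratio J (\<lambda>j. \<Phi> j z) (\<lambda>j. deriv (\<Phi> j) z))"
    unfolding L1(3)[OF z] H(3)[OF z] r N_def[symmetric] w_def[symmetric] by (simp add: field_simps)
  have cw: "(cmod (w / of_real N))\<^sup>2 = (cmod w)\<^sup>2 / N\<^sup>2" using N by (simp add: norm_divide power_divide)
  have w4: "(2 * Re w)\<^sup>2 + (- 2 * Im w)\<^sup>2 = 4 * (cmod w)\<^sup>2" by (simp add: cmod_power2 algebra_simps)
  show "ddc (\<lambda>z. ln (hsum J (\<lambda>j. \<Phi> j z))) z =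
      (hsum J (\<lambda>j. deriv (\<Phi> j) z) / hsum J (\<lambda>j. \<Phi> j z) - (cmod (hratio J (\<lambda>j. \<Phi> j z) (\<lambda>j. deriv (\<Phi> j) z)))\<^sup>2) / pi"
    unfolding L(2)[OF z] H(2)[OF z] H(3)[OF z] H(4)[OF z] r cw N_def[symmetric] w_def[symmetric] w4
    using N by (simp add: divide_simps power2_eq_square)
qed

text \<open>Apply the covariant estimate to the family consisting of \<open>F s\<close> for \<open>s \<in> Z\<close> and of
  \<open>sqrt \<kappa> * F s\<close> for \<open>s \<in> B\<close>: its sum of squares is \<open>\<rho> + \<kappa>\<close> times the one of \<open>B\<close>.\<close>

lemma powr_ddc_estimate:
  fixes Z B :: "'s set"
  assumes D: "open D" "z \<in> D" and fin: "finite Z" "finite B"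
    and F: "\<And>s. s \<in> Z \<union> B ==> F s holomorphic_on D"
    and pos: "\<And>z. z \<in> D ==> hsum B (\<lambda>s. F s z) > 0" and \<kappa>: "\<kappa> > 0" and e: "0 < \<epsilon>" "\<epsilon> < 1"
  defines "\<rho> \<equiv> (\<lambda>z. hsum Z (\<lambda>s. F s z) / hsum B (\<lambda>s. F s z))"
  shows "C2_on D (\<lambda>z. (\<rho> z + \<kappa>) powr \<epsilon>)"
    "\<epsilon>\<^sup>2 * ((\<rho> z + \<kappa>) powr (\<epsilon> - 1) *
       (hsum Z (\<lambda>s. deriv (F s) z - hratio B (\<lambda>s. F s z) (\<lambda>s. deriv (F s) z) * F s z) / hsum B (\<lambda>s. F s z)))
     \<le> pi * ddc (\<lambda>z. (\<rho> z + \<kappa>) powr \<epsilon>) z + \<epsilon> * pi * ((\<rho> z + \<kappa>) powr \<epsilon> * ddc (\<lambda>z. ln (hsum B (\<lambda>s. F s z))) z)"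
proof -
  \<comment> \<open>A disjoint union, since the same section may occur in both families.\<close>
  define J where "J = Inl ` Z \<union> Inr ` B"
  define \<Phi> where "\<Phi> j = (case j of Inl s => F s | Inr s => (\<lambda>z. of_real (sqrt \<kappa>) * F s z))" for j :: "'s + 's"
  have J: "finite J" using fin by (simp add: J_def)
  have \<Phi>: "\<Phi> j holomorphic_on D" if "j \<in> J" for j
    using that F by (auto simp: J_def \<Phi>_def intro!: holomorphic_intros)
  have hJ: "hsum J A = hsum Z (\<lambda>s. A (Inl s)) + hsum B (\<lambda>s. A (Inr s))" for A
    unfolding hsum_def J_def using fin by (subst sum.union_disjoint) (auto simp: sum.reindex)
  have NJ: "hsum J (\<lambda>j. \<Phi> j z) = hsum Z (\<lambda>s. F s z) + \<kappa> * hsum B (\<lambda>s. F s z)" for z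
    unfolding hJ using \<kappa> by (simp add: \<Phi>_def hsum_def norm_mult power_mult_distrib sum_distrib_left)
  have posJ: "hsum J (\<lambda>j. \<Phi> j z) > 0" if "z \<in> D" for z
    unfolding NJ using pos[OF that] \<kappa> hsum_nonneg[of Z] by (intro add_nonneg_pos) auto
  have rk: "\<rho> z + \<kappa> = hsum J (\<lambda>j. \<Phi> j z) / hsum B (\<lambda>s. F s z)" if "z \<in> D" for z
    unfolding NJ \<rho>_def using pos[OF that] by (simp add: add_divide_distrib)
  \<comment> \<open>v is ln (\<rho> + \<kappa>), a difference of two logarithms of sums of squares,
    so that (\<rho> + \<kappa>) powr \<epsilon> = exp (\<epsilon> v).\<close>
  define v where "v z = ln (hsum J (\<lambda>j. \<Phi> j z)) + (-1) * ln (hsum B (\<lambda>s. F s z))" for z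
  have FJ: "\<forall>j\<in>J. \<Phi> j holomorphic_on D" "\<forall>z\<in>D. hsum J (\<lambda>j. \<Phi> j z) > 0" using \<Phi> posJ by blast+
  have FB: "\<forall>s\<in>B. F s holomorphic_on D" "\<forall>z\<in>D. hsum B (\<lambda>s. F s z) > 0" using F pos by blast+
  note LJ = ln_hsum_C2[OF D(1) J FJ] and LB = ln_hsum_C2[OF D(1) fin(2) FB]
  note LB' = parts_scale[OF D(1) LB(1) D(2), of "-1"]
  have v: "C2_on D v" unfolding v_def[abs_def] by (intro C2_on_add D LJ(1) parts_scale(4)[OF D(1) LB(1) D(2)])
  note pv = parts_add[OF D(1) LJ(1) LB'(4) D(2), folded v_def[abs_def]]
  have ev: "(\<rho> z + \<kappa>) powr \<epsilon> = exp (\<epsilon> * v z)" if "z \<in> D" for z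
  proof -
    have "\<rho> z + \<kappa> > 0" unfolding rk[OF that] using posJ[OF that] pos[OF that] by simp
    moreover have "ln (\<rho> z + \<kappa>) = v z" unfolding rk[OF that] v_def using posJ[OF that] pos[OF that] by (simp add: ln_div)
    ultimately show ?thesis by (simp add: powr_def)
  qed
  have 1: "\<forall>t\<in>UNIV. ((\<lambda>t. exp (\<epsilon> * t)) has_real_derivative \<epsilon> * exp (\<epsilon> * t)) (at t)"
    by (auto intro!: derivative_eq_intros)
  have 2: "\<forall>t\<in>UNIV. ((\<lambda>t. \<epsilon> * exp (\<epsilon> * t)) has_real_derivative \<epsilon>\<^sup>2 * exp (\<epsilon> * t)) (at t)"
    by (auto intro!: derivative_eq_intros simp: power2_eq_square)
  have 3: "continuous_on UNIV (\<lambda>t::real. \<epsilon>\<^sup>2 * exp (\<epsilon> * t))" by (auto intro!: continuous_intros)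
  note Ex = C2_on_compose[OF D(1) v 1 2 subset_UNIV 3]
  show "C2_on D (\<lambda>z. (\<rho> z + \<kappa>) powr \<epsilon>)" by (rule C2_on_cong(1)[OF D(1) Ex(1)]) (rule ev)
  have C: "ddc (\<lambda>z. (\<rho> z + \<kappa>) powr \<epsilon>) z = ddc (\<lambda>z. exp (\<epsilon> * v z)) z"
    by (rule C2_on_cong(2)[OF D(1) Ex(1) _ D(2)]) (rule ev)
  define A A' \<alpha> \<beta> NA H where "A j = \<Phi> j z" and "A' j = deriv (\<Phi> j) z" and "\<alpha> = hratio J A A'"
    and "\<beta> = hratio B (\<lambda>s. F s z) (\<lambda>s. deriv (F s) z)" and "NA = hsum J A" and "H = hsum B (\<lambda>s. F s z)" for j
  have NA: "NA > 0" and H: "H > 0" using posJ[OF D(2)] pos[OF D(2)] by (auto simp: NA_def A_def[abs_def] H_def)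
  define T where "T = ddc (\<lambda>z. ln (hsum B (\<lambda>s. F s z))) z"
  have pr: "part_re v z = 2 * Re (\<alpha> - \<beta>)" "part_im v z = - 2 * Im (\<alpha> - \<beta>)"
    unfolding pv LJ(2)[OF D(2)] LJ(3)[OF D(2)] LB'(1,2) LB(2)[OF D(2)] LB(3)[OF D(2)]
    by (simp_all add: \<alpha>_def \<beta>_def A_def[abs_def] A'_def[abs_def])
  have dv: "ddc v z = (hsum J A' / NA - (cmod \<alpha>)\<^sup>2) / pi - T"
    unfolding pv(3) LJ(4)[OF D(2)] LB'(3) T_def by (simp add: \<alpha>_def A_def[abs_def] A'_def[abs_def] NA_def)
  \<comment> \<open>The gradient of v is given by the difference \<alpha> - \<beta> of the two
    connections. Its square is the last term of the covariant estimate with b = \<beta>.\<close>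
  have g: "(part_re v z)\<^sup>2 + (part_im v z)\<^sup>2 = 4 * (cmod (\<alpha> - \<beta>))\<^sup>2"
  proof -
    have "(2 * Re x)\<^sup>2 + (- 2 * Im x)\<^sup>2 = 4 * (cmod x)\<^sup>2" for x by (simp add: cmod_power2 algebra_simps)
    then show ?thesis unfolding pr .
  qed
  define P where "P = (\<rho> z + \<kappa>) powr \<epsilon>"
  have P0: "P \<ge> 0" by (simp add: P_def)
  have "pi * ddc (\<lambda>z. (\<rho> z + \<kappa>) powr \<epsilon>) z = \<epsilon> * P * (hsum J A' / NA - (cmod \<alpha>)\<^sup>2 + \<epsilon> * (cmod (\<alpha> - \<beta>))\<^sup>2) - \<epsilon> * pi * (P * T)"
    unfolding C Ex(2)[OF D(2)] g dv ev[OF D(2), symmetric] P_def[symmetric]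
    by (simp add: field_simps power2_eq_square)
  moreover have "\<epsilon> * (hsum J (\<lambda>j. A' j - \<beta> * A j) / NA) \<le> hsum J A' / NA - (cmod \<alpha>)\<^sup>2 + \<epsilon> * (cmod (\<alpha> - \<beta>))\<^sup>2"
    unfolding NA_def \<alpha>_def by (rule covariant_estimate) (use NA e in \<open>auto simp: NA_def\<close>)
  then have "\<epsilon> * P * (\<epsilon> * (hsum J (\<lambda>j. A' j - \<beta> * A j) / NA)) \<le> \<epsilon> * P * (hsum J A' / NA - (cmod \<alpha>)\<^sup>2 + \<epsilon> * (cmod (\<alpha> - \<beta>))\<^sup>2)"
    using e P0 by (intro mult_left_mono) auto
  moreover have "\<epsilon>\<^sup>2 * ((\<rho> z + \<kappa>) powr (\<epsilon> - 1) * (hsum Z (\<lambda>s. deriv (F s) z - \<beta> * F s z) / H)) \<le> \<epsilon> * P * (\<epsilon> * (hsum J (\<lambda>j. A' j - \<beta> * A j) / NA))"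
  proof -
    have rz: "\<rho> z + \<kappa> = NA / H" using rk[OF D(2)] by (simp add: NA_def A_def[abs_def] H_def)
    then have rp: "\<rho> z + \<kappa> > 0" using NA H by simp
    have "(\<rho> z + \<kappa>) powr (\<epsilon> - 1) = P / (\<rho> z + \<kappa>)" using rp by (simp add: P_def powr_diff)
    also have "\<dots> = P * H / NA" unfolding rz using NA H by simp
    finally have "(\<rho> z + \<kappa>) powr (\<epsilon> - 1) * (hsum Z (\<lambda>s. deriv (F s) z - \<beta> * F s z) / H) = P * (hsum Z (\<lambda>s. deriv (F s) z - \<beta> * F s z) / NA)"
      using NA H by (simp add: field_simps)
    \<comment> \<open>The part of the sum over J that comes from B is dropped.\<close>
    moreover have "hsum Z (\<lambda>s. deriv (F s) z - \<beta> * F s z) \<le> hsum J (\<lambda>j. A' j - \<beta> * A j)"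
      unfolding hJ using hsum_nonneg[of B] by (simp add: A_def A'_def \<Phi>_def)
    then have "P * (hsum Z (\<lambda>s. deriv (F s) z - \<beta> * F s z) / NA) \<le> P * (hsum J (\<lambda>j. A' j - \<beta> * A j) / NA)"
      using NA P0 by (intro mult_left_mono divide_right_mono) auto
    ultimately have "\<epsilon>\<^sup>2 * ((\<rho> z + \<kappa>) powr (\<epsilon> - 1) * (hsum Z (\<lambda>s. deriv (F s) z - \<beta> * F s z) / H)) \<le> \<epsilon>\<^sup>2 * (P * (hsum J (\<lambda>j. A' j - \<beta> * A j) / NA))"
      by (intro mult_left_mono) auto
    then show ?thesis by (simp add: power2_eq_square mult_ac)
  qed
  ultimately show "\<epsilon>\<^sup>2 * ((\<rho> z + \<kappa>) powr (\<epsilon> - 1) *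
       (hsum Z (\<lambda>s. deriv (F s) z - hratio B (\<lambda>s. F s z) (\<lambda>s. deriv (F s) z) * F s z) / hsum B (\<lambda>s. F s z)))
     \<le> pi * ddc (\<lambda>z. (\<rho> z + \<kappa>) powr \<epsilon>) z + \<epsilon> * pi * ((\<rho> z + \<kappa>) powr \<epsilon> * ddc (\<lambda>z. ln (hsum B (\<lambda>s. F s z))) z)"
    unfolding \<beta>_def[symmetric] H_def[symmetric] P_def[symmetric] T_def[symmetric] by linarith
qed

section \<open>Linear systems separating 1-jets\<close>

interpretation sec: vector_space "scale_section :: complex => ('i => 'x => complex) => ('i => 'x => complex)"
  by unfold_locales (intro ext, simp only: plus_fun_def distrib_left distrib_right mult.assoc mult_1_left)+

lemma sum_fun_apply2: "(\<Sum>v\<in>A. g v) i x = (\<Sum>v\<in>A. (g v i x :: complex))"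
  by (induction A rule: infinite_finite_induct) auto

lemma section_span_coords:
  assumes "finite Z" "s \<in> module.span scale_section Z"
  obtains r where "\<forall>i x. s i x = (\<Sum>b\<in>Z. r b * b i x)"
proof -
  obtain r where "s = (\<Sum>b\<in>Z. scale_section (r b) b)" using assms sec.span_finite[OF assms(1)] by auto
  then have "\<forall>i x. s i x = (\<Sum>b\<in>Z. r b * b i x)" by (simp add: sum_fun_apply2)
  then show thesis by (rule that)
qed

lemma hsum_cong: "(\<And>j. j \<in> J ==> A j = A2 j) ==> hsum J A = hsum J A2"
  by (simp add: hsum_def)

lemma hratio_cong:
  assumes "\<And>j. j \<in> J ==> A j = A2 j" "\<And>j. j \<in> J ==> A' j = A2' j"
  shows "hratio J A A' = hratio J A2 A2'"
proof -
  have "hsum J A = hsum J A2" by (rule hsum_cong) (rule assms(1))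
  moreover have "(\<Sum>j\<in>J. A' j * cnj (A j)) = (\<Sum>j\<in>J. A2' j * cnj (A2 j))" using assms by simp
  ultimately show ?thesis by (simp only: hratio_def)
qed

lemma hsum_scale: "hsum J (\<lambda>j. g * A j) = (cmod g)\<^sup>2 * hsum J A"
  by (simp add: hsum_def norm_mult power_mult_distrib sum_distrib_left)

lemma hratio_scale: "hratio J A (\<lambda>j. r * A' j) = r * hratio J A A'"
  by (simp add: hratio_def sum_distrib_left mult.assoc)

text \<open>Transformation of the connection coefficient under a change of frame g, where d plays
  the role of the derivative of g: the logarithmic derivative is added.\<close>

lemma hratio_change:
  assumes A: "hsum J A ~= 0" and g: "g ~= 0"
  shows "hratio J (\<lambda>j. g * A j) (\<lambda>j. g * A' j + d * A j) = hratio J A A' + d / g"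
proof -
  have "(\<Sum>j\<in>J. (g * A' j + d * A j) * cnj (g * A j)) =
      (g * cnj g) * (\<Sum>j\<in>J. A' j * cnj (A j)) + (d * cnj g) * (\<Sum>j\<in>J. A j * cnj (A j))"
    unfolding sum_distrib_left sum.distrib[symmetric] by (intro sum.cong refl) (simp add: algebra_simps)
  also have "\<dots> = (g * cnj g) * (hratio J A A' * of_real (hsum J A)) + (d * cnj g) * of_real (hsum J A)"
    unfolding hratio_mult[OF A, of A'] hsum_of_real[symmetric] ..
  finally have n: "(\<Sum>j\<in>J. (g * A' j + d * A j) * cnj (g * A j)) =
      (g * cnj g * of_real (hsum J A)) * (hratio J A A' + d / g)" using g by (simp add: field_simps)
  have "complex_of_real (hsum J (\<lambda>j. g * A j)) = g * cnj g * of_real (hsum J A)"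
    unfolding hsum_scale of_real_mult complex_norm_square ..
  moreover have "g * cnj g * of_real (hsum J A) ~= 0" using A g by simp
  ultimately show ?thesis unfolding hratio_def n by (simp add: hratio_def)
qed

lemma tendsto_hsum: "(\<And>j. j \<in> J ==> ((\<lambda>x. A x j) \<longlongrightarrow> A0 j) F) ==> ((\<lambda>x. hsum J (A x)) \<longlongrightarrow> hsum J A0) F"
  unfolding hsum_def by (intro tendsto_intros)

lemma tendsto_hratio:
  assumes "\<And>j. j \<in> J ==> ((\<lambda>x. A x j) \<longlongrightarrow> A0 j) F" "\<And>j. j \<in> J ==> ((\<lambda>x. A' x j) \<longlongrightarrow> A0' j) F" "hsum J A0 ~= 0"
  shows "((\<lambda>x. hratio J (A x) (A' x)) \<longlongrightarrow> hratio J A0 A0') F"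
  unfolding hratio_def using assms by (intro tendsto_intros tendsto_hsum) auto

lemma differential_sum_prod:
  assumes W: "open W" and P: "\<forall>s\<in>T. ambient_holomorphic W (P s)" and H: "\<forall>s\<in>T. ambient_holomorphic W (H s)"
    and a: "a ~= 0" "pt a \<in> W" and g: "\<forall>y\<in>W \<inter> X. g y = (\<Sum>s\<in>T. P s y * H s y)" and v: "v \<in> affine_tangent X (pt a)"
  shows "differential X g a v = (\<Sum>s\<in>T. P s (pt a) * cone_deriv (H s) a v + cone_deriv (P s) a v * H s (pt a))"
proof -
  have "ambient_holomorphic W (\<lambda>y. \<Sum>s\<in>T. P s y * H s y)"
    using P H by (intro ambient_holomorphic_sum W ambient_holomorphic_mult) auto
  then have "differential X g a v = cone_deriv (\<lambda>y. \<Sum>s\<in>T. P s y * H s y) a v"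
    by (rule differential_eq[OF _ a _ v]) (use g in blast)
  also have "cone_deriv (\<lambda>y. \<Sum>s\<in>T. P s y * H s y) a =
      (\<lambda>v. \<Sum>s\<in>T. P s (pt a) * cone_deriv (H s) a v + cone_deriv (P s) a v * H s (pt a))"
    using P H a by (intro cone_deriv_unique has_derivative_sum has_derivative_mult cone_deriv(1)) auto
  finally show ?thesis .
qed

lemma holo_germ_tendsto:
  assumes g: "holo_germ X (pt a0) g" and a0: "a0 ~= 0" and X: "pt a0 \<in> X" and h: "(h \<longlongrightarrow> a0) F"
    and ev: "eventually (\<lambda>x. h x ~= 0 \<and> pt (h x) \<in> X) F"
  shows "((\<lambda>x. g (pt (h x))) \<longlongrightarrow> g (pt a0)) F"
    "(k \<longlongrightarrow> v0) F ==> eventually (\<lambda>x. k x \<in> affine_tangent X (pt (h x))) F ==> v0 \<in> affine_tangent X (pt a0) ==>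
      ((\<lambda>x. differential X g (h x) (k x)) \<longlongrightarrow> differential X g a0 v0) F"
proof -
  obtain W G where W: "pt a0 \<in> W" and G: "ambient_holomorphic W G" and e: "\<forall>y\<in>W \<inter> X. g y = G y"
    using g unfolding holo_germ_def by (elim exE conjE) (rule that)
  have "eventually (\<lambda>x. h x \<in> {a. a ~= 0 \<and> pt a \<in> W}) F"
    by (rule topological_tendstoD[OF h open_pt_vimage[OF ambient_holomorphic_open[OF G]]]) (use a0 W in auto)
  then have evW: "eventually (\<lambda>x. h x ~= 0 \<and> pt (h x) \<in> W \<inter> X) F" using ev by eventually_elim auto
  have "eventually (\<lambda>x. G (pt (h x)) = g (pt (h x))) F" using evW by eventually_elim (use e in simp)
  moreover have "G (pt a0) = g (pt a0)" using e W X by simp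
  ultimately show "((\<lambda>x. g (pt (h x))) \<longlongrightarrow> g (pt a0)) F"
    using Lim_transform_eventually[OF ambient_holomorphic_tendsto[OF G a0 W h]] by simp
  assume k: "(k \<longlongrightarrow> v0) F" and kV: "eventually (\<lambda>x. k x \<in> affine_tangent X (pt (h x))) F"
    and v0: "v0 \<in> affine_tangent X (pt a0)"
  have "eventually (\<lambda>x. cone_deriv G (h x) (k x) = differential X g (h x) (k x)) F"
    using evW kV by eventually_elim (rule differential_eq[OF G, symmetric], use e in auto)
  moreover have "cone_deriv G a0 v0 = differential X g a0 v0"
    by (rule differential_eq[OF G a0 W _ v0, symmetric]) (use e in blast)
  ultimately show "((\<lambda>x. differential X g (h x) (k x)) \<longlongrightarrow> differential X g a0 v0) F"
    using Lim_transform_eventually[OF cone_deriv_tendsto[OF G a0 W h k]] by simp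
qed

lemma germ_ideal_sq_zero:
  assumes "g \<in> max_ideal_sq X x" "x \<in> X"
  shows "g x = 0"
proof -
  obtain n :: nat and c e and W where e: "\<forall>k<n. e k \<in> {\<lambda>y. a y * b y | a b. a \<in> max_ideal X x \<and> b \<in> max_ideal X x}"
    and W: "x \<in> W" "\<forall>y\<in>W \<inter> X. g y = (\<Sum>k<n. c k y * e k y)"
    using assms(1) unfolding max_ideal_sq_def germ_ideal_def by (elim CollectE exE conjE) (rule that, simp_all)
  have "e k x = 0" if "k < n" for k
  proof -
    have "e k \<in> {\<lambda>y. a y * b y | a b. a \<in> max_ideal X x \<and> b \<in> max_ideal X x}" using e that by blast
    then obtain a b where "e k = (\<lambda>y. a y * b y)" "a \<in> max_ideal X x" by (elim CollectE exE conjE)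
    then show ?thesis by (simp add: max_ideal_def)
  qed
  then show ?thesis using W assms(2) by simp
qed

lemma holomorphic_subbundle_tangent:
  assumes "holomorphic_subbundle X V" "x \<in> X"
  shows "line_of x \<subseteq> V x" "V x \<subseteq> affine_tangent X x" "vec.subspace (V x)"
proof -
  from assms(1) obtain r :: nat where r: "\<forall>x\<in>X. line_of x \<subseteq> V x \<and> V x \<subseteq> affine_tangent X x \<and>
     (\<exists>W (E :: nat => 'a cproj => complex^'a). open W \<and> x \<in> W \<and>
        (\<forall>y\<in>W \<inter> X. (\<forall>k<r. \<forall>j. holo_germ X y (\<lambda>y'. E k y' $ j)) \<and>
           V y = vec.span (line_of y \<union> {E k y | k. k < r}) \<and> vec.dim (V y) = r + 1))"
    unfolding holomorphic_subbundle_def by (rule exE)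
  obtain W E where h: "line_of x \<subseteq> V x" "V x \<subseteq> affine_tangent X x" "x \<in> W"
    "\<forall>y\<in>W \<inter> X. (\<forall>k<r. \<forall>j. holo_germ X y (\<lambda>y'. E k y' $ j)) \<and>
           V y = vec.span (line_of y \<union> {E k y | k. k < r}) \<and> vec.dim (V y) = r + 1"
    using bspec[OF r assms(2)] by (elim exE conjE) (rule that)
  have "V x = vec.span (line_of x \<union> {E k x | k. k < r})" using h assms(2) by blast
  then show "vec.subspace (V x)" by (simp only: vec.subspace_span)
  show "line_of x \<subseteq> V x" "V x \<subseteq> affine_tangent X x" by (rule h(1), rule h(2))
qed

locale jet_separating_system =
  fixes X :: "('n::finite) cproj set" and V :: "'n cproj => (complex^'n) set" and I :: "'n cproj ideal_sheaf"
    and L :: "('i, 'n cproj) bundle_data" and S B Z :: "('i => 'n cproj => complex) set"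
  assumes manifold: "projective_manifold X" and subbundle: "holomorphic_subbundle X V"
    and scheme: "closed_subscheme X I" and bdl: "line_bundle X L" and system: "linear_system X L S"
    and jets: "\<forall>x\<in>X. separates_1_jets X L S x"
    and base: "base_ideal_eq X L (subsystem_containing X L S I) I"
    and basis: "section_basis S B"
    and finite_Z: "finite Z" and Z_sub: "Z \<subseteq> subsystem_containing X L S I"
    and Z_span: "subsystem_containing X L S I \<subseteq> module.span scale_section Z"
begin

lemma closed_X: "closed X" using manifold by (simp add: projective_manifold_def)

lemma finite_BZ: "finite B" "finite (B \<union> Z)"
  using basis finite_Z by (auto simp: section_basis_def)

lemma BZ_sections: "B \<union> Z \<subseteq> sections X L" and S_span: "S = module.span scale_section B"
proof -
  show S: "S = module.span scale_section B" using basis by (simp add: section_basis_def)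
  have "B \<subseteq> S" unfolding S by (rule sec.span_superset)
  then show "B \<union> Z \<subseteq> sections X L" using system Z_sub by (auto simp: linear_system_def subsystem_containing_def)
qed

lemma triv_subset: "x \<in> triv L i ==> x \<in> X"
  using bdl by (auto simp: line_bundle_def)

text \<open>The same choice as in \<open>pullback_ddc\<close>, so the two are identified by folding
  this definition. The quantities built with it are shown to be independent of the choice.\<close>

definition idx :: "'n cproj => 'i" where "idx x = (SOME i. x \<in> triv L i)"

lemma idx: "x \<in> X ==> x \<in> triv L (idx x)"
  unfolding idx_def by (rule someI_ex) (use bdl in \<open>auto simp: line_bundle_def\<close>)

lemma section_germ: "s \<in> B \<union> Z ==> x \<in> triv L i ==> holo_germ X x (s i)"
  using BZ_sections by (auto simp: sections_def)

lemma section_transition: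
  assumes "s \<in> B \<union> Z" "x \<in> triv L i" "x \<in> triv L j"
  shows "s i x = trans_fun L i j x * s j x"
proof -
  have "\<forall>i j. \<forall>x\<in>triv L i \<inter> triv L j. s i x = trans_fun L i j x * s j x"
    using subsetD[OF BZ_sections assms(1)] unfolding sections_def by (elim CollectE conjE)
  from bspec[OF spec[OF spec[OF this, of i], of j] IntI[OF assms(2,3)]] show ?thesis .
qed

lemma trans_fun_germ:
  assumes "x \<in> triv L i" "x \<in> triv L j"
  shows "holo_germ X x (trans_fun L i j) \<and> trans_fun L i j x ~= 0"
proof -
  have "\<forall>i j. \<forall>x\<in>triv L i \<inter> triv L j. holo_germ X x (trans_fun L i j) \<and> trans_fun L i j x ~= 0"
    using bdl unfolding line_bundle_def by (elim conjE)
  from bspec[OF spec[OF spec[OF this, of i], of j] IntI[OF assms]] show ?thesis .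
qed

lemma triv_open:
  obtains N where "open N" "triv L i = X \<inter> N"
proof -
  have "openin (top_of_set X) (triv L i)" using bdl by (simp add: line_bundle_def)
  then show thesis unfolding openin_open by (elim exE conjE) (rule that)
qed

text \<open>Separation of jets provides a section with value 1 at x in the trivialisation, so the
  basis cannot vanish there: the system has no base points.\<close>

lemma hsum_pos:
  assumes x: "x \<in> triv L i"
  shows "hsum B (\<lambda>s. s i x) > 0"
proof -
  have "holo_germ X x (\<lambda>_. 1)"
    unfolding holo_germ_def using ambient_holomorphic_const[of UNIV 1] by blast
  then obtain s where s: "s \<in> S" "(\<lambda>y. s i y - 1) \<in> max_ideal_sq X x"
    using jets triv_subset[OF x] x unfolding separates_1_jets_def by blast
  have "s i x - 1 = 0" using germ_ideal_sq_zero[OF s(2) triv_subset[OF x]] .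
  then have nz: "s i x ~= 0" by auto
  obtain r where r: "\<forall>i x. s i x = (\<Sum>b\<in>B. r b * b i x)"
    by (rule section_span_coords[OF finite_BZ(1)]) (use s(1) S_span in auto)
  have "\<exists>b\<in>B. b i x ~= 0"
  proof (rule ccontr)
    assume "\<not> (\<exists>b\<in>B. b i x ~= 0)"
    then have "(\<Sum>b\<in>B. r b * b i x) = 0" by (intro sum.neutral) simp
    then have "s i x = 0" using spec[OF spec[OF r, of i], of x] by simp
    then show False using nz by simp
  qed
  then obtain b where b: "b \<in> B" "b i x ~= 0" by blast
  have "0 < (cmod (b i x))\<^sup>2" using b by simp
  also have "\<dots> \<le> hsum B (\<lambda>s. s i x)" unfolding hsum_def by (rule member_le_sum[OF b(1)]) (use finite_BZ in auto)
  finally show ?thesis .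
qed

lemma hsum_nz: "x \<in> triv L i ==> hsum B (\<lambda>s. s i x) ~= 0"
  using hsum_pos[of x i] by simp

text \<open>One neighbourhood serves all sections of both families at once, so that their
  differentials can be computed by \<open>cone_deriv\<close> of ambient functions.\<close>

lemma local_extension:
  assumes x: "x \<in> triv L i"
  obtains W G where "open W" "x \<in> W" "W \<inter> X \<subseteq> triv L i" "\<forall>s\<in>B \<union> Z. ambient_holomorphic W (G s)"
    "\<forall>s\<in>B \<union> Z. \<forall>y\<in>W \<inter> X. s i y = G s y"
proof -
  obtain N where N: "open N" "triv L i = X \<inter> N" by (rule triv_open)
  show thesis
  proof (rule holo_germ_finite[where g = "\<lambda>s. s i" and X = X and x = x, OF finite_BZ(2)])
    show "holo_germ X x (s i)" if "s \<in> B \<union> Z" for s by (rule section_germ[OF that x])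
  next
    fix W G
    assume W: "open W" "x \<in> W" and G: "\<And>s. s \<in> B \<union> Z ==> ambient_holomorphic W (G s)"
      "\<And>s y. s \<in> B \<union> Z ==> y \<in> W \<inter> X ==> s i y = G s y"
    show thesis
    proof (rule that[of "W \<inter> N" G])
      show "open (W \<inter> N)" using W N by blast
      show "x \<in> W \<inter> N" using W N x by blast
      show "W \<inter> N \<inter> X \<subseteq> triv L i" using N by blast
      show "\<forall>s\<in>B \<union> Z. ambient_holomorphic (W \<inter> N) (G s)"
        using ambient_holomorphic_subset[OF G(1)] W N by blast
      show "\<forall>s\<in>B \<union> Z. \<forall>y\<in>W \<inter> N \<inter> X. s i y = G s y" using G(2) by blast
    qed
  qed
qed

lemma germ_differential_tendsto:
  assumes g: "holo_germ X (pt a0) g" and a0: "a0 ~= 0" and X: "pt a0 \<in> X" and h: "(h \<longlongrightarrow> a0) F"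
    and ev: "eventually (\<lambda>x. h x ~= 0 \<and> pt (h x) \<in> X) F"
    and k: "(k \<longlongrightarrow> v0) F" and kV: "eventually (\<lambda>x. k x \<in> V (pt (h x))) F" and v0: "v0 \<in> V (pt a0)"
  shows "((\<lambda>x. differential X g (h x) (k x)) \<longlongrightarrow> differential X g a0 v0) F"
proof (rule holo_germ_tendsto(2)[OF g a0 X h ev k])
  show "eventually (\<lambda>x. k x \<in> affine_tangent X (pt (h x))) F"
    using ev kV by eventually_elim (use holomorphic_subbundle_tangent(2)[OF subbundle] in blast)
  show "v0 \<in> affine_tangent X (pt a0)" using holomorphic_subbundle_tangent(2)[OF subbundle X] v0 by blast
qed

section \<open>Covariant derivatives of the sections\<close>

abbreviation dS :: "'i => complex^'n => complex^'n => ('i => 'n cproj => complex) => complex" where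
  "dS i a v s \<equiv> differential X (s i) a v"

text \<open>The connection form of the metric on L whose weight is the logarithm of the sum of
  squares over B. With it \<open>cov\<close> is the covariant derivative of a section in the
  direction v, and \<open>qq\<close> sums the squared norms of these derivatives.\<close>

definition conn :: "'i => complex^'n => complex^'n => complex" where
  "conn i a v = hratio B (\<lambda>s. s i (pt a)) (dS i a v)"

definition cov :: "'i => complex^'n => complex^'n => ('i => 'n cproj => complex) => complex" where
  "cov i a v s = dS i a v s - conn i a v * s i (pt a)"

definition qq :: "('i => 'n cproj => complex) set => 'i => complex^'n => complex^'n => real" where
  "qq T i a v = hsum T (cov i a v) / hsum B (\<lambda>s. s i (pt a))"

definition rho :: "'n cproj => real" where
  "rho x = hsum Z (\<lambda>s. s (idx x) x) / hsum B (\<lambda>s. s (idx x) x)"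

lemma qq_nonneg: "0 \<le> qq T i a v" and rho_nonneg: "0 \<le> rho x"
  by (simp_all add: qq_def rho_def hsum_nonneg)

lemma dS_extension:
  assumes "\<forall>s\<in>B \<union> Z. ambient_holomorphic W (G s)" "\<forall>s\<in>B \<union> Z. \<forall>y\<in>W \<inter> X. s i y = G s y"
    "a ~= 0" "pt a \<in> W" "pt a \<in> X" "v \<in> V (pt a)" "s \<in> B \<union> Z"
  shows "dS i a v s = cone_deriv (G s) a v"
  by (rule differential_eq[of W "G s"])
    (use assms subsetD[OF holomorphic_subbundle_tangent(2)[OF subbundle assms(5)] assms(6)] in auto)

lemma index_change:
  assumes i: "pt a \<in> triv L i" and j: "pt a \<in> triv L j" and a: "a ~= 0" and v: "v \<in> V (pt a)"
  obtains g d where "g ~= 0" "\<forall>s\<in>B \<union> Z. s i (pt a) = g * s j (pt a)"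
    "\<forall>s\<in>B \<union> Z. dS i a v s = g * dS j a v s + d * s j (pt a)"
proof -
  obtain W G where W: "open W" "pt a \<in> W" "W \<inter> X \<subseteq> triv L i"
    "\<forall>s\<in>B \<union> Z. ambient_holomorphic W (G s)" "\<forall>s\<in>B \<union> Z. \<forall>y\<in>W \<inter> X. s i y = G s y"
    by (rule local_extension[OF i])
  obtain W' G' where W': "open W'" "pt a \<in> W'" "W' \<inter> X \<subseteq> triv L j"
    "\<forall>s\<in>B \<union> Z. ambient_holomorphic W' (G' s)" "\<forall>s\<in>B \<union> Z. \<forall>y\<in>W' \<inter> X. s j y = G' s y"
    by (rule local_extension[OF j])
  obtain W2 H where W2: "pt a \<in> W2" "ambient_holomorphic W2 H" "\<forall>y\<in>W2 \<inter> X. trans_fun L i j y = H y"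
    using trans_fun_germ[OF i j] unfolding holo_germ_def by (elim exE conjE)
  define Y where "Y = W \<inter> W' \<inter> W2"
  have Y: "open Y" "pt a \<in> Y" unfolding Y_def using W W' W2 ambient_holomorphic_open[OF W2(2)] by auto
  have X: "pt a \<in> X" by (rule triv_subset[OF i])
  have H: "ambient_holomorphic Y H" by (rule ambient_holomorphic_subset[OF W2(2) Y(1)]) (auto simp: Y_def)
  have tang: "v \<in> affine_tangent X (pt a)" using holomorphic_subbundle_tangent(2)[OF subbundle X] v by blast
  show thesis
  proof (rule that[of "H (pt a)" "cone_deriv H a v"])
    have Ha: "trans_fun L i j (pt a) = H (pt a)" using W2 X by blast
    show "H (pt a) ~= 0" using trans_fun_germ[OF i j] Ha by simp
    show "\<forall>s\<in>B \<union> Z. s i (pt a) = H (pt a) * s j (pt a)" using section_transition[OF _ i j] Ha by simp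
    show "\<forall>s\<in>B \<union> Z. dS i a v s = H (pt a) * dS j a v s + cone_deriv H a v * s j (pt a)"
    proof
      fix s assume s: "s \<in> B \<union> Z"
      have G': "ambient_holomorphic Y (G' s)"
        by (rule ambient_holomorphic_subset[OF _ Y(1)]) (use W'(4) s in \<open>auto simp: Y_def\<close>)
      \<comment> \<open>A sum with one term, to bring the product into the form of
        \<open>differential_sum_prod\<close>.\<close>
      have e: "\<forall>y\<in>Y \<inter> X. s i y = (\<Sum>u\<in>{()}. H y * G' s y)"
      proof
        fix y assume y: "y \<in> Y \<inter> X"
        then have "y \<in> triv L i" "y \<in> triv L j" using W(3) W'(3) by (auto simp: Y_def)
        from section_transition[OF s this] show "s i y = (\<Sum>u\<in>{()}. H y * G' s y)"
          using y W2(3) W'(5) s by (simp add: Y_def)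
      qed
      have "dS i a v s = H (pt a) * cone_deriv (G' s) a v + cone_deriv H a v * G' s (pt a)"
        using differential_sum_prod[OF Y(1) _ _ a Y(2) e tang] H G' by simp
      moreover have "dS j a v s = cone_deriv (G' s) a v" by (rule dS_extension[OF W'(4,5) a W'(2) X v s])
      moreover have "s j (pt a) = G' s (pt a)" using W'(2,5) s X by blast
      ultimately show "dS i a v s = H (pt a) * dS j a v s + cone_deriv H a v * s j (pt a)" by simp
    qed
  qed
qed

text \<open>The derivative of the transition function, which enters \<open>dS\<close>, is cancelled
  by the change d / g of the connection; numerator and denominator of \<open>qq\<close> then both
  scale by |g|^2.\<close>

lemma qq_index:
  assumes i: "pt a \<in> triv L i" and j: "pt a \<in> triv L j" and a: "a ~= 0" and v: "v \<in> V (pt a)" and T: "T \<subseteq> B \<union> Z"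
  shows "qq T i a v = qq T j a v"
proof -
  obtain g d where g: "g ~= 0" "\<forall>s\<in>B \<union> Z. s i (pt a) = g * s j (pt a)"
    "\<forall>s\<in>B \<union> Z. dS i a v s = g * dS j a v s + d * s j (pt a)"
    by (rule index_change[OF i j a v])
  have "conn i a v = hratio B (\<lambda>s. g * s j (pt a)) (\<lambda>s. g * dS j a v s + d * s j (pt a))"
    unfolding conn_def by (rule hratio_cong) (use g in auto)
  then have c: "conn i a v = conn j a v + d / g" unfolding conn_def hratio_change[OF hsum_nz[OF j] g(1)] .
  have "cov i a v s = g * cov j a v s" if "s \<in> T" for s
  proof -
    have s: "s \<in> B \<union> Z" using that T by auto
    show ?thesis unfolding cov_def c bspec[OF g(2) s] bspec[OF g(3) s] using g(1) by (simp add: field_simps)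
  qed
  then have "hsum T (cov i a v) = (cmod g)\<^sup>2 * hsum T (cov j a v)"
    unfolding hsum_scale[symmetric] by (rule hsum_cong)
  moreover have "hsum B (\<lambda>s. s i (pt a)) = (cmod g)\<^sup>2 * hsum B (\<lambda>s. s j (pt a))"
    unfolding hsum_scale[symmetric] by (rule hsum_cong) (use g in auto)
  ultimately show ?thesis using g(1) by (simp add: qq_def)
qed

lemma hsum_index:
  assumes i: "x \<in> triv L i" and j: "x \<in> triv L j" and T: "T \<subseteq> B \<union> Z"
  shows "hsum T (\<lambda>s. s i x) = (cmod (trans_fun L i j x))\<^sup>2 * hsum T (\<lambda>s. s j x)"
  unfolding hsum_scale[symmetric] by (rule hsum_cong) (use section_transition[OF _ i j] T in auto)

lemma rho_index:
  assumes i: "x \<in> triv L i"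
  shows "rho x = hsum Z (\<lambda>s. s i x) / hsum B (\<lambda>s. s i x)"
proof -
  have j: "x \<in> triv L (idx x)" by (rule idx[OF triv_subset[OF i]])
  show ?thesis unfolding rho_def using trans_fun_germ[OF j i]
    by (simp add: hsum_index[OF j i])
qed

lemma dS_scale:
  assumes i: "pt a \<in> triv L i" and a: "a ~= 0" and v: "v \<in> V (pt a)" and k: "k ~= 0" and s: "s \<in> B \<union> Z"
  shows "dS i (k *s a) (l *s v + m *s a) s = l / k * dS i a v s"
proof -
  obtain W G where W: "open W" "pt a \<in> W" "W \<inter> X \<subseteq> triv L i"
    "\<forall>s\<in>B \<union> Z. ambient_holomorphic W (G s)" "\<forall>s\<in>B \<union> Z. \<forall>y\<in>W \<inter> X. s i y = G s y"
    by (rule local_extension[OF i])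
  have X: "pt a \<in> X" by (rule triv_subset[OF i])
  have G: "ambient_holomorphic W (G s)" using W(4) s by blast
  have p: "pt (k *s a) = pt a" by (rule pt_scale[OF k a])
  have vv: "l *s v + m *s a \<in> V (pt (k *s a))"
    unfolding p using holomorphic_subbundle_tangent[OF subbundle X] mem_line_self[OF a] v
    by (intro vec.subspace_add vec.subspace_scale) auto
  have ka: "k *s a ~= 0" using k a by (simp add: vector_mul_eq_0)
  \<comment> \<open>Written as k times a vector so that \<open>cone_deriv_scale\<close> applies; the
    radial component then drops out.\<close>
  have e: "l *s v + m *s a = k *s ((l / k) *s v + (m / k) *s a)"
    using k by (simp add: vector_add_ldistrib vector_smult_assoc)
  have "dS i (k *s a) (l *s v + m *s a) s = cone_deriv (G s) (k *s a) (l *s v + m *s a)"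
    by (rule dS_extension[OF W(4,5) ka _ _ vv s]) (use p W(2) X in auto)
  also have "\<dots> = cone_deriv (G s) a ((l / k) *s v + (m / k) *s a)"
    unfolding e by (rule cone_deriv_scale[OF G a W(2) k])
  also have "\<dots> = l / k * cone_deriv (G s) a v"
    unfolding cone_deriv_linear[OF G a W(2)] cone_deriv(2)[OF G a W(2)] cone_deriv_radial[OF G a W(2)] by simp
  also have "\<dots> = l / k * dS i a v s" unfolding dS_extension[OF W(4,5) a W(2) X v s] ..
  finally show ?thesis .
qed

text \<open>\<open>qq\<close> is quadratic in the tangent vector and sees it only modulo a. Both
  sides of the estimates below scale alike, which reduces them to unit frames.\<close>

lemma qq_scale:
  assumes i: "pt a \<in> triv L i" and a: "a ~= 0" and v: "v \<in> V (pt a)" and k: "k ~= 0" and T: "T \<subseteq> B \<union> Z"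
  shows "qq T i (k *s a) (l *s v + m *s a) = (cmod (l / k))\<^sup>2 * qq T i a v"
proof -
  note d = dS_scale[OF i a v k, of _ l m]
  have p: "pt (k *s a) = pt a" by (rule pt_scale[OF k a])
  have "conn i (k *s a) (l *s v + m *s a) = hratio B (\<lambda>s. s i (pt a)) (\<lambda>s. l / k * dS i a v s)"
    unfolding conn_def p by (rule hratio_cong) (use d in auto)
  then have c: "conn i (k *s a) (l *s v + m *s a) = l / k * conn i a v" unfolding hratio_scale conn_def .
  have "cov i (k *s a) (l *s v + m *s a) s = l / k * cov i a v s" if "s \<in> T" for s
  proof -
    have s: "s \<in> B \<union> Z" using that T by auto
    show ?thesis unfolding cov_def c d[OF s] p by (simp add: algebra_simps)
  qed
  then have "hsum T (cov i (k *s a) (l *s v + m *s a)) = (cmod (l / k))\<^sup>2 * hsum T (cov i a v)"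
    unfolding hsum_scale[symmetric] by (rule hsum_cong)
  then show ?thesis unfolding qq_def p by simp
qed

lemma tendsto_section:
  assumes i: "pt a0 \<in> triv L i" and a0: "a0 ~= 0" and h: "(h \<longlongrightarrow> a0) F"
    and ev: "eventually (\<lambda>x. h x ~= 0 \<and> pt (h x) \<in> X) F"
  shows "eventually (\<lambda>x. pt (h x) \<in> triv L i) F"
    "s \<in> B \<union> Z ==> ((\<lambda>x. s i (pt (h x))) \<longlongrightarrow> s i (pt a0)) F"
    "(k \<longlongrightarrow> v0) F ==> eventually (\<lambda>x. k x \<in> V (pt (h x))) F ==> v0 \<in> V (pt a0) ==> s \<in> B \<union> Z ==>
      ((\<lambda>x. dS i (h x) (k x) s) \<longlongrightarrow> dS i a0 v0 s) F"
proof -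
  obtain N where N: "open N" "triv L i = X \<inter> N" by (rule triv_open)
  have X: "pt a0 \<in> X" by (rule triv_subset[OF i])
  have "eventually (\<lambda>x. h x \<in> {a. a ~= 0 \<and> pt a \<in> N}) F"
    by (rule topological_tendstoD[OF h open_pt_vimage[OF N(1)]]) (use a0 N i in auto)
  then show "eventually (\<lambda>x. pt (h x) \<in> triv L i) F" using ev by eventually_elim (use N(2) in blast)
  show "((\<lambda>x. s i (pt (h x))) \<longlongrightarrow> s i (pt a0)) F" if s: "s \<in> B \<union> Z"
    by (rule holo_germ_tendsto(1)[OF section_germ[OF s i] a0 X h ev])
  show "((\<lambda>x. dS i (h x) (k x) s) \<longlongrightarrow> dS i a0 v0 s) F"
    if k: "(k \<longlongrightarrow> v0) F" and kV: "eventually (\<lambda>x. k x \<in> V (pt (h x))) F" and v0: "v0 \<in> V (pt a0)" and s: "s \<in> B \<union> Z"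
    by (rule germ_differential_tendsto[OF section_germ[OF s i] a0 X h ev k kV v0])
qed

text \<open>Here the base ideal hypothesis acts: elements of the stalk become combinations of the
  finitely many sections in Z, with coefficients that extend holomorphically to the ambient space
  and can therefore be differentiated.\<close>

lemma ideal_stalk_base:
  assumes g: "g \<in> ideal_stalk X I x" and x: "x \<in> triv L i"
  obtains W \<Gamma> where "open W" "x \<in> W" "\<forall>s\<in>Z. ambient_holomorphic W (\<Gamma> s)"
    "\<forall>y\<in>W \<inter> X. g y = (\<Sum>s\<in>Z. \<Gamma> s y * s i y)"
proof -
  have "g \<in> germ_ideal X x ((\<lambda>s. s i) ` subsystem_containing X L S I)"
    using base g x unfolding base_ideal_eq_def by blast
  then obtain n :: nat and c e W where ce: "\<forall>k<n. holo_germ X x (c k) \<and> e k \<in> (\<lambda>s. s i) ` subsystem_containing X L S I"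
    and W: "open W" "x \<in> W" "\<forall>y\<in>W \<inter> X. g y = (\<Sum>k<n. c k y * e k y)"
    unfolding germ_ideal_def by (elim CollectE exE conjE) (rule that)
  have "\<forall>k\<in>{..<n}. \<exists>r. \<forall>y. e k y = (\<Sum>s\<in>Z. r s * s i y)"
  proof
    fix k assume "k \<in> {..<n}"
    then obtain s where s: "s \<in> subsystem_containing X L S I" "e k = s i" using ce by auto
    obtain r where "\<forall>i x. s i x = (\<Sum>b\<in>Z. r b * b i x)"
      by (rule section_span_coords[OF finite_Z]) (use s(1) Z_span in auto)
    then show "\<exists>r. \<forall>y. e k y = (\<Sum>s\<in>Z. r s * s i y)" using s(2) by (intro exI[of _ r]) simp
  qed
  from bchoice[OF this] obtain r where r: "\<forall>k\<in>{..<n}. \<forall>y. e k y = (\<Sum>s\<in>Z. r k s * s i y)" by (elim exE)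
  show thesis
  proof (rule holo_germ_finite[where A = "{..<n}" and g = c and X = X and x = x])
    show "finite {..<n}" by simp
    show "holo_germ X x (c k)" if "k \<in> {..<n}" for k using ce that by auto
    fix W' C
    assume W': "open W'" "x \<in> W'" and C: "\<And>k. k \<in> {..<n} ==> ambient_holomorphic W' (C k)"
      "\<And>k y. k \<in> {..<n} ==> y \<in> W' \<inter> X ==> c k y = C k y"
    show thesis
    proof (rule that[of "W \<inter> W'" "\<lambda>s y. \<Sum>k<n. C k y * r k s"])
      show o: "open (W \<inter> W')" using W W' by blast
      show "x \<in> W \<inter> W'" using W W' by blast
      show "\<forall>s\<in>Z. ambient_holomorphic (W \<inter> W') (\<lambda>y. \<Sum>k<n. C k y * r k s)"
        by (intro ballI ambient_holomorphic_sum ambient_holomorphic_mult ambient_holomorphic_const o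
            ambient_holomorphic_subset[OF C(1)]) auto
      show "\<forall>y\<in>W \<inter> W' \<inter> X. g y = (\<Sum>s\<in>Z. (\<Sum>k<n. C k y * r k s) * s i y)"
      proof
        fix y assume y: "y \<in> W \<inter> W' \<inter> X"
        have "g y = (\<Sum>k<n. c k y * e k y)" using W(3) y by blast
        also have "\<dots> = (\<Sum>k<n. \<Sum>s\<in>Z. C k y * r k s * s i y)"
          using r C(2)[of _ y] y by (intro sum.cong refl) (simp add: sum_distrib_left mult.assoc)
        also have "\<dots> = (\<Sum>s\<in>Z. (\<Sum>k<n. C k y * r k s) * s i y)"
          unfolding sum_distrib_right by (rule sum.swap)
        finally show "g y = (\<Sum>s\<in>Z. (\<Sum>k<n. C k y * r k s) * s i y)" .
      qed
    qed
  qed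
qed

end

section \<open>Weil functions and linear systems\<close>

text \<open>\<phi> = O(Y) along the filter F. Sums, and products with convergent factors, preserve
  this for a fixed Y.\<close>

definition dominated :: "'x filter => ('x => real) => ('x => complex) => bool" where
  "dominated F Y \<phi> \<longleftrightarrow> (\<exists>M\<ge>0. \<forall>\<^sub>F x in F. cmod (\<phi> x) \<le> M * Y x)"

lemma dominatedE:
  assumes "dominated F Y \<phi>"
  obtains M where "0 \<le> M" "\<forall>\<^sub>F x in F. cmod (\<phi> x) \<le> M * Y x"
  using assms unfolding dominated_def by (elim exE conjE) (rule that)

lemma dominatedI: "0 \<le> M ==> \<forall>\<^sub>F x in F. cmod (\<phi> x) \<le> M * Y x ==> dominated F Y \<phi>"
  unfolding dominated_def by (intro exI[of _ M] conjI)

lemma dominated_add: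
  assumes "dominated F Y \<phi>" "dominated F Y \<psi>"
  shows "dominated F Y (\<lambda>x. \<phi> x + \<psi> x)"
proof -
  obtain M where M: "0 \<le> M" "\<forall>\<^sub>F x in F. cmod (\<phi> x) \<le> M * Y x" by (rule dominatedE[OF assms(1)])
  obtain M' where M': "0 \<le> M'" "\<forall>\<^sub>F x in F. cmod (\<psi> x) \<le> M' * Y x" by (rule dominatedE[OF assms(2)])
  show ?thesis
  proof (rule dominatedI[of "M + M'"])
    show "\<forall>\<^sub>F x in F. cmod (\<phi> x + \<psi> x) \<le> (M + M') * Y x" using M(2) M'(2)
    proof eventually_elim
      case (elim x)
      then show ?case using norm_triangle_ineq[of "\<phi> x" "\<psi> x"] by (simp add: distrib_right)
    qed
  qed (use M M' in simp)
qed

lemma dominated_zero: "dominated F Y (\<lambda>_. 0)"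
  by (rule dominatedI[of 0]) auto

lemma dominated_sum: "(\<And>k. k \<in> A ==> dominated F Y (\<phi> k)) ==> dominated F Y (\<lambda>x. \<Sum>k\<in>A. \<phi> k x)"
  by (induction A rule: infinite_finite_induct) (auto simp: dominated_zero intro: dominated_add)

lemma dominated_mult:
  assumes b: "(b \<longlongrightarrow> b0) F" and d: "dominated F Y \<phi>"
  shows "dominated F Y (\<lambda>x. b x * \<phi> x)"
proof -
  obtain M where M: "0 \<le> M" "\<forall>\<^sub>F x in F. cmod (\<phi> x) \<le> M * Y x" by (rule dominatedE[OF d])
  have "\<forall>\<^sub>F x in F. cmod (b x) < cmod b0 + 1" by (rule order_tendstoD(2)[OF tendsto_norm[OF b]]) simp
  then have "\<forall>\<^sub>F x in F. cmod (b x * \<phi> x) \<le> (cmod b0 + 1) * M * Y x" using M(2)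
  proof eventually_elim
    case (elim x)
    have "cmod (b x * \<phi> x) \<le> (cmod b0 + 1) * (M * Y x)"
      unfolding norm_mult by (rule mult_mono) (use elim in \<open>auto intro: less_imp_le\<close>)
    then show ?case by (simp add: mult.assoc)
  qed
  then show ?thesis by (rule dominatedI[rotated]) (use M in simp)
qed

lemma dominated_cong:
  assumes "dominated F Y \<phi>" "\<forall>\<^sub>F x in F. \<psi> x = \<phi> x"
  shows "dominated F Y \<psi>"
proof -
  obtain M where M: "0 \<le> M" "\<forall>\<^sub>F x in F. cmod (\<phi> x) \<le> M * Y x" by (rule dominatedE[OF assms(1)])
  show ?thesis by (rule dominatedI[OF M(1)]) (use M(2) assms(2) in eventually_elim, simp)
qed

lemma dominated_le: "(\<And>x. cmod (\<phi> x) \<le> Y x) ==> dominated F Y \<phi>"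
  by (rule dominatedI[of 1]) auto

lemma dominated_finite:
  assumes "finite A" "\<forall>k\<in>A. dominated F Y (\<phi> k)" and Y: "\<forall>x. 0 \<le> Y x"
  obtains M where "0 \<le> M" "\<forall>\<^sub>F x in F. \<forall>k\<in>A. cmod (\<phi> k x) \<le> M * Y x"
proof -
  have "\<forall>k\<in>A. \<exists>M\<ge>0. \<forall>\<^sub>F x in F. cmod (\<phi> k x) \<le> M * Y x" using assms(2) unfolding dominated_def by blast
  from bchoice[OF this] obtain M where M: "\<forall>k\<in>A. 0 \<le> M k \<and> (\<forall>\<^sub>F x in F. cmod (\<phi> k x) \<le> M k * Y x)" by (elim exE)
  show thesis
  proof (rule that[of "sum M A"])
    show "0 \<le> sum M A" using M by (intro sum_nonneg) auto
    have "\<forall>\<^sub>F x in F. \<forall>k\<in>A. cmod (\<phi> k x) \<le> M k * Y x"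
      by (rule eventually_ball_finite[OF assms(1)]) (use M in auto)
    then show "\<forall>\<^sub>F x in F. \<forall>k\<in>A. cmod (\<phi> k x) \<le> sum M A * Y x"
    proof eventually_elim
      case (elim x)
      show ?case
      proof
        fix k assume k: "k \<in> A"
        have "M k \<le> sum M A" by (rule member_le_sum[OF k _ assms(1)]) (use M in auto)
        then have "M k * Y x \<le> sum M A * Y x" using Y by (intro mult_right_mono) auto
        then show "cmod (\<phi> k x) \<le> sum M A * Y x" using elim k by force
      qed
    qed
  qed
qed

lemma weil_local:
  assumes "weil_function M I lam" "x \<in> M"
  obtains U gs b where "affine_open M U" "x \<in> U" "gs ~= []" "generates U I gs" "continuous_on U b"
    "\<forall>x\<in>U - supp M I. \<bar>lam x + ln (Max ((\<lambda>g. cmod (g x)) ` set gs))\<bar> \<le> b x"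
proof -
  obtain \<U> where U: "\<Union>\<U> = M" "\<forall>U\<in>\<U>. affine_open M U \<and>
        (\<exists>gs B. gs ~= [] \<and> generates U I gs \<and> continuous_on U B \<and>
           (\<forall>x\<in>U - supp M I. \<bar>lam x + ln (Max ((\<lambda>g. cmod (g x)) ` set gs))\<bar> \<le> B x))"
    using assms(1) unfolding weil_function_def by (elim conjE exE) (rule that)
  obtain U where x: "U \<in> \<U>" "x \<in> U" using U(1) assms(2) by blast
  show thesis using bspec[OF U(2) x(1)] by (elim conjE exE) (rule that[OF _ x(2)])
qed

lemma weil_bounds:
  fixes l m b :: real
  assumes "\<bar>l + ln m\<bar> \<le> b" "0 < m"
  shows "m\<^sup>2 \<le> exp (2 * b) * exp (- 2 * l)" "exp (- 2 * l) \<le> exp (2 * b) * m\<^sup>2"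
proof -
  have m: "m\<^sup>2 = exp (2 * ln m)" by (simp only: exp_double exp_ln[OF assms(2)])
  show "m\<^sup>2 \<le> exp (2 * b) * exp (- 2 * l)" "exp (- 2 * l) \<le> exp (2 * b) * m\<^sup>2"
    unfolding m exp_add[symmetric] using assms(1) by auto
qed

lemma unit_representative:
  obtains a where "norm a = 1" "x = pt (a :: complex^('n::finite))"
proof -
  obtain a where a: "a ~= 0" "x = pt a" by (rule cproj_cases)
  show thesis
  proof (rule that[of "of_real (1 / norm a) *s a"])
    show "norm (of_real (1 / norm a) *s a) = 1" unfolding norm_smult using a by (simp add: norm_divide)
    show "x = pt (of_real (1 / norm a) *s a)" using a pt_scale[of "of_real (1 / norm a)" a] by simp
  qed
qed

lemma section_in_stalk:
  assumes "zariski_open X U" "x \<in> U" "g \<in> I U"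
  shows "g \<in> ideal_stalk X I x"
  unfolding ideal_stalk_def germ_ideal_def
proof (intro CollectI exI conjI)
  show "\<forall>k<Suc 0. holo_germ X x ((\<lambda>_ _. 1) k) \<and> (\<lambda>_. g) k \<in> \<Union> {I U |U. zariski_open X U \<and> x \<in> U}"
    using assms ambient_holomorphic_const[of UNIV 1] unfolding holo_germ_def by blast
  show "open UNIV" "x \<in> UNIV" by auto
  show "\<forall>y\<in>UNIV \<inter> X. g y = (\<Sum>k<Suc 0. (\<lambda>_ _. 1) k y * (\<lambda>_. g) k y)" by simp
qed

text \<open>Cauchy--Schwarz gives the factor \<open>card Z\<close>, and (a + b)^2 \<le> 2 a^2 + 2
  b^2 the factor 2.\<close>

lemma sum_square_bound:
  assumes "finite Z"
  shows "(\<Sum>s\<in>Z. cmod (p s) + cmod (q s))\<^sup>2 \<le> 2 * real (card Z) * (hsum Z p + hsum Z q)"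
proof -
  have "(\<Sum>s\<in>Z. cmod (p s) + cmod (q s))\<^sup>2 \<le> (\<Sum>s\<in>Z. (cmod (p s) + cmod (q s))\<^sup>2) * card Z"
    by (rule sum_squared_le_sum_of_squares)
  also have "(\<Sum>s\<in>Z. (cmod (p s) + cmod (q s))\<^sup>2) \<le> (\<Sum>s\<in>Z. 2 * (cmod (p s))\<^sup>2 + 2 * (cmod (q s))\<^sup>2)"
  proof (rule sum_mono)
    fix s
    have "0 \<le> (cmod (p s) - cmod (q s))\<^sup>2" by simp
    then show "(cmod (p s) + cmod (q s))\<^sup>2 \<le> 2 * (cmod (p s))\<^sup>2 + 2 * (cmod (q s))\<^sup>2"
      by (simp add: power2_sum power2_diff)
  qed
  also have "\<dots> = 2 * (hsum Z p + hsum Z q)" by (simp add: hsum_def sum.distrib sum_distrib_left)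
  finally show ?thesis by (simp add: mult_right_mono mult_ac)
qed

lemma tendsto_flag_tensor:
  fixes h k :: "'x => complex^('n::finite)"
  assumes "(h \<longlongrightarrow> a0) F" "(k \<longlongrightarrow> v0) F"
  shows "((\<lambda>x. flag_tensor (h x) (k x)) \<longlongrightarrow> flag_tensor a0 v0) F"
proof (rule vec_tendstoI)
  fix t :: "'n \<times> 'n \<times> 'n"
  obtain i j l where t: "t = (i, j, l)" by (cases t)
  show "((\<lambda>x. vec_nth (flag_tensor (h x) (k x)) t) \<longlongrightarrow> vec_nth (flag_tensor a0 v0) t) F"
    unfolding t flag_tensor_nth by (intro tendsto_intros tendsto_vec_nth assms)
qed

section \<open>Weil functions compared with the sections in Z\<close>

context jet_separating_system
begin

text \<open>Sections in Z belong to the ideal, so locally they are dominated by the maximum of the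
  generators, which off the support is bounded by a constant times exp (- lam). Squaring gives the
  estimate near each point, and compactness of the unit cone gives a uniform constant.\<close>

lemma rho_weil_bound:
  assumes lam: "weil_function X I lam"
  shows "\<exists>C>0. \<forall>x\<in>X - supp X I. rho x \<le> C * exp (- 2 * lam x)"
proof -
  define P where "P C a \<longleftrightarrow> (pt a \<notin> supp X I --> rho (pt a) \<le> C * exp (- 2 * lam (pt a)))" for C a
  have "\<exists>C>0. \<forall>a\<in>{a. norm a = 1 \<and> pt a \<in> X}. P C a"
  proof (rule compact_uniform_constant[OF compact_unit_cone[OF closed_X]])
    fix C C' a assume "P C a" and C: "C \<le> C'"
    moreover have "C * exp (- 2 * lam (pt a)) \<le> C' * exp (- 2 * lam (pt a))" by (rule mult_right_mono[OF C]) simp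
    ultimately show "P C' a" unfolding P_def by linarith
  next
    fix a0 assume "a0 \<in> {a. norm a = 1 \<and> pt a \<in> X}"
    then have a0: "a0 ~= 0" "pt a0 \<in> X" by auto
    \<comment> \<open>The filter of approach to a0 through the cone over X.\<close>
    define F where "F = inf (nhds a0) (principal {a. a ~= 0 \<and> pt a \<in> X})"
    have h: "((\<lambda>a. a) \<longlongrightarrow> a0) F" unfolding filterlim_def filtermap_ident F_def by (rule inf_le1)
    have ev: "eventually (\<lambda>a. a ~= 0 \<and> pt a \<in> X) F" unfolding F_def eventually_inf_principal by simp
    obtain U gs b where U: "affine_open X U" "pt a0 \<in> U" and gs: "gs ~= []" "generates U I gs" and b: "continuous_on U b"
      "\<forall>x\<in>U - supp X I. \<bar>lam x + ln (Max ((\<lambda>g. cmod (g x)) ` set gs))\<bar> \<le> b x"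
      by (rule weil_local[OF lam a0(2)])
    have zU: "zariski_open X U" using U(1) by (simp add: affine_open_def)
    define i where "i = idx (pt a0)"
    have i: "pt a0 \<in> triv L i" unfolding i_def by (rule idx[OF a0(2)])
    define Y where "Y a = Max ((\<lambda>g. cmod (g (pt a))) ` set gs)" for a
    have Yge: "cmod (g (pt a)) \<le> Y a" if "g \<in> set gs" for g a unfolding Y_def by (rule Max_ge) (use that in auto)
    obtain g0 where g0: "g0 \<in> set gs" using gs(1) by (cases gs) auto
    have Y0: "0 \<le> Y a" for a using Yge[OF g0, of a] norm_ge_zero[of "g0 (pt a)"] by linarith
    have dom: "dominated F Y (\<lambda>a. s i (pt a))" if s: "s \<in> Z" for s
    proof -
      have "s i \<in> ideal_stalk X I (pt a0)" using Z_sub s i unfolding subsystem_containing_def by blast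
      then obtain n :: nat and c e W where ce: "\<forall>k<n. holo_germ X (pt a0) (c k) \<and> e k \<in> \<Union>{I U | U. zariski_open X U \<and> pt a0 \<in> U}"
        and W: "open W" "pt a0 \<in> W" "\<forall>y\<in>W \<inter> X. s i y = (\<Sum>k<n. c k y * e k y)"
        unfolding ideal_stalk_def germ_ideal_def by (elim CollectE exE conjE) (rule that)
      have e: "dominated F Y (\<lambda>a. e k (pt a))" if k: "k < n" for k
      proof -
        obtain U' where U': "zariski_open X U'" "pt a0 \<in> U'" "e k \<in> I U'" using ce k by blast
        obtain W' c' where W': "zariski_open X W'" "pt a0 \<in> W'" "W' \<subseteq> U \<inter> U'" "\<forall>k<length gs. regular_on W' (c' k)"
          "\<forall>v\<in>W'. e k v = (\<Sum>k<length gs. c' k v * (gs ! k) v)"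
          by (rule generates_stalk[OF scheme U(1) gs(2) U(2) U'(2,1,3)])
        have evW': "eventually (\<lambda>a. pt a \<in> W') F" by (rule zariski_open_eventually[OF W'(1) a0(1) W'(2) h ev])
        have evW2: "eventually (\<lambda>a. a ~= 0 \<and> pt a \<in> W') F" using evW' ev by eventually_elim simp
        have "dominated F Y (\<lambda>a. \<Sum>l<length gs. c' l (pt a) * (gs ! l) (pt a))"
        proof (intro dominated_sum)
          fix l assume "l \<in> {..<length gs}"
          then have l: "l < length gs" by simp
          show "dominated F Y (\<lambda>a. c' l (pt a) * (gs ! l) (pt a))"
            by (rule dominated_mult[OF regular_on_tendsto[OF _ a0(1) W'(2) h evW2] dominated_le])
              (use W'(4) l Yge in auto)
        qed
        then show ?thesis by (rule dominated_cong) (use evW' in eventually_elim, use W'(5) in blast)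
      qed
      have "eventually (\<lambda>a. a \<in> {a. a ~= 0 \<and> pt a \<in> W}) F"
        by (rule topological_tendstoD[OF h open_pt_vimage[OF W(1)]]) (use a0 W in auto)
      then have evW: "eventually (\<lambda>a. s i (pt a) = (\<Sum>k<n. c k (pt a) * e k (pt a))) F"
        using ev by eventually_elim (use W(3) in blast)
      have "dominated F Y (\<lambda>a. \<Sum>k<n. c k (pt a) * e k (pt a))"
        by (intro dominated_sum dominated_mult[OF holo_germ_tendsto(1)[OF _ a0 h ev]]) (use ce e in auto)
      then show ?thesis using evW by (rule dominated_cong)
    qed
    obtain M where M: "0 \<le> M" "\<forall>\<^sub>F a in F. \<forall>s\<in>Z. cmod (s i (pt a)) \<le> M * Y a"
      by (rule dominated_finite[where \<phi> = "\<lambda>s a. s i (pt a)" and F = F and Y = Y, OF finite_Z]) (use dom Y0 in auto)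
    define H where "H a = hsum B (\<lambda>s. s i (pt a))" for a
    have H0: "H a0 > 0" unfolding H_def by (rule hsum_pos[OF i])
    have "(H \<longlongrightarrow> H a0) F"
      unfolding H_def by (intro tendsto_hsum tendsto_section(2)[OF i a0(1) h ev]) auto
    then have evH: "\<forall>\<^sub>F a in F. H a0 / 2 < H a" by (rule order_tendstoD) (use H0 in simp)
    have evU: "eventually (\<lambda>a. pt a \<in> U) F" by (rule zariski_open_eventually[OF zU a0(1) U(2) h ev])
    have "((\<lambda>a. pt a) \<longlongrightarrow> pt a0) F"
      by (rule continuous_on_tendsto_compose[OF pt_continuous h]) (use a0 ev in \<open>auto elim: eventually_mono\<close>)
    then have "((\<lambda>a. b (pt a)) \<longlongrightarrow> b (pt a0)) F"
      by (rule continuous_on_tendsto_compose[OF b(1) _ U(2) evU])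
    then have evb: "\<forall>\<^sub>F a in F. b (pt a) < b (pt a0) + 1" by (rule order_tendstoD) simp
    define C where "C = real (card Z) * M\<^sup>2 / (H a0 / 2) * exp (2 * (b (pt a0) + 1))"
    have "\<forall>\<^sub>F a in F. P C a"
      using M(2) evH evU evb tendsto_section(1)[OF i a0(1) h ev]
    proof eventually_elim
      case (elim a)
      show "P C a" unfolding P_def
      proof
        assume ns: "pt a \<notin> supp X I"
        have "hsum Z (\<lambda>s. s i (pt a)) \<le> (\<Sum>s\<in>Z. (M * Y a)\<^sup>2)"
          unfolding hsum_def by (intro sum_mono power_mono) (use elim in auto)
        then have hZ: "hsum Z (\<lambda>s. s i (pt a)) \<le> real (card Z) * M\<^sup>2 * (Y a)\<^sup>2" by (simp add: power_mult_distrib mult_ac)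
        have "rho (pt a) = hsum Z (\<lambda>s. s i (pt a)) / H a" unfolding H_def by (rule rho_index) (use elim in auto)
        also have "\<dots> \<le> real (card Z) * M\<^sup>2 * (Y a)\<^sup>2 / (H a0 / 2)"
          by (rule frac_le) (use hZ elim H0 in auto)
        finally have r: "rho (pt a) \<le> real (card Z) * M\<^sup>2 / (H a0 / 2) * (Y a)\<^sup>2" by (simp add: mult_ac)
        have "(Y a)\<^sup>2 \<le> exp (2 * (b (pt a0) + 1)) * exp (- 2 * lam (pt a))"
        \<comment> \<open>With \<open>ln 0\<close> equal to 0 the Weil bound does not control Y
          where all generators vanish, but there the left side is 0.\<close>
        proof (cases "Y a = 0")
          case False
          then have "0 < Y a" using Y0[of a] by simp
          moreover have "\<bar>lam (pt a) + ln (Y a)\<bar> \<le> b (pt a)" using b(2) elim ns unfolding Y_def by blast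
          then have "\<bar>lam (pt a) + ln (Y a)\<bar> \<le> b (pt a0) + 1" using elim by linarith
          ultimately show ?thesis by (intro weil_bounds(1))
        qed simp
        then have "real (card Z) * M\<^sup>2 / (H a0 / 2) * (Y a)\<^sup>2 \<le>
            real (card Z) * M\<^sup>2 / (H a0 / 2) * (exp (2 * (b (pt a0) + 1)) * exp (- 2 * lam (pt a)))"
          by (rule mult_left_mono) (use H0 in simp)
        then show "rho (pt a) \<le> C * exp (- 2 * lam (pt a))" using r by (simp add: C_def mult.assoc)
      qed
    qed
    then have "\<forall>\<^sub>F a in nhds a0. a \<in> {a. a ~= 0 \<and> pt a \<in> X} --> P C a" unfolding F_def eventually_inf_principal .
    then have "\<forall>\<^sub>F a in nhds a0. a \<in> {a. norm a = 1 \<and> pt a \<in> X} --> P C a"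
      by (rule eventually_mono) auto
    then show "\<exists>C. \<forall>\<^sub>F a in nhds a0. a \<in> {a. norm a = 1 \<and> pt a \<in> X} --> P C a" by (rule exI)
  qed
  then obtain C where C: "C > 0" "\<forall>a\<in>{a. norm a = 1 \<and> pt a \<in> X}. P C a" by (elim exE conjE)
  show ?thesis
  proof (intro exI[of _ C] conjI ballI C(1))
    fix x assume x: "x \<in> X - supp X I"
    obtain a where "norm a = 1" "x = pt a" by (rule unit_representative)
    then show "rho x \<le> C * exp (- 2 * lam x)" using C(2) x unfolding P_def by blast
  qed
qed

text \<open>Leibniz' rule: the differential of a combination of sections in Z involves only these
  sections and their differentials. This is the direction in which the ideal of the subscheme must
  be contained in the base ideal.\<close>

lemma stalk_dominated:
  assumes i: "pt a0 \<in> triv L i" and a0: "a0 ~= 0" and h: "(h \<longlongrightarrow> a0) F"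
    and ev: "eventually (\<lambda>x. h x ~= 0 \<and> pt (h x) \<in> X) F"
    and k: "(k \<longlongrightarrow> v0) F" and kV: "eventually (\<lambda>x. k x \<in> V (pt (h x))) F"
    and g: "g \<in> ideal_stalk X I (pt a0)"
    and S: "\<forall>s\<in>Z. dominated F Y (\<lambda>x. s i (pt (h x)))"
    and D: "\<forall>s\<in>Z. dominated F Y (\<lambda>x. dS i (h x) (k x) s)"
  shows "dominated F Y (\<lambda>x. g (pt (h x)))" "dominated F Y (\<lambda>x. differential X g (h x) (k x))"
proof -
  obtain W \<Gamma> where W: "open W" "pt a0 \<in> W" "\<forall>s\<in>Z. ambient_holomorphic W (\<Gamma> s)"
    "\<forall>y\<in>W \<inter> X. g y = (\<Sum>s\<in>Z. \<Gamma> s y * s i y)" by (rule ideal_stalk_base[OF g i])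
  obtain W' G where W': "open W'" "pt a0 \<in> W'" "W' \<inter> X \<subseteq> triv L i"
    "\<forall>s\<in>B \<union> Z. ambient_holomorphic W' (G s)" "\<forall>s\<in>B \<union> Z. \<forall>y\<in>W' \<inter> X. s i y = G s y"
    by (rule local_extension[OF i])
  have o: "open (W \<inter> W')" using W W' by blast
  have "eventually (\<lambda>x. h x \<in> {a. a ~= 0 \<and> pt a \<in> W \<inter> W'}) F"
    by (rule topological_tendstoD[OF h open_pt_vimage[OF o]]) (use a0 W W' in auto)
  then have evW: "eventually (\<lambda>x. h x ~= 0 \<and> pt (h x) \<in> W \<inter> W' \<and> pt (h x) \<in> X) F" using ev by eventually_elim auto
  have \<Gamma>: "ambient_holomorphic W (\<Gamma> s)" if "s \<in> Z" for s using W(3) that by blast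
  have "dominated F Y (\<lambda>x. \<Sum>s\<in>Z. \<Gamma> s (pt (h x)) * s i (pt (h x)))"
    by (intro dominated_sum dominated_mult[OF ambient_holomorphic_tendsto[OF \<Gamma> a0 W(2) h]] bspec[OF S])
  then show "dominated F Y (\<lambda>x. g (pt (h x)))"
    by (rule dominated_cong) (use evW in eventually_elim, use W(4) in blast)
  have "dominated F Y (\<lambda>x. \<Sum>s\<in>Z. \<Gamma> s (pt (h x)) * dS i (h x) (k x) s + cone_deriv (\<Gamma> s) (h x) (k x) * s i (pt (h x)))"
    by (intro dominated_sum dominated_add dominated_mult[OF ambient_holomorphic_tendsto[OF \<Gamma> a0 W(2) h]] bspec[OF D]
        dominated_mult[OF cone_deriv_tendsto[OF \<Gamma> a0 W(2) h k]] bspec[OF S])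
  moreover have "eventually (\<lambda>x. differential X g (h x) (k x) =
      (\<Sum>s\<in>Z. \<Gamma> s (pt (h x)) * dS i (h x) (k x) s + cone_deriv (\<Gamma> s) (h x) (k x) * s i (pt (h x)))) F"
    using evW kV
  proof eventually_elim
    case (elim x)
    have x: "h x ~= 0" "pt (h x) \<in> W \<inter> W'" "pt (h x) \<in> X" using elim by auto
    have ex: "\<forall>s\<in>Z. ambient_holomorphic (W \<inter> W') (\<Gamma> s)" "\<forall>s\<in>Z. ambient_holomorphic (W \<inter> W') (G s)"
      using ambient_holomorphic_subset[OF \<Gamma> o] ambient_holomorphic_subset[OF _ o, of W'] W'(4) by blast+
    have gg: "\<forall>y\<in>W \<inter> W' \<inter> X. g y = (\<Sum>s\<in>Z. \<Gamma> s y * G s y)" using W(4) W'(5) by simp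
    have t: "k x \<in> affine_tangent X (pt (h x))" using holomorphic_subbundle_tangent(2)[OF subbundle x(3)] elim by blast
    show ?case unfolding differential_sum_prod[OF o ex x(1,2) gg t]
    proof (rule sum.cong[OF refl])
      fix s assume "s \<in> Z"
      then have s: "s \<in> B \<union> Z" by simp
      have "cone_deriv (G s) (h x) (k x) = dS i (h x) (k x) s"
        by (rule dS_extension[OF W'(4,5) x(1) _ x(3) _ s, symmetric]) (use x elim in auto)
      moreover have "G s (pt (h x)) = s i (pt (h x))" using W'(5) s x by simp
      ultimately show "\<Gamma> s (pt (h x)) * cone_deriv (G s) (h x) (k x) + cone_deriv (\<Gamma> s) (h x) (k x) * G s (pt (h x)) =
          \<Gamma> s (pt (h x)) * dS i (h x) (k x) s + cone_deriv (\<Gamma> s) (h x) (k x) * s i (pt (h x))" by simp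
    qed
  qed
  ultimately show "dominated F Y (\<lambda>x. differential X g (h x) (k x))" by (rule dominated_cong)
qed

text \<open>In a chart the section is a combination of generators of I and of their differentials
  divided by that of h. All coefficients, including this inverse, converge, and
  \<open>stalk_dominated\<close> applies to the generators.\<close>

lemma jet_dominated:
  assumes i: "pt a0 \<in> triv L i" and a0: "a0 ~= 0" and h: "(h \<longlongrightarrow> a0) F"
    and ev: "eventually (\<lambda>x. h x ~= 0 \<and> pt (h x) \<in> X) F"
    and k: "(k \<longlongrightarrow> v0) F" and kV: "eventually (\<lambda>x. k x \<in> V (pt (h x)) \<and> k x \<notin> line_of (pt (h x))) F"
    and v0: "v0 \<in> V (pt a0)" "v0 \<notin> line_of (pt a0)"
    and U1: "flag_pt a0 v0 \<in> U1" and g: "g \<in> jet_ideal X V I U1"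
    and S: "\<forall>s\<in>Z. dominated F Y (\<lambda>x. s i (pt (h x)))"
    and D: "\<forall>s\<in>Z. dominated F Y (\<lambda>x. dS i (h x) (k x) s)"
  shows "dominated F Y (\<lambda>x. g (flag_pt (h x) (k x)))"
proof (rule jet_ideal_chart[OF g U1])
  have X: "pt a0 \<in> X" by (rule triv_subset[OF i])
  fix U zs h' W b c
  assume ch: "jet_chart X V I U zs h' W" and p: "flag_pt a0 v0 \<in> W" "W \<subseteq> U1"
    and bc: "\<And>k. k < length zs ==> regular_on W (b k) \<and> regular_on W (c k)"
    and gW: "\<And>a v. a ~= 0 ==> pt a \<in> X ==> v \<in> V (pt a) ==> v \<notin> line_of (pt a) ==> flag_pt a v \<in> W ==>
       g (flag_pt a v) = (\<Sum>k<length zs. b k (flag_pt a v) * (zs ! k) (pt a)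
                + c k (flag_pt a v) * (differential X (zs ! k) a v / differential X h' a v))"
  have U: "zariski_open X U" "generates U I zs" "regular_on U h'" "zariski_open (PV X V) W"
    using ch by (auto simp: jet_chart_def affine_open_def)
  have 0: "pt a0 \<in> U" "differential X h' a0 v0 ~= 0"
    using ch a0 X v0 p(1) unfolding jet_chart_def by blast+
  define t where "t x = flag_tensor (h x) (k x)" for x
  have t: "(t \<longlongrightarrow> flag_tensor a0 v0) F" unfolding t_def by (rule tendsto_flag_tensor[OF h k])
  have t0: "flag_tensor a0 v0 ~= 0" "pt (flag_tensor a0 v0) \<in> W"
    using flag_tensor_nonzero[OF a0 v0(2)] p by (auto simp: flag_pt_eq)
  have evt: "eventually (\<lambda>x. t x ~= 0 \<and> pt (t x) \<in> PV X V) F" using ev kV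
  proof eventually_elim
    case (elim x)
    then show ?case using flag_tensor_nonzero[of "h x" "k x"] unfolding t_def flag_pt_eq[symmetric] PV_def by blast
  qed
  have evW: "eventually (\<lambda>x. pt (t x) \<in> W) F" by (rule zariski_open_eventually[OF U(4) t0 t evt])
  have evW': "eventually (\<lambda>x. t x ~= 0 \<and> pt (t x) \<in> W) F" using evt evW by eventually_elim simp
  have kV': "eventually (\<lambda>x. k x \<in> V (pt (h x))) F" using kV by eventually_elim simp
  have lim: "((\<lambda>x. r (flag_pt (h x) (k x))) \<longlongrightarrow> r (flag_pt a0 v0)) F" if "regular_on W r" for r
    using regular_on_tendsto[OF that t0 t evW'] unfolding t_def flag_pt_eq .
  have dh: "((\<lambda>x. differential X h' (h x) (k x)) \<longlongrightarrow> differential X h' a0 v0) F"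
    by (rule germ_differential_tendsto[OF regular_on_holo_germ[OF U(1,3) 0(1)] a0 X h ev k kV' v0(1)])
  have "dominated F Y (\<lambda>x. \<Sum>l<length zs. b l (flag_pt (h x) (k x)) * (zs ! l) (pt (h x))
      + (c l (flag_pt (h x) (k x)) * inverse (differential X h' (h x) (k x))) * differential X (zs ! l) (h x) (k x))"
  proof (intro dominated_sum dominated_add)
    fix l assume "l \<in> {..<length zs}"
    then have l: "l < length zs" by simp
    note sd = stalk_dominated[OF i a0 h ev k kV' section_in_stalk[where I = I, OF U(1) 0(1) generates_mem[OF U(2) l]] S D]
    show "dominated F Y (\<lambda>x. b l (flag_pt (h x) (k x)) * (zs ! l) (pt (h x)))"
      by (rule dominated_mult[OF lim]) (use bc l sd in auto)
    have cl: "regular_on W (c l)" using bc l by blast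
    show "dominated F Y (\<lambda>x. (c l (flag_pt (h x) (k x)) * inverse (differential X h' (h x) (k x))) * differential X (zs ! l) (h x) (k x))"
      by (rule dominated_mult[where b = "\<lambda>x. c l (flag_pt (h x) (k x)) * inverse (differential X h' (h x) (k x))",
            OF tendsto_mult[OF lim[OF cl] tendsto_inverse[OF dh 0(2)]] sd(2)])
  qed
  moreover have "eventually (\<lambda>x. g (flag_pt (h x) (k x)) = (\<Sum>l<length zs. b l (flag_pt (h x) (k x)) * (zs ! l) (pt (h x))
      + (c l (flag_pt (h x) (k x)) * inverse (differential X h' (h x) (k x))) * differential X (zs ! l) (h x) (k x))) F"
    using ev kV evW
  proof eventually_elim
    case (elim x)
    then have "flag_pt (h x) (k x) \<in> W" by (simp add: t_def flag_pt_eq)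
    then show ?case using gW[of "h x" "k x"] elim by (simp add: divide_inverse mult_ac)
  qed
  ultimately show ?thesis by (rule dominated_cong)
qed

end

section \<open>Estimates along the curve\<close>

context jet_separating_system
begin

text \<open>Generators of the jet ideal are O(Y) with Y the sum of |s| and |cov s| over Z, hence exp
  (- 2 lam1) is locally at most a constant times \<open>rho\<close> + \<open>qq Z\<close>.
  Multiplying by the locally bounded \<open>qq B\<close> and simplifying produces a form in which
  both sides are homogeneous of degree 2 in the tangent vector.\<close>

lemma jet_weil_bound:
  assumes lam1: "weil_function (PV X V) (jet_ideal X V I) lam1"
  shows "\<exists>C>0. \<forall>p\<in>unit_frames X V. pt (fst p) \<notin> supp X I -->
    exp (- 2 * lam1 (flag_pt (fst p) (snd p))) * qq B (idx (pt (fst p))) (fst p) (snd p)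
     \<le> C * (rho (pt (fst p)) * qq B (idx (pt (fst p))) (fst p) (snd p) + qq Z (idx (pt (fst p))) (fst p) (snd p))"
proof -
  define P where "P C p \<longleftrightarrow> (pt (fst p) \<notin> supp X I -->
    exp (- 2 * lam1 (flag_pt (fst p) (snd p))) * qq B (idx (pt (fst p))) (fst p) (snd p)
     \<le> C * (rho (pt (fst p)) * qq B (idx (pt (fst p))) (fst p) (snd p) + qq Z (idx (pt (fst p))) (fst p) (snd p)))"
    for C and p :: "(complex^'n) \<times> (complex^'n)"
  have uf: "fst p ~= 0 \<and> pt (fst p) \<in> X \<and> snd p \<in> V (pt (fst p)) \<and> snd p \<notin> line_of (pt (fst p))"
    if "p \<in> unit_frames X V" for p
  proof -
    have p: "(fst p, snd p) \<in> unit_frames X V" using that by simp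
    show ?thesis using unit_frames_not_line[OF p] p unfolding unit_frames_def by (simp add: case_prod_beta)
  qed
  have "\<exists>C>0. \<forall>p\<in>unit_frames X V. P C p"
  proof (rule compact_uniform_constant[OF compact_unit_frames[OF closed_X subbundle]])
    fix C C' p assume P: "P C p" and C: "C \<le> C'"
    have "0 \<le> rho (pt (fst p)) * qq B (idx (pt (fst p))) (fst p) (snd p) + qq Z (idx (pt (fst p))) (fst p) (snd p)"
      by (intro add_nonneg_nonneg mult_nonneg_nonneg qq_nonneg rho_nonneg)
    from mult_right_mono[OF C this] show "P C' p" using P unfolding P_def by linarith
  next
    fix p0 assume p0: "p0 \<in> unit_frames X V"
    define a0 v0 where "a0 = fst p0" and "v0 = snd p0"
    have a0: "a0 ~= 0" "pt a0 \<in> X" and v0: "v0 \<in> V (pt a0)" "v0 \<notin> line_of (pt a0)"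
      using uf[OF p0] unfolding a0_def v0_def by auto
    define F where "F = inf (nhds p0) (principal (unit_frames X V))"
    have "((\<lambda>p. p) \<longlongrightarrow> p0) F" unfolding filterlim_def filtermap_ident F_def by (rule inf_le1)
    from tendsto_fst[OF this] tendsto_snd[OF this]
    have h: "(fst \<longlongrightarrow> a0) F" and k: "(snd \<longlongrightarrow> v0) F" unfolding a0_def v0_def by simp_all
    have evu: "eventually (\<lambda>p. p \<in> unit_frames X V) F" unfolding F_def eventually_inf_principal by simp
    have ev: "eventually (\<lambda>p. fst p ~= 0 \<and> pt (fst p) \<in> X) F" using evu by eventually_elim (use uf in blast)
    have kV: "eventually (\<lambda>p. snd p \<in> V (pt (fst p)) \<and> snd p \<notin> line_of (pt (fst p))) F"
      using evu by eventually_elim (use uf in blast)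
    have kV': "eventually (\<lambda>p. snd p \<in> V (pt (fst p))) F" using kV by eventually_elim simp
    define i where "i = idx (pt a0)"
    have i: "pt a0 \<in> triv L i" unfolding i_def by (rule idx[OF a0(2)])
    have evi: "eventually (\<lambda>p. pt (fst p) \<in> triv L i) F" by (rule tendsto_section(1)[OF i a0(1) h ev])
    note ts = tendsto_section(2)[OF i a0(1) h ev] and td = tendsto_section(3)[OF i a0(1) h ev k kV' v0(1)]
    have hB: "((\<lambda>p. hsum B (\<lambda>s. s i (pt (fst p)))) \<longlongrightarrow> hsum B (\<lambda>s. s i (pt a0))) F"
      by (rule tendsto_hsum) (rule ts, simp)
    have cn: "((\<lambda>p. conn i (fst p) (snd p)) \<longlongrightarrow> conn i a0 v0) F"
      unfolding conn_def
    proof (rule tendsto_hratio)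
      show "((\<lambda>p. s i (pt (fst p))) \<longlongrightarrow> s i (pt a0)) F" if "s \<in> B" for s by (rule ts) (use that in simp)
      show "((\<lambda>p. dS i (fst p) (snd p) s) \<longlongrightarrow> dS i a0 v0 s) F" if "s \<in> B" for s by (rule td) (use that in simp)
    qed (rule hsum_nz[OF i])
    have tc: "((\<lambda>p. cov i (fst p) (snd p) s) \<longlongrightarrow> cov i a0 v0 s) F" if "s \<in> B \<union> Z" for s
      unfolding cov_def by (intro tendsto_diff tendsto_mult cn ts td that)
    have qB: "((\<lambda>p. qq B i (fst p) (snd p)) \<longlongrightarrow> qq B i a0 v0) F"
      unfolding qq_def by (intro tendsto_divide hB hsum_nz[OF i] tendsto_hsum tc) simp
    \<comment> \<open>Covariant derivatives may replace \<open>dS\<close> here: the two differ by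
      the convergent factor \<open>conn\<close> times the section.\<close>
    define Y where "Y p = (\<Sum>s\<in>Z. cmod (s i (pt (fst p))) + cmod (cov i (fst p) (snd p) s))" for p
    have Y0: "0 \<le> Y p" for p unfolding Y_def by (intro sum_nonneg) simp
    have Yge: "cmod (s i (pt (fst p))) + cmod (cov i (fst p) (snd p) s) \<le> Y p" if "s \<in> Z" for s p
      unfolding Y_def by (rule member_le_sum[OF that _ finite_Z]) simp
    have S: "dominated F Y (\<lambda>p. s i (pt (fst p)))" if "s \<in> Z" for s
    proof (rule dominated_le)
      fix p show "cmod (s i (pt (fst p))) \<le> Y p"
        using Yge[OF that, of p] norm_ge_zero[of "cov i (fst p) (snd p) s"] by linarith
    qed
    have Dc: "dominated F Y (\<lambda>p. cov i (fst p) (snd p) s)" if "s \<in> Z" for s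
    proof (rule dominated_le)
      fix p show "cmod (cov i (fst p) (snd p) s) \<le> Y p"
        using Yge[OF that, of p] norm_ge_zero[of "s i (pt (fst p))"] by linarith
    qed
    have D: "dominated F Y (\<lambda>p. dS i (fst p) (snd p) s)" if "s \<in> Z" for s
    proof -
      have "dominated F Y (\<lambda>p. cov i (fst p) (snd p) s + conn i (fst p) (snd p) * s i (pt (fst p)))"
        by (intro dominated_add Dc dominated_mult[OF cn] S that)
      then show ?thesis by (simp add: cov_def)
    qed
    have "flag_pt a0 v0 \<in> PV X V" using a0 v0 unfolding PV_def by blast
    then obtain U gs b where U: "affine_open (PV X V) U" "flag_pt a0 v0 \<in> U" and gs: "gs ~= []" "generates U (jet_ideal X V I) gs"
      and b: "continuous_on U b"
      "\<forall>x\<in>U - supp (PV X V) (jet_ideal X V I). \<bar>lam1 x + ln (Max ((\<lambda>g. cmod (g x)) ` set gs))\<bar> \<le> b x"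
      by (rule weil_local[OF lam1])
    have zU: "zariski_open (PV X V) U" using U(1) by (simp add: affine_open_def)
    have gI: "g \<in> jet_ideal X V I U" if g: "g \<in> set gs" for g
    proof -
      obtain l where "l < length gs" "g = gs ! l" using g by (auto simp: in_set_conv_nth)
      then show ?thesis using generates_mem[OF gs(2)] by blast
    qed
    define m where "m p = Max ((\<lambda>g. cmod (g (flag_pt (fst p) (snd p)))) ` set gs)" for p
    have dg: "dominated F Y (\<lambda>p. g (flag_pt (fst p) (snd p)))" if "g \<in> set gs" for g
      by (rule jet_dominated[OF i a0(1) h ev k kV v0 U(2) gI[OF that]]) (use S D in blast)+
    obtain M where M: "0 \<le> M" "\<forall>\<^sub>F p in F. \<forall>g\<in>set gs. cmod (g (flag_pt (fst p) (snd p))) \<le> M * Y p"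
      by (rule dominated_finite[where \<phi> = "\<lambda>g p. g (flag_pt (fst p) (snd p))" and F = F and Y = Y and A = "set gs"]) (use dg Y0 in auto)
    define t where "t p = flag_tensor (fst p) (snd p)" for p :: "(complex^'n) \<times> (complex^'n)"
    have t: "(t \<longlongrightarrow> flag_tensor a0 v0) F" unfolding t_def by (rule tendsto_flag_tensor[OF h k])
    have t0: "flag_tensor a0 v0 ~= 0" "pt (flag_tensor a0 v0) \<in> U"
      using flag_tensor_nonzero[OF a0(1) v0(2)] U(2) by (auto simp: flag_pt_eq)
    have evt: "eventually (\<lambda>p. t p ~= 0 \<and> pt (t p) \<in> PV X V) F" using ev kV
    proof eventually_elim
      case (elim p)
      then show ?case using flag_tensor_nonzero[of "fst p" "snd p"] unfolding t_def flag_pt_eq[symmetric] PV_def by blast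
    qed
    have evU: "eventually (\<lambda>p. pt (t p) \<in> U) F" by (rule zariski_open_eventually[OF zU t0 t evt])
    have "((\<lambda>p. pt (t p)) \<longlongrightarrow> pt (flag_tensor a0 v0)) F"
      by (rule continuous_on_tendsto_compose[OF pt_continuous t]) (use t0 evt in \<open>auto elim: eventually_mono\<close>)
    then have "((\<lambda>p. b (pt (t p))) \<longlongrightarrow> b (pt (flag_tensor a0 v0))) F"
      by (rule continuous_on_tendsto_compose[OF b(1) _ t0(2) evU])
    then have evb: "\<forall>\<^sub>F p in F. b (pt (t p)) < b (pt (flag_tensor a0 v0)) + 1" by (rule order_tendstoD) simp
    define b1 H1 q1 where "b1 = b (pt (flag_tensor a0 v0)) + 1" and "H1 = hsum B (\<lambda>s. s i (pt a0)) + 1" and "q1 = qq B i a0 v0 + 1"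
    have evH: "\<forall>\<^sub>F p in F. hsum B (\<lambda>s. s i (pt (fst p))) < H1" unfolding H1_def by (rule order_tendstoD(2)[OF hB]) simp
    have evq: "\<forall>\<^sub>F p in F. qq B i (fst p) (snd p) < q1" unfolding q1_def by (rule order_tendstoD(2)[OF qB]) simp
    have q1: "1 \<le> q1" unfolding q1_def using qq_nonneg by simp
    define K where "K = exp (2 * b1) * (M\<^sup>2 * (2 * real (card Z) * H1))"
    have H1: "0 \<le> H1" unfolding H1_def using hsum_nonneg[of B] by (simp add: add_nonneg_nonneg)
    have K: "0 \<le> K" unfolding K_def using H1 by simp
    have "\<forall>\<^sub>F p in F. P (K * q1) p"
      using M(2) evH evq evU evb evu evi
    proof eventually_elim
      case (elim p)
      define a v where "a = fst p" and "v = snd p"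
      have av: "a ~= 0" "pt a \<in> X" "v \<in> V (pt a)" "v \<notin> line_of (pt a)" using uf[of p] elim unfolding a_def v_def by auto
      have ai: "pt a \<in> triv L i" using elim unfolding a_def by blast
      note j = idx[OF av(2)]
      define f where "f = flag_pt a v"
      have fU: "f \<in> U" using elim unfolding f_def a_def v_def t_def flag_pt_eq by blast
      define H where "H = hsum B (\<lambda>s. s i (pt a))"
      have H: "0 < H" "H \<le> H1" unfolding H_def using hsum_pos[OF ai] elim by (auto simp: a_def)
      define r qB qZ where "r = rho (pt a)" and "qB = qq B i a v" and "qZ = qq Z i a v"
      have nn: "0 \<le> r" "0 \<le> qB" "0 \<le> qZ" unfolding r_def qB_def qZ_def by (rule rho_nonneg qq_nonneg)+
      have qi: "qq B (idx (pt a)) a v = qB" "qq Z (idx (pt a)) a v = qZ"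
        unfolding qB_def qZ_def by (rule qq_index[OF j ai av(1,3)], simp)+
      show "P (K * q1) p" unfolding P_def a_def[symmetric] v_def[symmetric] f_def[symmetric] qi r_def[symmetric]
      proof
        assume ns: "pt a \<notin> supp X I"
        \<comment> \<open>Without a non-vanishing generator \<open>ln (m p)\<close> would be
          \<open>ln 0\<close>, and the Weil bound would not relate lam1 to the size of the
          generators.\<close>
        have "\<exists>g\<in>set gs. g f ~= 0"
          by (rule jet_generators_nonvanishing[OF scheme U(1) gs(2) fU]) (use ns flag_base_flag_pt[OF av(1,4)] f_def in simp)
        then obtain g where g: "g \<in> set gs" "g f ~= 0" by blast
        have "f \<notin> supp (PV X V) (jet_ideal X V I)" using zU fU gI[OF g(1)] g(2) unfolding supp_def by blast
        then have lb: "\<bar>lam1 f + ln (m p)\<bar> \<le> b f" using b(2) fU unfolding m_def a_def v_def f_def by blast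
        have mp: "0 < m p"
        proof -
          have "0 < cmod (g f)" using g by simp
          also have "cmod (g f) \<le> m p" unfolding m_def f_def a_def v_def by (rule Max_ge) (use g in auto)
          finally show ?thesis .
        qed
        have "b f \<le> b1" using elim unfolding b1_def f_def a_def v_def t_def flag_pt_eq by simp
        then have "exp (- 2 * lam1 f) \<le> exp (2 * b1) * (m p)\<^sup>2" by (intro weil_bounds(2)[OF _ mp]) (use lb in linarith)
        moreover have "m p \<le> M * Y p" unfolding m_def using elim gs(1) by (intro Max.boundedI) auto
        then have "(m p)\<^sup>2 \<le> (M * Y p)\<^sup>2" by (rule power_mono) (use mp in simp)
        moreover have "(Y p)\<^sup>2 \<le> 2 * real (card Z) * (hsum Z (\<lambda>s. s i (pt a)) + hsum Z (cov i a v))"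
          unfolding Y_def a_def v_def by (rule sum_square_bound[OF finite_Z])
        moreover have "hsum Z (\<lambda>s. s i (pt a)) + hsum Z (cov i a v) = H * (r + qZ)"
          unfolding r_def qZ_def rho_index[OF ai] qq_def H_def[symmetric] using H(1) by (simp add: distrib_left)
        moreover have "H * (r + qZ) \<le> H1 * (r + qZ)" by (rule mult_right_mono[OF H(2)]) (use nn in simp)
        ultimately have c: "exp (- 2 * lam1 f) \<le> exp (2 * b1) * (m p)\<^sup>2" "(m p)\<^sup>2 \<le> M\<^sup>2 * (Y p)\<^sup>2"
          "(Y p)\<^sup>2 \<le> 2 * real (card Z) * (H * (r + qZ))" "H * (r + qZ) \<le> H1 * (r + qZ)" by (simp_all add: power_mult_distrib)
        have "(Y p)\<^sup>2 \<le> 2 * real (card Z) * (H1 * (r + qZ))"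
          by (rule order_trans[OF c(3) mult_left_mono[OF c(4)]]) simp
        from order_trans[OF c(2) mult_left_mono[OF this]]
        have "(m p)\<^sup>2 \<le> M\<^sup>2 * (2 * real (card Z) * (H1 * (r + qZ)))" by simp
        from order_trans[OF c(1) mult_left_mono[OF this]]
        have "exp (- 2 * lam1 f) \<le> exp (2 * b1) * (M\<^sup>2 * (2 * real (card Z) * (H1 * (r + qZ))))" by simp
        also have "\<dots> = K * (r + qZ)" by (simp add: K_def mult_ac)
        finally have "exp (- 2 * lam1 f) * qB \<le> K * (r + qZ) * qB" using nn(2) by (rule mult_right_mono)
        also have "\<dots> = K * (r * qB + qZ * qB)" by (simp add: algebra_simps)
        \<comment> \<open>q1 bounds \<open>qB\<close>, which handles the second summand, and is at
          least 1, so it may also be put in front of the first.\<close>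
        also have "\<dots> \<le> K * (q1 * (r * qB) + q1 * qZ)"
        proof (rule mult_left_mono[OF add_mono K])
          show "r * qB \<le> q1 * (r * qB)" using mult_right_mono[OF q1, of "r * qB"] nn by simp
          have "qB \<le> q1" using elim unfolding qB_def a_def v_def by simp
          from mult_right_mono[OF this nn(3)] show "qZ * qB \<le> q1 * qZ" by (simp add: mult.commute)
        qed
        also have "\<dots> = K * q1 * (r * qB + qZ)" by (simp add: algebra_simps)
        finally show "exp (- 2 * lam1 f) * qB \<le> K * q1 * (r * qB + qZ)" .
      qed
    qed
    then have "\<forall>\<^sub>F p in nhds p0. p \<in> unit_frames X V --> P (K * q1) p" unfolding F_def eventually_inf_principal .
    then show "\<exists>C. \<forall>\<^sub>F p in nhds p0. p \<in> unit_frames X V --> P C p" by (rule exI)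
  qed
  then show ?thesis unfolding P_def .
qed

lemma bounded_on_X:
  fixes u :: "'n cproj => real"
  assumes u: "\<And>a0 F. a0 ~= 0 ==> pt a0 \<in> X ==> ((\<lambda>a. a) \<longlongrightarrow> a0) F ==> eventually (\<lambda>a. a ~= 0 \<and> pt a \<in> X) F ==>
    ((\<lambda>a. u (pt a)) \<longlongrightarrow> u (pt a0)) F"
  shows "\<exists>C>0. \<forall>x\<in>X. \<bar>u x\<bar> \<le> C"
proof -
  have "\<exists>C>0. \<forall>a\<in>{a. norm a = 1 \<and> pt a \<in> X}. \<bar>u (pt a)\<bar> \<le> C"
  proof (rule compact_uniform_constant[OF compact_unit_cone[OF closed_X]])
    fix a0 assume "a0 \<in> {a. norm a = 1 \<and> pt a \<in> X}"
    then have a0: "a0 ~= 0" "pt a0 \<in> X" by auto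
    define F where "F = inf (nhds a0) (principal {a. a ~= 0 \<and> pt a \<in> X})"
    have h: "((\<lambda>a. a) \<longlongrightarrow> a0) F" unfolding filterlim_def filtermap_ident F_def by (rule inf_le1)
    have ev: "eventually (\<lambda>a. a ~= 0 \<and> pt a \<in> X) F" unfolding F_def eventually_inf_principal by simp
    have "\<forall>\<^sub>F a in F. \<bar>u (pt a)\<bar> < \<bar>u (pt a0)\<bar> + 1" by (rule order_tendstoD(2)[OF tendsto_rabs[OF u[OF a0 h ev]]]) simp
    then have "\<forall>\<^sub>F a in nhds a0. a \<in> {a. a ~= 0 \<and> pt a \<in> X} --> \<bar>u (pt a)\<bar> < \<bar>u (pt a0)\<bar> + 1"
      unfolding F_def eventually_inf_principal .
    then have "\<forall>\<^sub>F a in nhds a0. a \<in> {a. norm a = 1 \<and> pt a \<in> X} --> \<bar>u (pt a)\<bar> \<le> \<bar>u (pt a0)\<bar> + 1"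
      by (rule eventually_mono) auto
    then show "\<exists>C. \<forall>\<^sub>F a in nhds a0. a \<in> {a. norm a = 1 \<and> pt a \<in> X} --> \<bar>u (pt a)\<bar> \<le> C" by (rule exI)
  qed simp
  then obtain C where C: "C > 0" "\<forall>a\<in>{a. norm a = 1 \<and> pt a \<in> X}. \<bar>u (pt a)\<bar> \<le> C" by (elim exE conjE)
  show ?thesis
  proof (intro exI[of _ C] conjI ballI C(1))
    fix x assume x: "x \<in> X"
    obtain a where "norm a = 1" "x = pt a" by (rule unit_representative)
    then show "\<bar>u x\<bar> \<le> C" using C(2) x by blast
  qed
qed

lemma rho_bounded: "\<exists>C>0. \<forall>x\<in>X. \<bar>rho x\<bar> \<le> C"
proof (rule bounded_on_X)
  fix a0 :: "complex^'n" and F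
  assume a0: "a0 ~= 0" "pt a0 \<in> X" and h: "((\<lambda>a. a) \<longlongrightarrow> a0) F" and ev: "eventually (\<lambda>a. a ~= 0 \<and> pt a \<in> X) F"
  note i = idx[OF a0(2)]
  have "((\<lambda>a. hsum Z (\<lambda>s. s (idx (pt a0)) (pt a)) / hsum B (\<lambda>s. s (idx (pt a0)) (pt a))) \<longlongrightarrow> rho (pt a0)) F"
    unfolding rho_def by (intro tendsto_divide hsum_nz[OF i] tendsto_hsum tendsto_section(2)[OF i a0(1) h ev]) auto
  moreover have "\<forall>\<^sub>F a in F. hsum Z (\<lambda>s. s (idx (pt a0)) (pt a)) / hsum B (\<lambda>s. s (idx (pt a0)) (pt a)) = rho (pt a)"
    using tendsto_section(1)[OF i a0(1) h ev] by eventually_elim (rule rho_index[symmetric])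
  ultimately show "((\<lambda>a. rho (pt a)) \<longlongrightarrow> rho (pt a0)) F" by (rule Lim_transform_eventually)
qed

text \<open>Both weights change by the same logarithm of a transition function, so their difference
  is a global continuous function on the compact X. It is the bounded w of the current
  argument.\<close>

lemma weight_bounded:
  assumes \<phi>: "hermitian_weight L \<phi>"
  shows "\<exists>C>0. \<forall>x\<in>X. \<bar>\<phi> (idx x) x - ln (hsum B (\<lambda>s. s (idx x) x))\<bar> \<le> C"
    "x \<in> triv L i ==> \<phi> (idx x) x - ln (hsum B (\<lambda>s. s (idx x) x)) = \<phi> i x - ln (hsum B (\<lambda>s. s i x))"
proof -
  have ix: "\<phi> (idx x) x - ln (hsum B (\<lambda>s. s (idx x) x)) = \<phi> i x - ln (hsum B (\<lambda>s. s i x))" if i: "x \<in> triv L i" for x i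
  proof -
    have j: "x \<in> triv L (idx x)" by (rule idx[OF triv_subset[OF i]])
    have "\<phi> (idx x) x = \<phi> i x + ln ((cmod (trans_fun L (idx x) i x))\<^sup>2)"
      using \<phi>[unfolded hermitian_weight_def, THEN conjunct2, THEN spec, THEN spec, THEN bspec, OF IntI[OF j i]] .
    moreover have "0 < (cmod (trans_fun L (idx x) i x))\<^sup>2" using trans_fun_germ[OF j i] by simp
    ultimately show ?thesis using hsum_pos[OF i] by (simp add: hsum_index[OF j i] ln_mult_pos)
  qed
  then show "x \<in> triv L i ==> \<phi> (idx x) x - ln (hsum B (\<lambda>s. s (idx x) x)) = \<phi> i x - ln (hsum B (\<lambda>s. s i x))" .
  show "\<exists>C>0. \<forall>x\<in>X. \<bar>\<phi> (idx x) x - ln (hsum B (\<lambda>s. s (idx x) x))\<bar> \<le> C"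
  proof (rule bounded_on_X)
    fix a0 :: "complex^'n" and F
    assume a0: "a0 ~= 0" "pt a0 \<in> X" and h: "((\<lambda>a. a) \<longlongrightarrow> a0) F" and ev: "eventually (\<lambda>a. a ~= 0 \<and> pt a \<in> X) F"
    note i = idx[OF a0(2)]
    define j where "j = idx (pt a0)"
    have evi: "\<forall>\<^sub>F a in F. pt a \<in> triv L j" unfolding j_def by (rule tendsto_section(1)[OF i a0(1) h ev])
    have "((\<lambda>a. pt a) \<longlongrightarrow> pt a0) F"
      by (rule continuous_on_tendsto_compose[OF pt_continuous h]) (use a0 ev in \<open>auto elim: eventually_mono\<close>)
    then have p: "((\<lambda>a. \<phi> j (pt a)) \<longlongrightarrow> \<phi> j (pt a0)) F"
      by (rule continuous_on_tendsto_compose[OF \<phi>[unfolded hermitian_weight_def, THEN conjunct1, THEN spec] _ _ evi])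
        (use i in \<open>simp add: j_def\<close>)
    have "((\<lambda>a. \<phi> j (pt a) - ln (hsum B (\<lambda>s. s j (pt a)))) \<longlongrightarrow> \<phi> j (pt a0) - ln (hsum B (\<lambda>s. s j (pt a0)))) F"
      using p unfolding j_def
      by (intro tendsto_diff tendsto_ln hsum_nz[OF i] tendsto_hsum tendsto_section(2)[OF i a0(1) h ev]) auto
    moreover have "\<forall>\<^sub>F a in F. \<phi> j (pt a) - ln (hsum B (\<lambda>s. s j (pt a))) =
        \<phi> (idx (pt a)) (pt a) - ln (hsum B (\<lambda>s. s (idx (pt a)) (pt a)))"
      using evi by eventually_elim (rule ix[symmetric])
    ultimately show "((\<lambda>a. \<phi> (idx (pt a)) (pt a) - ln (hsum B (\<lambda>s. s (idx (pt a)) (pt a)))) \<longlongrightarrow>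
        \<phi> (idx (pt a0)) (pt a0) - ln (hsum B (\<lambda>s. s (idx (pt a0)) (pt a0)))) F"
      unfolding j_def by (rule Lim_transform_eventually)
  qed
qed

end

lemma continuous_on_local:
  fixes g :: "'x::t2_space => 'y::topological_space"
  assumes "\<And>z. \<exists>D. open D \<and> z \<in> D \<and> continuous_on D g"
  shows "continuous_on UNIV g"
proof -
  have "isCont g z" for z
  proof -
    obtain D where "open D" "z \<in> D" "continuous_on D g" using assms by blast
    then show ?thesis by (simp add: continuous_on_eq_continuous_at)
  qed
  then show ?thesis by (simp add: continuous_at_imp_continuous_on)
qed

lemma ddc_zero_outside:
  assumes "closed K" "\<And>z. z \<notin> K ==> \<eta> z = 0" "z \<notin> K"
  shows "ddc \<eta> z = 0"
proof -
  have "ddc \<eta> z = ddc (\<lambda>_. 0) z"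
    by (rule C2_on_cong(2)[of "- K" "\<lambda>_. 0"]) (use assms C2_on_const in auto)
  then show ?thesis by (simp add: parts_const_zero)
qed

text \<open>Raising the bound to the power 1 - \<epsilon> produces C powr (1 - \<epsilon>), which is
  at most max 1 C for every \<epsilon>; the constant has to be free of \<epsilon>.\<close>

lemma powr_weil_bound:
  fixes R C l \<epsilon> :: real
  assumes R: "0 < R" "R \<le> C * exp (- 2 * l)" and C: "0 < C" and e: "0 < \<epsilon>" "\<epsilon> < 1"
  shows "exp (2 * (1 - \<epsilon>) * l) \<le> max 1 C * R powr (\<epsilon> - 1)"
proof -
  have "ln R \<le> ln (C * exp (- 2 * l))" using R C by simp
  also have "\<dots> = ln C - 2 * l" using C by (simp add: ln_mult_pos)
  finally have "(1 - \<epsilon>) * ln R \<le> (1 - \<epsilon>) * (ln C - 2 * l)" using e by (intro mult_left_mono) auto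
  then have "2 * (1 - \<epsilon>) * l \<le> (1 - \<epsilon>) * ln C + (\<epsilon> - 1) * ln R" by (simp add: algebra_simps)
  then have "exp (2 * (1 - \<epsilon>) * l) \<le> exp ((1 - \<epsilon>) * ln C + (\<epsilon> - 1) * ln R)" by simp
  also have "\<dots> = exp ((1 - \<epsilon>) * ln C) * R powr (\<epsilon> - 1)" using R(1) by (simp add: exp_add powr_def)
  also have "\<dots> \<le> max 1 C * R powr (\<epsilon> - 1)"
  proof (rule mult_right_mono)
    show "exp ((1 - \<epsilon>) * ln C) \<le> max 1 C"
    proof (cases "C \<le> 1")
      case True
      then have "(1 - \<epsilon>) * ln C \<le> 0" using C e by (intro mult_nonneg_nonpos) auto
      then show ?thesis by (simp add: le_max_iff_disj)
    next
      case False
      then have "(1 - \<epsilon>) * ln C \<le> 1 * ln C" using e by (intro mult_right_mono) auto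
      then have "exp ((1 - \<epsilon>) * ln C) \<le> exp (ln C)" by simp
      then show ?thesis using C by simp
    qed
  qed simp
  finally show ?thesis .
qed

section \<open>Quantities along the curve and the final estimate\<close>

locale jet_separating_curve = jet_separating_system X V I L S B Z
  for X :: "('n::finite) cproj set" and V :: "'n cproj => (complex^'n) set" and I :: "'n cproj ideal_sheaf"
    and L :: "('i, 'n cproj) bundle_data" and S B Z :: "('i => 'n cproj => complex) set" +
  fixes f :: "complex => 'n cproj"
  assumes curve: "directed_curve X V f" and nondegenerate: "\<not> range f \<subseteq> supp X I"
begin

lemma f_in_X: "f z \<in> X"
  using curve unfolding directed_curve_def by blast

lemma lift_at:
  obtains D F where "z \<in> D" "local_lift f D F"
proof -
  have "\<exists>D F. z \<in> D \<and> local_lift f D F" using curve unfolding directed_curve_def by blast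
  then show thesis by (elim exE conjE) (rule that)
qed

lemma lift_props:
  assumes "local_lift f D F" "z \<in> D"
  shows "F z ~= 0" "pt (F z) = f z" "vec_deriv F z \<in> V (f z)" "open D"
proof -
  have "\<forall>D F. local_lift f D F --> (\<forall>z\<in>D. vec_deriv F z \<in> V (f z))"
    using curve unfolding directed_curve_def by (elim conjE)
  from bspec[OF mp[OF spec[OF spec[OF this]] assms(1)] assms(2)] show "vec_deriv F z \<in> V (f z)" .
  show "F z ~= 0" "pt (F z) = f z" "open D" using assms unfolding local_lift_def by simp_all
qed

lemma f_continuous: "continuous_on UNIV f"
proof (rule continuous_at_imp_continuous_on, rule ballI)
  fix z
  obtain D F where "z \<in> D" "local_lift f D F" by (rule lift_at)
  then show "isCont f z" using local_lift_continuous(2) by blast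
qed

definition dom :: "'i => complex set" where "dom i = {z. f z \<in> triv L i}"

lemma open_dom: "open (dom i)"
proof -
  obtain N where N: "open N" "triv L i = X \<inter> N" by (rule triv_open)
  have "dom i = f -` N" using N(2) f_in_X by (auto simp: dom_def)
  then show ?thesis using open_vimage[OF N(1) f_continuous] by simp
qed

lemma in_dom: "z \<in> dom (idx (f z))"
  unfolding dom_def using idx[OF f_in_X] by simp

lemma section_deriv:
  assumes F: "local_lift f D F" "z \<in> D" and z: "z \<in> dom i" and s: "s \<in> B \<union> Z"
  shows "((\<lambda>w. s i (f w)) has_field_derivative dS i (F z) (vec_deriv F z) s) (at z)"
proof -
  note lp = lift_props[OF F]
  have zi: "f z \<in> triv L i" using z by (simp add: dom_def)
  obtain W G where W: "open W" "f z \<in> W" "W \<inter> X \<subseteq> triv L i"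
    "\<forall>s\<in>B \<union> Z. ambient_holomorphic W (G s)" "\<forall>s\<in>B \<union> Z. \<forall>y\<in>W \<inter> X. s i y = G s y"
    by (rule local_extension[OF zi])
  have d: "((\<lambda>w. G s (f w)) has_field_derivative cone_deriv (G s) (F z) (vec_deriv F z)) (at z)"
    by (rule curve_chain_rule[OF F _ W(2)]) (use W(4) s in blast)
  have e: "cone_deriv (G s) (F z) (vec_deriv F z) = dS i (F z) (vec_deriv F z) s"
    by (rule dS_extension[OF W(4,5) lp(1) _ _ _ s, symmetric]) (use lp W(2) f_in_X in auto)
  show ?thesis
  proof (rule has_field_derivative_transform_within_open[OF d[unfolded e], of "f -` W"])
    show "open (f -` W)" by (rule open_vimage[OF W(1) f_continuous])
    show "z \<in> f -` W" using W(2) by simp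
    show "G s (f w) = s i (f w)" if "w \<in> f -` W" for w using that W(5) s f_in_X by simp
  qed
qed

lemma section_holomorphic:
  assumes "s \<in> B \<union> Z"
  shows "(\<lambda>w. s i (f w)) holomorphic_on dom i"
proof (rule holomorphic_onI)
  fix z assume z: "z \<in> dom i"
  obtain D F where F: "z \<in> D" "local_lift f D F" by (rule lift_at)
  show "(\<lambda>w. s i (f w)) field_differentiable (at z within dom i)"
    unfolding field_differentiable_def
    using has_field_derivative_at_within[OF section_deriv[OF F(2,1) z assms]] by blast
qed

text \<open>\<open>qq\<close> at the velocity of the curve, written with the one-variable functions
  s i (f z) so that the estimates for families of holomorphic functions apply.\<close>

definition Qi :: "('i => 'n cproj => complex) set => 'i => complex => real" where
  "Qi T i z = hsum T (\<lambda>s. deriv (\<lambda>w. s i (f w)) z -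
     hratio B (\<lambda>s. s i (f z)) (\<lambda>s. deriv (\<lambda>w. s i (f w)) z) * s i (f z)) / hsum B (\<lambda>s. s i (f z))"

definition Q :: "('i => 'n cproj => complex) set => complex => real" where "Q T z = Qi T (idx (f z)) z"

definition R :: "complex => real" where "R z = rho (f z)"

lemma Qi_lift:
  assumes F: "local_lift f D F" "z \<in> D" and z: "z \<in> dom i" and T: "T \<subseteq> B \<union> Z"
  shows "Qi T i z = qq T i (F z) (vec_deriv F z)"
proof -
  have d: "deriv (\<lambda>w. s i (f w)) z = dS i (F z) (vec_deriv F z) s" if "s \<in> B \<union> Z" for s
    by (rule DERIV_imp_deriv[OF section_deriv[OF F z that]])
  have "hratio B (\<lambda>s. s i (f z)) (\<lambda>s. deriv (\<lambda>w. s i (f w)) z) = conn i (F z) (vec_deriv F z)"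
    unfolding conn_def lift_props(2)[OF F] by (rule hratio_cong) (use d in auto)
  note c = this
  have "hsum T (\<lambda>s. deriv (\<lambda>w. s i (f w)) z - conn i (F z) (vec_deriv F z) * s i (f z)) = hsum T (cov i (F z) (vec_deriv F z))"
    unfolding cov_def lift_props(2)[OF F] by (rule hsum_cong) (use d T in auto)
  then show ?thesis unfolding Qi_def qq_def c lift_props(2)[OF F] by simp
qed

lemma Q_index:
  assumes z: "z \<in> dom i" and T: "T \<subseteq> B \<union> Z"
  shows "Q T z = Qi T i z"
proof -
  obtain D F where F: "z \<in> D" "local_lift f D F" by (rule lift_at)
  note lp = lift_props[OF F(2,1)]
  have "qq T (idx (f z)) (F z) (vec_deriv F z) = qq T i (F z) (vec_deriv F z)"
    by (rule qq_index[OF _ _ lp(1) _ T]) (use lp z in_dom in \<open>auto simp: dom_def\<close>)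
  then show ?thesis unfolding Q_def Qi_lift[OF F(2,1) in_dom T] Qi_lift[OF F(2,1) z T] .
qed

lemma R_index: "z \<in> dom i ==> R z = hsum Z (\<lambda>s. s i (f z)) / hsum B (\<lambda>s. s i (f z))"
  unfolding R_def dom_def by (simp add: rho_index)

lemma Q_nonneg: "0 \<le> Q T z" and R_nonneg: "0 \<le> R z"
  unfolding Q_def Qi_def R_def by (auto simp: hsum_nonneg rho_nonneg)

lemma dom_hsum_pos: "z \<in> dom i ==> 0 < hsum B (\<lambda>s. s i (f z))"
  unfolding dom_def by (simp add: hsum_pos)

lemma continuous_section:
  assumes "s \<in> B \<union> Z" "z \<in> dom i"
  shows "((\<lambda>w. s i (f w)) \<longlongrightarrow> s i (f z)) (at z within dom i)"
    "((\<lambda>w. deriv (\<lambda>w. s i (f w)) w) \<longlongrightarrow> deriv (\<lambda>w. s i (f w)) z) (at z within dom i)"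
proof -
  have "continuous_on (dom i) (\<lambda>w. s i (f w))" "continuous_on (dom i) (deriv (\<lambda>w. s i (f w)))"
    using section_holomorphic[OF assms(1), of i] holomorphic_deriv[OF section_holomorphic[OF assms(1)] open_dom]
    by (auto intro: holomorphic_on_imp_continuous_on)
  then show "((\<lambda>w. s i (f w)) \<longlongrightarrow> s i (f z)) (at z within dom i)"
    "((\<lambda>w. deriv (\<lambda>w. s i (f w)) w) \<longlongrightarrow> deriv (\<lambda>w. s i (f w)) z) (at z within dom i)"
    using assms(2) unfolding continuous_on_def by blast+
qed

lemma R_continuous: "continuous_on UNIV R"
proof (rule continuous_on_local)
  fix z
  define i where "i = idx (f z)"
  have "continuous_on (dom i) (\<lambda>z. hsum Z (\<lambda>s. s i (f z)) / hsum B (\<lambda>s. s i (f z)))"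
    unfolding continuous_on_def
    by (intro ballI tendsto_divide tendsto_hsum continuous_section(1)) (use dom_hsum_pos in force)+
  then have "continuous_on (dom i) R" by (rule continuous_on_eq) (simp add: R_index)
  then show "\<exists>D. open D \<and> z \<in> D \<and> continuous_on D R" using open_dom in_dom unfolding i_def by blast
qed

lemma Q_continuous:
  assumes T: "T \<subseteq> B \<union> Z"
  shows "continuous_on UNIV (Q T)"
proof (rule continuous_on_local)
  fix z
  define i where "i = idx (f z)"
  have "continuous_on (dom i) (Qi T i)"
    unfolding continuous_on_def Qi_def
    by (intro ballI tendsto_divide tendsto_hsum tendsto_hratio tendsto_diff tendsto_mult continuous_section)
      (use T dom_hsum_pos in force)+
  then have "continuous_on (dom i) (Q T)" by (rule continuous_on_eq) (simp add: Q_index[OF _ T])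
  then show "\<exists>D. open D \<and> z \<in> D \<and> continuous_on D (Q T)" using open_dom in_dom unfolding i_def by blast
qed

text \<open>For b equal to the connection coefficient itself the last term of
  \<open>hsum_shift\<close> vanishes, and the Fubini--Study density becomes the sum of squares of
  covariant derivatives.\<close>

lemma weight_ddc:
  shows "C2_on (dom i) (\<lambda>z. ln (hsum B (\<lambda>s. s i (f z))))"
    "z \<in> dom i ==> ddc (\<lambda>z. ln (hsum B (\<lambda>s. s i (f z)))) z = Q B z / pi"
proof -
  have h: "\<forall>s\<in>B. (\<lambda>z. s i (f z)) holomorphic_on dom i" "\<forall>z\<in>dom i. 0 < hsum B (\<lambda>s. s i (f z))"
    using section_holomorphic dom_hsum_pos by blast+
  note L = ln_hsum_C2[OF open_dom finite_BZ(1) h]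
  show "C2_on (dom i) (\<lambda>z. ln (hsum B (\<lambda>s. s i (f z))))" by (rule L(1))
  show "ddc (\<lambda>z. ln (hsum B (\<lambda>s. s i (f z)))) z = Q B z / pi" if z: "z \<in> dom i"
  proof -
    have n: "hsum B (\<lambda>s. s i (f z)) ~= 0" using dom_hsum_pos[OF z] by simp
    show ?thesis unfolding L(4)[OF z] Q_index[OF z Un_upper1] Qi_def hsum_shift[OF n] by simp
  qed
qed

lemma pullback_weight: "pullback_ddc L (weight_of_basis B) f z = Q B z / pi"
  unfolding pullback_ddc_def weight_of_basis_def hsum_def[symmetric] idx_def[symmetric]
  by (rule weight_ddc(2)[OF in_dom])

lemma R_powr:
  assumes \<kappa>: "0 < \<kappa>" and e: "0 < \<epsilon>" "\<epsilon> < 1"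
  shows "C2_on UNIV (\<lambda>z. (R z + \<kappa>) powr \<epsilon>)"
    "\<epsilon>\<^sup>2 * ((R z + \<kappa>) powr (\<epsilon> - 1) * Q Z z) \<le>
      pi * ddc (\<lambda>z. (R z + \<kappa>) powr \<epsilon>) z + \<epsilon> * pi * ((R z + \<kappa>) powr \<epsilon> * (Q B z / pi))"
proof -
  define u where "u i z = (hsum Z (\<lambda>s. s i (f z)) / hsum B (\<lambda>s. s i (f z)) + \<kappa>) powr \<epsilon>" for i z
  have u: "C2_on (dom i) (u i)" if "z \<in> dom i" for i z
    unfolding u_def
    by (rule powr_ddc_estimate(1)[where F = "\<lambda>s w. s i (f w)" and z = z])
      (use that open_dom finite_BZ finite_Z section_holomorphic dom_hsum_pos \<kappa> e in auto)
  have ru: "(R z + \<kappa>) powr \<epsilon> = u i z" if "z \<in> dom i" for i z unfolding R_index[OF that] u_def ..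
  show "C2_on UNIV (\<lambda>z. (R z + \<kappa>) powr \<epsilon>)"
  proof (rule C2_on_local)
    fix z
    have "C2_on (dom (idx (f z))) (\<lambda>z. (R z + \<kappa>) powr \<epsilon>)"
      by (rule C2_on_cong(1)[OF open_dom u[OF in_dom]]) (rule ru)
    then show "\<exists>E. open E \<and> z \<in> E \<and> C2_on E (\<lambda>z. (R z + \<kappa>) powr \<epsilon>)" using open_dom in_dom by blast
  qed
  define i where "i = idx (f z)"
  have z: "z \<in> dom i" unfolding i_def by (rule in_dom)
  have d: "ddc (\<lambda>z. (R z + \<kappa>) powr \<epsilon>) z = ddc (u i) z"
    by (rule C2_on_cong(2)[OF open_dom u[OF z] _ z]) (rule ru)
  have "\<epsilon>\<^sup>2 * ((hsum Z (\<lambda>s. s i (f z)) / hsum B (\<lambda>s. s i (f z)) + \<kappa>) powr (\<epsilon> - 1) * Qi Z i z)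
     \<le> pi * ddc (u i) z + \<epsilon> * pi * (u i z * ddc (\<lambda>z. ln (hsum B (\<lambda>s. s i (f z)))) z)"
    unfolding u_def Qi_def
    by (rule powr_ddc_estimate(2)[where F = "\<lambda>s w. s i (f w)" and D = "dom i"])
      (use z open_dom finite_BZ finite_Z section_holomorphic dom_hsum_pos \<kappa> e in auto)
  then show "\<epsilon>\<^sup>2 * ((R z + \<kappa>) powr (\<epsilon> - 1) * Q Z z) \<le>
      pi * ddc (\<lambda>z. (R z + \<kappa>) powr \<epsilon>) z + \<epsilon> * pi * ((R z + \<kappa>) powr \<epsilon> * (Q B z / pi))"
    by (simp only: d weight_ddc(2)[OF z] Q_index[OF z Un_upper2] R_index[OF z] u_def)
qed

lemma R_zero: "z \<in> dom i ==> R z = 0 \<longleftrightarrow> (\<forall>s\<in>Z. s i (f z) = 0)"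
  using dom_hsum_pos[of z i] unfolding R_index by (simp add: hsum_def sum_nonneg_eq_0_iff[OF finite_Z])

text \<open>The sections in Z generate the stalks of the ideal and lie in them, so both have the
  same zeros.\<close>

lemma R_zero_supp: "R z = 0 \<longleftrightarrow> f z \<in> supp X I"
proof
  assume 0: "R z = 0"
  show "f z \<in> supp X I"
    unfolding supp_def
  proof (intro CollectI conjI allI impI ballI f_in_X)
    fix U g assume U: "zariski_open X U \<and> f z \<in> U" and g: "g \<in> I U"
    have i: "f z \<in> triv L (idx (f z))" using in_dom unfolding dom_def by blast
    obtain W \<Gamma> where W: "open W" "f z \<in> W" "\<forall>s\<in>Z. ambient_holomorphic W (\<Gamma> s)"
      "\<forall>y\<in>W \<inter> X. g y = (\<Sum>s\<in>Z. \<Gamma> s y * s (idx (f z)) y)"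
      by (rule ideal_stalk_base[OF section_in_stalk[where I = I, OF conjunct1[OF U] conjunct2[OF U] g] i])
    have "g (f z) = (\<Sum>s\<in>Z. \<Gamma> s (f z) * s (idx (f z)) (f z))" using bspec[OF W(4) IntI[OF W(2) f_in_X]] .
    also have "\<dots> = 0" using 0 R_zero[OF in_dom, of z] by (intro sum.neutral) simp
    finally show "g (f z) = 0" .
  qed
next
  assume sp: "f z \<in> supp X I"
  have i: "f z \<in> triv L (idx (f z))" using in_dom unfolding dom_def by blast
  have "s (idx (f z)) (f z) = 0" if s: "s \<in> Z" for s
  proof -
    have "s (idx (f z)) \<in> ideal_stalk X I (f z)" using Z_sub s i unfolding subsystem_containing_def by blast
    then obtain n :: nat and c e W where ce: "\<forall>k<n. holo_germ X (f z) (c k) \<and> e k \<in> \<Union>{I U | U. zariski_open X U \<and> f z \<in> U}"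
      and W: "open W" "f z \<in> W" "\<forall>y\<in>W \<inter> X. s (idx (f z)) y = (\<Sum>k<n. c k y * e k y)"
      unfolding ideal_stalk_def germ_ideal_def by (elim CollectE exE conjE) (rule that)
    have "e k (f z) = 0" if k: "k < n" for k
    proof -
      obtain U where U: "zariski_open X U \<and> f z \<in> U" "e k \<in> I U" using ce k by blast
      have "\<forall>U. zariski_open X U \<and> f z \<in> U --> (\<forall>g\<in>I U. g (f z) = 0)" using sp unfolding supp_def by simp
      from bspec[OF mp[OF spec[OF this] U(1)] U(2)] show ?thesis .
    qed
    then show ?thesis using bspec[OF W(3) IntI[OF W(2) f_in_X]] by simp
  qed
  then show "R z = 0" using R_zero[OF in_dom, of z] by blast
qed

text \<open>The identity theorem, applied along the curve to each section in Z.\<close>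

lemma R_zeros_interior:
  assumes "z islimpt {w. R w = 0}"
  shows "z \<in> interior {w. R w = 0}"
proof -
  define i where "i = idx (f z)"
  have z: "z \<in> dom i" unfolding i_def by (rule in_dom)
  obtain e where e: "e > 0" "ball z e \<subseteq> dom i" using open_dom z open_contains_ball by blast
  have lim: "z islimpt ({w. R w = 0} \<inter> ball z e)"
    unfolding islimpt_def
  proof (intro allI impI)
    fix T assume T: "z \<in> T" "open T"
    have "z \<in> T \<inter> ball z e" "open (T \<inter> ball z e)" using T e by auto
    then show "\<exists>y\<in>{w. R w = 0} \<inter> ball z e. y \<in> T \<and> y ~= z" using assms unfolding islimpt_def by blast
  qed
  have "R w = 0" if w: "w \<in> ball z e" for w
  proof -
    have "s i (f w) = 0" if s: "s \<in> Z" for s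
    proof (rule analytic_continuation[of "\<lambda>w. s i (f w)" "ball z e" "{w. R w = 0} \<inter> ball z e" z])
      show "(\<lambda>w. s i (f w)) holomorphic_on ball z e"
        by (rule holomorphic_on_subset[OF section_holomorphic e(2)]) (use s in simp)
      show "s i (f u) = 0" if "u \<in> {w. R w = 0} \<inter> ball z e" for u
      proof -
        have "u \<in> dom i" "R u = 0" using that e(2) by auto
        then show ?thesis using R_zero s by blast
      qed
    qed (use e lim w in auto)
    then show ?thesis using R_zero[of w i] e(2) w by blast
  qed
  then have "ball z e \<subseteq> {w. R w = 0}" by blast
  then show ?thesis using e(1) by (meson interiorI centre_in_ball open_ball)
qed

text \<open>The interior of the zero set contains the limit points of the zero set, so it is open
  and closed; it is not the plane because the curve leaves the support. Hence the zeros have no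
  limit point and are countable, a null set.\<close>

lemma R_positive_AE: "AE z in lborel. 0 < R z"
proof -
  define N where "N = {w. R w = 0}"
  have lim: "x \<in> interior N" if "x islimpt N" for x using R_zeros_interior that unfolding N_def .
  have "closed (interior N)" unfolding closed_limpt
  proof (intro allI impI)
    fix x assume "x islimpt interior N"
    then have "x islimpt N" by (rule islimpt_subset[OF _ interior_subset])
    then show "x \<in> interior N" by (rule lim)
  qed
  then have "interior N = {} \<or> interior N = UNIV" using clopen open_interior by blast
  moreover have "interior N ~= UNIV"
  proof
    assume "interior N = UNIV"
    then have "R z = 0" for z using interior_subset[of N] unfolding N_def by blast
    then have "f z \<in> supp X I" for z using R_zero_supp by blast
    then show False using nondegenerate by blast
  qed
  ultimately have nl: "\<not> x islimpt N" for x using lim by blast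
  have "finite (cball 0 (real n) \<inter> N)" for n
    by (rule finite_not_islimpt_in_compact) (use nl in auto)
  then have "countable (\<Union>n. cball 0 (real n) \<inter> N)" by (intro countable_UN) (auto intro: countable_finite)
  moreover have "(\<Union>n. cball 0 (real n) \<inter> N) = N"
  proof -
    have "\<exists>n. cmod z \<le> real n" for z by (rule real_arch_simple)
    then show ?thesis by auto
  qed
  ultimately have "N \<in> null_sets lborel" by (intro countable_imp_null_set_lborel) simp
  then have "AE z in lborel. z \<notin> N" by (rule AE_not_in)
  then show ?thesis
  proof eventually_elim
    case (elim z)
    then show ?case using R_nonneg[of z] by (simp add: N_def)
  qed
qed

text \<open>The estimate on unit frames is carried over to the velocity vector by normalising it;
  both sides acquire the same factor \<tau>.\<close>

lemma jet_curve_bound: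
  assumes lam1: "weil_function (PV X V) (jet_ideal X V I) lam1"
  shows "\<exists>C>0. \<forall>z. f z \<notin> supp X I --> exp (- 2 * lam1 (curve_lift f z)) * Q B z \<le> C * (R z * Q B z + Q Z z)"
proof -
  obtain C where C: "C > 0" "\<forall>p\<in>unit_frames X V. pt (fst p) \<notin> supp X I -->
    exp (- 2 * lam1 (flag_pt (fst p) (snd p))) * qq B (idx (pt (fst p))) (fst p) (snd p)
     \<le> C * (rho (pt (fst p)) * qq B (idx (pt (fst p))) (fst p) (snd p) + qq Z (idx (pt (fst p))) (fst p) (snd p))"
    using jet_weil_bound[OF lam1] by (elim exE conjE)
  show ?thesis
  proof (intro exI[of _ C] conjI allI impI C(1))
    fix z assume ns: "f z \<notin> supp X I"
    obtain D F where F: "z \<in> D" "local_lift f D F" by (rule lift_at)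
    note lp = lift_props[OF F(2,1)]
    define i where "i = idx (f z)"
    have zi: "z \<in> dom i" "f z \<in> triv L i" unfolding i_def using in_dom by (auto simp: dom_def)
    have Q: "Q T z = qq T i (F z) (vec_deriv F z)" if "T \<subseteq> B \<union> Z" for T
      unfolding Q_index[OF zi(1) that] by (rule Qi_lift[OF F(2,1) zi(1) that])
    show "exp (- 2 * lam1 (curve_lift f z)) * Q B z \<le> C * (R z * Q B z + Q Z z)"
    \<comment> \<open>At a critical point of f the pulled back form vanishes, and nothing has to be
      known about the lift.\<close>
    proof (cases "vec_deriv F z \<in> line_of (f z)")
      case True
      then obtain m where m: "vec_deriv F z = m *s F z" using line_of_pt[OF lp(1)] lp(2) by auto
      have pi: "pt (F z) \<in> triv L i" using zi lp by simp
      \<comment> \<open>The scaling rule with l = 0 and k = 1: a velocity in the line has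
        \<open>qq\<close> equal to 0.\<close>
      have "qq B i (1 *s F z) (0 *s vec_deriv F z + m *s F z) = (cmod (0 / 1))\<^sup>2 * qq B i (F z) (vec_deriv F z)"
        by (rule qq_scale[OF pi lp(1)]) (use lp in auto)
      then have "Q B z = 0" unfolding Q[OF Un_upper1] using m by simp
      then show ?thesis using C(1) Q_nonneg[of Z z] by simp
    next
      case False
      have X: "pt (F z) \<in> X" using f_in_X[of z] lp by simp
      obtain a v k l m where u: "(a, v) \<in> unit_frames X V" and kl: "k ~= 0" "l ~= 0" "F z = k *s a" "vec_deriv F z = l *s v + m *s a"
        by (rule unit_frame_normalisation[OF subbundle lp(1) X, of "vec_deriv F z"]) (use lp False in auto)
      have a: "a ~= 0" "v \<notin> line_of (pt a)" using unit_frames_not_line[OF u] by auto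
      have p: "pt a = f z" using pt_scale[OF kl(1) a(1)] kl(3) lp(2) by simp
      have v: "v \<in> V (pt a)" using u unfolding unit_frames_def by simp
      have ai: "pt a \<in> triv L i" using zi p by simp
      have cl: "curve_lift f z = flag_pt a v"
        unfolding curve_lift_regular_point[OF F(2,1) False] kl(3,4) by (rule flag_pt_change[OF a kl(1,2)])
      define \<tau> where "\<tau> = (cmod (l / k))\<^sup>2"
      have Qa: "Q T z = \<tau> * qq T i a v" if "T \<subseteq> B \<union> Z" for T
        unfolding Q[OF that] kl(3,4) \<tau>_def by (rule qq_scale[OF ai a(1) v kl(1) that])
      have "exp (- 2 * lam1 (flag_pt a v)) * qq B i a v \<le> C * (R z * qq B i a v + qq Z i a v)"
        using bspec[OF C(2) u] ns p unfolding R_def i_def by simp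
      then have "\<tau> * (exp (- 2 * lam1 (flag_pt a v)) * qq B i a v) \<le> \<tau> * (C * (R z * qq B i a v + qq Z i a v))"
        by (rule mult_left_mono) (simp add: \<tau>_def)
      then show ?thesis unfolding cl Qa[OF Un_upper1] Qa[OF Un_upper2] by (simp add: algebra_simps)
    qed
  qed
qed

text \<open>The given metric on L and the weight of B differ by the bounded continuous w. The
  identity of currents is given only for test functions supported in one trivialising set; splitting
  test functions extends it to the logarithmic cut-off.\<close>

lemma weight_integral_bound:
  assumes T: "characteristic_fun L f T"
  obtains K where "\<And>r m. 0 < r ==> (\<integral>z. log_cutoff r (real (Suc m)) z * (Q B z / pi) \<partial>lborel) \<le> T r + K" "0 \<le> T 0 + K"
proof -
  obtain \<phi> \<mu> \<nu> where \<phi>: "hermitian_weight L \<phi>" and cur: "pullback_ddc_current L \<phi> f \<mu> \<nu>"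
    and fin: "\<forall>r\<ge>0. nevanlinna_N \<mu> r < \<infinity> \<and> nevanlinna_N \<nu> r < \<infinity>"
    and bd: "bounded ((\<lambda>r. T r - (enn2real (nevanlinna_N \<mu> r) - enn2real (nevanlinna_N \<nu> r))) ` {0..})"
    using T unfolding characteristic_fun_def by (elim exE conjE) (rule that)
  have sets: "sets \<mu> = sets borel" "sets \<nu> = sets borel"
    and ball: "\<And>r. emeasure \<mu> (ball 0 r) < \<infinity>" "\<And>r. emeasure \<nu> (ball 0 r) < \<infinity>"
    using cur unfolding pullback_ddc_current_def by blast+
  have cur': "(\<integral>z. \<eta> z \<partial>\<mu>) - (\<integral>z. \<eta> z \<partial>\<nu>) = (\<integral>z. \<phi> i (f z) * ddc \<eta> z \<partial>lborel)"
    if "C_k 2 \<eta>" "compact (closure {z. \<eta> z ~= 0})" "closure {z. \<eta> z ~= 0} \<subseteq> {z. f z \<in> triv L i}" for i \<eta>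
    using cur that unfolding pullback_ddc_current_def by blast
  define w where "w z = \<phi> (idx (f z)) (f z) - ln (hsum B (\<lambda>s. s (idx (f z)) (f z)))" for z
  have wi: "w z = \<phi> i (f z) - ln (hsum B (\<lambda>s. s i (f z)))" if "z \<in> dom i" for i z
    unfolding w_def by (rule weight_bounded(2)[OF \<phi>]) (use that in \<open>simp add: dom_def\<close>)
  obtain Cw where Cw: "\<forall>x\<in>X. \<bar>\<phi> (idx x) x - ln (hsum B (\<lambda>s. s (idx x) x))\<bar> \<le> Cw"
    using weight_bounded(1)[OF \<phi>] by blast
  have wb: "\<bar>w z\<bar> \<le> Cw" for z unfolding w_def using Cw f_in_X by blast
  have \<phi>c: "continuous_on (dom i) (\<lambda>z. \<phi> i (f z))" for i
  proof (rule continuous_on_compose2[of "triv L i" "\<phi> i"])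
    show "continuous_on (triv L i) (\<phi> i)" using \<phi>[unfolded hermitian_weight_def, THEN conjunct1, THEN spec] .
    show "continuous_on (dom i) f" by (rule continuous_on_subset[OF f_continuous]) simp
  qed (auto simp: dom_def)
  have uc: "continuous_on (dom i) (\<lambda>z. ln (hsum B (\<lambda>s. s i (f z))))" for i
    using weight_ddc(1)[of i] C1_on_continuous unfolding C2_on_def by blast
  have wc: "continuous_on UNIV w"
  proof (rule continuous_on_local)
    fix z
    define i where "i = idx (f z)"
    have "continuous_on (dom i) (\<lambda>z. \<phi> i (f z) - ln (hsum B (\<lambda>s. s i (f z))))" by (intro continuous_intros \<phi>c uc)
    then have "continuous_on (dom i) w" by (rule continuous_on_eq) (simp add: wi)
    then show "\<exists>D. open D \<and> z \<in> D \<and> continuous_on D w" using open_dom in_dom unfolding i_def by blast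
  qed
  define \<Theta> where "\<Theta> z = Q B z / pi" for z
  have \<Theta>c: "continuous_on UNIV \<Theta>" unfolding \<Theta>_def by (intro continuous_intros Q_continuous) auto
  have int_cs: "integrable M \<eta>" if \<eta>: "continuous_on UNIV \<eta>" and K: "compact K" "\<And>z. z \<notin> K ==> \<eta> z = 0"
    and M: "sets M = sets borel" "\<And>r. emeasure M (ball 0 r) < \<infinity>" for \<eta> :: "complex => real" and K and M :: "complex measure"
  proof -
    have "bounded (\<eta> ` K)" using compact_continuous_image[OF continuous_on_subset[OF \<eta>] K(1)] compact_imp_bounded by blast
    then obtain b where b: "\<forall>z\<in>K. norm (\<eta> z) \<le> b" unfolding bounded_iff by blast
    obtain r where r: "K \<subseteq> ball 0 r" using bounded_subset_ballD[OF compact_imp_bounded[OF K(1)]] by blast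
    have "\<eta> \<in> borel_measurable borel" by (rule borel_measurable_continuous_onI[OF \<eta>])
    then have m: "\<eta> \<in> borel_measurable M" unfolding measurable_cong_sets[OF M(1) refl] .
    show ?thesis
    proof (rule integrableI_bounded_set[OF _ m, of K b])
      show "K \<in> sets M" unfolding M(1) using K(1) by (simp add: borel_compact)
      have "emeasure M K \<le> emeasure M (ball 0 r)" by (rule emeasure_mono[OF r]) (simp add: M(1))
      then show "emeasure M K < \<infinity>" using M(2) le_less_trans by blast
    qed (use b K(2) in auto)
  qed
  \<comment> \<open>Integrability is included so that the property is additive in \<eta>.\<close>
  define P where "P \<eta> \<longleftrightarrow> integrable lborel (\<lambda>z. \<eta> z * \<Theta> z) \<and> integrable lborel (\<lambda>z. w z * ddc \<eta> z) \<and>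
    (\<integral>z. \<eta> z \<partial>\<mu>) - (\<integral>z. \<eta> z \<partial>\<nu>) - (\<integral>z. \<eta> z * \<Theta> z \<partial>lborel) = (\<integral>z. w z * ddc \<eta> z \<partial>lborel)" for \<eta>
  have c2c: "continuous_on UNIV \<eta>" if "C2_on UNIV \<eta>" for \<eta>
    using that C1_on_continuous unfolding C2_on_def by blast
  have all: "P \<eta>" if \<eta>: "C2_on UNIV \<eta>" and K: "compact K" and supp: "\<And>z. z \<notin> K ==> \<eta> z = 0" for \<eta> K
  proof (rule partition_of_unity_induct[where \<D> = "range dom", OF _ K \<eta>])
    show "\<exists>D\<in>range dom. open D \<and> z \<in> D" for z using open_dom in_dom by blast
    show "\<eta> z = 0" if "z \<notin> K" for z by (rule supp[OF that])
    show "P (\<lambda>_. 0)" by (simp add: P_def parts_const_zero)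
  next
    fix a b :: "complex => real"
    assume a: "C2_on UNIV a" "\<And>z. z \<notin> K ==> a z = 0" "P a" and b: "C2_on UNIV b" "\<And>z. z \<notin> K ==> b z = 0" "P b"
    have d: "ddc (\<lambda>z. a z + b z) z = ddc a z + ddc b z" for z by (rule parts_add(3)[OF open_UNIV a(1) b(1) UNIV_I])
    have "integrable \<mu> a" "integrable \<nu> a" "integrable \<mu> b" "integrable \<nu> b"
      by (rule int_cs[OF c2c[OF a(1)] K a(2) sets(1) ball(1)] int_cs[OF c2c[OF a(1)] K a(2) sets(2) ball(2)]
        int_cs[OF c2c[OF b(1)] K b(2) sets(1) ball(1)] int_cs[OF c2c[OF b(1)] K b(2) sets(2) ball(2)]; assumption)+
    then show "P (\<lambda>z. a z + b z)" using a(3) b(3) unfolding P_def d distrib_left distrib_right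
      by (simp add: Bochner_Integration.integral_add)
  next
    fix \<eta> :: "complex => real" and D K'
    assume \<eta>: "C2_on UNIV \<eta>" and D: "D \<in> range dom" and K': "compact K'" "K' \<subseteq> D" and s: "\<And>z. z \<notin> K' ==> \<eta> z = 0"
    obtain i where i: "D = dom i" using D by blast
    define u where "u z = ln (hsum B (\<lambda>s. s i (f z)))" for z
    have u: "C2_on D u" unfolding u_def i by (rule weight_ddc(1))
    have oD: "open D" unfolding i by (rule open_dom)
    note parts = integral_ddc_by_parts[OF oD u \<eta> K' s]
    have e1: "\<eta> z * ddc u z = \<eta> z * \<Theta> z" for z
    proof (cases "z \<in> K'")
      case True
      then have "z \<in> dom i" using K' i by blast
      from weight_ddc(2)[OF this] show ?thesis unfolding u_def \<Theta>_def by simp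
    qed (use s in simp)
    have d0: "ddc \<eta> z = 0" if "z \<notin> K'" for z by (rule ddc_zero_outside[OF compact_imp_closed[OF K'(1)] s that])
    have e2: "w z * ddc \<eta> z = \<phi> i (f z) * ddc \<eta> z - u z * ddc \<eta> z" for z
    proof (cases "z \<in> K'")
      case True
      then have "z \<in> dom i" using K' i by blast
      show ?thesis unfolding wi[OF \<open>z \<in> dom i\<close>] u_def by (rule left_diff_distrib)
    qed (use d0 in simp)
    have p1: "(\<integral>z. \<eta> z * \<Theta> z \<partial>lborel) = (\<integral>z. u z * ddc \<eta> z \<partial>lborel)" "integrable lborel (\<lambda>z. \<eta> z * \<Theta> z)"
      "integrable lborel (\<lambda>z. u z * ddc \<eta> z)"
      using parts unfolding e1 by blast+
    have i\<phi>: "integrable lborel (\<lambda>z. \<phi> i (f z) * ddc \<eta> z)"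
    proof (rule integrable_continuous_compact[OF _ K'(1)])
      show "continuous_on K' (\<lambda>z. \<phi> i (f z) * ddc \<eta> z)"
        by (intro continuous_on_mult continuous_on_subset[OF \<phi>c] continuous_on_subset[OF C2_on_ddc_continuous[OF \<eta>]])
          (use K' i in auto)
    qed (use d0 in simp)
    have cl: "closure {z. \<eta> z ~= 0} \<subseteq> K'" by (rule closure_minimal) (use s compact_imp_closed[OF K'(1)] in auto)
    have "compact (closure {z. \<eta> z ~= 0})"
      by (rule compact_closure[THEN iffD2]) (rule bounded_subset[OF compact_imp_bounded[OF K'(1)] order_trans[OF closure_subset cl]])
    moreover have "closure {z. \<eta> z ~= 0} \<subseteq> {z. f z \<in> triv L i}" using cl K'(2) unfolding i dom_def by blast
    ultimately have "(\<integral>z. \<eta> z \<partial>\<mu>) - (\<integral>z. \<eta> z \<partial>\<nu>) = (\<integral>z. \<phi> i (f z) * ddc \<eta> z \<partial>lborel)"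
      by (intro cur' C2_on_C_k[OF \<eta>])
    then show "P \<eta>" unfolding P_def e2 using p1 i\<phi> by (simp add: Bochner_Integration.integral_diff)
  qed
  obtain K where K: "\<forall>r\<ge>0. \<bar>T r - (enn2real (nevanlinna_N \<mu> r) - enn2real (nevanlinna_N \<nu> r))\<bar> \<le> K"
    using bd unfolding bounded_iff by auto
  show thesis
  \<comment> \<open>K comes from the choice of the representative T, and Cw from the change of
    metric.\<close>
  proof (rule that[of "K + \<bar>Cw\<bar>"])
    fix r :: real and m assume r: "0 < r"
    have "(\<integral>z. log_cutoff r (real (Suc m)) z * \<Theta> z \<partial>lborel) \<le> enn2real (nevanlinna_N \<mu> r) - enn2real (nevanlinna_N \<nu> r) + Cw"
    proof (rule current_characteristic_bound[OF sets(1) ball(1) _ sets(2) ball(2) _ wc wb \<Theta>c _ _ r])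
      show "nevanlinna_N \<mu> r < \<infinity>" "nevanlinna_N \<nu> r < \<infinity>" using fin r by auto
      show "0 \<le> \<Theta> z" for z unfolding \<Theta>_def using Q_nonneg by simp
      fix \<eta> K assume "C2_on UNIV \<eta>" "compact K" "\<And>z. z \<notin> K ==> \<eta> z = 0"
      from all[OF this] show "(\<integral>z. \<eta> z \<partial>\<mu>) - (\<integral>z. \<eta> z \<partial>\<nu>) - (\<integral>z. \<eta> z * \<Theta> z \<partial>lborel) = (\<integral>z. w z * ddc \<eta> z \<partial>lborel)"
        unfolding P_def by blast
    qed
    moreover have "\<bar>T r - (enn2real (nevanlinna_N \<mu> r) - enn2real (nevanlinna_N \<nu> r))\<bar> \<le> K" using K r by auto
    ultimately show "(\<integral>z. log_cutoff r (real (Suc m)) z * (Q B z / pi) \<partial>lborel) \<le> T r + (K + \<bar>Cw\<bar>)"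
      unfolding \<Theta>_def by linarith
  next
    have "nevanlinna_N M 0 = 0" for M by (simp add: nevanlinna_N_def)
    then have "\<bar>T 0\<bar> \<le> K" using K[rule_format, of 0] by simp
    then show "0 \<le> T 0 + (K + \<bar>Cw\<bar>)" by linarith
  qed
qed

lemma jet_inequality:
  assumes lam: "weil_function X I lam" and lam1: "weil_function (PV X V) (jet_ideal X V I) lam1"
    and T: "characteristic_fun L f T"
  shows "\<exists>c>0. \<forall>\<epsilon>. 0 < \<epsilon> \<and> \<epsilon> < 1 -->
    (\<exists>b :: real => real. bounded (b ` {0..}) \<and>
      (\<forall>r\<ge>0.
        let N = nevanlinna_N (density lborel (\<lambda>z. ennreal
                  (exp (2 * (1 - \<epsilon>) * lam (f z) - 2 * lam1 (curve_lift f z))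
                   * pullback_ddc L (weight_of_basis B) f z))) r
        in N < \<infinity> \<and> \<epsilon> * enn2real N \<le> c * T r + b r))"
proof -
  obtain C1 where C1: "C1 > 0" "\<forall>x\<in>X - supp X I. rho x \<le> C1 * exp (- 2 * lam x)"
    using rho_weil_bound[OF lam] by (elim exE conjE)
  obtain C2 where C2: "C2 > 0" "\<forall>z. f z \<notin> supp X I --> exp (- 2 * lam1 (curve_lift f z)) * Q B z \<le> C2 * (R z * Q B z + Q Z z)"
    using jet_curve_bound[OF lam1] by (elim exE conjE)
  obtain C0 where C0: "C0 > 0" "\<forall>x\<in>X. \<bar>rho x\<bar> \<le> C0" using rho_bounded by (elim exE conjE)
  obtain K where K: "\<And>r m. 0 < r ==> (\<integral>z. log_cutoff r (real (Suc m)) z * (Q B z / pi) \<partial>lborel) \<le> T r + K" "0 \<le> T 0 + K"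
    by (rule weight_integral_bound[OF T]) (rule that)
  define C where "C = max 1 C1 * C2"
  have C: "0 < C" unfolding C_def using C2 by simp
  \<comment> \<open>The coefficient of A in \<open>nevanlinna_N_singular_density\<close>. All
    constants entering it come from Weil functions and from \<rho>, and are fixed before
    \<epsilon>.\<close>
  define c where "c = C * (C0 + 1) * (1 + pi)"
  have c: "0 < c" unfolding c_def using C C0 pi_gt_zero by (intro mult_pos_pos add_pos_pos) auto
  have RC0: "R z \<le> C0" for z using C0(2) f_in_X[of z] unfolding R_def by force
  show ?thesis
  proof (intro exI[of _ c] conjI allI impI c)
    fix \<epsilon> :: real assume e: "0 < \<epsilon> \<and> \<epsilon> < 1"
    define E where "E z = ennreal (exp (2 * (1 - \<epsilon>) * lam (f z) - 2 * lam1 (curve_lift f z)) * pullback_ddc L (weight_of_basis B) f z)" for z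
    have E: "AE z in lborel. E z \<le> ennreal (C * (R z powr (\<epsilon> - 1) * Q Z z + R z powr \<epsilon> * (Q B z / pi)))"
      using R_positive_AE
    proof eventually_elim
      case (elim z)
      then have ns: "f z \<notin> supp X I" using R_zero_supp[of z] by simp
      have "R z \<le> C1 * exp (- 2 * lam (f z))" unfolding R_def using C1(2) ns f_in_X by blast
      note p = powr_weil_bound[OF elim this C1(1)]
      define q where "q = exp (- 2 * lam1 (curve_lift f z)) * (Q B z / pi)"
      have q0: "0 \<le> q" unfolding q_def using Q_nonneg by simp
      \<comment> \<open>The normalising factor 1 / pi of the form is kept in the term with
        \<open>Q B\<close> and estimated by 1 in the term with \<open>Q Z\<close>.\<close>
      have QZ: "Q Z z / pi \<le> Q Z z" using Q_nonneg[of Z z] pi_ge_two by (simp add: divide_le_eq mult_le_cancel_left1)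
      have "exp (- 2 * lam1 (curve_lift f z)) * Q B z / pi \<le> C2 * (R z * Q B z + Q Z z) / pi"
        by (rule divide_right_mono) (use C2(2) ns pi_gt_zero in auto)
      also have "\<dots> = C2 * (R z * (Q B z / pi) + Q Z z / pi)" by (simp add: field_simps)
      also have "\<dots> \<le> C2 * (R z * (Q B z / pi) + Q Z z)" using QZ C2(1) by (intro mult_left_mono) auto
      finally have q: "q \<le> C2 * (R z * (Q B z / pi) + Q Z z)" unfolding q_def by simp
      have Rp: "R z powr (\<epsilon> - 1) * R z = R z powr \<epsilon>" using elim by (simp add: powr_diff)
      have "exp (2 * (1 - \<epsilon>) * lam (f z) - 2 * lam1 (curve_lift f z)) * pullback_ddc L (weight_of_basis B) f z =
          exp (2 * (1 - \<epsilon>) * lam (f z)) * q"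
        unfolding pullback_weight q_def diff_conv_add_uminus exp_add by (simp add: mult_ac)
      also have "\<dots> \<le> (max 1 C1 * R z powr (\<epsilon> - 1)) * (C2 * (R z * (Q B z / pi) + Q Z z))"
        by (rule mult_mono[OF _ q _ q0]) (use p e in auto)
      also have "\<dots> = C * ((R z powr (\<epsilon> - 1) * R z) * (Q B z / pi) + R z powr (\<epsilon> - 1) * Q Z z)"
        unfolding C_def by (simp add: algebra_simps)
      also have "\<dots> = C * (R z powr (\<epsilon> - 1) * Q Z z + R z powr \<epsilon> * (Q B z / pi))" unfolding Rp by (simp add: add.commute)
      finally show ?case unfolding E_def by (rule ennreal_leI)
    qed
    \<comment> \<open>Constant in r. It grows like 1 / \<epsilon>, which is permitted since the
      bounded term of the claim is chosen after \<epsilon>.\<close>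
    define b where "b = c * K + C * (C0 + 1) * pi / \<epsilon>"
    have b0: "0 \<le> C * (C0 + 1) * pi / \<epsilon>" using C C0(1) e by simp
    show "\<exists>b :: real => real. bounded (b ` {0..}) \<and>
      (\<forall>r\<ge>0.
        let N = nevanlinna_N (density lborel (\<lambda>z. ennreal
                  (exp (2 * (1 - \<epsilon>) * lam (f z) - 2 * lam1 (curve_lift f z))
                   * pullback_ddc L (weight_of_basis B) f z))) r
        in N < \<infinity> \<and> \<epsilon> * enn2real N \<le> c * T r + b r)"
      unfolding E_def[symmetric] Let_def
    proof (intro exI[of _ "\<lambda>_. b"] conjI allI impI)
      show "bounded ((\<lambda>_. b) ` {0..})" by (rule bounded_subset[of "{b}"]) auto
      fix r :: real assume r: "0 \<le> r"
      have "nevanlinna_N (density lborel E) r < \<infinity> \<and> \<epsilon> * enn2real (nevanlinna_N (density lborel E) r) \<le> c * T r + b"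
      \<comment> \<open>The logarithmic cut-off requires r > 0. At r = 0 the counting function is 0,
        and \<open>T 0 + K\<close> is non-negative by the choice of K.\<close>
      proof (cases "r = 0")
        case True
        have "nevanlinna_N (density lborel E) 0 = 0" by (simp add: nevanlinna_N_def)
        moreover have "0 \<le> c * (T 0 + K)" using c K(2) by simp
        ultimately show ?thesis using True b0 by (simp add: b_def distrib_left)
      next
        case False
        then have r: "r > 0" using r by simp
        have \<Theta>c: "continuous_on UNIV (\<lambda>z. Q B z / pi)" by (intro continuous_intros Q_continuous) auto
        have e': "0 < \<epsilon>" "\<epsilon> < 1" using e by auto
        have QB: "0 \<le> Q B z / pi" for z using Q_nonneg by simp
        note N = nevanlinna_N_singular_density[OF e' R_continuous Q_continuous[OF Un_upper2] \<Theta>c R_nonneg Q_nonneg QB RC0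
            R_positive_AE R_powr(1)[OF _ e'] R_powr(2)[OF _ e'] K(1)[OF r] r E less_imp_le[OF C]]
        have "\<epsilon> * enn2real (nevanlinna_N (density lborel E) r) \<le> c * (T r + K) + C * (C0 + 1) * pi / \<epsilon>"
          using N(2) unfolding c_def by simp
        then have "\<epsilon> * enn2real (nevanlinna_N (density lborel E) r) \<le> c * T r + b" by (simp add: b_def distrib_left)
        then show ?thesis using N(1) by blast
      qed
      then show "nevanlinna_N (density lborel E) r < \<infinity>"
        "\<epsilon> * enn2real (nevanlinna_N (density lborel E) r) \<le> c * T r + b" by blast+
    qed
  qed
qed

end

theorem lemma0p8:
  fixes X :: "('n::finite) cproj set"
    and V :: "'n cproj \<Rightarrow> (complex^'n) set"
    and I :: "'n cproj ideal_sheaf"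
    and f :: "complex \<Rightarrow> 'n cproj"
    and L :: "('i, 'n cproj) bundle_data"
    and S B :: "('i \<Rightarrow> 'n cproj \<Rightarrow> complex) set"
    and lam :: "'n cproj \<Rightarrow> real"
    and lam1 :: "('n \<times> 'n \<times> 'n) cproj \<Rightarrow> real"
    and T :: "real \<Rightarrow> real"
  assumes "projective_manifold X"
    and "holomorphic_subbundle X V"
    and "closed_subscheme X I"
    and "directed_curve X V f"
    and "\<not> f constant_on UNIV"
    and "\<not> range f \<subseteq> supp X I"
    and "line_bundle X L"
    and "linear_system X L S"
    and "\<forall>x\<in>X. separates_1_jets X L S x"
    and "base_ideal_eq X L (subsystem_containing X L S I) I"
    and "section_basis S B"
    and "weil_function X I lam"
    and "weil_function (PV X V) (jet_ideal X V I) lam1"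
    and "characteristic_fun L f T"
  shows "\<exists>c>0. \<forall>\<epsilon>. 0 < \<epsilon> \<and> \<epsilon> < 1 \<longrightarrow>
    (\<exists>b :: real \<Rightarrow> real. bounded (b ` {0..}) \<and>
      (\<forall>r\<ge>0.
        let N = nevanlinna_N (density lborel (\<lambda>z. ennreal
                  (exp (2 * (1 - \<epsilon>) * lam (f z) - 2 * lam1 (curve_lift f z))
                   * pullback_ddc L (weight_of_basis B) f z))) r
        in N < \<infinity> \<and> \<epsilon> * enn2real N \<le> c * T r + b r))"
proof -
  have "subsystem_containing X L S I \<subseteq> S" by (auto simp: subsystem_containing_def)
  also have "S = module.span scale_section B" using assms(11) by (simp add: section_basis_def)
  finally have sub: "subsystem_containing X L S I \<subseteq> module.span scale_section B" .
  \<comment> \<open>A maximal independent subset of the subsystem spans it; finiteness follows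
    because it lies in the span of the finite basis B.\<close>
  obtain Z where Z: "Z \<subseteq> subsystem_containing X L S I" "\<not> module.dependent scale_section Z"
    "subsystem_containing X L S I \<subseteq> module.span scale_section Z"
    by (rule sec.maximal_independent_subset)
  have "finite B" using assms(11) by (simp add: section_basis_def)
  then have fin: "finite Z" using sec.independent_span_bound[OF _ Z(2) order_trans[OF Z(1) sub]] by blast
  interpret jet_separating_curve X V I L S B Z f
    by (intro jet_separating_curve.intro jet_separating_system.intro jet_separating_curve_axioms.intro) (fact assms Z fin)+
  show ?thesis by (rule jet_inequality[OF assms(12,13,14)])
qed

end
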